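(* Let $A$ be an associative, commutative ring with unit, and let $n$ and $d$ be integers with $1\leq d\leq n$. Let $R_n=A[x_1,\ldots,x_n]$ and let $I_{d,n}\subset R_n$ be the ideal generated by all squarefree monomials of degree $d$ in $x_1,\ldots,x_n$. Then the complex $F^{d,n}_\bullet$, with modules $F^{d,n}_i=U^{d,n}_i\otimes_A R_n(-d-i)$ and differentials $\partial^{d,n}_i\colon F^{d,n}_i\to F^{d,n}_{i-1}$ defined in the context, is an $\mathfrak{S}_n$-equivariant minimal free resolution of the $R_n$-module $I_{d,n}$.
   Context: $R_n=A[x_1,\ldots,x_n]$ has the standard grading, and the symmetric group $\mathfrak{S}_n$ acts on it $A$-linearly by permuting the variables; $I_{d,n}$ is stable under this action. An $R_n[\mathfrak{S}_n]$-module is an $R_n$-module $M$ with an $A$-linear $\mathfrak{S}_n$-action compatible with the action on $R_n$: $\sigma(pm)=\sigma(p)\sigma(m)$. Tableaux. Let $[n]=\{1,\ldots,n\}$. A tableau of shape $\lambda$ (a partition) with entries in $[n]$ is a filling of the Young diagram of $\lambda$ (English notation) with distinct elements of $[n]$. For $\lambda$ a partition of $m$, the Specht module $S^\lambda$ is the $A[\mathfrak{S}_m]$-module generated by classes $[T]$ of tableaux $T$ of shape $\lambda$ with entries in $[m]$ (with $\sigma[T]=[\sigma T]$, where $\sigma T$ applies $\sigma$ to all entries), modulo: (alternating columns) $[\sigma T]=\operatorname{sgn}(\sigma)[T]$ for every permutation $\sigma$ of the entries of $T$ preserving each column of $T$; (shuffling relations) $[T]=\sum [T']$, the sum being over all $T'$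 obtained from $T$ by exchanging the top $k$ elements of the $(j+1)$-st column of $T$ with $k$ elements in the $j$-th column, preserving the vertical order of each set of $k$ elements. Modules. For $1\leq d\leq n$ and $0\leq i\leq n-d$ set $U^{d,n}_i:=\operatorname{Ind}^{\mathfrak{S}_n}_{\mathfrak{S}_{d+i}\times\mathfrak{S}_{n-d-i}}(S^{(d,1^i)}\otimes_A S^{(n-d-i)})$, where $\mathfrak{S}_{d+i}\times\mathfrak{S}_{n-d-i}$ is the subgroup of $\mathfrak{S}_n$ preserving $\{1,\ldots,d+i\}$ and $\{d+i+1,\ldots,n\}$; otherwise $U^{d,n}_i:=0$. The module $U^{d,n}_i$ is identified with the $A[\mathfrak{S}_n]$-module generated by classes $[T]$ of tableaux of shape $(d,1^i)$ with entries in $[n]$ modulo alternating columns and shuffling relations. Set $F^{d,n}_i:=U^{d,n}_i\otimes_A R_n(-d-i)$, with $\mathfrak{S}_n$ acting on both factors, and write $p[T]$ for $[T]\otimes p$. Differentials. Let $1\leq i\leq n-d$ and let $T$ be a tableau of shape $(d,1^i)$ with first column $a_0,a_1,\ldots,a_i$ (top to bottom) and first row $a_0,b_1,\ldots,b_{d-1}$. For $0\leq j\leq i$, $T\setminus a_j$ is the tableau of shape $(d,1^{i-1})$ obtained from $T$ by removing the box containing $a_j$ and sliding upward the boxes below it in the first column (so $T\setminus a_0$ has first row $a_1,b_1,\ldots,b_{d-1}$ and first column $a_1,\ldots,a_i$). The map $\partial^{d,n}_i\colon F^{d,n}_i\to F^{d,n}_{i-1}$ is the map of $R_n[\mathfrak{S}_n]$-modules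 with $\partial^{d,n}_i([T])=\sum_{j=0}^i(-1)^{i-j}x_{a_j}[T\setminus a_j]$ for every such $T$. An $\mathfrak{S}_n$-equivariant minimal free resolution of $I_{d,n}$ is a graded free resolution in which all modules have compatible $\mathfrak{S}_n$-actions and all maps (including the augmentation to $I_{d,n}$) are $\mathfrak{S}_n$-equivariant, and such that the image of each differential $F_i\to F_{i-1}$ ($i\geq1$) lies in $(x_1,\ldots,x_n)F_{i-1}$. *)

theory Defs
  imports "HOL-Algebra.Indexed_Polynomials" "HOL-Combinatorics.Permutations"
begin

section \<open>Modules: spans, quotients, free modules, tensor products\<close>

text \<open>Only the fields \<open>carrier\<close>, \<open>zero\<close>, \<open>add\<close>, \<open>smult\<close> of a record are relevant when it is
  used as a module; \<open>mult\<close> and \<open>one\<close> are then left unspecified.\<close>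

definition module_span :: "('r, 'x) ring_scheme \<Rightarrow> ('r, 'm, 'y) module_scheme \<Rightarrow> 'm set \<Rightarrow> 'm set"
  where "module_span R M S = \<Inter>{H. submodule H R M \<and> S \<subseteq> H}"

definition module_homs ::
  "('r, 'x) ring_scheme \<Rightarrow> ('r, 'm, 'y) module_scheme \<Rightarrow> ('r, 'n, 'z) module_scheme \<Rightarrow> ('m \<Rightarrow> 'n) set"
  where "module_homs R M N =
    {h \<in> carrier M \<rightarrow> carrier N.
       (\<forall>x\<in>carrier M. \<forall>y\<in>carrier M. h (x \<oplus>\<^bsub>M\<^esub> y) = h x \<oplus>\<^bsub>N\<^esub> h y) \<and>
       (\<forall>r\<in>carrier R. \<forall>x\<in>carrier M. h (r \<odot>\<^bsub>M\<^esub> x) = r \<odot>\<^bsub>N\<^esub> h x)}"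

definition quot_module :: "('r, 'm, 'y) module_scheme \<Rightarrow> 'm set \<Rightarrow> ('r, 'm set) module"
  where "quot_module M K =
    \<lparr>carrier = a_rcosets\<^bsub>M\<^esub> K, monoid.mult = undefined, one = undefined, zero = K, add = set_add M,
     smult = (\<lambda>r C. \<Union>x\<in>C. K +>\<^bsub>M\<^esub> (r \<odot>\<^bsub>M\<^esub> x))\<rparr>"

definition free_module :: "('a, 'x) ring_scheme \<Rightarrow> 'b set \<Rightarrow> ('a, 'b \<Rightarrow> 'a) module"
  where "free_module A B =
    \<lparr>carrier = {f. (\<forall>b. f b \<in> carrier A) \<and> (\<forall>b. b \<notin> B \<longrightarrow> f b = \<zero>\<^bsub>A\<^esub>) \<and> finite {b. f b \<noteq> \<zero>\<^bsub>A\<^esub>}},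
     monoid.mult = undefined, one = undefined, zero = (\<lambda>b. \<zero>\<^bsub>A\<^esub>), add = (\<lambda>f g b. f b \<oplus>\<^bsub>A\<^esub> g b),
     smult = (\<lambda>a f b. a \<otimes>\<^bsub>A\<^esub> f b)\<rparr>"

definition unit_vec :: "('a, 'x) ring_scheme \<Rightarrow> 'b \<Rightarrow> ('b \<Rightarrow> 'a)"
  where "unit_vec A b = (\<lambda>c. if c = b then \<one>\<^bsub>A\<^esub> else \<zero>\<^bsub>A\<^esub>)"

definition tensor_relations ::
  "('a, 'x) ring_scheme \<Rightarrow> ('a, 'm, 'y) module_scheme \<Rightarrow> ('a, 'n, 'z) module_scheme \<Rightarrow> ('m \<times> 'n \<Rightarrow> 'a) set"
  where "tensor_relations A M N =
    (let F = free_module A (carrier M \<times> carrier N); e = (\<lambda>u v. unit_vec A (u, v)) in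
       {e (u \<oplus>\<^bsub>M\<^esub> u') v \<ominus>\<^bsub>F\<^esub> (e u v \<oplus>\<^bsub>F\<^esub> e u' v) | u u' v.
          u \<in> carrier M \<and> u' \<in> carrier M \<and> v \<in> carrier N} \<union>
       {e u (v \<oplus>\<^bsub>N\<^esub> v') \<ominus>\<^bsub>F\<^esub> (e u v \<oplus>\<^bsub>F\<^esub> e u v') | u v v'.
          u \<in> carrier M \<and> v \<in> carrier N \<and> v' \<in> carrier N} \<union>
       {e (a \<odot>\<^bsub>M\<^esub> u) v \<ominus>\<^bsub>F\<^esub> (a \<odot>\<^bsub>F\<^esub> e u v) | a u v.
          a \<in> carrier A \<and> u \<in> carrier M \<and> v \<in> carrier N} \<union>
       {e u (a \<odot>\<^bsub>N\<^esub> v) \<ominus>\<^bsub>F\<^esub> (a \<odot>\<^bsub>F\<^esub> e u v) | a u v.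
          a \<in> carrier A \<and> u \<in> carrier M \<and> v \<in> carrier N})"

definition tensor_module ::
  "('a, 'x) ring_scheme \<Rightarrow> ('a, 'm, 'y) module_scheme \<Rightarrow> ('a, 'n, 'z) module_scheme \<Rightarrow> ('a, ('m \<times> 'n \<Rightarrow> 'a) set) module"
  where "tensor_module A M N =
    (let F = free_module A (carrier M \<times> carrier N)
     in quot_module F (module_span A F (tensor_relations A M N)))"

definition pure_tensor ::
  "('a, 'x) ring_scheme \<Rightarrow> ('a, 'm, 'y) module_scheme \<Rightarrow> ('a, 'n, 'z) module_scheme \<Rightarrow> 'm \<Rightarrow> 'n \<Rightarrow> ('m \<times> 'n \<Rightarrow> 'a) set"
  where "pure_tensor A M N u v =
    (let F = free_module A (carrier M \<times> carrier N)
     in module_span A F (tensor_relations A M N) +>\<^bsub>F\<^esub> unit_vec A (u, v))"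

definition tensor_map ::
  "('a, 'x) ring_scheme \<Rightarrow> ('a, 'm, 'y) module_scheme \<Rightarrow> ('a, 'n, 'z) module_scheme \<Rightarrow>
   ('m \<Rightarrow> 'm) \<Rightarrow> ('n \<Rightarrow> 'n) \<Rightarrow> ('m \<times> 'n \<Rightarrow> 'a) set \<Rightarrow> ('m \<times> 'n \<Rightarrow> 'a) set"
  \<comment> \<open>\<open>f \<otimes> g\<close> for \<open>A\<close>-linear endomorphisms \<open>f\<close> of \<open>M\<close> and \<open>g\<close> of \<open>N\<close>\<close>
  where "tensor_map A M N f g =
    (THE h. h \<in> module_homs A (tensor_module A M N) (tensor_module A M N) \<and>
       h \<in> extensional (carrier (tensor_module A M N)) \<and>
       (\<forall>u\<in>carrier M. \<forall>v\<in>carrier N. h (pure_tensor A M N u v) = pure_tensor A M N (f u) (g v)))"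

definition module_basis :: "('r, 'x) ring_scheme \<Rightarrow> ('r, 'm, 'y) module_scheme \<Rightarrow> 'm set \<Rightarrow> bool"
  where "module_basis R M B \<longleftrightarrow> B \<subseteq> carrier M \<and>
    (\<forall>m\<in>carrier M. \<exists>!c. c \<in> carrier (free_module R B) \<and>
       m = (\<Oplus>\<^bsub>M\<^esub>b\<in>{b. c b \<noteq> \<zero>\<^bsub>R\<^esub>}. c b \<odot>\<^bsub>M\<^esub> b))"


section \<open>Modules with a symmetric group action and a grading\<close>

text \<open>\<open>act M s\<close> is only meaningful for permutations \<open>s\<close> of \<open>{1..n}\<close>;
  \<open>hcomp M k\<close> is the homogeneous component of degree \<open>k\<close>.\<close>

record ('r, 'm) sym_module = "('r, 'm) module" +
  act :: "(nat \<Rightarrow> nat) \<Rightarrow> 'm \<Rightarrow> 'm"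

record ('r, 'm) gr_sym_module = "('r, 'm) sym_module" +
  hcomp :: "int \<Rightarrow> 'm set"

definition shift :: "('r, 'm) gr_sym_module \<Rightarrow> int \<Rightarrow> ('r, 'm) gr_sym_module"
  \<comment> \<open>the twist \<open>M(s)\<close>, with \<open>M(s)\<^sub>k = M\<^bsub>s + k\<^esub>\<close>\<close>
  where "shift M s = M\<lparr>hcomp := (\<lambda>k. hcomp M (s + k))\<rparr>"

text \<open>The polynomial ring \<open>R\<^sub>n = A[x\<^sub>1, \<dots>, x\<^sub>n]\<close>, as a ring and as a graded \<open>A\<close>-module on
  which permutations act by \<open>x\<^sub>i \<mapsto> x\<^bsub>s i\<^esub>\<close>. As in \<^theory>\<open>HOL-Algebra.Indexed_Polynomials\<close>,
  a polynomial maps monomials, i.e. multisets of indices, to coefficients.\<close>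

definition poly_ring :: "('a, 'x) ring_scheme \<Rightarrow> nat \<Rightarrow> ('a, nat multiset \<Rightarrow> 'a) gr_sym_module"
  where "poly_ring A n =
    \<lparr>carrier = ring.indexed_pset A {1..n} (carrier A),
     monoid.mult = (\<lambda>p q m. \<Oplus>\<^bsub>A\<^esub>m'\<in>{m'. m' \<subseteq># m}. p m' \<otimes>\<^bsub>A\<^esub> q (m - m')),
     one = ring.indexed_const A \<one>\<^bsub>A\<^esub>,
     zero = ring.indexed_const A \<zero>\<^bsub>A\<^esub>,
     add = ring.indexed_padd A,
     smult = (\<lambda>a p m. a \<otimes>\<^bsub>A\<^esub> p m),
     act = (\<lambda>s p m. p (image_mset (inv_into UNIV s) m)),
     hcomp = (\<lambda>k. {p \<in> ring.indexed_pset A {1..n} (carrier A).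
                      \<forall>m. p m \<noteq> \<zero>\<^bsub>A\<^esub> \<longrightarrow> int (size m) = k})\<rparr>"

definition squarefree_ideal :: "('a, 'x) ring_scheme \<Rightarrow> nat \<Rightarrow> nat \<Rightarrow> (nat multiset \<Rightarrow> 'a) set"
  where "squarefree_ideal A d n = Idl\<^bsub>poly_ring A n\<^esub>
    {finprod (poly_ring A n) (ring.indexed_var A) S | S. S \<subseteq> {1..n} \<and> card S = d}"

definition squarefree_ideal_module ::
  "('a, 'x) ring_scheme \<Rightarrow> nat \<Rightarrow> nat \<Rightarrow> (nat multiset \<Rightarrow> 'a, nat multiset \<Rightarrow> 'a) gr_sym_module"
  where "squarefree_ideal_module A d n =
    \<lparr>carrier = squarefree_ideal A d n, monoid.mult = undefined, one = undefined,
     zero = zero (poly_ring A n), add = add (poly_ring A n), smult = monoid.mult (poly_ring A n),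
     act = act (poly_ring A n),
     hcomp = (\<lambda>k. squarefree_ideal A d n \<inter> hcomp (poly_ring A n) k)\<rparr>"

definition graded_module ::
  "('a, 'p) gr_sym_module \<Rightarrow> ('p, 'm) gr_sym_module \<Rightarrow> bool"
  where "graded_module P M \<longleftrightarrow> module P M \<and>
    (\<forall>k. additive_subgroup (hcomp M k) M) \<and>
    (\<forall>m\<in>carrier M. \<exists>!f. (\<forall>k. f k \<in> hcomp M k) \<and> finite {k. f k \<noteq> \<zero>\<^bsub>M\<^esub>} \<and>
       m = (\<Oplus>\<^bsub>M\<^esub>k\<in>{k. f k \<noteq> \<zero>\<^bsub>M\<^esub>}. f k)) \<and>
    (\<forall>j k. \<forall>p\<in>hcomp P j. \<forall>m\<in>hcomp M k. p \<odot>\<^bsub>M\<^esub> m \<in> hcomp M (j + k))"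

definition graded_free :: "('a, 'p) gr_sym_module \<Rightarrow> ('p, 'm) gr_sym_module \<Rightarrow> bool"
  where "graded_free P M \<longleftrightarrow> graded_module P M \<and>
    (\<exists>B. B \<subseteq> (\<Union>k. hcomp M k) \<and> module_basis P M B)"

definition equivariant_module ::
  "('a, 'x) ring_scheme \<Rightarrow> nat \<Rightarrow> (nat multiset \<Rightarrow> 'a, 'm) gr_sym_module \<Rightarrow> bool"
  \<comment> \<open>an \<open>R\<^sub>n[S\<^sub>n]\<close>-module\<close>
  where "equivariant_module A n M \<longleftrightarrow> module (poly_ring A n) M \<and>
    (\<forall>m\<in>carrier M. act M id m = m) \<and>
    (\<forall>s t. s permutes {1..n} \<longrightarrow> t permutes {1..n} \<longrightarrow>
       (\<forall>m\<in>carrier M. act M (s \<circ> t) m = act M s (act M t m))) \<and>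
    (\<forall>s. s permutes {1..n} \<longrightarrow>
       act M s \<in> carrier M \<rightarrow> carrier M \<and>
       (\<forall>m\<in>carrier M. \<forall>m'\<in>carrier M. act M s (m \<oplus>\<^bsub>M\<^esub> m') = act M s m \<oplus>\<^bsub>M\<^esub> act M s m') \<and>
       (\<forall>a\<in>carrier A. \<forall>m\<in>carrier M.
          act M s (ring.indexed_const A a \<odot>\<^bsub>M\<^esub> m) = ring.indexed_const A a \<odot>\<^bsub>M\<^esub> act M s m) \<and>
       (\<forall>p\<in>carrier (poly_ring A n). \<forall>m\<in>carrier M.
          act M s (p \<odot>\<^bsub>M\<^esub> m) = act (poly_ring A n) s p \<odot>\<^bsub>M\<^esub> act M s m))"

definition equivariant_homs ::
  "('a, 'x) ring_scheme \<Rightarrow> nat \<Rightarrow> (nat multiset \<Rightarrow> 'a, 'm) gr_sym_module \<Rightarrow>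
   (nat multiset \<Rightarrow> 'a, 'k) gr_sym_module \<Rightarrow> ('m \<Rightarrow> 'k) set"
  where "equivariant_homs A n M N =
    {h \<in> module_homs (poly_ring A n) M N.
       \<forall>s. s permutes {1..n} \<longrightarrow> (\<forall>m\<in>carrier M. h (act M s m) = act N s (h m))}"

definition degree_preserving ::
  "('r, 'm) gr_sym_module \<Rightarrow> ('r, 'k) gr_sym_module \<Rightarrow> ('m \<Rightarrow> 'k) \<Rightarrow> bool"
  where "degree_preserving M N h \<longleftrightarrow> (\<forall>k. h ` hcomp M k \<subseteq> hcomp N k)"

definition irrelevant_multiples ::
  "('a, 'x) ring_scheme \<Rightarrow> nat \<Rightarrow> (nat multiset \<Rightarrow> 'a, 'm) gr_sym_module \<Rightarrow> 'm set"
  \<comment> \<open>the submodule \<open>(x\<^sub>1, \<dots>, x\<^sub>n)M\<close>\<close>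
  where "irrelevant_multiples A n M = module_span (poly_ring A n) M
    {p \<odot>\<^bsub>M\<^esub> m | p m. p \<in> Idl\<^bsub>poly_ring A n\<^esub> (ring.indexed_var A ` {1..n}) \<and> m \<in> carrier M}"

text \<open>\<open>D i\<close> is the map from \<open>F i\<close> to \<open>F (i - 1)\<close>; the value of \<open>D 0\<close> is irrelevant.\<close>

definition equivariant_minimal_free_resolution ::
  "('a, 'x) ring_scheme \<Rightarrow> nat \<Rightarrow> (nat \<Rightarrow> (nat multiset \<Rightarrow> 'a, 'm) gr_sym_module) \<Rightarrow>
   (nat \<Rightarrow> 'm \<Rightarrow> 'm) \<Rightarrow> (nat multiset \<Rightarrow> 'a, 'k) gr_sym_module \<Rightarrow> bool"
  where "equivariant_minimal_free_resolution A n F D M \<longleftrightarrow>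
    graded_module (poly_ring A n) M \<and> equivariant_module A n M \<and>
    (\<forall>i. graded_free (poly_ring A n) (F i) \<and> equivariant_module A n (F i)) \<and>
    (\<forall>i\<ge>1. D i \<in> equivariant_homs A n (F i) (F (i - 1)) \<and>
            degree_preserving (F i) (F (i - 1)) (D i)) \<and>
    (\<forall>i\<ge>1. D (i + 1) ` carrier (F (i + 1)) = a_kernel (F i) (F (i - 1)) (D i)) \<and>
    (\<exists>e. e \<in> equivariant_homs A n (F 0) M \<and> degree_preserving (F 0) M e \<and>
         e ` carrier (F 0) = carrier M \<and>
         D 1 ` carrier (F 1) = a_kernel (F 0) M e) \<and>
    (\<forall>i\<ge>1. D i ` carrier (F i) \<subseteq> irrelevant_multiples A n (F (i - 1)))"


section \<open>Tableaux and the modules they generate\<close>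

text \<open>A tableau is the list of its rows, top to bottom; rows and columns are numbered from 0.\<close>

definition tableaux :: "nat list \<Rightarrow> nat \<Rightarrow> nat list list set"
  where "tableaux shape n =
    {T. map length T = shape \<and> distinct (concat T) \<and> set (concat T) \<subseteq> {1..n}}"

definition perm_tableau :: "(nat \<Rightarrow> nat) \<Rightarrow> nat list list \<Rightarrow> nat list list"
  where "perm_tableau s T = map (map s) T"

definition column :: "nat list list \<Rightarrow> nat \<Rightarrow> nat set"
  where "column T c = {T ! r ! c | r. r < length T \<and> c < length (T ! r)}"

definition column_length :: "nat list list \<Rightarrow> nat \<Rightarrow> nat"
  where "column_length T c = card {r. r < length T \<and> c < length (T ! r)}"

definition exchange :: "nat list list \<Rightarrow> nat \<Rightarrow> nat set \<Rightarrow> nat list list"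
  \<comment> \<open>exchange the top \<open>card S\<close> entries of column \<open>j + 1\<close> with the entries of column \<open>j\<close>
      in the rows belonging to \<open>S\<close>, keeping the vertical order of both sets of entries\<close>
  where "exchange T j S =
    map (\<lambda>r. map (\<lambda>c.
        if c = j + 1 \<and> r < card S then T ! (sorted_list_of_set S ! r) ! j
        else if c = j \<and> r \<in> S then T ! card {r' \<in> S. r' < r} ! (j + 1)
        else T ! r ! c) [0..<length (T ! r)]) [0..<length T]"

definition shuffles :: "nat list list \<Rightarrow> nat \<Rightarrow> nat \<Rightarrow> nat list list set"
  where "shuffles T j k = exchange T j ` {S. S \<subseteq> {..<column_length T j} \<and> card S = k}"

definition alternating_relations :: "('a, 'x) ring_scheme \<Rightarrow> nat list \<Rightarrow> nat \<Rightarrow> (nat list list \<Rightarrow> 'a) set"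
  where "alternating_relations A shape n =
    (let F = free_module A (tableaux shape n) in
       {unit_vec A (perm_tableau s T) \<ominus>\<^bsub>F\<^esub> add_pow F (sign s) (unit_vec A T) | s T.
          T \<in> tableaux shape n \<and> s permutes set (concat T) \<and>
          (\<forall>c. s ` column T c = column T c)})"

definition shuffling_relations :: "('a, 'x) ring_scheme \<Rightarrow> nat list \<Rightarrow> nat \<Rightarrow> (nat list list \<Rightarrow> 'a) set"
  where "shuffling_relations A shape n =
    (let F = free_module A (tableaux shape n) in
       {unit_vec A T \<ominus>\<^bsub>F\<^esub> (\<Oplus>\<^bsub>F\<^esub>T'\<in>shuffles T j k. unit_vec A T') | T j k.
          T \<in> tableaux shape n \<and> 1 \<le> k \<and> k \<le> column_length T (j + 1)})"

definition tableau_relations :: "('a, 'x) ring_scheme \<Rightarrow> nat list \<Rightarrow> nat \<Rightarrow> (nat list list \<Rightarrow> 'a) set"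
  where "tableau_relations A shape n = module_span A (free_module A (tableaux shape n))
    (alternating_relations A shape n \<union> shuffling_relations A shape n)"

definition tableau_class ::
  "('a, 'x) ring_scheme \<Rightarrow> nat list \<Rightarrow> nat \<Rightarrow> nat list list \<Rightarrow> (nat list list \<Rightarrow> 'a) set"
  where "tableau_class A shape n T =
    tableau_relations A shape n +>\<^bsub>free_module A (tableaux shape n)\<^esub> unit_vec A T"

text \<open>The \<open>A[S\<^sub>n]\<close>-module generated by the classes of tableaux of the given shape with entries
  in \<open>{1..n}\<close>. It is the Specht module if the shape is a partition of \<open>n\<close>. The action is
  the one induced by permuting the basis of the free module, applied to each representative of
  a coset.\<close>

definition tableau_module ::
  "('a, 'x) ring_scheme \<Rightarrow> nat list \<Rightarrow> nat \<Rightarrow> ('a, (nat list list \<Rightarrow> 'a) set) sym_module"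
  where "tableau_module A shape n =
    module.extend
      (quot_module (free_module A (tableaux shape n)) (tableau_relations A shape n))
      (sym_module.fields (\<lambda>s C. (\<lambda>f T. f (perm_tableau (inv_into UNIV s) T)) ` C))"


section \<open>The complex\<close>

definition hook :: "nat \<Rightarrow> nat \<Rightarrow> nat list"
  where "hook d i = d # replicate i 1"

text \<open>\<open>U\<^sub>i\<^bsup>d,n\<^esup>\<close>, which is the representation of the symmetric group on \<open>n\<close> letters induced from
  \<open>S\<^bsup>(d,1^i)\<^esup> \<otimes> S\<^bsup>(n-d-i)\<^esup>\<close>, in its description by tableaux. For \<open>i > n - d\<close> there are no
  tableaux, so that the module is zero.\<close>

definition U_mod :: "('a, 'x) ring_scheme \<Rightarrow> nat \<Rightarrow> nat \<Rightarrow> nat \<Rightarrow> ('a, (nat list list \<Rightarrow> 'a) set) sym_module"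
  where "U_mod A d n i = tableau_module A (hook d i) n"

definition extend_scalars ::
  "('a, 'x) ring_scheme \<Rightarrow> ('a, 'u) sym_module \<Rightarrow> ('a, 'p) gr_sym_module \<Rightarrow>
   ('p, ('u \<times> 'p \<Rightarrow> 'a) set) gr_sym_module"
  \<comment> \<open>\<open>U \<otimes>\<^sub>A N\<close>, where \<open>N\<close> is an \<open>A\<close>-algebra acting through the second factor, possibly with a
      shifted grading; \<open>U\<close> is placed in degree 0\<close>
  where "extend_scalars A U N =
    \<lparr>carrier = carrier (tensor_module A U N), monoid.mult = undefined, one = undefined,
     zero = zero (tensor_module A U N), add = add (tensor_module A U N),
     smult = (\<lambda>p. tensor_map A U N (\<lambda>u. u) (\<lambda>q. p \<otimes>\<^bsub>N\<^esub> q)),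
     act = (\<lambda>s. tensor_map A U N (act U s) (act N s)),
     hcomp = (\<lambda>k. module_span A (tensor_module A U N)
                    {pure_tensor A U N u q | u q. u \<in> carrier U \<and> q \<in> hcomp N k})\<rparr>"

definition F_mod ::
  "('a, 'x) ring_scheme \<Rightarrow> nat \<Rightarrow> nat \<Rightarrow> nat \<Rightarrow>
   (nat multiset \<Rightarrow> 'a, ((nat list list \<Rightarrow> 'a) set \<times> (nat multiset \<Rightarrow> 'a) \<Rightarrow> 'a) set) gr_sym_module"
  where "F_mod A d n i = extend_scalars A (U_mod A d n i) (shift (poly_ring A n) (- int d - int i))"

definition F_class ::
  "('a, 'x) ring_scheme \<Rightarrow> nat \<Rightarrow> nat \<Rightarrow> nat \<Rightarrow> (nat multiset \<Rightarrow> 'a) \<Rightarrow> nat list list \<Rightarrow>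
   ((nat list list \<Rightarrow> 'a) set \<times> (nat multiset \<Rightarrow> 'a) \<Rightarrow> 'a) set"
  \<comment> \<open>\<open>p[T] = [T] \<otimes> p\<close>\<close>
  where "F_class A d n i p T =
    pure_tensor A (U_mod A d n i) (shift (poly_ring A n) (- int d - int i))
      (tableau_class A (hook d i) n T) p"

definition first_column :: "nat list list \<Rightarrow> nat list"
  where "first_column T = map hd T"

definition remove_box :: "nat list list \<Rightarrow> nat \<Rightarrow> nat list list"
  \<comment> \<open>\<open>T \ a\<^sub>j\<close> for a tableau \<open>T\<close> of hook shape\<close>
  where "remove_box T j =
    (let as = take j (first_column T) @ drop (Suc j) (first_column T)
     in (hd as # tl (hd T)) # map (\<lambda>a. [a]) (tl as))"

text \<open>If \<open>i > n - d\<close>, the only such map is the zero map.\<close>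

definition is_differential ::
  "('a, 'x) ring_scheme \<Rightarrow> nat \<Rightarrow> nat \<Rightarrow> nat \<Rightarrow>
   (((nat list list \<Rightarrow> 'a) set \<times> (nat multiset \<Rightarrow> 'a) \<Rightarrow> 'a) set \<Rightarrow>
    ((nat list list \<Rightarrow> 'a) set \<times> (nat multiset \<Rightarrow> 'a) \<Rightarrow> 'a) set) \<Rightarrow> bool"
  where "is_differential A d n i f \<longleftrightarrow>
    f \<in> equivariant_homs A n (F_mod A d n i) (F_mod A d n (i - 1)) \<and>
    f \<in> extensional (carrier (F_mod A d n i)) \<and>
    (\<forall>T\<in>tableaux (hook d i) n.
       f (F_class A d n i \<one>\<^bsub>poly_ring A n\<^esub> T) =
         (\<Oplus>\<^bsub>F_mod A d n (i - 1)\<^esub>j\<in>{0..i}.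
            add_pow (F_mod A d n (i - 1)) ((- 1) ^ (i - j) :: int)
              (F_class A d n (i - 1) (ring.indexed_var A (first_column T ! j)) (remove_box T j))))"

definition differential ::
  "('a, 'x) ring_scheme \<Rightarrow> nat \<Rightarrow> nat \<Rightarrow> nat \<Rightarrow>
   ((nat list list \<Rightarrow> 'a) set \<times> (nat multiset \<Rightarrow> 'a) \<Rightarrow> 'a) set \<Rightarrow>
   ((nat list list \<Rightarrow> 'a) set \<times> (nat multiset \<Rightarrow> 'a) \<Rightarrow> 'a) set"
  where "differential A d n i = (THE f. is_differential A d n i f)"

end

theory Submission
  imports Defs
begin

text \<open>Modulo the shuffling relations \<open>U\<^sub>i\<close> is the sum, over the sets \<open>W\<close> of \<open>d + i\<close> letters, of the
  quotients \<open>\<Lambda>\<^sup>i\<^sup>+\<^sup>1 / \<partial> \<Lambda>\<^sup>i\<^sup>+\<^sup>2\<close> of the exterior algebra on \<open>W\<close>. It is free on the standard hook tableaux,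
  which correspond to the Eliahou-Kervaire symbols \<open>(u, S)\<close> with \<open>u\<close> a set of \<open>d\<close> letters and \<open>S\<close> a
  set of \<open>i\<close> letters outside \<open>u\<close> and greater than \<open>Min u\<close>; linear independence is detected by explicit
  signed coordinate functionals. In these coordinates the differential is, up to terms in which the
  sum of the letters of \<open>u\<close> is different, the Koszul differential in the variables \<open>x\<^sub>a\<close> with
  \<open>a \<notin> u\<close> and \<open>a > Min u\<close>. Hence cycles can be reduced by the Koszul homotopy, one value of that sum at
  a time; in degree \<open>0\<close> each remaining monomial determines \<open>u\<close> as the \<open>d\<close> largest elements of its
  support, so that the augmentation is injective on reduced elements.\<close>

text \<open>Nothing may be divided by, since \<open>A\<close> is arbitrary, so the relations of
  \<open>U_mod\<close> have to be controlled integrally. All bookkeeping passes through integer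
  functions of a filling that obey the tableau relations; one such function induces a map out of
  \<open>F_mod\<close> for every coefficient ring. They come from exterior forms: on a set W of
  letters let w be the sum of all coordinate forms. Contractions by w are what the shuffling
  relations divide out, and forms divisible by w vanish on them. The resulting coordinates separate
  points, so identities in \<open>F_mod\<close> are tested coordinatewise. This includes the
  well-definedness of the differential, which on tableaux would need a calculation with shuffles:
  every coordinate of a boundary is built from functions of the same type, with the removed letter
  appended. That two differentials compose to zero is then the sign rule for exchanging two appended
  letters. The Koszul complexes that appear have homology only in degree 0, which is why reduced
  elements keep monomials there and nowhere else.\<close>

lemma (in abelian_group) eq_if_minus_zero:
  assumes "x \<in> carrier G" "y \<in> carrier G" "x \<ominus> y = \<zero>"
  shows "x = y"
proof -
  have "x = (x \<ominus> y) \<oplus> y"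
    using assms(1,2) by (simp add: a_minus_def a_assoc l_neg)
  then show ?thesis using assms by simp
qed

lemma (in abelian_group) diff_zero: "x \<in> carrier G \<Longrightarrow> x \<ominus> \<zero> = x"
  by (simp add: a_minus_def)

section \<open>Homomorphisms, submodules and spans of modules\<close>

lemma module_homsI:
  assumes "\<And>x. x \<in> carrier M \<Longrightarrow> h x \<in> carrier N"
    and "\<And>x y. x \<in> carrier M \<Longrightarrow> y \<in> carrier M \<Longrightarrow> h (x \<oplus>\<^bsub>M\<^esub> y) = h x \<oplus>\<^bsub>N\<^esub> h y"
    and "\<And>r x. r \<in> carrier R \<Longrightarrow> x \<in> carrier M \<Longrightarrow> h (r \<odot>\<^bsub>M\<^esub> x) = r \<odot>\<^bsub>N\<^esub> h x"
  shows "h \<in> module_homs R M N"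
  using assms by (auto simp: module_homs_def)

lemma module_homsD:
  assumes "h \<in> module_homs R M N"
  shows module_homs_closed: "x \<in> carrier M \<Longrightarrow> h x \<in> carrier N"
    and module_homs_add: "x \<in> carrier M \<Longrightarrow> y \<in> carrier M \<Longrightarrow> h (x \<oplus>\<^bsub>M\<^esub> y) = h x \<oplus>\<^bsub>N\<^esub> h y"
    and module_homs_smult: "r \<in> carrier R \<Longrightarrow> x \<in> carrier M \<Longrightarrow> h (r \<odot>\<^bsub>M\<^esub> x) = r \<odot>\<^bsub>N\<^esub> h x"
  using assms by (auto simp: module_homs_def)

lemma module_homs_comp:
  assumes "f \<in> module_homs R M N" "g \<in> module_homs R N L"
  shows "(\<lambda>x. g (f x)) \<in> module_homs R M L"
  using assms by (intro module_homsI) (simp_all add: module_homsD)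

lemma module_homs_sum:
  assumes "module R N" "f \<in> module_homs R M N" "g \<in> module_homs R M N"
  shows "(\<lambda>x. f x \<oplus>\<^bsub>N\<^esub> g x) \<in> module_homs R M N"
proof -
  interpret N: module R N by fact
  show ?thesis
    by (rule module_homsI)
      (simp_all add: module_homsD[OF assms(2)] module_homsD[OF assms(3)] N.smult_r_distr N.a_ac)
qed

lemma module_homs_scale:
  assumes "module R M" "r \<in> carrier R"
  shows "(\<lambda>x. r \<odot>\<^bsub>M\<^esub> x) \<in> module_homs R M M"
proof -
  interpret M: module R M by fact
  show ?thesis
    using assms(2) by (intro module_homsI)
      (simp_all add: M.smult_r_distr M.smult_assoc1[symmetric] M.R.m_comm)
qed

lemma module_homs_id: "(\<lambda>x. x) \<in> module_homs R M M"
  by (intro module_homsI) auto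

lemma module_homs_group_hom:
  assumes "module R M" "module R N" "h \<in> module_homs R M N"
  shows "abelian_group_hom M N h"
proof -
  interpret M: module R M by fact
  interpret N: module R N by fact
  show ?thesis
    using assms(3)
    by (intro abelian_group_homI M.abelian_group_axioms N.abelian_group_axioms)
      (auto simp: group_hom_def group_hom_axioms_def hom_def module_homsD M.add.is_group N.add.is_group)
qed

lemma module_homs_zero:
  assumes "module R M" "module R N" "h \<in> module_homs R M N"
  shows "h \<zero>\<^bsub>M\<^esub> = \<zero>\<^bsub>N\<^esub>"
  using abelian_group_hom.hom_zero[OF module_homs_group_hom[OF assms]] .

lemma module_homs_a_inv:
  assumes "module R M" "module R N" "h \<in> module_homs R M N" "x \<in> carrier M"
  shows "h (\<ominus>\<^bsub>M\<^esub> x) = \<ominus>\<^bsub>N\<^esub> h x"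
  using abelian_group_hom.hom_a_inv[OF module_homs_group_hom[OF assms(1-3)]] assms(4) by simp

lemma module_homs_minus:
  assumes "module R M" "module R N" "h \<in> module_homs R M N" "x \<in> carrier M" "y \<in> carrier M"
  shows "h (x \<ominus>\<^bsub>M\<^esub> y) = h x \<ominus>\<^bsub>N\<^esub> h y"
proof -
  interpret M: module R M by fact
  show ?thesis
    using assms by (simp add: a_minus_def module_homs_add module_homs_a_inv)
qed

lemma module_homs_add_pow:
  assumes "module R M" "module R N" "h \<in> module_homs R M N" "x \<in> carrier M"
  shows "h (add_pow M (k :: int) x) = add_pow N k (h x)"
proof -
  interpret h: abelian_group_hom M N h by (rule module_homs_group_hom[OF assms(1-3)])
  interpret h: group_hom "add_monoid M" "add_monoid N" h by (rule h.a_group_hom)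
  show ?thesis
    using h.hom_int_pow[of x k] assms(4) by (simp add: add_pow_def)
qed

lemma module_homs_finsum:
  assumes "module R M" "module R N" "h \<in> module_homs R M N" "f \<in> I \<rightarrow> carrier M"
  shows "h (\<Oplus>\<^bsub>M\<^esub>i\<in>I. f i) = (\<Oplus>\<^bsub>N\<^esub>i\<in>I. h (f i))"
proof -
  interpret M: module R M by fact
  interpret N: module R N by fact
  show ?thesis
    using assms(4)
  proof (induction I rule: infinite_finite_induct)
    case (insert a I)
    have "h (\<Oplus>\<^bsub>M\<^esub>i\<in>insert a I. f i) = h (f a \<oplus>\<^bsub>M\<^esub> (\<Oplus>\<^bsub>M\<^esub>i\<in>I. f i))"
      using insert by (subst M.finsum_insert) auto
    also have "\<dots> = h (f a) \<oplus>\<^bsub>N\<^esub> h (\<Oplus>\<^bsub>M\<^esub>i\<in>I. f i)"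
      using insert by (intro module_homs_add[OF assms(3)]) auto
    also have "\<dots> = (\<Oplus>\<^bsub>N\<^esub>i\<in>insert a I. h (f i))"
      using insert module_homs_closed[OF assms(3)] by (subst N.finsum_insert) auto
    finally show ?case .
  qed (simp_all add: module_homs_zero[OF assms(1-3)])
qed

text \<open>The additive inverse is multiplication by minus one, so closure under negation comes for
  free.\<close>

lemma submodule_by_closure:
  assumes "module R M" "H \<subseteq> carrier M" "\<zero>\<^bsub>M\<^esub> \<in> H"
    and "\<And>x y. x \<in> H \<Longrightarrow> y \<in> H \<Longrightarrow> x \<oplus>\<^bsub>M\<^esub> y \<in> H"
    and "\<And>r x. r \<in> carrier R \<Longrightarrow> x \<in> H \<Longrightarrow> r \<odot>\<^bsub>M\<^esub> x \<in> H"
  shows "submodule H R M"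
proof -
  interpret M: module R M by fact
  have "\<ominus>\<^bsub>M\<^esub> x \<in> H" if "x \<in> H" for x
  proof -
    have "\<ominus>\<^bsub>M\<^esub> x = (\<ominus>\<^bsub>R\<^esub> \<one>\<^bsub>R\<^esub>) \<odot>\<^bsub>M\<^esub> x"
      using that assms(2) by (subst M.smult_l_minus) auto
    then show ?thesis using assms(5) that by simp
  qed
  then show ?thesis
    using assms by (intro M.submoduleI) auto
qed

lemma submodule_finsum:
  assumes "module R M" "submodule H R M" "f \<in> I \<rightarrow> H"
  shows "(\<Oplus>\<^bsub>M\<^esub>i\<in>I. f i) \<in> H"
proof -
  interpret M: module R M by fact
  note E = M.submoduleE[OF assms(2)]
  have z: "\<zero>\<^bsub>M\<^esub> \<in> H"
    using submodule.axioms(1)[OF assms(2)] subgroup.one_closed by force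
  show ?thesis
    using assms(3)
  proof (induction I rule: infinite_finite_induct)
    case (insert a I)
    have "(\<Oplus>\<^bsub>M\<^esub>i\<in>insert a I. f i) = f a \<oplus>\<^bsub>M\<^esub> (\<Oplus>\<^bsub>M\<^esub>i\<in>I. f i)"
      using insert E(1) by (subst M.finsum_insert) auto
    then show ?case using insert E(5) by auto
  qed (simp_all add: z)
qed

lemma submodule_zero: "submodule H R M \<Longrightarrow> \<zero>\<^bsub>M\<^esub> \<in> H"
  using submodule.axioms(1) subgroup.one_closed by force

lemma module_span_superset: "S \<subseteq> module_span R M S"
  by (auto simp: module_span_def)

lemma module_span_minimal: "submodule H R M \<Longrightarrow> S \<subseteq> H \<Longrightarrow> module_span R M S \<subseteq> H"
  by (auto simp: module_span_def)

lemma module_span_submodule: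
  assumes "module R M" "S \<subseteq> carrier M"
  shows "submodule (module_span R M S) R M"
proof -
  interpret M: module R M by fact
  have c: "module_span R M S \<subseteq> carrier M"
    using assms(2) by (intro module_span_minimal M.carrier_is_submodule)
  show ?thesis
    using c M.submoduleE(4,5)
    by (intro submodule_by_closure[OF assms(1)]) (auto simp: module_span_def submodule_zero)
qed

text \<open>The elements of the carrier that satisfy \<open>P\<close> form a submodule containing
  \<open>S\<close>.\<close>

lemma module_span_induct [consumes 3, case_names base zero add smult]:
  assumes "module R M" "S \<subseteq> carrier M" "x \<in> module_span R M S"
    and "\<And>x. x \<in> S \<Longrightarrow> P x" "P \<zero>\<^bsub>M\<^esub>"
    and "\<And>x y. x \<in> carrier M \<Longrightarrow> y \<in> carrier M \<Longrightarrow> P x \<Longrightarrow> P y \<Longrightarrow> P (x \<oplus>\<^bsub>M\<^esub> y)"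
    and "\<And>r x. r \<in> carrier R \<Longrightarrow> x \<in> carrier M \<Longrightarrow> P x \<Longrightarrow> P (r \<odot>\<^bsub>M\<^esub> x)"
  shows "P x"
proof -
  interpret M: module R M by fact
  have "submodule {x \<in> carrier M. P x} R M"
    using assms by (intro submodule_by_closure) auto
  then have "module_span R M S \<subseteq> {x \<in> carrier M. P x}"
    using assms by (intro module_span_minimal) auto
  then show ?thesis using assms(3) by auto
qed

lemma module_homs_eq_on_span:
  assumes "module R M" "module R N" "f \<in> module_homs R M N" "g \<in> module_homs R M N"
    and "S \<subseteq> carrier M" "\<And>x. x \<in> S \<Longrightarrow> f x = g x" "x \<in> module_span R M S"
  shows "f x = g x"
  using assms(1,5,7)
  by (induction rule: module_span_induct)
    (simp_all add: assms(6) module_homsD[OF assms(3)] module_homsD[OF assms(4)]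
      module_homs_zero[OF assms(1-3)] module_homs_zero[OF assms(1,2,4)])

lemma module_homs_span_image:
  assumes "module R M" "module R N" "f \<in> module_homs R M N" "S \<subseteq> carrier M"
    and "submodule H R N" "\<And>x. x \<in> S \<Longrightarrow> f x \<in> H" "x \<in> module_span R M S"
  shows "f x \<in> H"
proof -
  interpret N: module R N by fact
  show ?thesis
    using assms(1,4,7)
  by (induction rule: module_span_induct)
    (simp_all add: assms(6) module_homsD[OF assms(3)] submodule_zero[OF assms(5)]
      module_homs_zero[OF assms(1-3)] N.submoduleE[OF assms(5)])
qed

lemma submodule_image:
  assumes "module R M" "module R N" "f \<in> module_homs R M N"
  shows "submodule (f ` carrier M) R N"
proof -
  interpret M: module R M by fact
  interpret N: module R N by fact
  show ?thesis
  proof (rule submodule_by_closure)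
    show "\<zero>\<^bsub>N\<^esub> \<in> f ` carrier M"
      using module_homs_zero[OF assms] by (metis M.zero_closed imageI)
    show "x \<oplus>\<^bsub>N\<^esub> y \<in> f ` carrier M" if "x \<in> f ` carrier M" "y \<in> f ` carrier M" for x y
      using that module_homs_add[OF assms(3)] by (smt (verit) M.add.m_closed image_iff)
    show "r \<odot>\<^bsub>N\<^esub> x \<in> f ` carrier M" if "r \<in> carrier R" "x \<in> f ` carrier M" for r x
      using that module_homs_smult[OF assms(3)] by (smt (verit) M.smult_closed image_iff)
  qed (use assms module_homs_closed in fastforce)+
qed

text \<open>Several records share their additive group and differ at most in scalars or extra
  fields: \<open>U i\<close> and a quotient module, \<open>F i\<close> and \<open>TT i\<close>,
  \<open>PP\<close> and \<open>P\<close>, \<open>res M\<close> and \<open>M\<close>. Finite sums,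
  inverses and integer multiples depend only on the three fields compared here and can be carried
  over.\<close>

definition same_group :: "('m, 'y) ring_scheme \<Rightarrow> ('m, 'z) ring_scheme \<Rightarrow> bool"
  where "same_group M' M \<longleftrightarrow> carrier M' = carrier M \<and> add M' = add M \<and> zero M' = zero M"

lemma same_group_finsum: "same_group M' M \<Longrightarrow> finsum M' f I = finsum M f I"
  by (simp add: same_group_def finsum_def finprod_def)

lemma same_group_a_inv: "same_group M' M \<Longrightarrow> a_inv M' = a_inv M"
  by (simp add: same_group_def a_inv_def m_inv_def fun_eq_iff)

lemma same_group_add_pow:
  fixes k :: int
  assumes "same_group M' M"
  shows "add_pow M' k x = add_pow M k x"
  unfolding add_pow_def int_pow_def nat_pow_def same_group_a_inv[OF assms, unfolded a_inv_def]
  using assms by (simp add: same_group_def)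

lemma same_group_submodule:
  assumes "same_group M' M"
    and "\<And>r x. r \<in> carrier R \<Longrightarrow> x \<in> carrier M \<Longrightarrow> r \<odot>\<^bsub>M'\<^esub> x = r \<odot>\<^bsub>M\<^esub> x"
  shows "submodule H R M' \<longleftrightarrow> submodule H R M"
  using assms unfolding submodule_def submodule_axioms_def subgroup_def same_group_def
  by (auto simp: m_inv_def subset_iff)

lemma same_group_subgroup:
  assumes "same_group M' M" shows "subgroup H (add_monoid M') \<longleftrightarrow> subgroup H (add_monoid M)"
  using assms unfolding subgroup_def same_group_def
  by (auto simp: m_inv_def subset_iff)

lemma same_group_abelian_group:
  assumes "abelian_group M" and "same_group M' M"
  shows "abelian_group M'"
proof -
  interpret M: abelian_group M by fact
  have e: "carrier M' = carrier M" "add M' = add M" "zero M' = zero M"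
    using assms(2) by (simp_all add: same_group_def)
  show ?thesis
    by (rule abelian_groupI) (auto simp: e M.a_ac intro: bexI[of _ "\<ominus>\<^bsub>M\<^esub> _"] M.l_neg)
qed

lemma same_group_module:
  assumes "module R M" and g: "same_group M' M"
    and s: "\<And>r x. r \<in> carrier R \<Longrightarrow> x \<in> carrier M \<Longrightarrow> r \<odot>\<^bsub>M'\<^esub> x = r \<odot>\<^bsub>M\<^esub> x"
  shows "module R M'"
proof -
  interpret M: module R M by fact
  have e: "carrier M' = carrier M" "add M' = add M" "zero M' = zero M"
    using g by (simp_all add: same_group_def)
  have "abelian_group M'"
    by (rule same_group_abelian_group[OF M.abelian_group_axioms g])
  then show ?thesis
    by (intro moduleI M.R.is_cring) (simp_all add: e s M.smult_l_distr M.smult_r_distr M.smult_assoc1)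
qed

subsection \<open>Free modules\<close>

context
  fixes A :: "('a, 'x) ring_scheme"
  assumes A: "cring A"
begin

interpretation A: cring A by (rule A)

lemma free_module_simps:
  "zero (free_module A B) = (\<lambda>b. \<zero>\<^bsub>A\<^esub>)" "f \<oplus>\<^bsub>free_module A B\<^esub> g = (\<lambda>b. f b \<oplus>\<^bsub>A\<^esub> g b)"
  "a \<odot>\<^bsub>free_module A B\<^esub> f = (\<lambda>b. a \<otimes>\<^bsub>A\<^esub> f b)"
  by (simp_all add: free_module_def)

lemma free_module_carrier:
  "f \<in> carrier (free_module A B) \<longleftrightarrow>
    (\<forall>b. f b \<in> carrier A) \<and> (\<forall>b. b \<notin> B \<longrightarrow> f b = \<zero>\<^bsub>A\<^esub>) \<and> finite {b. f b \<noteq> \<zero>\<^bsub>A\<^esub>}"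
  by (auto simp add: free_module_def)

lemma free_module_module: "module A (free_module A B)"
proof (rule moduleI)
  let ?F = "free_module A B"
  show "abelian_group ?F"
  proof (rule abelian_groupI)
    fix f g assume fg: "f \<in> carrier ?F" "g \<in> carrier ?F"
    have "finite {b. f b \<oplus>\<^bsub>A\<^esub> g b \<noteq> \<zero>\<^bsub>A\<^esub>}"
      by (rule finite_subset[of _ "{b. f b \<noteq> \<zero>\<^bsub>A\<^esub>} \<union> {b. g b \<noteq> \<zero>\<^bsub>A\<^esub>}"])
        (use fg in \<open>auto simp: free_module_carrier\<close>)
    then show "f \<oplus>\<^bsub>?F\<^esub> g \<in> carrier ?F"
      using fg by (auto simp: free_module_carrier free_module_simps)
  next
    fix f assume f: "f \<in> carrier ?F"
    have "finite {b. \<ominus>\<^bsub>A\<^esub> f b \<noteq> \<zero>\<^bsub>A\<^esub>}"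
      by (rule finite_subset[of _ "{b. f b \<noteq> \<zero>\<^bsub>A\<^esub>}"])
        (use f in \<open>auto simp: free_module_carrier\<close>)
    then show "\<exists>g\<in>carrier ?F. g \<oplus>\<^bsub>?F\<^esub> f = \<zero>\<^bsub>?F\<^esub>"
      using f by (intro bexI[of _ "\<lambda>b. \<ominus>\<^bsub>A\<^esub> f b"]) (auto simp: free_module_carrier free_module_simps A.l_neg)
  qed (auto simp: free_module_simps free_module_carrier A.a_ac)
  show "a \<odot>\<^bsub>?F\<^esub> f \<in> carrier ?F" if "a \<in> carrier A" "f \<in> carrier ?F" for a f
  proof -
    have "finite {b. a \<otimes>\<^bsub>A\<^esub> f b \<noteq> \<zero>\<^bsub>A\<^esub>}"
      by (rule finite_subset[of _ "{b. f b \<noteq> \<zero>\<^bsub>A\<^esub>}"])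
        (use that in \<open>auto simp: free_module_carrier\<close>)
    then show ?thesis using that by (auto simp: free_module_carrier free_module_simps)
  qed
qed (auto simp: A free_module_simps free_module_carrier A.l_distr A.r_distr A.m_assoc)

lemma unit_vec_closed: "b \<in> B \<Longrightarrow> unit_vec A b \<in> carrier (free_module A B)"
proof -
  assume "b \<in> B"
  moreover have "finite {c. (if c = b then \<one>\<^bsub>A\<^esub> else \<zero>\<^bsub>A\<^esub>) \<noteq> \<zero>\<^bsub>A\<^esub>}"
    by (rule finite_subset[of _ "{b}"]) auto
  ultimately show ?thesis
    by (auto simp: free_module_carrier unit_vec_def)
qed

lemma free_module_finsum_apply:
  assumes "finite I" "f \<in> I \<rightarrow> carrier (free_module A B)"
  shows "(\<Oplus>\<^bsub>free_module A B\<^esub>i\<in>I. f i) b = (\<Oplus>\<^bsub>A\<^esub>i\<in>I. f i b)"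
  using assms
proof (induction I rule: finite_induct)
  interpret F: module A "free_module A B" by (rule free_module_module)
  case empty
  then show ?case by (simp add: free_module_simps)
next
  interpret F: module A "free_module A B" by (rule free_module_module)
  case (insert x I)
  then show ?case
    by (subst F.finsum_insert) (auto simp: free_module_simps free_module_carrier Pi_iff)
qed

lemma free_module_expand:
  assumes "f \<in> carrier (free_module A B)"
  shows "f = (\<Oplus>\<^bsub>free_module A B\<^esub>b\<in>{b. f b \<noteq> \<zero>\<^bsub>A\<^esub>}. f b \<odot>\<^bsub>free_module A B\<^esub> unit_vec A b)"
proof
  interpret F: module A "free_module A B" by (rule free_module_module)
  fix c
  let ?S = "{b. f b \<noteq> \<zero>\<^bsub>A\<^esub>}"
  have fin: "finite ?S" and SB: "?S \<subseteq> B" and fc: "\<And>b. f b \<in> carrier A"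
    using assms by (auto simp: free_module_carrier)
  have "(\<Oplus>\<^bsub>free_module A B\<^esub>b\<in>?S. f b \<odot>\<^bsub>free_module A B\<^esub> unit_vec A b) c
      = (\<Oplus>\<^bsub>A\<^esub>b\<in>?S. f b \<otimes>\<^bsub>A\<^esub> unit_vec A b c)"
  proof -
    have "(\<lambda>b. f b \<odot>\<^bsub>free_module A B\<^esub> unit_vec A b) \<in> ?S \<rightarrow> carrier (free_module A B)"
      using SB fc by (intro Pi_I F.smult_closed unit_vec_closed) auto
    from free_module_finsum_apply[OF fin this] show ?thesis by (simp add: free_module_simps)
  qed
  also have "\<dots> = (\<Oplus>\<^bsub>A\<^esub>b\<in>?S. if c = b then f b else \<zero>\<^bsub>A\<^esub>)"
    using fc by (intro A.finsum_cong') (auto simp: unit_vec_def)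
  also have "\<dots> = f c"
  proof (cases "c \<in> ?S")
    case True
    then show ?thesis using A.finsum_singleton[OF True fin] fc by auto
  next
    case False
    then have "(\<Oplus>\<^bsub>A\<^esub>b\<in>?S. if c = b then f b else \<zero>\<^bsub>A\<^esub>) = (\<Oplus>\<^bsub>A\<^esub>b\<in>?S. \<zero>\<^bsub>A\<^esub>)"
      by (intro A.finsum_cong') auto
    then show ?thesis using False by simp
  qed
  finally show "f c = (\<Oplus>\<^bsub>free_module A B\<^esub>b\<in>?S. f b \<odot>\<^bsub>free_module A B\<^esub> unit_vec A b) c" by simp
qed

lemma free_module_span:
  "carrier (free_module A B) = module_span A (free_module A B) (unit_vec A ` B)" (is "?C = ?S")
proof
  interpret F: module A "free_module A B" by (rule free_module_module)
  have sub: "submodule ?S A (free_module A B)"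
    using unit_vec_closed by (intro module_span_submodule free_module_module) auto
  show "?S \<subseteq> ?C" using F.submoduleE(1)[OF sub] .
  show "?C \<subseteq> ?S"
  proof
    fix f assume f: "f \<in> ?C"
    have "f b \<odot>\<^bsub>free_module A B\<^esub> unit_vec A b \<in> ?S" if "f b \<noteq> \<zero>\<^bsub>A\<^esub>" for b
    proof -
      have "b \<in> B" "f b \<in> carrier A" using f that by (auto simp: free_module_carrier)
      then show ?thesis
        using module_span_superset[of "unit_vec A ` B" A "free_module A B"]
        by (intro F.submoduleE(4)[OF sub]) auto
    qed
    then show "f \<in> ?S"
      by (subst free_module_expand[OF f], intro submodule_finsum[OF free_module_module sub]) auto
  qed
qed

lemma free_module_lift:
  assumes M: "module A M" and g: "g \<in> B \<rightarrow> carrier M"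
  shows "\<exists>h\<in>module_homs A (free_module A B) M. \<forall>b\<in>B. h (unit_vec A b) = g b"
proof (intro bexI ballI)
  interpret M: module A M by fact
  let ?F = "free_module A B"
  let ?h = "\<lambda>f. \<Oplus>\<^bsub>M\<^esub>b\<in>{b. f b \<noteq> \<zero>\<^bsub>A\<^esub>}. f b \<odot>\<^bsub>M\<^esub> g b"
  have mem: "f b \<odot>\<^bsub>M\<^esub> g b \<in> carrier M" if "f \<in> carrier ?F" "b \<in> B" for f b
    using that g by (auto simp: free_module_carrier)
  \<comment> \<open>Any finite index set between the support and \<open>B\<close> gives the same
    sum; passing to a common one allows \<open>f\<close>, \<open>f'\<close> and their sum to be
    compared termwise.\<close>
  have ext: "?h f = (\<Oplus>\<^bsub>M\<^esub>b\<in>I. f b \<odot>\<^bsub>M\<^esub> g b)"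
    if f: "f \<in> carrier ?F" and I: "finite I" "{b. f b \<noteq> \<zero>\<^bsub>A\<^esub>} \<subseteq> I" "I \<subseteq> B" for f I
    using f I g by (intro M.add.finprod_mono_neutral_cong_left) (auto simp: free_module_carrier Pi_iff subset_iff)
  show "?h \<in> module_homs A ?F M"
  proof (rule module_homsI)
    fix f assume f: "f \<in> carrier ?F"
    show "?h f \<in> carrier M"
      using f mem by (intro M.finsum_closed) (auto simp: free_module_carrier)
    fix r assume r: "r \<in> carrier A"
    let ?I = "{b. f b \<noteq> \<zero>\<^bsub>A\<^esub>}"
    have I: "finite ?I" "?I \<subseteq> B" using f by (auto simp: free_module_carrier)
    interpret F: module A ?F by (rule free_module_module)
    have "?h (r \<odot>\<^bsub>?F\<^esub> f) = (\<Oplus>\<^bsub>M\<^esub>b\<in>?I. (r \<odot>\<^bsub>?F\<^esub> f) b \<odot>\<^bsub>M\<^esub> g b)"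
      by (rule ext) (use f I r F.smult_closed[OF r f] in \<open>auto simp: free_module_simps\<close>)
    also have "\<dots> = (\<Oplus>\<^bsub>M\<^esub>b\<in>?I. r \<odot>\<^bsub>M\<^esub> (f b \<odot>\<^bsub>M\<^esub> g b))"
      using f r I g mem[OF f]
      by (intro M.finsum_cong') (auto simp: free_module_simps free_module_carrier M.smult_assoc1 Pi_iff subset_iff)
    also have "\<dots> = r \<odot>\<^bsub>M\<^esub> ?h f"
      using I r mem[OF f] by (subst M.finsum_smult_ldistr) auto
    finally show "?h (r \<odot>\<^bsub>?F\<^esub> f) = r \<odot>\<^bsub>M\<^esub> ?h f" .
  next
    fix f f' assume f: "f \<in> carrier ?F" "f' \<in> carrier ?F"
    interpret F: module A ?F by (rule free_module_module)
    let ?I = "{b. f b \<noteq> \<zero>\<^bsub>A\<^esub>} \<union> {b. f' b \<noteq> \<zero>\<^bsub>A\<^esub>}"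
    have I: "finite ?I" "?I \<subseteq> B" using f by (auto simp: free_module_carrier)
    have "?h (f \<oplus>\<^bsub>?F\<^esub> f') = (\<Oplus>\<^bsub>M\<^esub>b\<in>?I. (f \<oplus>\<^bsub>?F\<^esub> f') b \<odot>\<^bsub>M\<^esub> g b)"
      by (rule ext) (use f I F.a_closed[OF f] in \<open>auto simp: free_module_simps\<close>)
    also have "\<dots> = (\<Oplus>\<^bsub>M\<^esub>b\<in>?I. f b \<odot>\<^bsub>M\<^esub> g b \<oplus>\<^bsub>M\<^esub> f' b \<odot>\<^bsub>M\<^esub> g b)"
      using f I g mem[OF f(1)] mem[OF f(2)]
      by (intro M.finsum_cong') (auto simp: free_module_simps free_module_carrier M.smult_l_distr Pi_iff subset_iff)
    also have "\<dots> = (\<Oplus>\<^bsub>M\<^esub>b\<in>?I. f b \<odot>\<^bsub>M\<^esub> g b) \<oplus>\<^bsub>M\<^esub> (\<Oplus>\<^bsub>M\<^esub>b\<in>?I. f' b \<odot>\<^bsub>M\<^esub> g b)"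
      using I mem f by (intro M.finsum_addf) auto
    also have "\<dots> = ?h f \<oplus>\<^bsub>M\<^esub> ?h f'"
      using ext[OF f(1) I(1) _ I(2)] ext[OF f(2) I(1) _ I(2)] by auto
    finally show "?h (f \<oplus>\<^bsub>?F\<^esub> f') = ?h f \<oplus>\<^bsub>M\<^esub> ?h f'" .
  qed
  fix b assume b: "b \<in> B"
  have "?h (unit_vec A b) = (\<Oplus>\<^bsub>M\<^esub>c\<in>{b}. unit_vec A b c \<odot>\<^bsub>M\<^esub> g c)"
    by (rule ext) (use b unit_vec_closed in \<open>auto simp: unit_vec_def\<close>)
  also have "\<dots> = g b"
    using b g M.r_zero[of "g b"] by (subst M.finsum_insert) (auto simp: unit_vec_def Pi_iff)
  finally show "?h (unit_vec A b) = g b" .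
qed

end

subsection \<open>Quotient modules\<close>

context
  fixes R :: "('r, 'x) ring_scheme" and M :: "('r, 'm, 'y) module_scheme" and K :: "'m set"
  assumes M: "module R M" and K: "submodule K R M"
begin

interpretation M: module R M by (rule M)

lemma submodule_abelian_subgroup: "abelian_subgroup K M"
  using submodule.axioms(1)[OF K]
  by (intro abelian_subgroupI3 additive_subgroupI M.abelian_group_axioms)

interpretation K: abelian_subgroup K M by (rule submodule_abelian_subgroup)

lemma coset_eq_iff:
  assumes "x \<in> carrier M" "y \<in> carrier M"
  shows "K +>\<^bsub>M\<^esub> x = K +>\<^bsub>M\<^esub> y \<longleftrightarrow> x \<ominus>\<^bsub>M\<^esub> y \<in> K"
proof
  assume "K +>\<^bsub>M\<^esub> x = K +>\<^bsub>M\<^esub> y"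
  then have "x \<in> K +>\<^bsub>M\<^esub> y" using K.a_rcos_self[OF assms(1)] by simp
  then show "x \<ominus>\<^bsub>M\<^esub> y \<in> K"
    using K.a_rcos_module[of y x] assms by (simp add: a_minus_def)
next
  assume "x \<ominus>\<^bsub>M\<^esub> y \<in> K"
  then have "x \<in> K +>\<^bsub>M\<^esub> y" 
    using K.a_rcos_module[of y x] assms by (simp add: a_minus_def)
  then show "K +>\<^bsub>M\<^esub> x = K +>\<^bsub>M\<^esub> y"
    using K.a_repr_independence'[of x y] assms by simp
qed


lemma quot_module_carrier: "carrier (quot_module M K) = (\<lambda>x. K +>\<^bsub>M\<^esub> x) ` carrier M"
  by (auto simp: quot_module_def A_RCOSETS_def')

lemma quot_module_zero: "\<zero>\<^bsub>quot_module M K\<^esub> = K +>\<^bsub>M\<^esub> \<zero>\<^bsub>M\<^esub>"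
  using K.a_subset by (simp add: quot_module_def)

lemma quot_module_add:
  "x \<in> carrier M \<Longrightarrow> y \<in> carrier M \<Longrightarrow>
    (K +>\<^bsub>M\<^esub> x) \<oplus>\<^bsub>quot_module M K\<^esub> (K +>\<^bsub>M\<^esub> y) = K +>\<^bsub>M\<^esub> (x \<oplus>\<^bsub>M\<^esub> y)"
  by (simp add: quot_module_def K.a_rcos_sum)

text \<open>\<open>quot_module\<close> takes a union over all representatives. The submodule is
  stable under scalars, so this is a union of a nonempty family of equal cosets.\<close>

lemma quot_module_smult:
  assumes "r \<in> carrier R" "x \<in> carrier M"
  shows "r \<odot>\<^bsub>quot_module M K\<^esub> (K +>\<^bsub>M\<^esub> x) = K +>\<^bsub>M\<^esub> (r \<odot>\<^bsub>M\<^esub> x)"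
proof -
  have "K +>\<^bsub>M\<^esub> (r \<odot>\<^bsub>M\<^esub> z) = K +>\<^bsub>M\<^esub> (r \<odot>\<^bsub>M\<^esub> x)" if z: "z \<in> K +>\<^bsub>M\<^esub> x" for z
  proof -
    have zc: "z \<in> carrier M" using z assms K.a_elemrcos_carrier by blast
    have "z \<ominus>\<^bsub>M\<^esub> x \<in> K"
      using K.a_rcos_module[of x z] z zc assms by (simp add: a_minus_def)
    then have "r \<odot>\<^bsub>M\<^esub> (z \<ominus>\<^bsub>M\<^esub> x) \<in> K"
      using M.submoduleE(4)[OF K] assms by simp
    then show ?thesis
      using zc assms coset_eq_iff[of "r \<odot>\<^bsub>M\<^esub> z" "r \<odot>\<^bsub>M\<^esub> x"]
        M.smult_r_distr[of r z "\<ominus>\<^bsub>M\<^esub> x"] M.smult_r_minus[of r x]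
      unfolding a_minus_def by (metis M.smult_closed M.a_inv_closed)
  qed
  then have "(\<Union>z\<in>K +>\<^bsub>M\<^esub> x. K +>\<^bsub>M\<^esub> (r \<odot>\<^bsub>M\<^esub> z)) = K +>\<^bsub>M\<^esub> (r \<odot>\<^bsub>M\<^esub> x)"
  proof (rule SUP_eq_const[rotated])
    show "K +>\<^bsub>M\<^esub> x \<noteq> {}" using K.a_rcos_self[OF assms(2)] by blast
  qed
  then show ?thesis
    by (simp add: quot_module_def)
qed

lemmas quot_module_simps = quot_module_carrier quot_module_zero quot_module_add quot_module_smult

lemma quot_module_module: "module R (quot_module M K)"
proof (rule moduleI)
  show "abelian_group (quot_module M K)"
  proof (rule abelian_groupI)
    fix C assume "C \<in> carrier (quot_module M K)"
    then obtain x where "x \<in> carrier M" "C = K +>\<^bsub>M\<^esub> x" by (auto simp: quot_module_carrier)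
    then show "\<exists>D\<in>carrier (quot_module M K). D \<oplus>\<^bsub>quot_module M K\<^esub> C = \<zero>\<^bsub>quot_module M K\<^esub>"
      by (intro bexI[of _ "K +>\<^bsub>M\<^esub> (\<ominus>\<^bsub>M\<^esub> x)"]) (auto simp: quot_module_simps M.l_neg)
  qed (auto simp: quot_module_carrier quot_module_add quot_module_zero M.a_ac simp del: M.a_coset_add_zero)
qed (auto simp: quot_module_carrier quot_module_add quot_module_smult M.smult_l_distr
       M.smult_r_distr M.smult_assoc1 M.R.is_cring)

lemma quot_module_proj: "(\<lambda>x. K +>\<^bsub>M\<^esub> x) \<in> module_homs R M (quot_module M K)"
  by (intro module_homsI) (auto simp: quot_module_carrier quot_module_add quot_module_smult)

lemma quot_module_span:
  assumes "carrier M = module_span R M S" "S \<subseteq> carrier M"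
  shows "carrier (quot_module M K) = module_span R (quot_module M K) ((\<lambda>x. K +>\<^bsub>M\<^esub> x) ` S)"
    (is "_ = module_span R ?Q ?S")
proof
  interpret Q: module R ?Q by (rule quot_module_module)
  have sub: "submodule (module_span R ?Q ?S) R ?Q"
    using assms(2) by (intro module_span_submodule Q.module_axioms) (auto simp: quot_module_carrier)
  show "module_span R ?Q ?S \<subseteq> carrier ?Q" using Q.submoduleE(1)[OF sub] .
  show "carrier ?Q \<subseteq> module_span R ?Q ?S"
    using module_homs_span_image[OF M Q.module_axioms quot_module_proj assms(2) sub] assms(1)
      module_span_superset[of ?S] by (fastforce simp: quot_module_carrier)
qed

text \<open>The map evaluates \<open>h\<close> at a representative picked by \<open>SOME\<close>; as
  \<open>h\<close> vanishes on \<open>K\<close>, every representative gives the same value.\<close>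

lemma quot_module_lift:
  assumes N: "module R N" and h: "h \<in> module_homs R M N" and "\<And>x. x \<in> K \<Longrightarrow> h x = \<zero>\<^bsub>N\<^esub>"
  shows "\<exists>h'\<in>module_homs R (quot_module M K) N. \<forall>x\<in>carrier M. h' (K +>\<^bsub>M\<^esub> x) = h x"
proof (intro bexI ballI)
  interpret N: module R N by fact
  let ?h = "\<lambda>C. h (SOME x. x \<in> C)"
  have *: "?h (K +>\<^bsub>M\<^esub> x) = h x" if x: "x \<in> carrier M" for x
  proof -
    define z where "z = (SOME z. z \<in> K +>\<^bsub>M\<^esub> x)"
    have z: "z \<in> K +>\<^bsub>M\<^esub> x"
      unfolding z_def by (rule someI[of _ x]) (use K.a_rcos_self x in simp)
    have zc: "z \<in> carrier M" using z x K.a_elemrcos_carrier by blast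
    have "z \<ominus>\<^bsub>M\<^esub> x \<in> K"
      using K.a_rcos_module[of x z] z zc x by (simp add: a_minus_def)
    then have "h z \<ominus>\<^bsub>N\<^esub> h x = \<zero>\<^bsub>N\<^esub>"
      using assms(3) module_homs_minus[OF M N h zc x] by metis
    then show ?thesis
      using module_homs_closed[OF h zc] module_homs_closed[OF h x] N.eq_if_minus_zero unfolding z_def[symmetric]
      by simp
  qed
  show "\<And>x. x \<in> carrier M \<Longrightarrow> ?h (K +>\<^bsub>M\<^esub> x) = h x" by (rule *)
  show "?h \<in> module_homs R (quot_module M K) N"
    by (intro module_homsI)
      (auto simp: quot_module_carrier quot_module_add quot_module_smult * module_homsD[OF h]
        simp del: M.a_coset_add_zero)
qed

end

subsection \<open>Tensor products\<close>

lemma setcompr_pair_image: "{f u v | u v. u \<in> S \<and> v \<in> T} = (\<lambda>p. f (fst p) (snd p)) ` (S \<times> T)"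
  by force

context
  fixes A :: "('a, 'x) ring_scheme" and M :: "('a, 'm, 'y) module_scheme"
    and N :: "('a, 'n, 'z) module_scheme"
  assumes A: "cring A" and M: "module A M" and N: "module A N"
begin

interpretation A: cring A by (rule A)
interpretation M: module A M by (rule M)
interpretation N: module A N by (rule N)

private abbreviation (input) "FT \<equiv> free_module A (carrier M \<times> carrier N)"
private abbreviation (input) "KT \<equiv> module_span A FT (tensor_relations A M N)"

interpretation F: module A FT by (rule free_module_module[OF A])

lemma tensor_relations_closed: "tensor_relations A M N \<subseteq> carrier FT"
  unfolding tensor_relations_def Let_def
  by (auto intro!: F.minus_closed F.a_closed F.smult_closed unit_vec_closed[OF A])

lemma tensor_relations_submodule: "submodule KT A FT"
  by (rule module_span_submodule[OF F.module_axioms tensor_relations_closed])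

lemma tensor_module_eq: "tensor_module A M N = quot_module FT KT"
  by (simp add: tensor_module_def Let_def)

lemma pure_tensor_eq: "pure_tensor A M N u v = KT +>\<^bsub>FT\<^esub> unit_vec A (u, v)"
  by (simp add: pure_tensor_def Let_def)

lemma tensor_module_module: "module A (tensor_module A M N)"
  unfolding tensor_module_eq by (rule quot_module_module[OF F.module_axioms tensor_relations_submodule])

lemma pure_tensor_closed:
  "u \<in> carrier M \<Longrightarrow> v \<in> carrier N \<Longrightarrow> pure_tensor A M N u v \<in> carrier (tensor_module A M N)"
  unfolding tensor_module_eq pure_tensor_eq
  by (auto simp: quot_module_carrier[OF F.module_axioms tensor_relations_submodule] intro!: imageI unit_vec_closed[OF A])

lemma tensor_module_span:
  "carrier (tensor_module A M N) = module_span A (tensor_module A M N)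
    {pure_tensor A M N u v | u v. u \<in> carrier M \<and> v \<in> carrier N}"
proof -
  have e: "{pure_tensor A M N u v | u v. u \<in> carrier M \<and> v \<in> carrier N}
      = (\<lambda>x. KT +>\<^bsub>FT\<^esub> x) ` unit_vec A ` (carrier M \<times> carrier N)"
    unfolding setcompr_pair_image pure_tensor_eq image_image prod.collapse ..
  have "unit_vec A ` (carrier M \<times> carrier N) \<subseteq> carrier FT"
    by (rule image_subsetI, rule unit_vec_closed[OF A])
  note quot_module_span[OF F.module_axioms tensor_relations_submodule free_module_span[OF A] this]
  then show ?thesis
    unfolding tensor_module_eq e .
qed

lemma tensor_relation_eq:
  assumes "x \<ominus>\<^bsub>FT\<^esub> y \<in> tensor_relations A M N" "x \<in> carrier FT" "y \<in> carrier FT"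
  shows "KT +>\<^bsub>FT\<^esub> x = KT +>\<^bsub>FT\<^esub> y"
  using assms module_span_superset[of "tensor_relations A M N" A FT]
  by (subst coset_eq_iff[OF F.module_axioms tensor_relations_submodule]) auto

lemmas tensor_quot_simps = quot_module_add[OF F.module_axioms tensor_relations_submodule]
  quot_module_smult[OF F.module_axioms tensor_relations_submodule]

lemma pure_tensor_add_left:
  assumes "u \<in> carrier M" "u' \<in> carrier M" "v \<in> carrier N"
  shows "pure_tensor A M N (u \<oplus>\<^bsub>M\<^esub> u') v =
    pure_tensor A M N u v \<oplus>\<^bsub>tensor_module A M N\<^esub> pure_tensor A M N u' v"
proof -
  have e: "\<And>u v. u \<in> carrier M \<Longrightarrow> v \<in> carrier N \<Longrightarrow> unit_vec A (u, v) \<in> carrier FT"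
    by (intro unit_vec_closed[OF A]) auto
  show ?thesis
    unfolding tensor_module_eq pure_tensor_eq using assms
    by (subst tensor_quot_simps)
      (simp_all add: e, intro tensor_relation_eq, auto intro!: e F.a_closed F.smult_closed simp: tensor_relations_def Let_def)
qed

lemma pure_tensor_add_right:
  assumes "u \<in> carrier M" "v \<in> carrier N" "v' \<in> carrier N"
  shows "pure_tensor A M N u (v \<oplus>\<^bsub>N\<^esub> v') =
    pure_tensor A M N u v \<oplus>\<^bsub>tensor_module A M N\<^esub> pure_tensor A M N u v'"
proof -
  have e: "\<And>u v. u \<in> carrier M \<Longrightarrow> v \<in> carrier N \<Longrightarrow> unit_vec A (u, v) \<in> carrier FT"
    by (intro unit_vec_closed[OF A]) auto
  show ?thesis
    unfolding tensor_module_eq pure_tensor_eq using assms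
    by (subst tensor_quot_simps)
      (simp_all add: e, intro tensor_relation_eq, auto intro!: e F.a_closed F.smult_closed simp: tensor_relations_def Let_def)
qed

lemma pure_tensor_smult_left:
  assumes "a \<in> carrier A" "u \<in> carrier M" "v \<in> carrier N"
  shows "pure_tensor A M N (a \<odot>\<^bsub>M\<^esub> u) v = a \<odot>\<^bsub>tensor_module A M N\<^esub> pure_tensor A M N u v"
proof -
  have e: "\<And>u v. u \<in> carrier M \<Longrightarrow> v \<in> carrier N \<Longrightarrow> unit_vec A (u, v) \<in> carrier FT"
    by (intro unit_vec_closed[OF A]) auto
  show ?thesis
    unfolding tensor_module_eq pure_tensor_eq using assms
    by (subst tensor_quot_simps)
      (simp_all add: e, intro tensor_relation_eq, auto intro!: e F.a_closed F.smult_closed simp: tensor_relations_def Let_def)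
qed

lemma pure_tensor_smult_right:
  assumes "a \<in> carrier A" "u \<in> carrier M" "v \<in> carrier N"
  shows "pure_tensor A M N u (a \<odot>\<^bsub>N\<^esub> v) = a \<odot>\<^bsub>tensor_module A M N\<^esub> pure_tensor A M N u v"
proof -
  have e: "\<And>u v. u \<in> carrier M \<Longrightarrow> v \<in> carrier N \<Longrightarrow> unit_vec A (u, v) \<in> carrier FT"
    by (intro unit_vec_closed[OF A]) auto
  show ?thesis
    unfolding tensor_module_eq pure_tensor_eq using assms
    by (subst tensor_quot_simps)
      (simp_all add: e, intro tensor_relation_eq, auto intro!: e F.a_closed F.smult_closed simp: tensor_relations_def Let_def)
qed

lemma tensor_homs_eq:
  assumes "module A L" "f \<in> module_homs A (tensor_module A M N) L" "g \<in> module_homs A (tensor_module A M N) L"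
    and "\<And>u v. u \<in> carrier M \<Longrightarrow> v \<in> carrier N \<Longrightarrow> f (pure_tensor A M N u v) = g (pure_tensor A M N u v)"
    and "x \<in> carrier (tensor_module A M N)"
  shows "f x = g x"
proof (rule module_homs_eq_on_span[OF tensor_module_module assms(1-3)])
  show "x \<in> module_span A (tensor_module A M N) {pure_tensor A M N u v | u v. u \<in> carrier M \<and> v \<in> carrier N}"
    using assms(5) tensor_module_span by simp
qed (use assms(4) pure_tensor_closed in auto)

text \<open>Each of the four kinds of tensor relation is killed by one of the four bilinearity
  assumptions, so the lift to the free module descends to the quotient.\<close>

lemma tensor_lift:
  assumes L: "module A L"
    and cl: "\<And>u v. u \<in> carrier M \<Longrightarrow> v \<in> carrier N \<Longrightarrow> \<beta> u v \<in> carrier L"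
    and "\<And>u u' v. u \<in> carrier M \<Longrightarrow> u' \<in> carrier M \<Longrightarrow> v \<in> carrier N \<Longrightarrow>
      \<beta> (u \<oplus>\<^bsub>M\<^esub> u') v = \<beta> u v \<oplus>\<^bsub>L\<^esub> \<beta> u' v"
    and "\<And>u v v'. u \<in> carrier M \<Longrightarrow> v \<in> carrier N \<Longrightarrow> v' \<in> carrier N \<Longrightarrow>
      \<beta> u (v \<oplus>\<^bsub>N\<^esub> v') = \<beta> u v \<oplus>\<^bsub>L\<^esub> \<beta> u v'"
    and "\<And>a u v. a \<in> carrier A \<Longrightarrow> u \<in> carrier M \<Longrightarrow> v \<in> carrier N \<Longrightarrow>
      \<beta> (a \<odot>\<^bsub>M\<^esub> u) v = a \<odot>\<^bsub>L\<^esub> \<beta> u v"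
    and "\<And>a u v. a \<in> carrier A \<Longrightarrow> u \<in> carrier M \<Longrightarrow> v \<in> carrier N \<Longrightarrow>
      \<beta> u (a \<odot>\<^bsub>N\<^esub> v) = a \<odot>\<^bsub>L\<^esub> \<beta> u v"
  shows "\<exists>h\<in>module_homs A (tensor_module A M N) L.
    \<forall>u\<in>carrier M. \<forall>v\<in>carrier N. h (pure_tensor A M N u v) = \<beta> u v"
proof -
  interpret L: module A L by fact
  have e: "\<And>u v. u \<in> carrier M \<Longrightarrow> v \<in> carrier N \<Longrightarrow> unit_vec A (u, v) \<in> carrier FT"
    by (intro unit_vec_closed[OF A]) auto
  obtain h where h: "h \<in> module_homs A FT L"
    and hu: "\<And>u v. u \<in> carrier M \<Longrightarrow> v \<in> carrier N \<Longrightarrow> h (unit_vec A (u, v)) = \<beta> u v"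
  proof -
    have "(\<lambda>(u, v). \<beta> u v) \<in> carrier M \<times> carrier N \<rightarrow> carrier L" using cl by auto
    from free_module_lift[OF A L this] show ?thesis using that by auto
  qed
  have "h x = \<zero>\<^bsub>L\<^esub>" if "x \<in> tensor_relations A M N" for x
    using that unfolding tensor_relations_def Let_def
    by (auto simp: module_homs_minus[OF F.module_axioms L h] module_homsD[OF h] hu e cl assms(3-) L.r_neg a_minus_def[of L])
  moreover have "submodule {\<zero>\<^bsub>L\<^esub>} A L"
    by (rule submodule_by_closure[OF L]) auto
  ultimately have "h x = \<zero>\<^bsub>L\<^esub>" if "x \<in> KT" for x
    using module_homs_span_image[OF F.module_axioms L h tensor_relations_closed, of "{\<zero>\<^bsub>L\<^esub>}"] that
    by simp
  then obtain h' where "h' \<in> module_homs A (quot_module FT KT) L"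
    "\<forall>x\<in>carrier FT. h' (KT +>\<^bsub>FT\<^esub> x) = h x"
    using quot_module_lift[OF F.module_axioms tensor_relations_submodule L h] by blast
  then show ?thesis
    unfolding tensor_module_eq pure_tensor_eq
    by (intro bexI[of _ h'] ballI) (simp_all add: e hu)
qed

text \<open>\<open>tensor_map\<close> is a definite description, so both facts rest on exactly one
  map qualifying: bilinearity provides one, pure tensors determine it on the carrier, and
  extensionality fixes it outside.\<close>

lemma tensor_map:
  assumes f: "f \<in> module_homs A M M" and g: "g \<in> module_homs A N N"
  shows tensor_map_hom: "tensor_map A M N f g \<in> module_homs A (tensor_module A M N) (tensor_module A M N)"
    and tensor_map_pure: "u \<in> carrier M \<Longrightarrow> v \<in> carrier N \<Longrightarrow>
      tensor_map A M N f g (pure_tensor A M N u v) = pure_tensor A M N (f u) (g v)"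
proof -
  let ?T = "tensor_module A M N"
  let ?P = "\<lambda>h. h \<in> module_homs A ?T ?T \<and> h \<in> extensional (carrier ?T) \<and>
       (\<forall>u\<in>carrier M. \<forall>v\<in>carrier N. h (pure_tensor A M N u v) = pure_tensor A M N (f u) (g v))"
  interpret T: module A ?T by (rule tensor_module_module)
  have "\<exists>h\<in>module_homs A ?T ?T.
      \<forall>u\<in>carrier M. \<forall>v\<in>carrier N. h (pure_tensor A M N u v) = pure_tensor A M N (f u) (g v)"
    by (rule tensor_lift[OF T.module_axioms])
      (simp_all add: module_homsD[OF f] module_homsD[OF g] pure_tensor_closed pure_tensor_add_left
        pure_tensor_add_right pure_tensor_smult_left pure_tensor_smult_right)
  then obtain h where h: "h \<in> module_homs A ?T ?T"
    and hp: "\<forall>u\<in>carrier M. \<forall>v\<in>carrier N. h (pure_tensor A M N u v) = pure_tensor A M N (f u) (g v)"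
    by blast
  have "restrict h (carrier ?T) \<in> module_homs A ?T ?T"
    by (rule module_homsI) (simp_all add: module_homsD[OF h])
  then have ex: "?P (restrict h (carrier ?T))"
    using hp by (simp add: pure_tensor_closed)
  have "?P (THE h. ?P h)"
  proof (rule theI[of ?P, OF ex])
    fix k assume k: "?P k"
    show "k = restrict h (carrier ?T)"
    proof (rule extensionalityI[of _ "carrier ?T"])
      show "k x = restrict h (carrier ?T) x" if "x \<in> carrier ?T" for x
        by (rule tensor_homs_eq[of ?T, OF T.module_axioms _ _ _ that]) (use k ex in \<open>simp_all del: restrict_apply\<close>)
    qed (use k in auto)
  qed
  then show "tensor_map A M N f g \<in> module_homs A ?T ?T"
    and "u \<in> carrier M \<Longrightarrow> v \<in> carrier N \<Longrightarrow>
      tensor_map A M N f g (pure_tensor A M N u v) = pure_tensor A M N (f u) (g v)"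
    by (auto simp: tensor_map_def)
qed

end

subsection \<open>Hook tableaux\<close>

text \<open>The corner is stored in the column \<open>C\<close>, and \<open>bs\<close> is the
  remainder of the first row. Column permutations then concern \<open>C\<close> alone, because all
  other columns of a hook are single boxes.\<close>

definition hooktab :: "nat list \<Rightarrow> nat list \<Rightarrow> nat list list"
  where "hooktab C bs = (hd C # bs) # map (\<lambda>a. [a]) (tl C)"

definition hook_filling :: "nat \<Rightarrow> nat \<Rightarrow> nat \<Rightarrow> nat list \<Rightarrow> nat list \<Rightarrow> bool"
  where "hook_filling d n i C bs \<longleftrightarrow> length C = Suc i \<and> Suc (length bs) = d \<and>
    distinct (C @ bs) \<and> set (C @ bs) \<subseteq> {1..n}"

lemma hooktab_conv_map:
  "C \<noteq> [] \<Longrightarrow> hooktab C bs = map (\<lambda>r. if r = 0 then C ! 0 # bs else [C ! r]) [0..<length C]"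
  by (rule nth_equalityI) (auto simp: hooktab_def hd_conv_nth nth_Cons' nth_tl)

lemma concat_hooktab: "concat (hooktab C bs) = hd C # bs @ tl C"
  by (simp add: hooktab_def)

lemma set_concat_hooktab: "C \<noteq> [] \<Longrightarrow> set (concat (hooktab C bs)) = set C \<union> set bs"
  by (cases C) (auto simp: concat_hooktab)

lemma hooktab_eq_iff:
  "C \<noteq> [] \<Longrightarrow> C' \<noteq> [] \<Longrightarrow> hooktab C bs = hooktab C' bs' \<longleftrightarrow> C = C' \<and> bs = bs'"
  by (cases C; cases C') (auto simp: hooktab_def inj_map_eq_map inj_on_def)

lemma hook_filling_nonempty: "hook_filling d n i C bs \<Longrightarrow> C \<noteq> []"
  by (auto simp: hook_filling_def)

lemma hooktab_mem: "hook_filling d n i C bs \<Longrightarrow> hooktab C bs \<in> tableaux (hook d i) n"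
  by (cases C) (auto simp: hook_filling_def tableaux_def hook_def hooktab_def map_replicate_const comp_def)

lemma tableaux_hook:
  assumes "1 \<le> d"
  shows "tableaux (hook d i) n = {hooktab C bs | C bs. hook_filling d n i C bs}" (is "?L = ?R")
proof
  show "?R \<subseteq> ?L" using hooktab_mem by blast
  show "?L \<subseteq> ?R"
  proof
    fix T assume T: "T \<in> ?L"
    then obtain R Rs where TR: "T = R # Rs" and R: "length R = d" and Rs: "map length Rs = replicate i 1"
      by (auto simp: tableaux_def hook_def map_eq_Cons_conv)
    obtain a bs where Ra: "R = a # bs" using R assms by (cases R) auto
    define C where "C = a # map hd Rs"
    have len1: "length x = 1" if "x \<in> set Rs" for x
    proof -
      have "length x \<in> set (map length Rs)" using that by simp
      then show ?thesis using Rs by simp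
    qed
    have "[hd x] = x" if "x \<in> set Rs" for x
      using len1[OF that] by (cases x) auto
    then have "map (\<lambda>a. [a]) (map hd Rs) = Rs"
      by (simp add: map_idI)
    then have TC: "T = hooktab C bs"
      by (simp add: TR Ra C_def hooktab_def)
    have "length Rs = i" using Rs by (metis length_map length_replicate)
    moreover have "distinct (a # bs @ map hd Rs)" "set (a # bs @ map hd Rs) \<subseteq> {1..n}"
      using T unfolding TC tableaux_def by (simp_all only: concat_hooktab C_def list.sel mem_Collect_eq)
    ultimately have "hook_filling d n i C bs"
      using R by (auto simp: hook_filling_def C_def Ra)
    then show "T \<in> ?R" using TC by blast
  qed
qed

lemma perm_tableau_hooktab:
  "C \<noteq> [] \<Longrightarrow> perm_tableau s (hooktab C bs) = hooktab (map s C) (map s bs)"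
  by (cases C) (simp_all add: perm_tableau_def hooktab_def)

lemma first_column_hooktab: "C \<noteq> [] \<Longrightarrow> first_column (hooktab C bs) = C"
  by (cases C) (simp_all add: first_column_def hooktab_def comp_def)

lemma remove_box_hooktab:
  "C \<noteq> [] \<Longrightarrow> remove_box (hooktab C bs) j = hooktab (take j C @ drop (Suc j) C) bs"
  by (simp add: remove_box_def first_column_hooktab Let_def) (simp add: hooktab_def)

lemma hooktab_nth:
  assumes "C \<noteq> []"
  shows "length (hooktab C bs) = length C" "hooktab C bs ! 0 = C ! 0 # bs"
    "0 < r \<Longrightarrow> r < length C \<Longrightarrow> hooktab C bs ! r = [C ! r]"
    "r < length C \<Longrightarrow> hooktab C bs ! r ! 0 = C ! r"
  using assms by (simp_all add: hooktab_conv_map)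

lemma hooktab_nth_nonempty: "C \<noteq> [] \<Longrightarrow> r < length C \<Longrightarrow> hooktab C bs ! r \<noteq> []"
  by (simp add: hooktab_conv_map)

lemma column_hooktab_0: "C \<noteq> [] \<Longrightarrow> column (hooktab C bs) 0 = set C"
proof -
  assume C: "C \<noteq> []"
  have "column (hooktab C bs) 0 = {C ! r | r. r < length C}"
    unfolding column_def hooktab_nth(1)[OF C]
    using hooktab_nth(4)[OF C] hooktab_nth_nonempty[OF C]
    by (intro Collect_cong) (metis length_greater_0_conv)
  then show ?thesis by (auto simp: in_set_conv_nth)
qed

lemma column_hooktab_Suc: 
  "C \<noteq> [] \<Longrightarrow> column (hooktab C bs) (Suc c) = (if c < length bs then {bs ! c} else {})"
  unfolding column_def by (auto simp: hooktab_conv_map split: if_splits intro!: exI[of _ 0])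

lemma column_length_hooktab_0: "C \<noteq> [] \<Longrightarrow> column_length (hooktab C bs) 0 = length C"
proof -
  assume C: "C \<noteq> []"
  have "{r. r < length (hooktab C bs) \<and> 0 < length (hooktab C bs ! r)} = {..<length C}"
    using C hooktab_nth_nonempty[OF C] by (auto simp: hooktab_nth(1))
  then show ?thesis by (simp add: column_length_def)
qed

lemma column_length_hooktab_Suc: 
  "C \<noteq> [] \<Longrightarrow> column_length (hooktab C bs) (Suc c) = (if c < length bs then 1 else 0)"
proof -
  assume C: "C \<noteq> []"
  have "{r. r < length (hooktab C bs) \<and> Suc c < length (hooktab C bs ! r)} = (if c < length bs then {0} else {})"
    using C by (auto simp: hooktab_conv_map split: if_splits)
  then show ?thesis by (simp add: column_length_def)
qed

lemma exchange_hooktab_0: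
  assumes C: "C \<noteq> []" and r: "r < length C"
  shows "exchange (hooktab C (b # l)) 0 {r} = hooktab (C[r := b]) (C ! r # l)"
proof (rule nth_equalityI)
  have C': "C[r := b] \<noteq> []" using C by simp
  let ?T = "hooktab C (b # l)"
  show "length (exchange ?T 0 {r}) = length (hooktab (C[r := b]) (C ! r # l))"
    using C C' by (simp add: exchange_def hooktab_nth)
  fix k assume "k < length (exchange ?T 0 {r})"
  then have k: "k < length C" using C by (simp add: exchange_def hooktab_nth)
  have e: "exchange ?T 0 {r} ! k = map (\<lambda>c.
        if c = 1 \<and> k < 1 then C ! r
        else if c = 0 \<and> k = r then b
        else ?T ! k ! c) [0..<length (?T ! k)]"
    using k C r by (auto simp: exchange_def hooktab_nth less_irrefl conj_commute[of "_ = r"] cong: if_cong conj_cong)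
  show "exchange ?T 0 {r} ! k = hooktab (C[r := b]) (C ! r # l) ! k"
  proof (cases "k = 0")
    case True
    show ?thesis
      unfolding e unfolding True hooktab_nth(2)[OF C] hooktab_nth(2)[OF C']
      using r by (intro nth_equalityI) (auto simp: nth_Cons' nth_list_update simp del: upt_Suc)
  next
    case False
    then show ?thesis
      unfolding e using k r C' by (simp add: hooktab_nth(3)[OF C] hooktab_nth(3)[OF C'] nth_list_update)
  qed
qed

lemma exchange_hooktab_Suc:
  assumes C: "C \<noteq> []"
  shows "exchange (hooktab C (ps @ x # y # l)) (Suc (length ps)) {0} = hooktab C (ps @ y # x # l)"
proof (rule nth_equalityI)
  let ?T = "hooktab C (ps @ x # y # l)" and ?j = "Suc (length ps)"
  show "length (exchange ?T ?j {0}) = length (hooktab C (ps @ y # x # l))"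
    using C by (simp add: exchange_def hooktab_nth)
  fix k assume "k < length (exchange ?T ?j {0})"
  then have k: "k < length C" using C by (simp add: exchange_def hooktab_nth)
  have e: "exchange ?T ?j {0} ! k = map (\<lambda>c.
        if c = Suc ?j \<and> k < 1 then x
        else if c = ?j \<and> k = 0 then y
        else ?T ! k ! c) [0..<length (?T ! k)]"
    using k C by (auto simp: exchange_def hooktab_nth nth_append cong: if_cong)
  show "exchange ?T ?j {0} ! k = hooktab C (ps @ y # x # l) ! k"
  proof (cases "k = 0")
    case True
    show ?thesis
      unfolding e unfolding True hooktab_nth(2)[OF C]
      by (intro nth_equalityI) (auto simp: nth_Cons' nth_append simp del: upt_Suc)
  next
    case False
    then show ?thesis
      unfolding e using k by (simp add: hooktab_nth(3)[OF C])
  qed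
qed

lemma shuffles_hooktab_0:
  assumes C: "C \<noteq> []"
  shows "shuffles (hooktab C (b # l)) 0 1 = (\<lambda>r. hooktab (C[r := b]) (C ! r # l)) ` {..<length C}"
proof -
  have "{S. S \<subseteq> {..<length C} \<and> card S = 1} = (\<lambda>r. {r}) ` {..<length C}"
    by (auto simp: card_1_singleton_iff)
  then show ?thesis
    using C by (auto simp: shuffles_def column_length_hooktab_0 exchange_hooktab_0 image_image)
qed

lemma shuffles_hooktab_Suc:
  assumes C: "C \<noteq> []"
  shows "shuffles (hooktab C (ps @ x # y # l)) (Suc (length ps)) 1 = {hooktab C (ps @ y # x # l)}"
proof -
  have "{S. S \<subseteq> {..<1::nat} \<and> card S = 1} = {{0}}"
    by (auto simp: card_1_singleton_iff)
  then show ?thesis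
    using C by (simp add: shuffles_def column_length_hooktab_Suc exchange_hooktab_Suc)
qed

lemma shuffle_step:
  assumes "hook_filling d n i C (b # l)" "r < length C"
  shows "hook_filling d n i (C[r := b]) (C ! r # l)"
proof -
  have "mset (C[r := b] @ C ! r # l) = mset (C @ b # l)"
    using assms(2) nth_mem_mset[OF assms(2)] by (simp add: mset_update)
  then have "distinct (C[r := b] @ C ! r # l)" "set (C[r := b] @ C ! r # l) = set (C @ b # l)"
    using assms(1) by (metis hook_filling_def mset_eq_imp_distinct_iff, metis mset_eq_setD)
  then show ?thesis using assms(1) by (simp only: hook_filling_def length_list_update list.size)
qed

lemma swap_step:
  "hook_filling d n i C (ps @ x # y # l) \<Longrightarrow> hook_filling d n i C (ps @ y # x # l)"
  by (auto simp: hook_filling_def)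

lemma perm_step:
  assumes "hook_filling d n i C bs" "s permutes set C"
  shows "hook_filling d n i (map s C) bs"
proof -
  have "set (map s C) = set C" using permutes_image[OF assms(2)] by simp
  moreover have "distinct (map s C)"
    using assms permutes_inj_on[OF assms(2)] by (simp add: hook_filling_def distinct_map)
  ultimately show ?thesis using assms(1) by (simp add: hook_filling_def)
qed

lemma global_perm_step:
  assumes "hook_filling d n i C bs" "s permutes {1..n}"
  shows "hook_filling d n i (map s C) (map s bs)"
proof -
  have "distinct (map s (C @ bs))"
    using assms permutes_inj_on[OF assms(2)] by (simp only: hook_filling_def distinct_map)
  moreover have "set (map s (C @ bs)) \<subseteq> {1..n}"
    using assms(1) image_mono[of "set (C @ bs)" "{1..n}" s]
    unfolding permutes_image[OF assms(2)] hook_filling_def set_map by blast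
  ultimately show ?thesis using assms(1) by (simp add: hook_filling_def)
qed

text \<open>These are the tableau relations of a hook, stated for a function of column and remaining
  row: alternation in the column, symmetry under exchanging neighbours in the row, and the shuffle
  of the first row letter into the column. Functions of this kind are the data that define maps out
  of \<open>U i\<close> and \<open>F i\<close>.\<close>

definition hook_relations ::
  "nat \<Rightarrow> nat \<Rightarrow> nat \<Rightarrow> ('m, 'y) ring_scheme \<Rightarrow> (nat list \<Rightarrow> nat list \<Rightarrow> 'm) \<Rightarrow> bool"
  where "hook_relations d n i M g \<longleftrightarrow> (\<forall>C bs. hook_filling d n i C bs \<longrightarrow>
    g C bs \<in> carrier M \<and>
    (\<forall>s. s permutes set C \<longrightarrow> g (map s C) bs = add_pow M (sign s) (g C bs)) \<and>
    (\<forall>ps x y l. bs = ps @ x # y # l \<longrightarrow> g C (ps @ y # x # l) = g C bs) \<and>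
    (\<forall>b l. bs = b # l \<longrightarrow> g C bs = (\<Oplus>\<^bsub>M\<^esub>r\<in>{..<length C}. g (C[r := b]) (C ! r # l))))"

lemma hook_relationsD:
  assumes "hook_relations d n i M g"
  shows hook_relations_closed: "hook_filling d n i C bs \<Longrightarrow> g C bs \<in> carrier M"
    and hook_relations_alt: "hook_filling d n i C bs \<Longrightarrow> s permutes set C \<Longrightarrow>
      g (map s C) bs = add_pow M (sign s) (g C bs)"
    and hook_relations_swap: "hook_filling d n i C (ps @ x # y # l) \<Longrightarrow>
      g C (ps @ y # x # l) = g C (ps @ x # y # l)"
    and hook_relations_shuffle: "hook_filling d n i C (b # l) \<Longrightarrow>
      g C (b # l) = (\<Oplus>\<^bsub>M\<^esub>r\<in>{..<length C}. g (C[r := b]) (C ! r # l))"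
  using assms by (auto simp: hook_relations_def)

lemma hook_relationsI:
  assumes "\<And>C bs. hook_filling d n i C bs \<Longrightarrow> g C bs \<in> carrier M"
    and "\<And>C bs s. hook_filling d n i C bs \<Longrightarrow> s permutes set C \<Longrightarrow>
      g (map s C) bs = add_pow M (sign s) (g C bs)"
    and "\<And>C ps x y l. hook_filling d n i C (ps @ x # y # l) \<Longrightarrow>
      g C (ps @ y # x # l) = g C (ps @ x # y # l)"
    and "\<And>C b l. hook_filling d n i C (b # l) \<Longrightarrow>
      g C (b # l) = (\<Oplus>\<^bsub>M\<^esub>r\<in>{..<length C}. g (C[r := b]) (C ! r # l))"
  shows "hook_relations d n i M g"
  using assms by (auto simp: hook_relations_def)

lemma hook_relations_hom:
  assumes "module R M" "module R N" "h \<in> module_homs R M N" and g: "hook_relations d n i M g"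
  shows "hook_relations d n i N (\<lambda>C bs. h (g C bs))"
proof (rule hook_relationsI)
  fix C b l assume v: "hook_filling d n i C (b # l)"
  show "h (g C (b # l)) = (\<Oplus>\<^bsub>N\<^esub>r\<in>{..<length C}. h (g (C[r := b]) (C ! r # l)))"
    unfolding hook_relations_shuffle[OF g v]
    using hook_relations_closed[OF g shuffle_step[OF v]]
    by (intro module_homs_finsum[OF assms(1-3)]) auto
qed (simp_all add: module_homs_closed[OF assms(3)] module_homs_add_pow[OF assms(1-3)]
      hook_relationsD[OF g])

lemma conj_permutes:
  assumes s: "bij s" and t: "t permutes V"
  shows "(s \<circ> t \<circ> inv_into UNIV s) permutes s ` V"
  unfolding permutes_def
proof (intro conjI allI impI)
  fix x assume "x \<notin> s ` V"
  then have "inv_into UNIV s x \<notin> V" using s by (auto simp: bij_is_surj surj_f_inv_f image_iff)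
  then show "(s \<circ> t \<circ> inv_into UNIV s) x = x"
    using t s by (auto simp: permutes_def bij_is_surj surj_f_inv_f)
next
  fix y
  have "bij (s \<circ> t \<circ> inv_into UNIV s)"
    using s permutes_bij[OF t] by (intro bij_comp bij_imp_bij_inv)
  then show "\<exists>!x. (s \<circ> t \<circ> inv_into UNIV s) x = y" by (simp add: bij_iff)
qed

lemma sign_conj:
  assumes "permutation s" "permutation t"
  shows "sign (s \<circ> t \<circ> inv_into UNIV s) = sign t"
proof -
  have "sign (s \<circ> t \<circ> inv_into UNIV s) = sign s * sign t * sign (inv_into UNIV s)"
    using assms permutation_inverse[OF assms(1)] by (simp add: sign_compose permutation_compose)
  then show ?thesis using assms sign_inverse[of s] by (simp add: sign_def)
qed

text \<open>Conjugation by \<open>s\<close> turns a permutation of the letters of \<open>C\<close>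
  into one of the letters of \<open>map s C\<close> with the same sign. The other relations refer to
  positions only and are unaffected by relabelling.\<close>

lemma hook_relations_perm:
  assumes "module R M" and s: "s permutes {1..n}" and g: "hook_relations d n i M g"
  shows "hook_relations d n i M (\<lambda>C bs. g (map s C) (map s bs))"
proof -
  interpret M: module R M by fact
  show ?thesis
proof (rule hook_relationsI)
  fix C bs t assume v: "hook_filling d n i C bs" and t: "t permutes set C"
  define t' where "t' = s \<circ> t \<circ> inv_into UNIV s"
  have bs: "bij s" using permutes_bij[OF s] .
  have t': "t' permutes set (map s C)"
    unfolding t'_def using conj_permutes[OF bs t] by simp
  have e: "map s (map t C) = map t' (map s C)"
    using bs by (simp add: t'_def bij_is_inj inv_f_f)
  have sg: "sign t' = sign t"
    unfolding t'_def using s t by (intro sign_conj) (auto simp: permutation_permutes)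
  show "g (map s (map t C)) (map s bs) = add_pow M (sign t) (g (map s C) (map s bs))"
    unfolding e using hook_relations_alt[OF g global_perm_step[OF v s] t'] unfolding sg .
next
  fix C b l assume v: "hook_filling d n i C (b # l)"
  have "g (map s C) (map s (b # l)) =
      (\<Oplus>\<^bsub>M\<^esub>r\<in>{..<length C}. g ((map s C)[r := s b]) (map s C ! r # map s l))"
    using hook_relations_shuffle[OF g, of "map s C" "s b" "map s l"] global_perm_step[OF v s] by simp
  also have "\<dots> = (\<Oplus>\<^bsub>M\<^esub>r\<in>{..<length C}. g (map s (C[r := b])) (map s (C ! r # l)))"
    using hook_relations_closed[OF g global_perm_step[OF shuffle_step[OF v] s]]
    by (intro M.finsum_cong') (simp_all add: map_update)
  finally show "g (map s C) (map s (b # l)) =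
    (\<Oplus>\<^bsub>M\<^esub>r\<in>{..<length C}. g (map s (C[r := b])) (map s (C ! r # l)))" .
next
  fix C ps x y l assume v: "hook_filling d n i C (ps @ x # y # l)"
  show "g (map s C) (map s (ps @ y # x # l)) = g (map s C) (map s (ps @ x # y # l))"
    using hook_relations_swap[OF g, of "map s C" "map s ps" "s x" "s y" "map s l"]
      global_perm_step[OF v s] by simp
qed (rule hook_relations_closed[OF g global_perm_step[OF _ s]])
qed

section \<open>Alternating and shuffling relations for hook shapes\<close>

context
  fixes A :: "('a, 'x) ring_scheme" and d n i :: nat
  assumes A: "cring A" and d: "1 \<le> d"
begin

private abbreviation "FF \<equiv> free_module A (tableaux (hook d i) n)"
private abbreviation "KK \<equiv> tableau_relations A (hook d i) n"

lemma hook_unit_vec_closed: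
  "hook_filling d n i C bs \<Longrightarrow> unit_vec A (hooktab C bs) \<in> carrier FF"
  by (rule unit_vec_closed[OF A hooktab_mem])

text \<open>The columns after the first have one box each, so a column-preserving permutation fixes
  every letter of \<open>bs\<close> and is supported on \<open>C\<close>.\<close>

lemma alternating_relation_cases:
  assumes "x \<in> alternating_relations A (hook d i) n"
  obtains C bs s where "hook_filling d n i C bs" "s permutes set C"
    "x = unit_vec A (hooktab (map s C) bs) \<ominus>\<^bsub>FF\<^esub> add_pow FF (sign s) (unit_vec A (hooktab C bs))"
proof -
  obtain T s where T: "T \<in> tableaux (hook d i) n" and s: "s permutes set (concat T)"
    and col: "\<And>c. s ` column T c = column T c"
    and x: "x = unit_vec A (perm_tableau s T) \<ominus>\<^bsub>FF\<^esub> add_pow FF (sign s) (unit_vec A T)"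
    using assms by (auto simp: alternating_relations_def Let_def)
  then obtain C bs where TC: "T = hooktab C bs" and v: "hook_filling d n i C bs"
    by (auto simp: tableaux_hook[OF d])
  have C: "C \<noteq> []" using hook_filling_nonempty[OF v] .
  have fixed: "s y = y" if y: "y \<in> set bs" for y
  proof -
    obtain c where c: "c < length bs" "y = bs ! c" using y by (auto simp: in_set_conv_nth)
    then have "s ` {y} = {y}" using col[of "Suc c"] by (simp add: TC column_hooktab_Suc[OF C])
    then show ?thesis by simp
  qed
  have "s permutes set C"
    by (rule permutes_superset[OF s]) (use fixed set_concat_hooktab[OF C] in \<open>auto simp: TC\<close>)
  moreover have "map s bs = bs" using fixed by (simp add: map_idI)
  ultimately show ?thesis
    using that[OF v] x by (simp add: TC perm_tableau_hooktab[OF C])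
qed

lemma alternating_relation_mem:
  assumes v: "hook_filling d n i C bs" and s: "s permutes set C"
  shows "unit_vec A (hooktab (map s C) bs) \<ominus>\<^bsub>FF\<^esub> add_pow FF (sign s) (unit_vec A (hooktab C bs))
    \<in> alternating_relations A (hook d i) n"
proof -
  have C: "C \<noteq> []" using hook_filling_nonempty[OF v] .
  have fixed: "s y = y" if "y \<in> set bs" for y
    using that v s by (auto simp: hook_filling_def permutes_def)
  have "s ` column (hooktab C bs) c = column (hooktab C bs) c" for c
    using fixed permutes_image[OF s] by (cases c) (auto simp: column_hooktab_0[OF C] column_hooktab_Suc[OF C])
  moreover have "s permutes set (concat (hooktab C bs))"
    using s by (rule permutes_subset) (simp only: set_concat_hooktab[OF C] Un_upper1)
  moreover have "perm_tableau s (hooktab C bs) = hooktab (map s C) bs"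
    using fixed by (simp add: perm_tableau_hooktab[OF C] map_idI)
  ultimately show ?thesis
    unfolding alternating_relations_def Let_def using hooktab_mem[OF v]
    by (intro CollectI exI[of _ s] exI[of _ "hooktab C bs"]) simp
qed

text \<open>A column after the first has at most one box, which forces \<open>k = 1\<close>. Against
  the first column this gives one term for each row; between two later columns there is a single
  term, the exchange of two neighbours in the row.\<close>

lemma shuffling_relation_cases:
  assumes "x \<in> shuffling_relations A (hook d i) n"
  obtains (shuffle) C b l where "hook_filling d n i C (b # l)"
    "x = unit_vec A (hooktab C (b # l)) \<ominus>\<^bsub>FF\<^esub>
      (\<Oplus>\<^bsub>FF\<^esub>T\<in>(\<lambda>r. hooktab (C[r := b]) (C ! r # l)) ` {..<length C}. unit_vec A T)"
  | (swap) C ps y z l where "hook_filling d n i C (ps @ y # z # l)"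
    "x = unit_vec A (hooktab C (ps @ y # z # l)) \<ominus>\<^bsub>FF\<^esub>
      (\<Oplus>\<^bsub>FF\<^esub>T\<in>{hooktab C (ps @ z # y # l)}. unit_vec A T)"
proof -
  obtain T j k where T: "T \<in> tableaux (hook d i) n" and k: "1 \<le> k" "k \<le> column_length T (j + 1)"
    and x: "x = unit_vec A T \<ominus>\<^bsub>FF\<^esub> (\<Oplus>\<^bsub>FF\<^esub>T'\<in>shuffles T j k. unit_vec A T')"
    using assms by (auto simp: shuffling_relations_def Let_def)
  then obtain C bs where TC: "T = hooktab C bs" and v: "hook_filling d n i C bs"
    by (auto simp: tableaux_hook[OF d])
  have C: "C \<noteq> []" using hook_filling_nonempty[OF v] .
  have j: "j < length bs" and k1: "k = 1"
    using k by (auto simp: TC column_length_hooktab_Suc[OF C] split: if_splits)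
  show thesis
  proof (cases j)
    case 0
    then obtain b l where bs: "bs = b # l" using j by (cases bs) auto
    show thesis
      using shuffle[of C b l] v x shuffles_hooktab_0[OF C, of b l] by (simp add: TC 0 k1 bs)
  next
    case (Suc j')
    define ps l where "ps = take j' bs" and "l = drop (Suc j) bs"
    have "bs = ps @ bs ! j' # bs ! j # l"
      using j Suc by (metis Cons_nth_drop_Suc Suc_lessD append_take_drop_id l_def ps_def)
    moreover have "length ps = j'" using j Suc by (simp add: ps_def)
    ultimately show thesis
      using swap[of C ps "bs ! j'" "bs ! j" l] v x shuffles_hooktab_Suc[OF C, of ps "bs ! j'" "bs ! j" l]
      unfolding TC Suc k1 by metis
  qed
qed

lemma shuffling_relation_mem:
  assumes v: "hook_filling d n i C (b # l)"
  shows "unit_vec A (hooktab C (b # l)) \<ominus>\<^bsub>FF\<^esub>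
      (\<Oplus>\<^bsub>FF\<^esub>T\<in>(\<lambda>r. hooktab (C[r := b]) (C ! r # l)) ` {..<length C}. unit_vec A T)
    \<in> shuffling_relations A (hook d i) n"
proof -
  have C: "C \<noteq> []" using hook_filling_nonempty[OF v] .
  show ?thesis
    unfolding shuffling_relations_def Let_def shuffles_hooktab_0[OF C, symmetric]
    by (rule CollectI, rule exI[of _ "hooktab C (b # l)"], rule exI[of _ 0], rule exI[of _ 1])
      (simp add: hooktab_mem[OF v] column_length_hooktab_Suc[OF C])
qed

lemma swap_relation_mem:
  assumes v: "hook_filling d n i C (ps @ y # z # l)"
  shows "unit_vec A (hooktab C (ps @ y # z # l)) \<ominus>\<^bsub>FF\<^esub>
      (\<Oplus>\<^bsub>FF\<^esub>T\<in>{hooktab C (ps @ z # y # l)}. unit_vec A T)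
    \<in> shuffling_relations A (hook d i) n"
proof -
  have C: "C \<noteq> []" using hook_filling_nonempty[OF v] .
  show ?thesis
    unfolding shuffling_relations_def Let_def shuffles_hooktab_Suc[OF C, symmetric]
    by (rule CollectI, rule exI[of _ "hooktab C (ps @ y # z # l)"],
        rule exI[of _ "Suc (length ps)"], rule exI[of _ 1])
      (simp add: hooktab_mem[OF v] column_length_hooktab_Suc[OF C])
qed

end

declare One_nat_def [simp del]

lemma finite_submultisets: "finite {m'. m' \<subseteq># m}"
proof (rule finite_subset)
  show "{m'. m' \<subseteq># m} \<subseteq> (\<Union>k\<in>{..size m}. multisets_of_size (set_mset m) k)"
    by (auto simp: multisets_of_size_def size_mset_mono dest: mset_subset_eqD)
qed auto

section \<open>The polynomial ring, with its symmetric group action and grading\<close>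

locale polys =
  fixes A :: "('a, 'x) ring_scheme" and n :: nat
  assumes A: "cring A"
begin

sublocale A: cring A by (rule A)

abbreviation P :: "('a, nat multiset \<Rightarrow> 'a) gr_sym_module" where "P \<equiv> poly_ring A n"
abbreviation Mon :: "nat multiset set" where "Mon \<equiv> {m. set_mset m \<subseteq> {1..n}}"
abbreviation mon :: "nat multiset \<Rightarrow> nat multiset \<Rightarrow> 'a" where "mon \<equiv> unit_vec A"

lemma P_simps:
  "zero P = (\<lambda>_. \<zero>\<^bsub>A\<^esub>)" "p \<oplus>\<^bsub>P\<^esub> q = (\<lambda>m. p m \<oplus>\<^bsub>A\<^esub> q m)" "a \<odot>\<^bsub>P\<^esub> p = (\<lambda>m. a \<otimes>\<^bsub>A\<^esub> p m)"
  "p \<otimes>\<^bsub>P\<^esub> q = (\<lambda>m. \<Oplus>\<^bsub>A\<^esub>m'\<in>{m'. m' \<subseteq># m}. p m' \<otimes>\<^bsub>A\<^esub> q (m - m'))"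
  by (auto simp add: poly_ring_def A.indexed_zero_def A.indexed_padd_def)

lemma const_eq: "A.indexed_const a = (\<lambda>m. if m = {#} then a else \<zero>\<^bsub>A\<^esub>)"
  by (simp add: A.indexed_const_def)

lemma one_P: "one P = mon {#}"
  by (simp add: poly_ring_def const_eq unit_vec_def)

lemma var_eq: "A.indexed_var i = mon {#i#}"
proof
  fix m :: "nat multiset"
  show "A.indexed_var i m = mon {#i#} m"
    by (cases "i \<in># m") (auto simp: A.indexed_var_def A.indexed_pmult_def const_eq unit_vec_def
      dest!: multi_member_split)
qed

text \<open>The inductively generated \<open>indexed_pset\<close> is replaced by finitely supported
  functions on monomials. The linear structure is then that of a free module, and identities that
  are linear in each argument can be checked on monomials.\<close>

lemma P_carrier: "carrier P = carrier (free_module A Mon)"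
proof
  let ?S = "A.indexed_pset {1..n} (carrier A)"
  interpret F: module A "free_module A Mon" by (rule free_module_module[OF A])
  have "p \<in> carrier (free_module A Mon)" if "p \<in> ?S" for p
    using that
  proof induction
    case (indexed_const k)
    have "finite {m. (if m = {#} then k else \<zero>\<^bsub>A\<^esub>) \<noteq> \<zero>\<^bsub>A\<^esub>}"
      by (rule finite_subset[of _ "{{#}}"]) auto
    then show ?case
      using indexed_const by (auto simp: const_eq free_module_carrier[OF A])
  next
    case (indexed_padd p q)
    then show ?case
      using F.a_closed[of p q] by (simp add: A.indexed_padd_def free_module_simps[OF A])
  next
    case (indexed_pmult p i)
    have "finite {m. (if i \<in># m then p (m - {#i#}) else \<zero>\<^bsub>A\<^esub>) \<noteq> \<zero>\<^bsub>A\<^esub>}"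
      by (rule finite_subset[of _ "add_mset i ` {m. p m \<noteq> \<zero>\<^bsub>A\<^esub>}"])
        (use indexed_pmult in \<open>auto simp: free_module_carrier[OF A] image_iff intro!: exI[of _ "_ - {#i#}"]\<close>)
    moreover have "p (m - {#i#}) = \<zero>\<^bsub>A\<^esub>" if "i \<in># m" "\<not> set_mset m \<subseteq> {1..n}" for m
    proof -
      obtain k where "m = add_mset i k" using \<open>i \<in># m\<close> by (metis multi_member_split)
      then show ?thesis using that indexed_pmult by (auto simp: free_module_carrier[OF A])
    qed
    ultimately show ?case
      using indexed_pmult by (auto simp: A.indexed_pmult_def free_module_carrier[OF A])
  qed
  then show "carrier P \<subseteq> carrier (free_module A Mon)"
    by (auto simp: poly_ring_def)
  \<comment> \<open>Closure under scalars is not among the generating rules of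
    \<open>indexed_pset\<close>, so it needs an induction of its own before the span of the
    monomials can be absorbed.\<close>
  have smultS: "(\<lambda>m. a \<otimes>\<^bsub>A\<^esub> p m) \<in> ?S" if "p \<in> ?S" "a \<in> carrier A" for a p
    using that
  proof induction
    case (indexed_const k)
    then have "(\<lambda>m. a \<otimes>\<^bsub>A\<^esub> A.indexed_const k m) = A.indexed_const (a \<otimes>\<^bsub>A\<^esub> k)"
      by (auto simp: const_eq)
    then show ?case using indexed_const A.indexed_pset.indexed_const by (metis A.m_closed)
  next
    case (indexed_padd p q)
    have "(\<lambda>m. a \<otimes>\<^bsub>A\<^esub> A.indexed_padd p q m)
        = A.indexed_padd (\<lambda>m. a \<otimes>\<^bsub>A\<^esub> p m) (\<lambda>m. a \<otimes>\<^bsub>A\<^esub> q m)"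
      using A.indexed_pset_in_carrier[OF subset_refl indexed_padd(1)]
        A.indexed_pset_in_carrier[OF subset_refl indexed_padd(2)] indexed_padd(5)
      by (auto simp: A.indexed_padd_def A.carrier_coeff_def A.r_distr)
    then show ?case using indexed_padd by (simp add: A.indexed_pset.indexed_padd)
  next
    case (indexed_pmult p i)
    have "(\<lambda>m. a \<otimes>\<^bsub>A\<^esub> A.indexed_pmult p i m) = A.indexed_pmult (\<lambda>m. a \<otimes>\<^bsub>A\<^esub> p m) i"
      using indexed_pmult(4) by (auto simp: A.indexed_pmult_def)
    then show ?case using indexed_pmult by (simp add: A.indexed_pset.indexed_pmult)
  qed
  have unit: "mon m \<in> ?S" if "set_mset m \<subseteq> {1..n}" for m
    using that
  proof (induction m)
    case empty
    then show ?case
      using A.indexed_pset.indexed_const[of "\<one>\<^bsub>A\<^esub>" "carrier A" "{1..n}"]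
      by (simp add: const_eq unit_vec_def)
  next
    case (add i m)
    have "mon (add_mset i m) = A.indexed_pmult (mon m) i"
    proof
      fix k
      show "mon (add_mset i m) k = A.indexed_pmult (mon m) i k"
        by (cases "i \<in># k") (auto simp: A.indexed_pmult_def unit_vec_def dest!: multi_member_split)
    qed
    then show ?case using add by (auto intro: A.indexed_pset.indexed_pmult)
  qed
  have "carrier (free_module A Mon) \<subseteq> ?S"
  proof
    fix f assume "f \<in> carrier (free_module A Mon)"
    then have f: "f \<in> module_span A (free_module A Mon) (mon ` Mon)"
      using free_module_span[OF A, of Mon] by simp
    have sub: "mon ` Mon \<subseteq> carrier (free_module A Mon)"
      by (rule image_subsetI, rule unit_vec_closed[OF A])
    show "f \<in> ?S"
      using F.module_axioms sub f
    proof (induction rule: module_span_induct)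
      case (base x)
      then show ?case using unit by auto
    next
      case zero
      then show ?case
        using A.indexed_pset.indexed_const[of "\<zero>\<^bsub>A\<^esub>" "carrier A" "{1..n}"]
        by (simp add: free_module_simps[OF A] A.indexed_zero_def)
    next
      case (add p q)
      then show ?case
        using A.indexed_pset.indexed_padd[of p "{1..n}" "carrier A" q]
        by (simp add: free_module_simps[OF A] A.indexed_padd_def)
    next
      case (smult a p)
      then show ?case using smultS[of p a]
        by (simp add: free_module_simps[OF A])
    qed
  qed
  then show "carrier (free_module A Mon) \<subseteq> carrier P"
    by (simp add: poly_ring_def)
qed

lemma P_carrier_iff:
  "p \<in> carrier P \<longleftrightarrow>
    (\<forall>m. p m \<in> carrier A) \<and> (\<forall>m. \<not> set_mset m \<subseteq> {1..n} \<longrightarrow> p m = \<zero>\<^bsub>A\<^esub>) \<and> finite {m. p m \<noteq> \<zero>\<^bsub>A\<^esub>}"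
  by (simp add: P_carrier free_module_carrier[OF A])

lemma P_coeff [simp]: "p \<in> carrier P \<Longrightarrow> p m \<in> carrier A"
  by (simp add: P_carrier_iff)

lemma same_group_P: "same_group P (free_module A Mon)"
  unfolding same_group_def by (intro conjI P_carrier) (auto simp: P_simps free_module_simps[OF A] fun_eq_iff)

lemma mon_closed: "set_mset m \<subseteq> {1..n} \<Longrightarrow> mon m \<in> carrier P"
  by (simp add: P_carrier unit_vec_closed[OF A])

lemma P_module: "module A P"
  by (rule same_group_module[OF free_module_module[OF A] same_group_P])
    (simp add: P_simps free_module_simps[OF A])

lemma P_span: "carrier P = module_span A P (mon ` Mon)"
proof -
  have "submodule H A P \<longleftrightarrow> submodule H A (free_module A Mon)" for H
    by (rule same_group_submodule[OF same_group_P]) (simp add: P_simps free_module_simps[OF A])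
  then show ?thesis
    by (simp add: module_span_def P_carrier free_module_span[OF A, unfolded module_span_def])
qed

lemma P_induct [consumes 1, case_names mon zero add smult]:
  assumes "p \<in> carrier P"
    and "\<And>m. set_mset m \<subseteq> {1..n} \<Longrightarrow> Q (mon m)" "Q (zero P)"
    and "\<And>p q. p \<in> carrier P \<Longrightarrow> q \<in> carrier P \<Longrightarrow> Q p \<Longrightarrow> Q q \<Longrightarrow> Q (p \<oplus>\<^bsub>P\<^esub> q)"
    and "\<And>a p. a \<in> carrier A \<Longrightarrow> p \<in> carrier P \<Longrightarrow> Q p \<Longrightarrow> Q (a \<odot>\<^bsub>P\<^esub> p)"
  shows "Q p"
  using P_module _ assms(1)[unfolded P_span]
  by (induction rule: module_span_induct) (use assms mon_closed in auto)

lemma P_homs_eq: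
  assumes "module A M" "f \<in> module_homs A P M" "g \<in> module_homs A P M"
    and "\<And>m. set_mset m \<subseteq> {1..n} \<Longrightarrow> f (mon m) = g (mon m)" "p \<in> carrier P"
  shows "f p = g p"
  using assms(5)
  by (induction rule: P_induct)
    (simp_all add: assms(4) module_homsD[OF assms(2)] module_homsD[OF assms(3)]
      module_homs_zero[OF P_module assms(1,2)] module_homs_zero[OF P_module assms(1,3)])

lemma mult_add_left:
  assumes "p \<in> carrier P" "p' \<in> carrier P" "q \<in> carrier P"
  shows "(p \<oplus>\<^bsub>P\<^esub> p') \<otimes>\<^bsub>P\<^esub> q = p \<otimes>\<^bsub>P\<^esub> q \<oplus>\<^bsub>P\<^esub> p' \<otimes>\<^bsub>P\<^esub> q"
  unfolding P_simps using assms
  by (subst A.finsum_addf[symmetric]) (auto simp: A.l_distr intro!: ext A.finsum_cong')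

lemma mult_add_right:
  assumes "p \<in> carrier P" "q \<in> carrier P" "q' \<in> carrier P"
  shows "p \<otimes>\<^bsub>P\<^esub> (q \<oplus>\<^bsub>P\<^esub> q') = p \<otimes>\<^bsub>P\<^esub> q \<oplus>\<^bsub>P\<^esub> p \<otimes>\<^bsub>P\<^esub> q'"
  unfolding P_simps using assms
  by (subst A.finsum_addf[symmetric]) (auto simp: A.r_distr intro!: ext A.finsum_cong')

lemma mult_smult_left:
  assumes "a \<in> carrier A" "p \<in> carrier P" "q \<in> carrier P"
  shows "(a \<odot>\<^bsub>P\<^esub> p) \<otimes>\<^bsub>P\<^esub> q = a \<odot>\<^bsub>P\<^esub> (p \<otimes>\<^bsub>P\<^esub> q)"
  unfolding P_simps using assms finite_submultisets
  by (subst A.finsum_rdistr) (auto simp: A.m_assoc intro!: ext A.finsum_cong')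

lemma mult_smult_right:
  assumes "a \<in> carrier A" "p \<in> carrier P" "q \<in> carrier P"
  shows "p \<otimes>\<^bsub>P\<^esub> (a \<odot>\<^bsub>P\<^esub> q) = a \<odot>\<^bsub>P\<^esub> (p \<otimes>\<^bsub>P\<^esub> q)"
  unfolding P_simps using assms finite_submultisets
  by (subst A.finsum_rdistr) (auto simp: A.m_lcomm intro!: ext A.finsum_cong')

text \<open>In the convolution only the splitting of \<open>m\<close> with first part
  \<open>k\<close> can contribute.\<close>

lemma mon_mult:
  assumes "\<And>m. p m \<in> carrier A"
  shows "(mon k \<otimes>\<^bsub>P\<^esub> p) m = (if k \<subseteq># m then p (m - k) else \<zero>\<^bsub>A\<^esub>)"
proof -
  have "(mon k \<otimes>\<^bsub>P\<^esub> p) m = (\<Oplus>\<^bsub>A\<^esub>m'\<in>{m'. m' \<subseteq># m}. if k = m' then p (m - m') else \<zero>\<^bsub>A\<^esub>)"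
    unfolding P_simps using assms by (intro A.finsum_cong') (auto simp: unit_vec_def)
  also have "\<dots> = (if k \<subseteq># m then p (m - k) else \<zero>\<^bsub>A\<^esub>)"
  proof (cases "k \<subseteq># m")
    case True
    then show ?thesis
      using A.finsum_singleton[of k "{m'. m' \<subseteq># m}" "\<lambda>m'. p (m - m')"] assms
      by (simp add: finite_submultisets)
  next
    case False
    then have "(\<Oplus>\<^bsub>A\<^esub>m'\<in>{m'. m' \<subseteq># m}. if k = m' then p (m - m') else \<zero>\<^bsub>A\<^esub>) = (\<Oplus>\<^bsub>A\<^esub>m'\<in>{m'. m' \<subseteq># m}. \<zero>\<^bsub>A\<^esub>)"
      by (intro A.finsum_cong') auto
    then show ?thesis using False by simp
  qed
  finally show ?thesis .
qed

lemma mon_mult_mon: "mon k \<otimes>\<^bsub>P\<^esub> mon l = mon (k + l)"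
proof
  fix m
  have "mon l m' \<in> carrier A" for m' by (simp add: unit_vec_def)
  then show "(mon k \<otimes>\<^bsub>P\<^esub> mon l) m = mon (k + l) m"
    by (subst mon_mult) (auto simp: unit_vec_def)
qed

lemma P_zero_closed: "zero P \<in> carrier P"
  by (simp add: P_carrier_iff P_simps)

lemma mult_zero_left: "(\<And>m. q m \<in> carrier A) \<Longrightarrow> zero P \<otimes>\<^bsub>P\<^esub> q = zero P"
  by (simp add: P_simps)
lemma mult_zero_right: "(\<And>m. p m \<in> carrier A) \<Longrightarrow> p \<otimes>\<^bsub>P\<^esub> zero P = zero P"
  by (simp add: P_simps)

lemma P_mult_closed: 
  assumes "p \<in> carrier P" "q \<in> carrier P" shows "p \<otimes>\<^bsub>P\<^esub> q \<in> carrier P"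
proof -
  interpret M: module A P by (rule P_module)
  have "mon m \<otimes>\<^bsub>P\<^esub> q \<in> carrier P" if m: "set_mset m \<subseteq> {1..n}" for m
    using assms(2)
  proof (induction rule: P_induct)
    case (mon k)
    then show ?case using m by (simp add: mon_mult_mon mon_closed)
  next
    case zero
    show ?case by (simp add: mult_zero_right unit_vec_def)
  qed (simp_all add: mult_add_right mult_smult_right mon_closed[OF m])
  note 1 = this
  show ?thesis
    using assms(1)
    by (induction rule: P_induct)
      (simp_all add: 1 mult_zero_left[OF P_coeff[OF assms(2)]] P_zero_closed assms(2) mult_add_left mult_smult_left)
qed

lemma mult_hom_left: "q \<in> carrier P \<Longrightarrow> (\<lambda>p. p \<otimes>\<^bsub>P\<^esub> q) \<in> module_homs A P P"
  by (intro module_homsI) (simp_all add: P_mult_closed mult_add_left mult_smult_left)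

lemma mult_hom_right: "p \<in> carrier P \<Longrightarrow> (\<lambda>q. p \<otimes>\<^bsub>P\<^esub> q) \<in> module_homs A P P"
  by (intro module_homsI) (simp_all add: P_mult_closed mult_add_right mult_smult_right)

lemma P_mult_comm:
  assumes "p \<in> carrier P" "q \<in> carrier P" shows "p \<otimes>\<^bsub>P\<^esub> q = q \<otimes>\<^bsub>P\<^esub> p"
proof -
  have "mon m \<otimes>\<^bsub>P\<^esub> q = q \<otimes>\<^bsub>P\<^esub> mon m" if m: "set_mset m \<subseteq> {1..n}" for m
    by (rule P_homs_eq[OF P_module mult_hom_right mult_hom_left _ assms(2)])
      (simp_all add: mon_closed m mon_mult_mon add.commute)
  then show ?thesis
    by (intro P_homs_eq[OF P_module mult_hom_left mult_hom_right _ assms(1)]) (simp_all add: assms)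
qed

text \<open>Both sides are linear in each factor. Replacing the factors by monomials one after
  another leaves the associativity of addition of exponents.\<close>

lemma P_mult_assoc:
  assumes "p \<in> carrier P" "q \<in> carrier P" "r \<in> carrier P"
  shows "(p \<otimes>\<^bsub>P\<^esub> q) \<otimes>\<^bsub>P\<^esub> r = p \<otimes>\<^bsub>P\<^esub> (q \<otimes>\<^bsub>P\<^esub> r)"
proof -
  have 1: "(mon m \<otimes>\<^bsub>P\<^esub> mon k) \<otimes>\<^bsub>P\<^esub> r = mon m \<otimes>\<^bsub>P\<^esub> (mon k \<otimes>\<^bsub>P\<^esub> r)"
    if m: "set_mset m \<subseteq> {1..n}" and k: "set_mset k \<subseteq> {1..n}" for m k
    by (rule P_homs_eq[OF P_module mult_hom_right module_homs_comp[OF mult_hom_right mult_hom_right] _ assms(3)])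
      (simp_all add: mon_closed m k mon_mult_mon add.assoc)
  have 2: "(mon m \<otimes>\<^bsub>P\<^esub> q) \<otimes>\<^bsub>P\<^esub> r = mon m \<otimes>\<^bsub>P\<^esub> (q \<otimes>\<^bsub>P\<^esub> r)"
    if m: "set_mset m \<subseteq> {1..n}" for m
    by (rule P_homs_eq[OF P_module module_homs_comp[OF mult_hom_right mult_hom_left]
          module_homs_comp[OF mult_hom_left mult_hom_right] _ assms(2)])
      (simp_all add: mon_closed m 1 assms(3))
  show ?thesis
    by (rule P_homs_eq[OF P_module module_homs_comp[OF mult_hom_left mult_hom_left]
          mult_hom_left _ assms(1)])
      (simp_all add: mon_closed 2 assms P_mult_closed)
qed

lemma P_one_closed: "one P \<in> carrier P"
  by (simp add: one_P mon_closed)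

lemma P_l_one: "p \<in> carrier P \<Longrightarrow> one P \<otimes>\<^bsub>P\<^esub> p = p"
  unfolding one_P by (rule ext) (simp add: mon_mult)

lemma P_cring: "cring P"
proof (rule cringI)
  interpret M: module A P by (rule P_module)
  show "abelian_group P" by (rule M.abelian_group_axioms)
  show "comm_monoid P"
    by (rule comm_monoidI)
      (auto simp: P_mult_closed P_one_closed P_mult_assoc P_l_one intro: P_mult_comm)
qed (rule mult_add_left)

sublocale P: cring P by (rule P_cring)

sublocale PA: module A P by (rule P_module)

lemma const_mult:
  assumes "a \<in> carrier A" "p \<in> carrier P"
  shows "A.indexed_const a \<otimes>\<^bsub>P\<^esub> p = a \<odot>\<^bsub>P\<^esub> p" "A.indexed_const a \<in> carrier P"
proof -
  have e: "A.indexed_const a = a \<odot>\<^bsub>P\<^esub> mon {#}"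
    using assms(1) by (auto simp: const_eq P_simps unit_vec_def)
  show "A.indexed_const a \<in> carrier P"
    unfolding e using assms(1) by (simp add: mon_closed)
  show "A.indexed_const a \<otimes>\<^bsub>P\<^esub> p = a \<odot>\<^bsub>P\<^esub> p"
    unfolding e using assms P_l_one[OF assms(2)] by (simp add: mult_smult_left mon_closed one_P)
qed

lemma var_closed: "i \<in> {1..n} \<Longrightarrow> A.indexed_var i \<in> carrier P"
  by (simp add: var_eq mon_closed)

lemma finprod_var: 
  assumes "S \<subseteq> {1..n}"
  shows "finprod P A.indexed_var S = mon (mset_set S)"
proof -
  have "finite S" using assms finite_subset by blast
  then show ?thesis
    using assms
  proof (induction S)
    case empty
    then show ?case by (simp add: one_P)
  next
    case (insert i S)
    have "finprod P A.indexed_var (insert i S) = A.indexed_var i \<otimes>\<^bsub>P\<^esub> finprod P A.indexed_var S"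
      using insert var_closed by (intro P.finprod_insert) (auto simp: subset_iff)
    also have "\<dots> = mon {#i#} \<otimes>\<^bsub>P\<^esub> mon (mset_set S)"
      using insert.prems by (simp add: var_eq insert.IH)
    finally show ?case
      using insert by (simp add: mon_mult_mon)
  qed
qed

subsection \<open>Permutation of variables\<close>

lemma act_P: "act P s p = (\<lambda>m. p (image_mset (inv_into UNIV s) m))"
  by (simp add: poly_ring_def)

lemma image_mset_permutes:
  assumes "s permutes {1..n}"
  shows "image_mset s (image_mset (inv_into UNIV s) m) = m"
    "image_mset (inv_into UNIV s) (image_mset s m) = m"
  using permutes_inverses[OF assms] by (simp_all add: multiset.map_comp comp_def)

lemma set_image_mset_permutes:
  assumes "s permutes {1..n}"
  shows "set_mset (image_mset s m) \<subseteq> {1..n} \<longleftrightarrow> set_mset m \<subseteq> {1..n}"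
  using permutes_in_image[OF assms] by auto

lemma act_P_mon:
  assumes "s permutes {1..n}"
  shows "act P s (mon m) = mon (image_mset s m)"
  using image_mset_permutes[OF assms] by (auto simp: act_P unit_vec_def fun_eq_iff)

lemma mon_image_closed:
  "s permutes {1..n} \<Longrightarrow> set_mset m \<subseteq> {1..n} \<Longrightarrow> mon (image_mset s m) \<in> carrier P"
  using set_image_mset_permutes by (intro mon_closed) auto

lemma act_P_hom:
  assumes s: "s permutes {1..n}"
  shows "act P s \<in> module_homs A P P"
proof (rule module_homsI)
  fix p assume p: "p \<in> carrier P"
  have "finite {m. p (image_mset (inv_into UNIV s) m) \<noteq> \<zero>\<^bsub>A\<^esub>}"
    by (rule finite_subset[of _ "image_mset s ` {m. p m \<noteq> \<zero>\<^bsub>A\<^esub>}"])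
      (use p image_mset_permutes[OF s] in \<open>auto simp: P_carrier_iff image_iff, metis\<close>)
  then show "act P s p \<in> carrier P"
    using p set_image_mset_permutes[OF permutes_inv[OF s]] by (auto simp: P_carrier_iff act_P)
qed (auto simp: act_P P_simps)

lemma act_P_mult:
  assumes s: "s permutes {1..n}" and "p \<in> carrier P" "q \<in> carrier P"
  shows "act P s (p \<otimes>\<^bsub>P\<^esub> q) = act P s p \<otimes>\<^bsub>P\<^esub> act P s q"
proof -
  note h = act_P_hom[OF s]
  note c = module_homs_closed[OF h]
  have 1: "act P s (mon m \<otimes>\<^bsub>P\<^esub> q) = act P s (mon m) \<otimes>\<^bsub>P\<^esub> act P s q" if m: "set_mset m \<subseteq> {1..n}" for m
    by (rule P_homs_eq[OF P_module module_homs_comp[OF mult_hom_right h] 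
          module_homs_comp[OF h mult_hom_right] _ assms(3)])
      (simp_all add: mon_closed mon_image_closed[OF s] m c mon_mult_mon act_P_mon[OF s])
  show ?thesis
    by (rule P_homs_eq[OF P_module module_homs_comp[OF mult_hom_left h] 
          module_homs_comp[OF h mult_hom_left] _ assms(2)])
      (simp_all add: mon_closed c 1 assms)
qed

lemma act_P_comp:
  assumes "s permutes {1..n}" "t permutes {1..n}"
  shows "act P (s \<circ> t) p = act P s (act P t p)"
  using permutes_bij[OF assms(1)] permutes_bij[OF assms(2)]
  by (simp add: act_P o_inv_distrib multiset.map_comp)

lemma act_P_id: "act P id p = p"
  by (simp add: act_P)

lemma act_P_const:
  assumes "s permutes {1..n}"
  shows "act P s (A.indexed_const a) = A.indexed_const a"
  by (auto simp: act_P const_eq)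

subsection \<open>Homogeneous components\<close>

lemma hcomp_P: "hcomp P k = {p \<in> carrier P. \<forall>m. p m \<noteq> \<zero>\<^bsub>A\<^esub> \<longrightarrow> int (size m) = k}"
  by (simp add: poly_ring_def)

definition hproj :: "int \<Rightarrow> (nat multiset \<Rightarrow> 'a) \<Rightarrow> nat multiset \<Rightarrow> 'a"
  where "hproj k p = (\<lambda>m. if int (size m) = k then p m else \<zero>\<^bsub>A\<^esub>)"

lemma hproj_closed: 
  assumes "p \<in> carrier P" shows "hproj k p \<in> hcomp P k"
proof -
  have "finite {m. (if int (size m) = k then p m else \<zero>\<^bsub>A\<^esub>) \<noteq> \<zero>\<^bsub>A\<^esub>}"
    by (rule finite_subset[of _ "{m. p m \<noteq> \<zero>\<^bsub>A\<^esub>}"]) (use assms in \<open>auto simp: P_carrier_iff\<close>)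
  then show ?thesis
    using assms by (auto simp: hcomp_P hproj_def P_carrier_iff)
qed

lemma hproj_hom: "hproj k \<in> module_homs A P P"
proof (rule module_homsI)
  show "hproj k p \<in> carrier P" if "p \<in> carrier P" for p
    using hproj_closed[OF that] by (simp only: hcomp_P mem_Collect_eq)
qed (simp_all add: hproj_def P_simps fun_eq_iff)

lemma hproj_hcomp: "p \<in> hcomp P j \<Longrightarrow> hproj k p = (if j = k then p else zero P)"
  unfolding hproj_def P_simps hcomp_P mem_Collect_eq fun_eq_iff by metis

lemma mon_hcomp: "set_mset m \<subseteq> {1..n} \<Longrightarrow> mon m \<in> hcomp P (int (size m))"
  by (auto simp: hcomp_P mon_closed) (auto simp: unit_vec_def split: if_splits)

text \<open>A nonzero coefficient of the product needs a splitting of its monomial at which both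
  factors are nonzero, and sizes add up along a splitting.\<close>

lemma hcomp_mult:
  assumes "p \<in> hcomp P j" "q \<in> hcomp P k"
  shows "p \<otimes>\<^bsub>P\<^esub> q \<in> hcomp P (j + k)"
proof -
  have pq: "p \<in> carrier P" "q \<in> carrier P" using assms by (auto simp: hcomp_P)
  have "int (size m) = j + k" if "(p \<otimes>\<^bsub>P\<^esub> q) m \<noteq> \<zero>\<^bsub>A\<^esub>" for m
  proof -
    have "\<exists>m'. m' \<subseteq># m \<and> p m' \<otimes>\<^bsub>A\<^esub> q (m - m') \<noteq> \<zero>\<^bsub>A\<^esub>"
    proof (rule ccontr)
      assume "\<nexists>m'. m' \<subseteq># m \<and> p m' \<otimes>\<^bsub>A\<^esub> q (m - m') \<noteq> \<zero>\<^bsub>A\<^esub>"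
      then have "(p \<otimes>\<^bsub>P\<^esub> q) m = (\<Oplus>\<^bsub>A\<^esub>m'\<in>{m'. m' \<subseteq># m}. \<zero>\<^bsub>A\<^esub>)"
        unfolding P_simps by (intro A.finsum_cong') auto
      then show False using that by simp
    qed
    then obtain m' where m': "m' \<subseteq># m" "p m' \<noteq> \<zero>\<^bsub>A\<^esub>" "q (m - m') \<noteq> \<zero>\<^bsub>A\<^esub>"
      using pq by (metis A.l_null A.r_null P_coeff)
    then have "int (size m') = j" "int (size (m - m')) = k"
      using assms by (auto simp: hcomp_P)
    then show ?thesis using m'(1) by (metis of_nat_add size_union subset_mset.add_diff_inverse)
  qed
  then show ?thesis using P_mult_closed[OF pq] by (simp add: hcomp_P)
qed

end

section \<open>The modules U: universal property and symmetric group action\<close>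

locale hooks = polys +
  fixes d :: nat
  assumes d: "1 \<le> d"
begin

abbreviation "FT i \<equiv> free_module A (tableaux (hook d i) n)"
abbreviation "KT i \<equiv> tableau_relations A (hook d i) n"
abbreviation "U i \<equiv> U_mod A d n i"
abbreviation "cls i C bs \<equiv> tableau_class A (hook d i) n (hooktab C bs)"
abbreviation "filling i \<equiv> hook_filling d n i"

lemma FT_module: "module A (FT i)"
  by (rule free_module_module[OF A])

lemma relations_closed:
  "alternating_relations A (hook d i) n \<union> shuffling_relations A (hook d i) n \<subseteq> carrier (FT i)"
proof (intro subsetI, elim UnE)
  interpret F: module A "FT i" by (rule FT_module)
  note u = hook_unit_vec_closed[OF A d]
  fix x
  {
    assume "x \<in> alternating_relations A (hook d i) n"
    then obtain C bs s where 1: "filling i C bs" "s permutes set C"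
      "x = unit_vec A (hooktab (map s C) bs) \<ominus>\<^bsub>FT i\<^esub> add_pow (FT i) (sign s) (unit_vec A (hooktab C bs))"
      using alternating_relation_cases[OF A d] by metis
    show "x \<in> carrier (FT i)"
      unfolding 1(3) by (intro F.minus_closed F.add.int_pow_closed u 1 perm_step)
  }
  {
    assume "x \<in> shuffling_relations A (hook d i) n"
    then show "x \<in> carrier (FT i)"
    proof (cases rule: shuffling_relation_cases[OF A d, consumes 1, case_names shuffle swap])
      case (shuffle C b l)
      have "unit_vec A \<in> (\<lambda>r. hooktab (C[r := b]) (C ! r # l)) ` {..<length C} \<rightarrow> carrier (FT i)"
        using u[OF shuffle_step[OF shuffle(1)]] by auto
      then show ?thesis
        unfolding shuffle(2) using u[OF shuffle(1)] by (intro F.minus_closed F.finsum_closed)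
    next
      case (swap C ps y z l)
      have "unit_vec A \<in> {hooktab C (ps @ z # y # l)} \<rightarrow> carrier (FT i)"
        using u[OF swap_step[OF swap(1)]] by auto
      then show ?thesis
        unfolding swap(2) using u[OF swap(1)] by (intro F.minus_closed F.finsum_closed)
    qed
  }
qed

lemma KT_submodule: "submodule (KT i) A (FT i)"
  unfolding tableau_relations_def by (rule module_span_submodule[OF FT_module relations_closed])

lemma U_simps:
  "carrier (U i) = carrier (quot_module (FT i) (KT i))" "zero (U i) = zero (quot_module (FT i) (KT i))"
  "add (U i) = add (quot_module (FT i) (KT i))" "smult (U i) = smult (quot_module (FT i) (KT i))"
  "act (U i) s S = (\<lambda>f T. f (perm_tableau (inv_into UNIV s) T)) ` S"
  by (simp_all add: U_mod_def tableau_module_def module.defs sym_module.defs)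

lemma same_group_U: "same_group (U i) (quot_module (FT i) (KT i))"
  by (simp add: same_group_def U_simps)

lemma U_module: "module A (U i)"
  by (rule same_group_module[OF quot_module_module[OF FT_module KT_submodule] same_group_U])
    (simp add: U_simps)

lemma U_proj: "(\<lambda>x. KT i +>\<^bsub>FT i\<^esub> x) \<in> module_homs A (FT i) (U i)"
  using quot_module_proj[OF FT_module KT_submodule] by (simp add: module_homs_def U_simps)

lemma cls_eq: "cls i C bs = KT i +>\<^bsub>FT i\<^esub> unit_vec A (hooktab C bs)"
  by (simp add: tableau_class_def)

text \<open>\<open>shuffling_relations\<close> sums over a set of tableaux,
  \<open>hook_relations\<close> over the rows of the column. The two agree because the letters of
  \<open>C\<close> are distinct, so that different rows produce different tableaux.\<close>

lemma finsum_unit_vec_hom: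
  assumes "module A M" "h \<in> module_homs A (FT i) M" "filling i C (b # l)"
  shows "h (\<Oplus>\<^bsub>FT i\<^esub>T\<in>(\<lambda>r. hooktab (C[r := b]) (C ! r # l)) ` {..<length C}. unit_vec A T)
    = (\<Oplus>\<^bsub>M\<^esub>r\<in>{..<length C}. h (unit_vec A (hooktab (C[r := b]) (C ! r # l))))"
proof -
  interpret F: module A "FT i" by (rule FT_module)
  note u = hook_unit_vec_closed[OF A d shuffle_step[OF assms(3)]]
  have C: "C \<noteq> []" using hook_filling_nonempty[OF assms(3)] .
  have "distinct C" using assms(3) by (simp add: hook_filling_def)
  then have inj: "inj_on (\<lambda>r. hooktab (C[r := b]) (C ! r # l)) {..<length C}"
    using C by (auto simp: inj_on_def hooktab_eq_iff nth_eq_iff_index_eq)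
  have "(\<Oplus>\<^bsub>FT i\<^esub>T\<in>(\<lambda>r. hooktab (C[r := b]) (C ! r # l)) ` {..<length C}. unit_vec A T)
    = (\<Oplus>\<^bsub>FT i\<^esub>r\<in>{..<length C}. unit_vec A (hooktab (C[r := b]) (C ! r # l)))"
    using u by (intro F.finsum_reindex[OF _ inj]) auto
  then show ?thesis
    using u by (simp add: module_homs_finsum[OF FT_module assms(1,2)])
qed

text \<open>The cases for a generating relation match the clauses of \<open>hook_relations\<close>
  one by one, and a homomorphism that kills the generators kills their span.\<close>

lemma hook_relations_kill:
  assumes M: "module A M" and h: "h \<in> module_homs A (FT i) M"
    and rel: "hook_relations d n i M (\<lambda>C bs. h (unit_vec A (hooktab C bs)))" and x: "x \<in> KT i"
  shows "h x = \<zero>\<^bsub>M\<^esub>"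
proof -
  interpret M: module A M by (rule M)
  interpret F: module A "FT i" by (rule FT_module)
  note u = hook_unit_vec_closed[OF A d]
  note minus = module_homs_minus[OF FT_module M h]
  note R = hook_relationsD[OF rel]
  have self: "y \<ominus>\<^bsub>M\<^esub> y = \<zero>\<^bsub>M\<^esub>" if "y \<in> carrier M" for y
    using that by (simp add: a_minus_def M.r_neg)
  have "h y \<in> {\<zero>\<^bsub>M\<^esub>}" if "y \<in> alternating_relations A (hook d i) n \<union> shuffling_relations A (hook d i) n" for y
    using that
  proof
    assume "y \<in> alternating_relations A (hook d i) n"
    then obtain C bs s where v: "filling i C bs" and s: "s permutes set C" and
      y: "y = unit_vec A (hooktab (map s C) bs) \<ominus>\<^bsub>FT i\<^esub> add_pow (FT i) (sign s) (unit_vec A (hooktab C bs))"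
      using alternating_relation_cases[OF A d] by metis
    have "h y = h (unit_vec A (hooktab (map s C) bs)) \<ominus>\<^bsub>M\<^esub>
          h (add_pow (FT i) (sign s) (unit_vec A (hooktab C bs)))"
        unfolding y by (intro minus F.add.int_pow_closed u v s perm_step)
      also have "\<dots> = \<zero>\<^bsub>M\<^esub>"
        using R(2)[OF v s] self[OF R(1)[OF perm_step[OF v s]]]
        by (simp add: module_homs_add_pow[OF FT_module M h u[OF v]])
      finally show ?thesis by simp
  next
    assume "y \<in> shuffling_relations A (hook d i) n"
    then show ?thesis
    proof (cases rule: shuffling_relation_cases[OF A d, consumes 1, case_names shuffle swap])
      case (shuffle C b l)
      note v = shuffle(1)
      have "unit_vec A \<in> (\<lambda>r. hooktab (C[r := b]) (C ! r # l)) ` {..<length C} \<rightarrow> carrier (FT i)"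
        using u[OF shuffle_step[OF v]] by auto
      then have "h y = h (unit_vec A (hooktab C (b # l))) \<ominus>\<^bsub>M\<^esub>
         h (\<Oplus>\<^bsub>FT i\<^esub>T\<in>(\<lambda>r. hooktab (C[r := b]) (C ! r # l)) ` {..<length C}. unit_vec A T)"
        unfolding shuffle(2) using u[OF v] by (intro minus F.finsum_closed)
      then show ?thesis
        unfolding finsum_unit_vec_hom[OF M h v] R(4)[OF v, symmetric] using self[OF R(1)[OF v]] by simp
    next
      case (swap C ps a b l)
      note v = swap(1) and v' = swap_step[OF swap(1)]
      have "(\<Oplus>\<^bsub>FT i\<^esub>T\<in>{hooktab C (ps @ b # a # l)}. unit_vec A T) = unit_vec A (hooktab C (ps @ b # a # l))"
        using u[OF v'] F.finsum_insert[of "{}" "hooktab C (ps @ b # a # l)" "unit_vec A"] by simp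
      then have "h y = h (unit_vec A (hooktab C (ps @ a # b # l))) \<ominus>\<^bsub>M\<^esub> h (unit_vec A (hooktab C (ps @ b # a # l)))"
        unfolding swap(2) using u[OF v] u[OF v'] by (simp add: minus)
      then show ?thesis
        using R(3)[OF v] self[OF R(1)[OF v]] by simp
    qed
  qed
  note 1 = this
  have "submodule {\<zero>\<^bsub>M\<^esub>} A M"
    by (rule submodule_by_closure[OF M]) simp_all
  from module_homs_span_image[OF FT_module M h relations_closed this 1 x[unfolded tableau_relations_def]]
  have "h x \<in> {\<zero>\<^bsub>M\<^esub>}" .
  then show ?thesis by simp
qed

text \<open>Universal property of \<open>U i\<close>. Combined with \<open>U_homs_eq\<close>, it
  identifies maps out of \<open>U i\<close> with functions of fillings that satisfy the
  relations.\<close>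

lemma U_lift:
  assumes M: "module A M" and g: "hook_relations d n i M g"
  shows "\<exists>h\<in>module_homs A (U i) M. \<forall>C bs. filling i C bs \<longrightarrow> h (cls i C bs) = g C bs"
proof -
  interpret M: module A M by (rule M)
  define g' where "g' T = g (first_column T) (tl (hd T))" for T
  have g': "g' (hooktab C bs) = g C bs" if v: "filling i C bs" for C bs
    using hook_filling_nonempty[OF v] by (simp add: g'_def first_column_hooktab) (simp add: hooktab_def)
  have "g' \<in> tableaux (hook d i) n \<rightarrow> carrier M"
  proof
    fix T assume "T \<in> tableaux (hook d i) n"
    then obtain C bs where "T = hooktab C bs" "filling i C bs" by (auto simp: tableaux_hook[OF d])
    then show "g' T \<in> carrier M" using g' hook_relations_closed[OF g] by simp
  qed
  from free_module_lift[OF A M this] obtain h where h: "h \<in> module_homs A (FT i) M"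
    and hu: "\<And>T. T \<in> tableaux (hook d i) n \<Longrightarrow> h (unit_vec A T) = g' T" by blast
  have hg: "h (unit_vec A (hooktab C bs)) = g C bs" if "filling i C bs" for C bs
    using hu[OF hooktab_mem[OF that]] g'[OF that] by simp
  have "hook_relations d n i M (\<lambda>C bs. h (unit_vec A (hooktab C bs)))"
  proof (rule hook_relationsI)
    fix C b l assume v: "filling i C (b # l)"
    have "(\<Oplus>\<^bsub>M\<^esub>r\<in>{..<length C}. g (C[r := b]) (C ! r # l))
      = (\<Oplus>\<^bsub>M\<^esub>r\<in>{..<length C}. h (unit_vec A (hooktab (C[r := b]) (C ! r # l))))"
      using hook_relations_closed[OF g shuffle_step[OF v]] hg[OF shuffle_step[OF v]]
      by (intro M.finsum_cong') auto
    then show "h (unit_vec A (hooktab C (b # l))) =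
       (\<Oplus>\<^bsub>M\<^esub>r\<in>{..<length C}. h (unit_vec A (hooktab (C[r := b]) (C ! r # l))))"
      using hook_relations_shuffle[OF g v] hg[OF v] by simp
  qed (simp_all add: hg perm_step swap_step hook_relationsD[OF g])
  from quot_module_lift[OF FT_module KT_submodule M h hook_relations_kill[OF M h this]]
  obtain h' where "h' \<in> module_homs A (quot_module (FT i) (KT i)) M"
    and "\<And>x. x \<in> carrier (FT i) \<Longrightarrow> h' (KT i +>\<^bsub>FT i\<^esub> x) = h x" by blast
  then show ?thesis
    by (intro bexI[of _ h']) (auto simp: cls_eq hg hook_unit_vec_closed[OF A d] module_homs_def U_simps)
qed

lemma U_span: "carrier (U i) = module_span A (U i) {cls i C bs | C bs. filling i C bs}"
proof -
  have 1: "unit_vec A ` tableaux (hook d i) n \<subseteq> carrier (FT i)"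
    by (rule image_subsetI, rule unit_vec_closed[OF A])
  have 2: "(\<lambda>x. KT i +>\<^bsub>FT i\<^esub> x) ` unit_vec A ` tableaux (hook d i) n = {cls i C bs | C bs. filling i C bs}"
    unfolding tableaux_hook[OF d] cls_eq by auto
  have 3: "submodule H A (U i) \<longleftrightarrow> submodule H A (quot_module (FT i) (KT i))" for H
    by (rule same_group_submodule[OF same_group_U]) (simp add: U_simps)
  show ?thesis
    using quot_module_span[OF FT_module KT_submodule free_module_span[OF A] 1]
    unfolding 2 module_span_def 3 U_simps by simp
qed

lemma cls_closed: "filling i C bs \<Longrightarrow> cls i C bs \<in> carrier (U i)"
  unfolding cls_eq by (rule module_homs_closed[OF U_proj hook_unit_vec_closed[OF A d]])

lemma U_homs_eq:
  assumes "module A M" "f \<in> module_homs A (U i) M" "g \<in> module_homs A (U i) M"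
    and "\<And>C bs. filling i C bs \<Longrightarrow> f (cls i C bs) = g (cls i C bs)" "x \<in> carrier (U i)"
  shows "f x = g x"
proof (rule module_homs_eq_on_span[OF U_module assms(1-3)])
  show "x \<in> module_span A (U i) {cls i C bs | C bs. filling i C bs}" using assms(5) U_span by simp
qed (use assms(4) cls_closed in auto)

lemma KT_zero:
  assumes "x \<in> KT i" shows "KT i +>\<^bsub>FT i\<^esub> x = \<zero>\<^bsub>U i\<^esub>"
proof -
  interpret F: module A "FT i" by (rule FT_module)
  have "x \<in> carrier (FT i)" using F.submoduleE(1)[OF KT_submodule] assms by (rule subsetD)
  then show ?thesis
    unfolding U_simps quot_module_zero[OF FT_module KT_submodule]
    using assms by (subst coset_eq_iff[OF FT_module KT_submodule]) (simp_all add: F.diff_zero)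
qed

lemma cls_relations: "hook_relations d n i (U i) (cls i)"
proof (rule hook_relationsI)
  interpret F: module A "FT i" by (rule FT_module)
  interpret U: module A "U i" by (rule U_module)
  note u = hook_unit_vec_closed[OF A d]
  note minus = module_homs_minus[OF FT_module U_module U_proj]
  {
    fix C bs s assume v: "filling i C bs" and s: "s permutes set C"
    have p: "add_pow (FT i) (sign s) (unit_vec A (hooktab C bs)) \<in> carrier (FT i)"
      by (intro F.add.int_pow_closed u v)
    have "unit_vec A (hooktab (map s C) bs) \<ominus>\<^bsub>FT i\<^esub> add_pow (FT i) (sign s) (unit_vec A (hooktab C bs)) \<in> KT i"
      unfolding tableau_relations_def
      by (rule subsetD[OF module_span_superset UnI1[OF alternating_relation_mem[OF A d v s]]])
    from KT_zero[OF this] have "cls i (map s C) bs \<ominus>\<^bsub>U i\<^esub> add_pow (U i) (sign s) (cls i C bs) = \<zero>\<^bsub>U i\<^esub>"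
      unfolding minus[OF u[OF perm_step[OF v s]] p] module_homs_add_pow[OF FT_module U_module U_proj u[OF v]]
      unfolding cls_eq .
    then show "cls i (map s C) bs = add_pow (U i) (sign s) (cls i C bs)"
      by (rule U.eq_if_minus_zero[OF cls_closed[OF perm_step[OF v s]] U.add.int_pow_closed[OF cls_closed[OF v]]])
  }
  {
    fix C ps a b l assume v: "filling i C (ps @ a # b # l)"
    note v' = swap_step[OF v]
    have "(\<Oplus>\<^bsub>FT i\<^esub>T\<in>{hooktab C (ps @ b # a # l)}. unit_vec A T) = unit_vec A (hooktab C (ps @ b # a # l))"
      using u[OF v'] F.finsum_insert[of "{}" "hooktab C (ps @ b # a # l)" "unit_vec A"] by simp
    then have "unit_vec A (hooktab C (ps @ a # b # l)) \<ominus>\<^bsub>FT i\<^esub> unit_vec A (hooktab C (ps @ b # a # l)) \<in> KT i"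
      using subsetD[OF module_span_superset UnI2[OF swap_relation_mem[OF A d v]]]
      unfolding tableau_relations_def by simp
    from KT_zero[OF this] have "cls i C (ps @ a # b # l) \<ominus>\<^bsub>U i\<^esub> cls i C (ps @ b # a # l) = \<zero>\<^bsub>U i\<^esub>"
      unfolding minus[OF u[OF v] u[OF v']] unfolding cls_eq .
    then show "cls i C (ps @ b # a # l) = cls i C (ps @ a # b # l)"
      using U.eq_if_minus_zero[OF cls_closed[OF v] cls_closed[OF v']] by simp
  }
  {
    fix C b l assume v: "filling i C (b # l)"
    let ?S = "\<Oplus>\<^bsub>FT i\<^esub>T\<in>(\<lambda>r. hooktab (C[r := b]) (C ! r # l)) ` {..<length C}. unit_vec A T"
    have "unit_vec A (hooktab C (b # l)) \<ominus>\<^bsub>FT i\<^esub> ?S \<in> KT i"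
      unfolding tableau_relations_def
      by (rule subsetD[OF module_span_superset UnI2[OF shuffling_relation_mem[OF A d v]]])
    from KT_zero[OF this]
    have "(KT i +>\<^bsub>FT i\<^esub> unit_vec A (hooktab C (b # l))) \<ominus>\<^bsub>U i\<^esub> (KT i +>\<^bsub>FT i\<^esub> ?S) = \<zero>\<^bsub>U i\<^esub>"
      using u[OF shuffle_step[OF v]] by (subst minus[symmetric]) (auto intro!: u[OF v] F.finsum_closed)
    then have "cls i C (b # l) \<ominus>\<^bsub>U i\<^esub> (\<Oplus>\<^bsub>U i\<^esub>r\<in>{..<length C}. cls i (C[r := b]) (C ! r # l)) = \<zero>\<^bsub>U i\<^esub>"
      unfolding finsum_unit_vec_hom[OF U_module U_proj v] cls_eq .
    then show "cls i C (b # l) = (\<Oplus>\<^bsub>U i\<^esub>r\<in>{..<length C}. cls i (C[r := b]) (C ! r # l))"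
      using cls_closed[OF shuffle_step[OF v]]
      by (intro U.eq_if_minus_zero[OF cls_closed[OF v]] U.finsum_closed) auto
  }
qed (rule cls_closed)

lemma perm_tableau_inv:
  assumes "s permutes {1..n}"
  shows "perm_tableau (inv_into UNIV s) (perm_tableau s T) = T"
    "perm_tableau s (perm_tableau (inv_into UNIV s) T) = T"
  using permutes_inverses[OF assms] by (simp_all add: perm_tableau_def comp_def)

lemma perm_tableau_mem:
  assumes "s permutes {1..n}" "T \<in> tableaux sh n"
  shows "perm_tableau s T \<in> tableaux sh n"
proof -
  have "concat (perm_tableau s T) = map s (concat T)" by (simp add: perm_tableau_def map_concat)
  moreover have "distinct (map s (concat T))"
    using assms(2) permutes_inj_on[OF assms(1)] by (simp add: tableaux_def distinct_map)
  moreover have "set (map s (concat T)) \<subseteq> {1..n}"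
    using assms(2) image_mono[of "set (concat T)" "{1..n}" s] permutes_image[OF assms(1)]
    by (simp add: tableaux_def)
  moreover have "map length (perm_tableau s T) = map length T" by (simp add: perm_tableau_def)
  ultimately show ?thesis
    using assms(2) unfolding tableaux_def mem_Collect_eq by metis
qed

abbreviation "move s \<equiv> (\<lambda>f T. f (perm_tableau (inv_into UNIV s) T))"

lemma move_hom:
  assumes s: "s permutes {1..n}"
  shows "move s \<in> module_homs A (FT i) (FT i)"
proof (rule module_homsI)
  fix f assume f: "f \<in> carrier (FT i)"
  have "finite {T. f (perm_tableau (inv_into UNIV s) T) \<noteq> \<zero>\<^bsub>A\<^esub>}"
    by (rule finite_subset[of _ "perm_tableau s ` {T. f T \<noteq> \<zero>\<^bsub>A\<^esub>}"])
      (use f perm_tableau_inv[OF s] in \<open>auto simp: free_module_carrier[OF A] image_iff, metis\<close>)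
  moreover have "f (perm_tableau (inv_into UNIV s) T) = \<zero>\<^bsub>A\<^esub>" if "T \<notin> tableaux (hook d i) n" for T
  proof -
    have "perm_tableau (inv_into UNIV s) T \<notin> tableaux (hook d i) n"
      using perm_tableau_mem[OF s, of "perm_tableau (inv_into UNIV s) T"] perm_tableau_inv[OF s] that by metis
    then show ?thesis using f by (simp add: free_module_carrier[OF A])
  qed
  ultimately show "move s f \<in> carrier (FT i)"
    using f by (simp add: free_module_carrier[OF A])
qed (simp_all add: free_module_simps[OF A])

lemma move_unit_vec:
  assumes "s permutes {1..n}" "filling i C bs"
  shows "move s (unit_vec A (hooktab C bs)) = unit_vec A (hooktab (map s C) (map s bs))"
proof
  fix T
  have "perm_tableau (inv_into UNIV s) T = hooktab C bs \<longleftrightarrow> T = hooktab (map s C) (map s bs)"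
    using perm_tableau_inv[OF assms(1)] perm_tableau_hooktab[OF hook_filling_nonempty[OF assms(2)]] by metis
  then show "move s (unit_vec A (hooktab C bs)) T = unit_vec A (hooktab (map s C) (map s bs)) T"
    by (simp add: unit_vec_def)
qed

text \<open>Instead of transforming relations one by one, \<open>hook_relations_kill\<close> is
  applied to the composite of \<open>move s\<close> with the projection. On unit vectors this
  composite takes the permuted classes as values, which satisfy the relations by
  \<open>hook_relations_perm\<close>.\<close>

lemma move_KT:
  assumes s: "s permutes {1..n}" and x: "x \<in> KT i"
  shows "move s x \<in> KT i"
proof -
  interpret F: module A "FT i" by (rule FT_module)
  interpret U: module A "U i" by (rule U_module)
  have "hook_relations d n i (U i) (\<lambda>C bs. KT i +>\<^bsub>FT i\<^esub> move s (unit_vec A (hooktab C bs)))"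
  proof -
    note R = hook_relationsD[OF hook_relations_perm[OF U_module s cls_relations]]
    have e: "KT i +>\<^bsub>FT i\<^esub> move s (unit_vec A (hooktab C bs)) = cls i (map s C) (map s bs)"
      if "filling i C bs" for C bs
      using move_unit_vec[OF s that] by (simp add: cls_eq)
    show ?thesis
    proof (rule hook_relationsI)
      fix C b l assume v: "filling i C (b # l)"
      show "KT i +>\<^bsub>FT i\<^esub> move s (unit_vec A (hooktab C (b # l))) =
         (\<Oplus>\<^bsub>U i\<^esub>r\<in>{..<length C}. KT i +>\<^bsub>FT i\<^esub> move s (unit_vec A (hooktab (C[r := b]) (C ! r # l))))"
        unfolding e[OF v] R(4)[OF v] using R(1)[OF shuffle_step[OF v]] e[OF shuffle_step[OF v]]
        by (intro U.finsum_cong') auto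
    qed (simp_all only: e perm_step swap_step R)
  qed
  from hook_relations_kill[OF U_module module_homs_comp[OF move_hom[OF s] U_proj] this x]
  have 0: "KT i +>\<^bsub>FT i\<^esub> move s x = KT i +>\<^bsub>FT i\<^esub> \<zero>\<^bsub>FT i\<^esub>"
    by (simp only: U_simps quot_module_zero[OF FT_module KT_submodule])
  have xc: "x \<in> carrier (FT i)" using F.submoduleE(1)[OF KT_submodule] x by (rule subsetD)
  have mc: "move s x \<in> carrier (FT i)" by (rule module_homs_closed[OF move_hom[OF s] xc])
  have "move s x \<ominus>\<^bsub>FT i\<^esub> \<zero>\<^bsub>FT i\<^esub> \<in> KT i"
    using 0 coset_eq_iff[OF FT_module KT_submodule mc F.zero_closed] by simp
  then show ?thesis using mc by (simp add: F.diff_zero)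
qed

text \<open>The action is defined as the image of a whole coset, so it is a coset again only if
  \<open>move s\<close> maps \<open>KT i\<close> onto itself; surjectivity comes from stability
  under the inverse permutation.\<close>

lemma act_U_coset:
  assumes s: "s permutes {1..n}" and x: "x \<in> carrier (FT i)"
  shows "act (U i) s (KT i +>\<^bsub>FT i\<^esub> x) = KT i +>\<^bsub>FT i\<^esub> move s x"
proof -
  interpret F: module A "FT i" by (rule FT_module)
  note c = subsetD[OF F.submoduleE(1)[OF KT_submodule]]
  have add: "move s (k \<oplus>\<^bsub>FT i\<^esub> x) = move s k \<oplus>\<^bsub>FT i\<^esub> move s x" if "k \<in> KT i" for k
    by (rule module_homs_add[OF move_hom[OF s] c[OF that] x])
  have inv: "move s (move (inv_into UNIV s) k) = k" for k
    using perm_tableau_inv[OF permutes_inv[OF s]] by (simp add: inv_inv_eq[OF permutes_bij[OF s]])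
  have "move s ` KT i = KT i"
  proof
    show "move s ` KT i \<subseteq> KT i" using move_KT[OF s] by (rule image_subsetI)
    show "KT i \<subseteq> move s ` KT i"
    proof
      fix k assume "k \<in> KT i"
      then have "move (inv_into UNIV s) k \<in> KT i" by (rule move_KT[OF permutes_inv[OF s]])
      then show "k \<in> move s ` KT i" using inv[of k] by (intro image_eqI[of _ _ "move (inv_into UNIV s) k"]) auto
    qed
  qed
  then have "(\<Union>k\<in>KT i. {k \<oplus>\<^bsub>FT i\<^esub> move s x}) = (\<Union>k\<in>KT i. {move s k \<oplus>\<^bsub>FT i\<^esub> move s x})"
    using SUP_image[of "\<lambda>k. {k \<oplus>\<^bsub>FT i\<^esub> move s x}" "move s" "KT i"] by (simp only: comp_def)
  then show ?thesis
    unfolding U_simps a_r_coset_def' image_UN using add by simp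
qed

lemma act_U_hom:
  assumes s: "s permutes {1..n}"
  shows "act (U i) s \<in> module_homs A (U i) (U i)"
proof (rule module_homsI)
  interpret F: module A "FT i" by (rule FT_module)
  note h = module_homsD[OF move_hom[OF s]] and p = module_homsD[OF U_proj]
  have ex: "\<exists>y\<in>carrier (FT i). x = KT i +>\<^bsub>FT i\<^esub> y" if "x \<in> carrier (U i)" for x
    using that by (auto simp: U_simps quot_module_carrier[OF FT_module KT_submodule])
  fix x assume "x \<in> carrier (U i)"
  then obtain x' where x': "x' \<in> carrier (FT i)" "x = KT i +>\<^bsub>FT i\<^esub> x'" using ex by blast
  show "act (U i) s x \<in> carrier (U i)"
    unfolding x'(2) act_U_coset[OF s x'(1)] by (rule p(1)[OF h(1)[OF x'(1)]])
  show "act (U i) s (r \<odot>\<^bsub>U i\<^esub> x) = r \<odot>\<^bsub>U i\<^esub> act (U i) s x" if r: "r \<in> carrier A" for r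
    unfolding x'(2) act_U_coset[OF s x'(1)] p(3)[OF r x'(1), symmetric]
      p(3)[OF r h(1)[OF x'(1)], symmetric] act_U_coset[OF s F.smult_closed[OF r x'(1)]] h(3)[OF r x'(1)] ..
  fix y assume "y \<in> carrier (U i)"
  then obtain y' where y': "y' \<in> carrier (FT i)" "y = KT i +>\<^bsub>FT i\<^esub> y'" using ex by blast
  show "act (U i) s (x \<oplus>\<^bsub>U i\<^esub> y) = act (U i) s x \<oplus>\<^bsub>U i\<^esub> act (U i) s y"
    unfolding x'(2) y'(2) act_U_coset[OF s x'(1)] act_U_coset[OF s y'(1)] p(2)[OF x'(1) y'(1), symmetric]
      p(2)[OF h(1)[OF x'(1)] h(1)[OF y'(1)], symmetric]
      act_U_coset[OF s F.add.m_closed[OF x'(1) y'(1)]] h(2)[OF x'(1) y'(1)] ..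
qed

lemma act_U_cls:
  assumes "s permutes {1..n}" "filling i C bs"
  shows "act (U i) s (cls i C bs) = cls i (map s C) (map s bs)"
  unfolding cls_eq using act_U_coset[OF assms(1) hook_unit_vec_closed[OF A d assms(2)]] move_unit_vec[OF assms]
  by simp

lemma act_U_comp:
  assumes s: "s permutes {1..n}" and t: "t permutes {1..n}" and u: "u \<in> carrier (U i)"
  shows "act (U i) (s \<circ> t) u = act (U i) s (act (U i) t u)"
  by (rule U_homs_eq[OF U_module act_U_hom[OF permutes_compose[OF t s]]
        module_homs_comp[OF act_U_hom[OF t] act_U_hom[OF s]] _ u])
    (simp add: act_U_cls s t permutes_compose[OF t s] global_perm_step)

lemma act_U_id: "u \<in> carrier (U i) \<Longrightarrow> act (U i) id u = u"
  by (rule U_homs_eq[OF U_module act_U_hom[OF permutes_id] module_homs_id])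
    (simp_all add: act_U_cls permutes_id)

end

subsection \<open>Gradings given by projections\<close>

definition proj_sum :: "('r, 'm) gr_sym_module \<Rightarrow> (int \<Rightarrow> 'm \<Rightarrow> 'm) \<Rightarrow> 'm \<Rightarrow> bool"
  where "proj_sum M \<pi> x \<longleftrightarrow> (\<exists>S. finite S \<and> (\<forall>k. k \<notin> S \<longrightarrow> \<pi> k x = \<zero>\<^bsub>M\<^esub>) \<and> x = (\<Oplus>\<^bsub>M\<^esub>k\<in>S. \<pi> k x))"

lemma (in abelian_group) additive_finsum:
  assumes cl: "\<And>x. x \<in> carrier G \<Longrightarrow> \<pi> x \<in> carrier G"
    and additive: "\<And>x y. x \<in> carrier G \<Longrightarrow> y \<in> carrier G \<Longrightarrow> \<pi> (x \<oplus> y) = \<pi> x \<oplus> \<pi> y"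
    and zero: "\<pi> \<zero> = \<zero>" and f: "f \<in> I \<rightarrow> carrier G"
  shows "\<pi> (\<Oplus>k\<in>I. f k) = (\<Oplus>k\<in>I. \<pi> (f k))"
  using f
proof (induction I rule: infinite_finite_induct)
  case (insert k I)
  then have "\<pi> (\<Oplus>k\<in>insert k I. f k) = \<pi> (f k) \<oplus> \<pi> (\<Oplus>k\<in>I. f k)"
    using additive[of "f k" "finsum G f I"] by (subst finsum_insert) auto
  also have "\<dots> = (\<Oplus>k\<in>insert k I. \<pi> (f k))"
    using insert cl by (subst finsum_insert) auto
  finally show ?case .
qed (simp_all add: zero)

text \<open>Uniqueness of the decomposition is the point of having projections: applying
  \<open>\<pi> j\<close> to an arbitrary homogeneous decomposition leaves its component of degree
  \<open>j\<close>.\<close>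

lemma graded_moduleI:
  fixes M :: "('p, 'm) gr_sym_module"
  assumes M: "module P M" and sub: "\<And>k. additive_subgroup (hcomp M k) M"
    and pr: "\<And>k x. x \<in> carrier M \<Longrightarrow> \<pi> k x \<in> hcomp M k"
    and add: "\<And>k x y. x \<in> carrier M \<Longrightarrow> y \<in> carrier M \<Longrightarrow> \<pi> k (x \<oplus>\<^bsub>M\<^esub> y) = \<pi> k x \<oplus>\<^bsub>M\<^esub> \<pi> k y"
    and delta: "\<And>j k x. x \<in> hcomp M k \<Longrightarrow> \<pi> j x = (if j = k then x else \<zero>\<^bsub>M\<^esub>)"
    and sum: "\<And>x. x \<in> carrier M \<Longrightarrow> proj_sum M \<pi> x"
    and mult: "\<And>j k p m. p \<in> hcomp P j \<Longrightarrow> m \<in> hcomp M k \<Longrightarrow> p \<odot>\<^bsub>M\<^esub> m \<in> hcomp M (j + k)"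
  shows "graded_module P M"
  unfolding graded_module_def
proof (intro conjI allI ballI M sub mult)
  interpret M: module P M by (rule M)
  have c: "x \<in> carrier M" if "x \<in> hcomp M k" for x k
    using additive_subgroup.a_subset[OF sub] that by blast
  have z: "\<zero>\<^bsub>M\<^esub> \<in> hcomp M k" for k
    by (rule additive_subgroup.zero_closed[OF sub])
  fix x assume x: "x \<in> carrier M"
  show "\<exists>!f. (\<forall>k. f k \<in> hcomp M k) \<and> finite {k. f k \<noteq> \<zero>\<^bsub>M\<^esub>} \<and>
      x = (\<Oplus>\<^bsub>M\<^esub>k\<in>{k. f k \<noteq> \<zero>\<^bsub>M\<^esub>}. f k)"
  proof (rule ex1I[of _ "\<lambda>k. \<pi> k x"])
    obtain S where S: "finite S" "\<And>k. k \<notin> S \<Longrightarrow> \<pi> k x = \<zero>\<^bsub>M\<^esub>" "x = (\<Oplus>\<^bsub>M\<^esub>k\<in>S. \<pi> k x)"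
      using sum[OF x] unfolding proj_sum_def by blast
    have sub: "{k. \<pi> k x \<noteq> \<zero>\<^bsub>M\<^esub>} \<subseteq> S" using S(2) by blast
    have "(\<Oplus>\<^bsub>M\<^esub>k\<in>{k. \<pi> k x \<noteq> \<zero>\<^bsub>M\<^esub>}. \<pi> k x) = (\<Oplus>\<^bsub>M\<^esub>k\<in>S. \<pi> k x)"
      using c[OF pr[OF x]] sub S(1) by (intro M.add.finprod_mono_neutral_cong_left) auto
    then show "(\<forall>k. \<pi> k x \<in> hcomp M k) \<and> finite {k. \<pi> k x \<noteq> \<zero>\<^bsub>M\<^esub>} \<and>
        x = (\<Oplus>\<^bsub>M\<^esub>k\<in>{k. \<pi> k x \<noteq> \<zero>\<^bsub>M\<^esub>}. \<pi> k x)"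
      using pr[OF x] finite_subset[OF sub S(1)] S(3) by simp
  next
    fix f assume f: "(\<forall>k. f k \<in> hcomp M k) \<and> finite {k. f k \<noteq> \<zero>\<^bsub>M\<^esub>} \<and>
        x = (\<Oplus>\<^bsub>M\<^esub>k\<in>{k. f k \<noteq> \<zero>\<^bsub>M\<^esub>}. f k)"
    let ?S = "{k. f k \<noteq> \<zero>\<^bsub>M\<^esub>}"
    have fc: "f k \<in> carrier M" for k using f c by blast
    show "f = (\<lambda>k. \<pi> k x)"
    proof
      fix j
      have "\<pi> j x = \<pi> j (\<Oplus>\<^bsub>M\<^esub>k\<in>?S. f k)" using f by simp
      also have "\<dots> = (\<Oplus>\<^bsub>M\<^esub>k\<in>?S. \<pi> j (f k))"
        using fc c[OF pr] delta[OF z, of j j] by (intro M.additive_finsum add) auto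
      also have "\<dots> = (\<Oplus>\<^bsub>M\<^esub>k\<in>?S. if j = k then f k else \<zero>\<^bsub>M\<^esub>)"
        using fc f delta by (intro M.finsum_cong') auto
      also have "\<dots> = f j"
      proof (cases "j \<in> ?S")
        case True
        then show ?thesis using M.finsum_singleton[OF True, of f] f fc by auto
      next
        case False
        then have "(\<Oplus>\<^bsub>M\<^esub>k\<in>?S. if j = k then f k else \<zero>\<^bsub>M\<^esub>) = (\<Oplus>\<^bsub>M\<^esub>k\<in>?S. \<zero>\<^bsub>M\<^esub>)"
          by (intro M.finsum_cong') auto
        then show ?thesis using False by simp
      qed
      finally show "f j = \<pi> j x" by simp
    qed
  qed
qed

lemma proj_sum_add:
  fixes M :: "('p, 'm) gr_sym_module"
  assumes M: "abelian_group M" and cl: "\<And>k x. x \<in> carrier M \<Longrightarrow> \<pi> k x \<in> carrier M"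
    and add: "\<And>k x y. x \<in> carrier M \<Longrightarrow> y \<in> carrier M \<Longrightarrow> \<pi> k (x \<oplus>\<^bsub>M\<^esub> y) = \<pi> k x \<oplus>\<^bsub>M\<^esub> \<pi> k y"
    and x: "x \<in> carrier M" "proj_sum M \<pi> x" and y: "y \<in> carrier M" "proj_sum M \<pi> y"
  shows "proj_sum M \<pi> (x \<oplus>\<^bsub>M\<^esub> y)"
proof -
  interpret M: abelian_group M by (rule M)
  obtain S where S: "finite S" "\<And>k. k \<notin> S \<Longrightarrow> \<pi> k x = \<zero>\<^bsub>M\<^esub>" "x = (\<Oplus>\<^bsub>M\<^esub>k\<in>S. \<pi> k x)"
    using x(2) unfolding proj_sum_def by blast
  obtain T where T: "finite T" "\<And>k. k \<notin> T \<Longrightarrow> \<pi> k y = \<zero>\<^bsub>M\<^esub>" "y = (\<Oplus>\<^bsub>M\<^esub>k\<in>T. \<pi> k y)"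
    using y(2) unfolding proj_sum_def by blast
  have "(\<Oplus>\<^bsub>M\<^esub>k\<in>S. \<pi> k x) = (\<Oplus>\<^bsub>M\<^esub>k\<in>S \<union> T. \<pi> k x)"
    using S T(1) cl[OF x(1)] by (intro M.add.finprod_mono_neutral_cong_left) auto
  moreover have "(\<Oplus>\<^bsub>M\<^esub>k\<in>T. \<pi> k y) = (\<Oplus>\<^bsub>M\<^esub>k\<in>S \<union> T. \<pi> k y)"
    using T S(1) cl[OF y(1)] by (intro M.add.finprod_mono_neutral_cong_left) auto
  moreover have "(\<Oplus>\<^bsub>M\<^esub>k\<in>S \<union> T. \<pi> k (x \<oplus>\<^bsub>M\<^esub> y)) = (\<Oplus>\<^bsub>M\<^esub>k\<in>S \<union> T. \<pi> k x \<oplus>\<^bsub>M\<^esub> \<pi> k y)"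
    using add[OF x(1) y(1)] cl x(1) y(1) by (intro M.finsum_cong') auto
  moreover have "\<dots> = (\<Oplus>\<^bsub>M\<^esub>k\<in>S \<union> T. \<pi> k x) \<oplus>\<^bsub>M\<^esub> (\<Oplus>\<^bsub>M\<^esub>k\<in>S \<union> T. \<pi> k y)"
    using cl x(1) y(1) by (intro M.finsum_addf) auto
  ultimately have "x \<oplus>\<^bsub>M\<^esub> y = (\<Oplus>\<^bsub>M\<^esub>k\<in>S \<union> T. \<pi> k (x \<oplus>\<^bsub>M\<^esub> y))"
    using S(3) T(3) by simp
  moreover have "\<pi> k (x \<oplus>\<^bsub>M\<^esub> y) = \<zero>\<^bsub>M\<^esub>" if "k \<notin> S \<union> T" for k
    using that S(2) T(2) add[OF x(1) y(1)] by simp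
  ultimately show ?thesis
    unfolding proj_sum_def using S(1) T(1) by (intro exI[of _ "S \<union> T"]) simp
qed

lemma proj_sum_homogeneous:
  fixes M :: "('p, 'm) gr_sym_module"
  assumes M: "abelian_group M" and x: "x \<in> carrier M"
    and "\<And>j. \<pi> j x = (if j = k then x else \<zero>\<^bsub>M\<^esub>)"
  shows "proj_sum M \<pi> x"
proof -
  interpret M: abelian_group M by (rule M)
  have "(\<Oplus>\<^bsub>M\<^esub>j\<in>{k}. \<pi> j x) = x"
    using assms by (subst M.finsum_insert) auto
  then show ?thesis
    unfolding proj_sum_def using assms(3) by (intro exI[of _ "{k}"]) auto
qed

context polys
begin

lemma finsum_hproj:
  assumes p: "p \<in> carrier P"
  shows "\<exists>S. finite S \<and> (\<forall>k. k \<notin> S \<longrightarrow> hproj k p = zero P) \<and> p = (\<Oplus>\<^bsub>P\<^esub>k\<in>S. hproj k p)"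
proof -
  define S where "S = (\<lambda>m. int (size m)) ` {m. p m \<noteq> \<zero>\<^bsub>A\<^esub>}"
  have fin: "finite S" using p by (simp add: S_def P_carrier_iff)
  have "p m = (\<Oplus>\<^bsub>P\<^esub>k\<in>S. hproj k p) m" for m
  proof -
    have "hproj k p \<in> carrier (free_module A Mon)" for k
      using module_homs_closed[OF hproj_hom p] by (simp only: P_carrier)
    then have "(\<Oplus>\<^bsub>P\<^esub>k\<in>S. hproj k p) m = (\<Oplus>\<^bsub>A\<^esub>k\<in>S. hproj k p m)"
      unfolding same_group_finsum[OF same_group_P] by (intro free_module_finsum_apply[OF A fin]) simp
    also have "\<dots> = (\<Oplus>\<^bsub>A\<^esub>k\<in>S. if int (size m) = k then p m else \<zero>\<^bsub>A\<^esub>)"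
      by (simp add: hproj_def)
    also have "\<dots> = p m"
    proof (cases "int (size m) \<in> S")
      case True
      then show ?thesis using A.finsum_singleton[OF True fin, of "\<lambda>_. p m"] p by simp
    next
      case False
      then have "(\<Oplus>\<^bsub>A\<^esub>k\<in>S. if int (size m) = k then p m else \<zero>\<^bsub>A\<^esub>) = (\<Oplus>\<^bsub>A\<^esub>k\<in>S. \<zero>\<^bsub>A\<^esub>)"
        by (intro A.finsum_cong') auto
      then show ?thesis using False by (auto simp: S_def)
    qed
    finally show ?thesis by simp
  qed
  then have "p = (\<Oplus>\<^bsub>P\<^esub>k\<in>S. hproj k p)" by (rule ext)
  moreover have "hproj k p = zero P" if "k \<notin> S" for k
    using that by (auto simp: hproj_def P_simps S_def fun_eq_iff)
  ultimately show ?thesis using fin by blast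
qed

text \<open>Restriction of scalars along the constants. The tensor products are formed over
  \<open>A\<close>, so their universal property can reach an \<open>R_n\<close>-module only in this
  guise.\<close>

definition res :: "(nat multiset \<Rightarrow> 'a, 'm, 'y) module_scheme \<Rightarrow> ('a, 'm) module"
  where "res M = \<lparr>carrier = carrier M, monoid.mult = undefined, one = undefined, zero = zero M,
    add = add M, smult = (\<lambda>a x. A.indexed_const a \<odot>\<^bsub>M\<^esub> x)\<rparr>"

lemma res_simps: "carrier (res M) = carrier M" "zero (res M) = zero M" "add (res M) = add M"
  "a \<odot>\<^bsub>res M\<^esub> x = A.indexed_const a \<odot>\<^bsub>M\<^esub> x" "same_group (res M) M"
  by (simp_all add: res_def same_group_def)

lemma const_closed: "a \<in> carrier A \<Longrightarrow> A.indexed_const a \<in> carrier P"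
  by (rule const_mult(2)[OF _ P_one_closed])

lemma res_module:
  assumes "module P M" shows "module A (res M)"
proof -
  interpret M: module P M by (rule assms)
  have "A.indexed_const (a \<otimes>\<^bsub>A\<^esub> b) = A.indexed_const a \<otimes>\<^bsub>P\<^esub> A.indexed_const b"
    if "a \<in> carrier A" "b \<in> carrier A" for a b
    unfolding const_mult(1)[OF that(1) const_closed[OF that(2)]]
    using that by (auto simp: P_simps const_eq)
  moreover have "A.indexed_const (a \<oplus>\<^bsub>A\<^esub> b) = A.indexed_const a \<oplus>\<^bsub>P\<^esub> A.indexed_const b"
    if "a \<in> carrier A" "b \<in> carrier A" for a b
    using that by (auto simp: P_simps const_eq)
  moreover have "A.indexed_const \<one>\<^bsub>A\<^esub> = one P"
    by (simp add: one_P const_eq unit_vec_def)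
  ultimately show ?thesis
    by (intro moduleI A same_group_abelian_group[OF M.abelian_group_axioms res_simps(5)])
      (simp_all add: res_simps const_closed M.smult_l_distr M.smult_r_distr M.smult_assoc1)
qed

end

subsection \<open>The modules of the complex\<close>

context hooks
begin

abbreviation "N i \<equiv> shift P (- int d - int i)"
abbreviation "TT i \<equiv> tensor_module A (U i) (N i)"
abbreviation "F i \<equiv> F_mod A d n i"
abbreviation "pure i \<equiv> pure_tensor A (U i) (N i)"
abbreviation "E i C bs \<equiv> F_class A d n i (one P) (hooktab C bs)"

lemma N_simps: "carrier (N i) = carrier P" "zero (N i) = zero P" "add (N i) = add P"
  "smult (N i) = smult P" "monoid.mult (N i) = monoid.mult P" "act (N i) = act P"
  "hcomp (N i) k = hcomp P (k - int d - int i)"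
  by (simp_all add: shift_def algebra_simps)

lemma N_module: "module A (N i)"
  by (rule same_group_module[OF P_module]) (simp_all add: same_group_def N_simps)

lemma N_homs: "h \<in> module_homs A P P \<Longrightarrow> h \<in> module_homs A (N i) (N i)"
  by (simp add: module_homs_def N_simps)

lemma TT_module: "module A (TT i)"
  by (rule tensor_module_module[OF A U_module N_module])

lemma F_simps: "carrier (F i) = carrier (TT i)" "zero (F i) = zero (TT i)" "add (F i) = add (TT i)"
  "smult (F i) p = tensor_map A (U i) (N i) (\<lambda>u. u) (\<lambda>q. p \<otimes>\<^bsub>P\<^esub> q)"
  "act (F i) s = tensor_map A (U i) (N i) (act (U i) s) (act P s)"
  by (simp_all add: F_mod_def extend_scalars_def N_simps)

lemma F_hcomp: "hcomp (F i) k = module_span A (TT i)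
    {pure i u q | u q. u \<in> carrier (U i) \<and> q \<in> hcomp P (k - int d - int i)}"
  by (simp add: F_mod_def extend_scalars_def N_simps)

lemma same_group_F: "same_group (F i) (TT i)"
  by (simp add: same_group_def F_simps)

lemma F_abelian_group: "abelian_group (F i)"
  by (rule same_group_abelian_group[OF _ same_group_F]) (rule module.axioms(2)[OF TT_module])

lemma pure_closed: "u \<in> carrier (U i) \<Longrightarrow> q \<in> carrier P \<Longrightarrow> pure i u q \<in> carrier (TT i)"
  by (rule pure_tensor_closed[OF A U_module N_module]) (simp_all add: N_simps)

lemma TT_homs_eq:
  assumes "module A L" "f \<in> module_homs A (TT i) L" "g \<in> module_homs A (TT i) L"
    and "\<And>u q. u \<in> carrier (U i) \<Longrightarrow> q \<in> carrier P \<Longrightarrow> f (pure i u q) = g (pure i u q)"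
    and "x \<in> carrier (TT i)"
  shows "f x = g x"
  by (rule tensor_homs_eq[OF A U_module N_module assms(1-3) _ assms(5)]) (rule assms(4), simp_all add: N_simps)

lemma F_smult_hom: "p \<in> carrier P \<Longrightarrow> smult (F i) p \<in> module_homs A (TT i) (TT i)"
  unfolding F_simps
  by (rule tensor_map_hom[OF A U_module N_module module_homs_id N_homs[OF mult_hom_right]])

lemma F_smult_pure:
  assumes "p \<in> carrier P" "u \<in> carrier (U i)" "q \<in> carrier P"
  shows "p \<odot>\<^bsub>F i\<^esub> pure i u q = pure i u (p \<otimes>\<^bsub>P\<^esub> q)"
  unfolding F_simps
  by (rule tensor_map_pure[OF A U_module N_module module_homs_id N_homs[OF mult_hom_right]])
    (use assms in \<open>simp_all add: N_simps\<close>)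

lemma pure_hom_left:
  assumes "q \<in> carrier P" shows "(\<lambda>u. pure i u q) \<in> module_homs A (U i) (TT i)"
  using assms
  by (intro module_homsI pure_closed pure_tensor_add_left[OF A U_module N_module]
      pure_tensor_smult_left[OF A U_module N_module]) (simp_all add: N_simps)

lemma pure_hom_right:
  assumes "u \<in> carrier (U i)" shows "(\<lambda>q. pure i u q) \<in> module_homs A P (TT i)"
  using assms pure_tensor_add_right[OF A U_module N_module] pure_tensor_smult_right[OF A U_module N_module]
  by (intro module_homsI pure_closed) (simp_all add: N_simps)

lemma F_module: "module P (F i)"
proof (rule moduleI)
  interpret T: module A "TT i" by (rule TT_module)
  note h = F_smult_hom
  note eq = TT_homs_eq[OF TT_module]
  show "cring P" by (rule P_cring)
  show "abelian_group (F i)" by (rule F_abelian_group)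
  show "p \<odot>\<^bsub>F i\<^esub> x \<in> carrier (F i)" if "p \<in> carrier P" "x \<in> carrier (F i)" for p x
    using module_homs_closed[OF h] that by (simp add: F_simps(1))
  show "p \<odot>\<^bsub>F i\<^esub> (x \<oplus>\<^bsub>F i\<^esub> y) = p \<odot>\<^bsub>F i\<^esub> x \<oplus>\<^bsub>F i\<^esub> p \<odot>\<^bsub>F i\<^esub> y"
    if "p \<in> carrier P" "x \<in> carrier (F i)" "y \<in> carrier (F i)" for p x y
    using module_homs_add[OF h] that by (simp add: F_simps(1,3))
  show "(p \<oplus>\<^bsub>P\<^esub> q) \<odot>\<^bsub>F i\<^esub> x = p \<odot>\<^bsub>F i\<^esub> x \<oplus>\<^bsub>F i\<^esub> q \<odot>\<^bsub>F i\<^esub> x"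
    if p: "p \<in> carrier P" and q: "q \<in> carrier P" and x: "x \<in> carrier (F i)" for p q x
    unfolding F_simps(3)
    by (rule eq[OF h[OF P.add.m_closed[OF p q]] module_homs_sum[OF TT_module h[OF p] h[OF q]] _ x[unfolded F_simps(1)]])
      (simp add: F_smult_pure p q P.l_distr module_homs_add[OF pure_hom_right])
  show "(p \<otimes>\<^bsub>P\<^esub> q) \<odot>\<^bsub>F i\<^esub> x = p \<odot>\<^bsub>F i\<^esub> (q \<odot>\<^bsub>F i\<^esub> x)"
    if p: "p \<in> carrier P" and q: "q \<in> carrier P" and x: "x \<in> carrier (F i)" for p q x
    by (rule eq[OF h[OF P_mult_closed[OF p q]] module_homs_comp[OF h[OF q] h[OF p]] _ x[unfolded F_simps(1)]])
      (simp add: F_smult_pure p q P_mult_closed P_mult_assoc)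
  show "one P \<odot>\<^bsub>F i\<^esub> x = x" if x: "x \<in> carrier (F i)" for x
    by (rule eq[OF h[OF P_one_closed] module_homs_id _ x[unfolded F_simps(1)]])
      (simp add: F_smult_pure P_one_closed P_l_one)
qed

text \<open>A constant can be moved across the tensor sign, so the scalars of the tensor product
  over \<open>A\<close> and the constant polynomials act alike.\<close>

lemma TT_smult:
  assumes a: "a \<in> carrier A" and x: "x \<in> carrier (TT i)"
  shows "a \<odot>\<^bsub>TT i\<^esub> x = A.indexed_const a \<odot>\<^bsub>F i\<^esub> x"
  by (rule TT_homs_eq[OF TT_module module_homs_scale[OF TT_module a] F_smult_hom[OF const_closed[OF a]] _ x])
    (simp add: F_smult_pure const_closed a const_mult module_homs_smult[OF pure_hom_right])

lemma F_class_eq: "F_class A d n i p (hooktab C bs) = pure i (cls i C bs) p"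
  by (simp add: F_class_def)

lemma E_smult: "filling i C bs \<Longrightarrow> p \<in> carrier P \<Longrightarrow> p \<odot>\<^bsub>F i\<^esub> E i C bs = F_class A d n i p (hooktab C bs)"
  by (simp add: F_class_eq F_smult_pure cls_closed P_one_closed)

lemma E_closed: "filling i C bs \<Longrightarrow> E i C bs \<in> carrier (F i)"
  by (simp only: F_class_eq F_simps pure_closed cls_closed P_one_closed)

lemma F_hom_res:
  assumes h: "h \<in> module_homs P (F i) M" shows "h \<in> module_homs A (TT i) (res M)"
  by (rule module_homsI)
    (simp_all add: res_simps TT_smult const_closed module_homsD[OF h, unfolded F_simps(1,3)])

text \<open>Every pure tensor is a polynomial multiple of one with second factor 1, and those are
  determined by the classes of tableaux.\<close>

lemma F_homs_eq:
  assumes M: "module P M" and f: "f \<in> module_homs P (F i) M" and g: "g \<in> module_homs P (F i) M"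
    and eq: "\<And>C bs. filling i C bs \<Longrightarrow> f (E i C bs) = g (E i C bs)" and x: "x \<in> carrier (F i)"
  shows "f x = g x"
proof (rule TT_homs_eq[OF res_module[OF M] F_hom_res[OF f] F_hom_res[OF g] _ x[unfolded F_simps(1)]])
  fix u q assume u: "u \<in> carrier (U i)" and q: "q \<in> carrier P"
  have "f (pure i u (one P)) = g (pure i u (one P))"
    by (rule U_homs_eq[OF res_module[OF M] module_homs_comp[OF pure_hom_left[OF P_one_closed] F_hom_res[OF f]]
          module_homs_comp[OF pure_hom_left[OF P_one_closed] F_hom_res[OF g]] _ u])
      (rule eq[unfolded F_class_eq])
  moreover have "pure i u q = q \<odot>\<^bsub>F i\<^esub> pure i u (one P)"
    using u q by (simp add: F_smult_pure P_one_closed)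
  ultimately show "f (pure i u q) = g (pure i u q)"
    using module_homs_smult[OF f] module_homs_smult[OF g] pure_closed[OF u P_one_closed] q
    by (simp add: F_simps(1))
qed

text \<open>Extension of scalars is left adjoint to \<open>res\<close>: an \<open>A\<close>-linear
  map \<open>f\<close> on \<open>U i\<close> extends by sending the tensor of \<open>u\<close> and
  \<open>q\<close> to \<open>q\<close> times \<open>f u\<close>.\<close>

lemma F_lift:
  assumes M: "module P M" and g: "hook_relations d n i M g"
  shows "\<exists>h\<in>module_homs P (F i) M. \<forall>C bs. filling i C bs \<longrightarrow> h (E i C bs) = g C bs"
proof -
  interpret M: module P M by (rule M)
  have "hook_relations d n i (res M) g"
    using g unfolding hook_relations_def same_group_finsum[OF res_simps(5)]
      same_group_add_pow[OF res_simps(5)] res_simps(1) .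
  from U_lift[OF res_module[OF M] this] obtain f where f: "f \<in> module_homs A (U i) (res M)"
    and fg: "\<And>C bs. filling i C bs \<Longrightarrow> f (cls i C bs) = g C bs" by blast
  note fD = module_homsD[OF f, unfolded res_simps]
  have sm: "a \<odot>\<^bsub>P\<^esub> p = A.indexed_const a \<otimes>\<^bsub>P\<^esub> p" if "a \<in> carrier A" "p \<in> carrier P" for a p
    using const_mult(1)[OF that] by simp
  have "\<exists>h\<in>module_homs A (TT i) (res M). \<forall>u\<in>carrier (U i). \<forall>q\<in>carrier (N i).
      h (pure i u q) = q \<odot>\<^bsub>M\<^esub> f u"
    by (rule tensor_lift[OF A U_module N_module res_module[OF M]])
      (simp_all add: N_simps res_simps fD M.smult_r_distr M.smult_l_distr sm const_closed M.smult_assoc1[symmetric] P.m_comm)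
  then obtain h where h: "h \<in> module_homs A (TT i) (res M)"
    and hp: "\<And>u q. u \<in> carrier (U i) \<Longrightarrow> q \<in> carrier P \<Longrightarrow> h (pure i u q) = q \<odot>\<^bsub>M\<^esub> f u"
    by (auto simp: N_simps)
  have sc: "(\<lambda>x. p \<odot>\<^bsub>M\<^esub> h x) \<in> module_homs A (TT i) (res M)" if "p \<in> carrier P" for p
    using that module_homsD[OF h, unfolded res_simps]
    by (intro module_homsI)
      (simp_all add: res_simps M.smult_r_distr const_closed M.smult_assoc1[symmetric] P.m_comm)
  have "h \<in> module_homs P (F i) M"
  proof (rule module_homsI)
    fix p x assume p: "p \<in> carrier P" and x: "x \<in> carrier (F i)"
    show "h (p \<odot>\<^bsub>F i\<^esub> x) = p \<odot>\<^bsub>M\<^esub> h x"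
      by (rule TT_homs_eq[OF res_module[OF M] module_homs_comp[OF F_smult_hom[OF p] h] sc[OF p] _ x[unfolded F_simps(1)]])
        (simp add: F_smult_pure p hp P_mult_closed M.smult_assoc1 fD)
  qed (simp_all add: F_simps(1,3) module_homsD[OF h, unfolded res_simps])
  moreover have "h (E i C bs) = g C bs" if v: "filling i C bs" for C bs
    using fg[OF v] fD(1)[OF cls_closed[OF v]] by (simp add: F_class_eq hp cls_closed[OF v] P_one_closed)
  ultimately show ?thesis by blast
qed

lemma E_relations: "hook_relations d n i (F i) (E i)"
  using hook_relations_hom[OF U_module TT_module pure_hom_left[OF P_one_closed] cls_relations]
  unfolding hook_relations_def same_group_finsum[OF same_group_F] same_group_add_pow[OF same_group_F]
    F_simps(1) F_class_eq .

lemma act_F_hom: "s permutes {1..n} \<Longrightarrow> act (F i) s \<in> module_homs A (TT i) (TT i)"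
  unfolding F_simps
  by (rule tensor_map_hom[OF A U_module N_module act_U_hom N_homs[OF act_P_hom]])

lemma act_F_pure:
  assumes s: "s permutes {1..n}" and "u \<in> carrier (U i)" "q \<in> carrier P"
  shows "act (F i) s (pure i u q) = pure i (act (U i) s u) (act P s q)"
  unfolding F_simps
  by (rule tensor_map_pure[OF A U_module N_module act_U_hom[OF s] N_homs[OF act_P_hom[OF s]]])
    (use assms in \<open>simp_all add: N_simps\<close>)

lemma act_P_one: "s permutes {1..n} \<Longrightarrow> act P s (one P) = one P"
  by (simp add: one_P act_P_mon)

lemma act_F_E:
  assumes "s permutes {1..n}" "filling i C bs"
  shows "act (F i) s (E i C bs) = E i (map s C) (map s bs)"
  using assms by (simp add: F_class_eq act_F_pure cls_closed P_one_closed act_P_one act_U_cls)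

lemma act_F_smult:
  assumes s: "s permutes {1..n}" and p: "p \<in> carrier P" and x: "x \<in> carrier (F i)"
  shows "act (F i) s (p \<odot>\<^bsub>F i\<^esub> x) = act P s p \<odot>\<^bsub>F i\<^esub> act (F i) s x"
proof -
  have p': "act P s p \<in> carrier P" by (rule module_homs_closed[OF act_P_hom[OF s] p])
  show ?thesis
    by (rule TT_homs_eq[OF TT_module module_homs_comp[OF F_smult_hom[OF p] act_F_hom[OF s]]
          module_homs_comp[OF act_F_hom[OF s] F_smult_hom[OF p']] _ x[unfolded F_simps(1)]])
      (simp add: F_smult_pure act_F_pure s p p' P_mult_closed act_P_mult
        module_homs_closed[OF act_U_hom[OF s]] module_homs_closed[OF act_P_hom[OF s]])
qed

lemma F_equivariant: "equivariant_module A n (F i)"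
  unfolding equivariant_module_def
proof (intro conjI allI impI ballI F_module)
  show "act (F i) id x = x" if x: "x \<in> carrier (F i)" for x
    by (rule TT_homs_eq[OF TT_module act_F_hom[OF permutes_id] module_homs_id _ x[unfolded F_simps(1)]])
      (simp add: act_F_pure permutes_id act_U_id act_P_id)
  show "act (F i) (s \<circ> t) x = act (F i) s (act (F i) t x)"
    if s: "s permutes {1..n}" and t: "t permutes {1..n}" and x: "x \<in> carrier (F i)" for s t x
    by (rule TT_homs_eq[OF TT_module act_F_hom[OF permutes_compose[OF t s]]
          module_homs_comp[OF act_F_hom[OF t] act_F_hom[OF s]] _ x[unfolded F_simps(1)]])
      (simp add: act_F_pure permutes_compose[OF t s] s t act_U_comp act_P_comp
        module_homs_closed[OF act_U_hom[OF t]] module_homs_closed[OF act_P_hom[OF t]])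
  fix s assume s: "s permutes {1..n}"
  note h = module_homsD[OF act_F_hom[OF s]]
  show "act (F i) s \<in> carrier (F i) \<rightarrow> carrier (F i)"
    using h(1) by (simp add: F_simps(1))
  show "act (F i) s (x \<oplus>\<^bsub>F i\<^esub> y) = act (F i) s x \<oplus>\<^bsub>F i\<^esub> act (F i) s y"
    if "x \<in> carrier (F i)" "y \<in> carrier (F i)" for x y
    using h(2) that by (simp add: F_simps(1,3))
  show "act (F i) s (p \<odot>\<^bsub>F i\<^esub> x) = act P s p \<odot>\<^bsub>F i\<^esub> act (F i) s x"
    if "p \<in> carrier P" "x \<in> carrier (F i)" for p x
    by (rule act_F_smult[OF s that])
  show "act (F i) s (A.indexed_const a \<odot>\<^bsub>F i\<^esub> x) = A.indexed_const a \<odot>\<^bsub>F i\<^esub> act (F i) s x"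
    if a: "a \<in> carrier A" and x: "x \<in> carrier (F i)" for a x
    using act_F_smult[OF s const_closed[OF a] x] by (simp add: act_P_const[OF s])
qed

lemma pure_homogeneous_closed:
  "{pure i u q | u q. u \<in> carrier (U i) \<and> q \<in> hcomp P k} \<subseteq> carrier (TT i)"
  using pure_closed by (auto simp: hcomp_P)

lemma pure_hcomp:
  "u \<in> carrier (U i) \<Longrightarrow> q \<in> hcomp P (k - int d - int i) \<Longrightarrow> pure i u q \<in> hcomp (F i) k"
  unfolding F_hcomp by (rule subsetD[OF module_span_superset]) blast

lemma F_hcomp_submodule: "submodule (hcomp (F i) k) A (TT i)"
  unfolding F_hcomp by (rule module_span_submodule[OF TT_module pure_homogeneous_closed])

text \<open>The projection to degree \<open>k\<close> is induced from the polynomial factor; the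
  offset \<open>d + i\<close> accounts for the twist.\<close>

definition F_proj :: "nat \<Rightarrow> int \<Rightarrow> ((nat list list \<Rightarrow> 'a) set \<times> (nat multiset \<Rightarrow> 'a) \<Rightarrow> 'a) set \<Rightarrow>
    ((nat list list \<Rightarrow> 'a) set \<times> (nat multiset \<Rightarrow> 'a) \<Rightarrow> 'a) set"
  where "F_proj i k = tensor_map A (U i) (N i) (\<lambda>u. u) (hproj (k - int d - int i))"

lemma F_proj_hom: "F_proj i k \<in> module_homs A (TT i) (TT i)"
  unfolding F_proj_def by (rule tensor_map_hom[OF A U_module N_module module_homs_id N_homs[OF hproj_hom]])

lemma F_proj_pure:
  "u \<in> carrier (U i) \<Longrightarrow> q \<in> carrier P \<Longrightarrow> F_proj i k (pure i u q) = pure i u (hproj (k - int d - int i) q)"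
  unfolding F_proj_def
  by (rule tensor_map_pure[OF A U_module N_module module_homs_id N_homs[OF hproj_hom]])
    (simp_all add: N_simps)

lemma TT_induct [consumes 1, case_names pure add smult]:
  assumes "x \<in> carrier (TT i)"
    and "\<And>u m. u \<in> carrier (U i) \<Longrightarrow> set_mset m \<subseteq> {1..n} \<Longrightarrow> Q (pure i u (mon m))"
    and add: "\<And>x y. x \<in> carrier (TT i) \<Longrightarrow> y \<in> carrier (TT i) \<Longrightarrow> Q x \<Longrightarrow> Q y \<Longrightarrow> Q (x \<oplus>\<^bsub>TT i\<^esub> y)"
    and smult: "\<And>a x. a \<in> carrier A \<Longrightarrow> x \<in> carrier (TT i) \<Longrightarrow> Q x \<Longrightarrow> Q (a \<odot>\<^bsub>TT i\<^esub> x)"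
  shows "Q x"
proof -
  interpret T: module A "TT i" by (rule TT_module)
  interpret U: module A "U i" by (rule U_module)
  \<comment> \<open>Zero is obtained as the zero multiple of a pure tensor and therefore needs no
    case of its own.\<close>
  have "Q (pure i \<zero>\<^bsub>U i\<^esub> (mon {#}))" using assms(2) by simp
  then have zero: "Q \<zero>\<^bsub>TT i\<^esub>"
    using smult[of "\<zero>\<^bsub>A\<^esub>" "pure i \<zero>\<^bsub>U i\<^esub> (mon {#})"] pure_closed[OF U.zero_closed mon_closed, of "{#}"]
    by simp
  have "Q (pure i u q)" if u: "u \<in> carrier (U i)" and q: "q \<in> carrier P" for u q
    using q
  proof (induction rule: P_induct)
    case (mon m)
    then show ?case using assms(2) u by simp
  next
    case zero
    then show ?case using \<open>Q \<zero>\<^bsub>TT i\<^esub>\<close> module_homs_zero[OF P_module TT_module pure_hom_right[OF u]] by simp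
  qed (simp_all add: module_homsD[OF pure_hom_right[OF u]] add smult pure_closed u)
  then have b: "Q y" if "y \<in> {pure i u q | u q. u \<in> carrier (U i) \<and> q \<in> carrier (N i)}" for y
    using that by (auto simp: N_simps)
  have s: "{pure i u q | u q. u \<in> carrier (U i) \<and> q \<in> carrier (N i)} \<subseteq> carrier (TT i)"
    using pure_closed by (auto simp: N_simps)
  show ?thesis
    using TT_module s assms(1)[unfolded tensor_module_span[OF A U_module N_module]]
    by (induction rule: module_span_induct) (use b zero add smult in auto)
qed

lemma F_proj_delta:
  assumes "x \<in> hcomp (F i) k" shows "F_proj i j x = (if j = k then x else \<zero>\<^bsub>TT i\<^esub>)"
proof -
  interpret T: module A "TT i" by (rule TT_module)
  show ?thesis
    using TT_module pure_homogeneous_closed assms[unfolded F_hcomp]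
  proof (induction rule: module_span_induct)
    case (base x)
    then obtain u q where u: "u \<in> carrier (U i)" and q: "q \<in> hcomp P (k - int d - int i)"
      and x: "x = pure i u q" by blast
    have qc: "q \<in> carrier P" using q by (simp add: hcomp_P)
    show ?case
      unfolding x F_proj_pure[OF u qc] hproj_hcomp[OF q]
      using module_homs_zero[OF P_module TT_module pure_hom_right[OF u]] by auto
  qed (auto simp: module_homsD[OF F_proj_hom] module_homs_zero[OF TT_module TT_module F_proj_hom])
qed

lemma F_graded: "graded_module P (F i)"
proof (rule graded_moduleI[OF F_module, where \<pi> = "F_proj i"])
  interpret T: module A "TT i" by (rule TT_module)
  interpret FA: abelian_group "F i" by (rule F_abelian_group)
  note h = module_homsD[OF F_proj_hom]
  show "additive_subgroup (hcomp (F i) k) (F i)" for k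
    using submodule.axioms(1)[OF F_hcomp_submodule] same_group_subgroup[OF same_group_F]
    by (intro additive_subgroupI) simp
  show "F_proj i k x \<in> hcomp (F i) k" if x: "x \<in> carrier (F i)" for k x
    using x[unfolded F_simps(1)]
  proof (induction rule: TT_induct)
    case (pure u m)
    then show ?case
      using hproj_closed[OF mon_closed[OF pure(2)]] mon_closed[OF pure(2)]
      by (simp add: F_proj_pure pure_hcomp)
  qed (simp_all add: h T.submoduleE[OF F_hcomp_submodule])
  show "F_proj i k (x \<oplus>\<^bsub>F i\<^esub> y) = F_proj i k x \<oplus>\<^bsub>F i\<^esub> F_proj i k y"
    if "x \<in> carrier (F i)" "y \<in> carrier (F i)" for k x y
    using that h(2) by (simp add: F_simps(1,3))
  show "F_proj i j x = (if j = k then x else \<zero>\<^bsub>F i\<^esub>)" if "x \<in> hcomp (F i) k" for j k x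
    using F_proj_delta[OF that] by (simp only: F_simps)
  show "proj_sum (F i) (F_proj i) x" if x: "x \<in> carrier (F i)" for x
    using x[unfolded F_simps(1)]
  proof (induction rule: TT_induct)
    case (pure u m)
    have m: "mon m \<in> hcomp P ((int (size m) + int d + int i) - int d - int i)"
      using mon_hcomp[OF pure(2)] by simp
    show ?case
      by (rule proj_sum_homogeneous[OF F_abelian_group, of _ i _ "int (size m) + int d + int i"])
        (use pure_closed[OF pure(1) mon_closed[OF pure(2)]] F_proj_delta[OF pure_hcomp[OF pure(1) m]]
          in \<open>simp_all only: F_simps\<close>)
  next
    case (add x y)
    show ?case
      using proj_sum_add[OF F_abelian_group, of i "F_proj i" x y] add h
      by (simp add: F_simps(1,3))
  next
    case (smult a x)
    obtain S where S: "finite S" "\<And>k. k \<notin> S \<Longrightarrow> F_proj i k x = \<zero>\<^bsub>F i\<^esub>" "x = (\<Oplus>\<^bsub>F i\<^esub>k\<in>S. F_proj i k x)"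
      using smult(3) unfolding proj_sum_def by blast
    have "a \<odot>\<^bsub>TT i\<^esub> x = a \<odot>\<^bsub>TT i\<^esub> (\<Oplus>\<^bsub>TT i\<^esub>k\<in>S. F_proj i k x)"
      using S(3) unfolding same_group_finsum[OF same_group_F] by simp
    also have "\<dots> = (\<Oplus>\<^bsub>TT i\<^esub>k\<in>S. a \<odot>\<^bsub>TT i\<^esub> F_proj i k x)"
      using h(1)[OF smult(2)] by (intro T.finsum_smult_ldistr[OF S(1) smult(1)]) simp
    also have "\<dots> = (\<Oplus>\<^bsub>F i\<^esub>k\<in>S. F_proj i k (a \<odot>\<^bsub>TT i\<^esub> x))"
      unfolding same_group_finsum[OF same_group_F] h(3)[OF smult(1,2)] ..
    finally have e: "a \<odot>\<^bsub>TT i\<^esub> x = (\<Oplus>\<^bsub>F i\<^esub>k\<in>S. F_proj i k (a \<odot>\<^bsub>TT i\<^esub> x))" .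
    have "F_proj i k (a \<odot>\<^bsub>TT i\<^esub> x) = \<zero>\<^bsub>F i\<^esub>" if "k \<notin> S" for k
      unfolding h(3)[OF smult(1,2)] S(2)[OF that] F_simps by (rule T.smult_r_null[OF smult(1)])
    then show ?case
      unfolding proj_sum_def using S(1) e by blast
  qed
  show "p \<odot>\<^bsub>F i\<^esub> x \<in> hcomp (F i) (j + k)" if p: "p \<in> hcomp P j" and x: "x \<in> hcomp (F i) k" for j k p x
  proof (rule module_homs_span_image[OF TT_module TT_module F_smult_hom pure_homogeneous_closed F_hcomp_submodule
        _ x[unfolded F_hcomp]])
    show pc: "p \<in> carrier P" using p by (simp add: hcomp_P)
    fix y assume "y \<in> {pure i u q | u q. u \<in> carrier (U i) \<and> q \<in> hcomp P (k - int d - int i)}"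
    then obtain u q where u: "u \<in> carrier (U i)" and q: "q \<in> hcomp P (k - int d - int i)"
      and y: "y = pure i u q" by blast
    have qc: "q \<in> carrier P" using q by (simp add: hcomp_P)
    have "p \<otimes>\<^bsub>P\<^esub> q \<in> hcomp P (j + k - int d - int i)"
      using hcomp_mult[OF p q] by (simp add: algebra_simps)
    then show "p \<odot>\<^bsub>F i\<^esub> y \<in> hcomp (F i) (j + k)"
      unfolding y F_smult_pure[OF pc u qc] by (rule pure_hcomp[OF u])
  qed
qed

lemma F_class_hcomp:
  assumes "filling i C bs" "q \<in> hcomp P (k - int d - int i)"
  shows "F_class A d n i q (hooktab C bs) \<in> hcomp (F i) k"
  unfolding F_class_eq by (rule pure_hcomp[OF cls_closed[OF assms(1)] assms(2)])

lemma E_hcomp: "filling i C bs \<Longrightarrow> E i C bs \<in> hcomp (F i) (int d + int i)"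
  using mon_hcomp[of "{#}"] by (intro F_class_hcomp) (simp_all add: one_P)

text \<open>Constants have degree 0, so the components of \<open>M\<close> are submodules over
  \<open>A\<close>. It then suffices to follow generators: first the classes of tableaux, then their
  multiples by homogeneous polynomials.\<close>

lemma degree_preservingI:
  assumes M: "graded_module P M" and h: "h \<in> module_homs P (F i) M"
    and deg: "\<And>C bs. filling i C bs \<Longrightarrow> h (E i C bs) \<in> hcomp M (int d + int i)"
  shows "degree_preserving (F i) M h"
  unfolding degree_preserving_def
proof (intro allI image_subsetI)
  fix k x assume x: "x \<in> hcomp (F i) k"
  have MP: "module P M" and gr: "\<And>j k p m. p \<in> hcomp P j \<Longrightarrow> m \<in> hcomp M k \<Longrightarrow> p \<odot>\<^bsub>M\<^esub> m \<in> hcomp M (j + k)"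
    and ad: "\<And>k. additive_subgroup (hcomp M k) M"
    using M unfolding graded_module_def by blast+
  interpret M: module P M by (rule MP)
  have sub: "submodule (hcomp M k) A (res M)" for k
  proof (rule submodule_by_closure[OF res_module[OF MP]])
    show "hcomp M k \<subseteq> carrier (res M)" "\<zero>\<^bsub>res M\<^esub> \<in> hcomp M k"
      using additive_subgroup.a_subset[OF ad] additive_subgroup.zero_closed[OF ad] by (simp_all add: res_simps)
    show "x \<oplus>\<^bsub>res M\<^esub> y \<in> hcomp M k" if "x \<in> hcomp M k" "y \<in> hcomp M k" for x y
      using additive_subgroup.a_closed[OF ad that] by (simp add: res_simps)
    show "a \<odot>\<^bsub>res M\<^esub> x \<in> hcomp M k" if a: "a \<in> carrier A" and x: "x \<in> hcomp M k" for a x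
    proof -
      have "A.indexed_const a \<in> hcomp P 0"
        using const_closed[OF a] by (auto simp: hcomp_P const_eq split: if_splits)
      from gr[OF this x] show ?thesis by (simp add: res_simps)
    qed
  qed
  have gen: "h (pure i u (one P)) \<in> hcomp M (int d + int i)" if u: "u \<in> carrier (U i)" for u
  proof (rule module_homs_span_image[OF U_module res_module[OF MP]
        module_homs_comp[OF pure_hom_left[OF P_one_closed] F_hom_res[OF h]] _ sub _ u[unfolded U_span]])
    show "{cls i C bs | C bs. filling i C bs} \<subseteq> carrier (U i)" using cls_closed by blast
  qed (use deg in \<open>auto simp: F_class_eq\<close>)
  show "h x \<in> hcomp M k"
  proof (rule module_homs_span_image[OF TT_module res_module[OF MP] F_hom_res[OF h]
        pure_homogeneous_closed sub _ x[unfolded F_hcomp]])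
    fix y assume "y \<in> {pure i u q | u q. u \<in> carrier (U i) \<and> q \<in> hcomp P (k - int d - int i)}"
    then obtain u q where u: "u \<in> carrier (U i)" and q: "q \<in> hcomp P (k - int d - int i)"
      and y: "y = pure i u q" by blast
    have qc: "q \<in> carrier P" using q by (simp add: hcomp_P)
    have "y = q \<odot>\<^bsub>F i\<^esub> pure i u (one P)"
      using u qc by (simp add: y F_smult_pure P_one_closed)
    then have "h y = q \<odot>\<^bsub>M\<^esub> h (pure i u (one P))"
      using module_homs_smult[OF h qc] pure_closed[OF u P_one_closed] by (simp add: F_simps(1))
    then show "h y \<in> hcomp M k" using gr[OF q gen[OF u]] by (simp add: algebra_simps)
  qed
qed

end

subsection \<open>Orientations\<close>

text \<open>With letters multiplied in list order in the exterior algebra, this is the coordinate of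
  the monomial of \<open>C\<close> along that of \<open>L\<close>. Lists with repetitions or with
  different letter sets receive 0.\<close>

definition orient :: "nat list \<Rightarrow> nat list \<Rightarrow> int"
  where "orient L C = (if distinct L \<and> distinct C \<and> set L = set C
    then sign (THE p. p permutes set L \<and> map p L = C) else 0)"

lemma orient_zero: "set L \<noteq> set C \<Longrightarrow> orient L C = 0"
  by (simp add: orient_def)

lemma orient_perm:
  assumes "distinct L" "p permutes set L"
  shows "orient L (map p L) = sign p"
proof -
  have "distinct (map p L)" "set (map p L) = set L"
    using assms permutes_inj_on[OF assms(2)] permutes_image[OF assms(2)] by (simp_all add: distinct_map)
  moreover have "(THE q. q permutes set L \<and> map q L = map p L) = p"
  proof (rule the_equality)
    fix q assume q: "q permutes set L \<and> map q L = map p L"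
    show "q = p"
    proof
      fix x
      show "q x = p x"
        using q assms(2) by (cases "x \<in> set L") (auto simp: permutes_not_in)
    qed
  qed (use assms in simp)
  ultimately show ?thesis using assms(1) by (simp add: orient_def)
qed

lemma orient_ex:
  assumes "distinct L" "distinct C" "set L = set C"
  shows "\<exists>p. p permutes set L \<and> map p L = C"
proof -
  have len: "length L = length C" using assms by (metis distinct_card)
  define p where "p x = (case map_of (zip L C) x of Some y \<Rightarrow> y | None \<Rightarrow> x)" for x
  have m: "map p L = C"
    by (rule nth_equalityI) (use len assms(1) in \<open>auto simp: p_def map_of_zip_nth\<close>)
  then have "p ` set L = set L" using assms(3) by (metis set_map)
  moreover have "inj_on p (set L)" using m assms(2) by (metis distinct_map)
  moreover have "p x = x" if "x \<notin> set L" for x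
  proof -
    have "map_of (zip L C) x = None" using that len by (simp add: map_of_zip_is_None)
    then show ?thesis by (simp add: p_def)
  qed
  ultimately have "p permutes set L" by (intro bij_imp_permutes) (auto simp: bij_betw_def)
  then show ?thesis using m by blast
qed

lemma permutes_set_permutation: "p permutes set L \<Longrightarrow> permutation p"
  by (auto simp: permutation_permutes)

lemma orient_map:
  assumes s: "s permutes set C"
  shows "orient L (map s C) = sign s * orient L C"
proof (cases "distinct L \<and> distinct C \<and> set L = set C")
  case True
  then obtain p where p: "p permutes set L" "map p L = C" using orient_ex by blast
  have sL: "s permutes set L" using s True by simp
  have "orient L (map (s \<circ> p) L) = sign (s \<circ> p)"
    using True permutes_compose[OF p(1) sL] by (intro orient_perm) auto
  moreover have "map (s \<circ> p) L = map s C" using p(2) by (metis map_map)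
  moreover have "sign (s \<circ> p) = sign s * sign p"
    by (rule sign_compose[OF permutes_set_permutation[OF sL] permutes_set_permutation[OF p(1)]])
  moreover have "orient L C = sign p" using orient_perm[of L p] True p by metis
  ultimately show ?thesis by metis
next
  case False
  have "set (map s C) = set C" using permutes_image[OF s] by simp
  moreover have "distinct (map s C) = distinct C" using permutes_inj_on[OF s] by (simp add: distinct_map)
  ultimately show ?thesis using False by (auto simp: orient_def)
qed

text \<open>Here both lists are relabelled, which conjugates the permutation and keeps its sign. In
  \<open>orient_map\<close> only the second list changes, and a sign appears.\<close>

lemma orient_rename:
  assumes t: "permutation t"
  shows "orient (map t L) (map t C) = orient L C"
proof (cases "distinct L \<and> distinct C \<and> set L = set C")
  case True
  then obtain p where p: "p permutes set L" "map p L = C" using orient_ex by blast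
  have b: "bij t" using t by (rule permutation_bijective)
  let ?q = "t \<circ> p \<circ> inv_into UNIV t"
  have "map t C = map ?q (map t L)"
    using b by (simp add: p(2)[symmetric] bij_is_inj)
  moreover have "?q permutes set (map t L)" using conj_permutes[OF b p(1)] by simp
  moreover have "distinct (map t L)"
    using True inj_on_subset[OF bij_is_inj[OF b] subset_UNIV] by (simp add: distinct_map)
  ultimately have "orient (map t L) (map t C) = sign ?q" by (metis orient_perm)
  then show ?thesis
    using sign_conj[OF t permutes_set_permutation[OF p(1)]] orient_perm[of L p] True p by simp
next
  case False
  have i: "inj t" using permutation_bijective[OF t] by (rule bij_is_inj)
  have "distinct (map t M) = distinct M" for M
    using inj_on_subset[OF i] by (simp add: distinct_map)
  moreover have "set (map t L) = set (map t C) \<longleftrightarrow> set L = set C"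
    using inj_image_eq_iff[OF i] by simp
  ultimately show ?thesis using False by (auto simp: orient_def)
qed

lemma orient_swap:
  assumes "distinct (xs @ x # y # zs)"
  shows "orient M (xs @ y # x # zs) = - orient M (xs @ x # y # zs)"
proof -
  have "map (transpose x y) xs = xs" "map (transpose x y) zs = zs"
    using assms by (auto intro!: map_idI simp: transpose_def)
  then have "map (transpose x y) (xs @ x # y # zs) = xs @ y # x # zs" by simp
  moreover have "transpose x y permutes set (xs @ x # y # zs)"
    by (intro permutes_swap_id) auto
  moreover have "sign (transpose x y) = - 1" using assms by (simp add: sign_swap_id)
  ultimately show ?thesis using orient_map[of "transpose x y" "xs @ x # y # zs" M] by simp
qed

text \<open>\<open>a\<close> passes the letters of \<open>zs\<close> one at a time, each exchange
  costing a sign.\<close>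

lemma orient_move:
  "distinct (xs @ a # zs) \<Longrightarrow> orient M (xs @ a # zs) = (- 1) ^ length zs * orient M (xs @ zs @ [a])"
proof (induction zs arbitrary: xs)
  case (Cons z zs)
  have "orient M (xs @ a # z # zs) = - orient M ((xs @ [z]) @ a # zs)"
    using orient_swap[of xs z a zs M] Cons.prems by auto
  also have "\<dots> = (- 1) ^ length (z # zs) * orient M (xs @ (z # zs) @ [a])"
    using Cons.IH[of "xs @ [z]"] Cons.prems by auto
  finally show ?case .
qed simp

lemma orient_snoc:
  assumes "a \<notin> set L" "a \<notin> set C"
  shows "orient (L @ [a]) (C @ [a]) = orient L C"
proof (cases "distinct L \<and> distinct C \<and> set L = set C")
  case True
  then obtain p where p: "p permutes set L" "map p L = C" using orient_ex by blast
  have "p permutes set (L @ [a])" using p(1) by (rule permutes_subset) auto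
  moreover have "map p (L @ [a]) = C @ [a]" using p assms by (simp add: permutes_not_in)
  ultimately have "orient (L @ [a]) (C @ [a]) = sign p"
    using orient_perm[of "L @ [a]" p] True assms by simp
  then show ?thesis using orient_perm[of L p] True p by simp
next
  case False
  then show ?thesis using assms by (auto simp: orient_def)
qed

lemma orient_self: "distinct L \<Longrightarrow> orient L L = 1"
  using orient_perm[of L id] by (simp add: permutes_id)

text \<open>Replacing an entry by a fresh letter becomes a relabelling by a transposition, to which
  the sign rules for \<open>orient\<close> apply.\<close>

lemma list_update_transpose:
  assumes "distinct C" "b \<notin> set C" "r < length C"
  shows "C[r := b] = map (transpose (C ! r) b) C"
proof (rule nth_equalityI)
  fix k assume "k < length (C[r := b])"
  then have k: "k < length C" by simp
  have "C ! k \<noteq> b" using k assms(2) nth_mem by metis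
  then show "C[r := b] ! k = map (transpose (C ! r) b) C ! k"
    using k assms nth_eq_iff_index_eq[OF assms(1) assms(3) k]
    by (cases "k = r") (auto simp: transpose_apply_other)
qed simp

lemma set_map_transpose:
  assumes "z \<in> set C" "b \<notin> set C"
  shows "set (map (transpose z b) C) = insert b (set C - {z})"
proof -
  have "transpose z b x = (if x = z then b else x)" if "x \<in> set C" for x
    using that assms by (auto simp: transpose_def)
  then have "set (map (transpose z b) C) = (\<lambda>x. if x = z then b else x) ` set C"
    by (simp add: image_def)
  then show ?thesis using assms(1) by auto
qed

text \<open>If \<open>b\<close> belongs to \<open>u\<close> the terms on both sides match after renaming; if \<open>b\<close> belongs
  to \<open>R\<close> the left side vanishes and the terms on the right cancel in pairs.\<close>

lemma orient_shuffle:
  assumes u: "finite u" and R: "distinct R" "u \<inter> set R = {}"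
    and C: "distinct C" and b: "b \<notin> set C" and sub: "insert b (set C) \<subseteq> u \<union> set R"
  shows "(\<Sum>y\<in>u. orient (y # R) C) = (\<Sum>r<length C. \<Sum>y\<in>u. orient (y # R) (C[r := b]))"
proof -
  define h where "h z y = orient (y # R) (map (transpose z b) C)" for z y
  have "(\<Sum>r<length C. \<Sum>y\<in>u. orient (y # R) (C[r := b])) = (\<Sum>r<length C. \<Sum>y\<in>u. h (C ! r) y)"
    using list_update_transpose[OF C b] by (intro sum.cong) (auto simp: h_def)
  also have "\<dots> = (\<Sum>z\<in>set C. \<Sum>y\<in>u. h z y)"
    using C by (intro sum.reindex_bij_betw bij_betw_nth) auto
  finally have rhs: "(\<Sum>r<length C. \<Sum>y\<in>u. orient (y # R) (C[r := b])) = (\<Sum>z\<in>set C. \<Sum>y\<in>u. h z y)" .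
  have hset: "insert b (set C - {z}) = insert y (set R)" if "h z y \<noteq> 0" "z \<in> set C" for z y
    using that set_map_transpose[OF that(2) b] orient_zero[of "y # R" "map (transpose z b) C"]
    by (auto simp: h_def)
  show ?thesis
  proof (cases "b \<in> u")
    case True
    then have bR: "b \<notin> set R" using R(2) by auto
    have "(\<Sum>y\<in>u. h z y) = (if z \<in> u then orient (z # R) C else 0)" if z: "z \<in> set C" for z
    proof -
      have "h z y = 0" if "y \<noteq> b" for y
        using hset[OF _ z, of y] that bR by (cases "h z y = 0") auto
      then have "(\<Sum>y\<in>u. h z y) = (\<Sum>y\<in>{b}. h z y)"
        using True u by (intro sum.mono_neutral_right) auto
      moreover have "h z b = (if z \<in> u then orient (z # R) C else 0)"
      proof (cases "z \<in> u")
        case True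
        then have "z \<notin> set R" using R(2) by auto
        then have "map (transpose z b) (z # R) = b # R"
          using bR by (auto intro!: map_idI simp: transpose_def)
        then show ?thesis
          using True orient_rename[OF permutation_swap_id, of z b "z # R" C] by (simp add: h_def)
      next
        case False
        then have "z \<in> set R" "z \<noteq> b" using sub z b by auto
        then show ?thesis using hset[OF _ z, of b] False bR by (cases "h z b = 0") auto
      qed
      ultimately show ?thesis by simp
    qed
    then have "(\<Sum>z\<in>set C. \<Sum>y\<in>u. h z y) = (\<Sum>z\<in>set C. if z \<in> u then orient (z # R) C else 0)"
      by (intro sum.cong) auto
    also have "\<dots> = (\<Sum>z\<in>set C \<inter> u. orient (z # R) C)"
      by (simp add: sum.inter_restrict)
    also have "\<dots> = (\<Sum>y\<in>u. orient (y # R) C)"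
    proof (intro sum.mono_neutral_left u ballI)
      show "orient (y # R) C = 0" if "y \<in> u - set C \<inter> u" for y
        using that by (intro orient_zero) auto
    qed auto
    finally show ?thesis using rhs by simp
  next
    case False
    then have bR: "b \<in> set R" using sub by auto
    have lhs: "(\<Sum>y\<in>u. orient (y # R) C) = 0"
      using b bR by (intro sum.neutral) (auto intro!: orient_zero)
    let ?X = "set C \<inter> u"
    \<comment> \<open>For a nonzero term the replaced letter \<open>z\<close> cannot belong to
      \<open>R\<close>, since it has disappeared from the column, and \<open>y\<close> must still be
      present in the column, where only \<open>b\<close> is new. So both lie in \<open>?X\<close>,
      and they differ.\<close>
    have zu: "z \<in> u \<and> y \<in> set C \<and> z \<noteq> y" if "h z y \<noteq> 0" "z \<in> set C" "y \<in> u" for z y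
      using hset[OF that(1,2)] sub that(2,3) b False R(2) by auto
    have "(\<Sum>z\<in>set C. \<Sum>y\<in>u. h z y) = (\<Sum>z\<in>?X. \<Sum>y\<in>?X. h z y)"
    proof -
      have "(\<Sum>y\<in>u. h z y) = (\<Sum>y\<in>?X. h z y)" if "z \<in> set C" for z
        using zu[OF _ that] u by (intro sum.mono_neutral_right) auto
      then have "(\<Sum>z\<in>set C. \<Sum>y\<in>u. h z y) = (\<Sum>z\<in>set C. \<Sum>y\<in>?X. h z y)"
        by (rule sum.cong[OF refl])
      also have "\<dots> = (\<Sum>z\<in>?X. \<Sum>y\<in>?X. h z y)"
        using zu by (intro sum.mono_neutral_right) (auto intro!: sum.neutral)
      finally show ?thesis .
    qed
    also have "\<dots> = (\<Sum>y\<in>?X. \<Sum>z\<in>?X. h z y)" by (rule sum.swap)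
    also have "\<dots> = (\<Sum>y\<in>?X. \<Sum>z\<in>?X. - h y z)"
    proof (intro sum.cong refl)
      fix y z assume y: "y \<in> ?X" and z: "z \<in> ?X"
      show "h z y = - h y z"
      proof (cases "y = z")
        case True
        have "h z z = 0" using zu[of z z] z by auto
        then show ?thesis using True by simp
      next
        case False
        have yb: "y \<noteq> b" "z \<noteq> b" using y z b by auto
        have yR: "y \<notin> set R" "z \<notin> set R" using y z R(2) by auto
        let ?Cz = "map (transpose z b) C" and ?s = "transpose b y" and ?t = "transpose y z"
        have zC: "z \<in> set C" using z by simp
        have "set ?Cz = insert b (set C - {z})" by (rule set_map_transpose[OF zC b])
        then have "?s permutes set ?Cz" using y False by (intro permutes_swap_id) auto
        then have 1: "orient (y # R) (map ?s ?Cz) = - h z y"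
          using orient_map[of ?s ?Cz "y # R"] yb by (simp add: h_def sign_swap_id)
        have a: "map ?t (y # R) = z # R"
          using yR by (auto intro!: map_idI simp: transpose_def)
        have c: "map ?t (map ?s ?Cz) = map (transpose y b) C"
        proof -
          have "?t (?s (transpose z b x)) = transpose y b x" if "x \<in> set C" for x
            using that b yb False by (auto simp: transpose_def)
          then show ?thesis by simp
        qed
        have "orient (z # R) (map (transpose y b) C) = orient (y # R) (map ?s ?Cz)"
          using orient_rename[OF permutation_swap_id, of y z "y # R" "map ?s ?Cz"] unfolding a c .
        then show ?thesis using 1 by (simp add: h_def)
      qed
    qed
    also have "\<dots> = - (\<Sum>z\<in>?X. \<Sum>y\<in>?X. h z y)" by (simp add: sum_negf)
    \<comment> \<open>The double sum equals its own negative and hence vanishes, because it is an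
      integer. The same inference in \<open>A\<close> would fail in the presence of 2-torsion, which
      is one reason for keeping all coefficients integral.\<close>
    finally have "(\<Sum>z\<in>?X. \<Sum>y\<in>?X. h z y) = - (\<Sum>z\<in>?X. \<Sum>y\<in>?X. h z y)" 
      and "(\<Sum>z\<in>set C. \<Sum>y\<in>u. h z y) = - (\<Sum>z\<in>?X. \<Sum>y\<in>?X. h z y)"
      using \<open>(\<Sum>z\<in>set C. \<Sum>y\<in>u. h z y) = (\<Sum>z\<in>?X. \<Sum>y\<in>?X. h z y)\<close> by simp_all
    then show ?thesis using rhs lhs by linarith
  qed
qed

text \<open>With coordinate forms of letters multiplied in list order, this evaluates on the
  monomial of \<open>C\<close> the form (sum over \<open>u\<close>) wedge (form of
  \<open>R\<close>). On W = \<open>u \<union> set R\<close> the first factor may be replaced by w,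
  the sum over all of W, as a repeated letter of \<open>R\<close> gives zero. Such a form kills
  contractions by w because w wedge w is zero. The condition on the letters selects the summand
  belonging to W.\<close>

definition coef :: "nat set \<Rightarrow> nat list \<Rightarrow> nat list \<Rightarrow> nat list \<Rightarrow> int"
  where "coef u R C bs = (if set C \<union> set bs = u \<union> set R then \<Sum>y\<in>u. orient (y # R) C else 0)"

text \<open>The integer form of \<open>hook_relations\<close>: a single function of this kind can be
  used in every abelian group, through integer multiples of a fixed element.\<close>

definition int_hook_relations :: "nat \<Rightarrow> nat \<Rightarrow> nat \<Rightarrow> (nat list \<Rightarrow> nat list \<Rightarrow> int) \<Rightarrow> bool"
  where "int_hook_relations d n i f \<longleftrightarrow> (\<forall>C bs. hook_filling d n i C bs \<longrightarrow>
    (\<forall>s. s permutes set C \<longrightarrow> f (map s C) bs = sign s * f C bs) \<and>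
    (\<forall>ps x y l. bs = ps @ x # y # l \<longrightarrow> f C (ps @ y # x # l) = f C bs) \<and>
    (\<forall>b l. bs = b # l \<longrightarrow> f C bs = (\<Sum>r<length C. f (C[r := b]) (C ! r # l))))"

text \<open>Alternation is inherited from \<open>orient\<close>, exchanges inside the row do not
  change the set of letters, and the shuffle is \<open>orient_shuffle\<close>, applicable because a
  shuffle preserves the letters of the whole filling.\<close>

lemma coef_relations:
  assumes "finite u" "distinct R" "u \<inter> set R = {}"
  shows "int_hook_relations d n i (coef u R)"
  unfolding int_hook_relations_def
proof (intro allI impI conjI)
  fix C bs assume v: "hook_filling d n i C bs"
  {
    fix s assume s: "s permutes set C"
    show "coef u R (map s C) bs = sign s * coef u R C bs"
      using orient_map[OF s] permutes_image[OF s] by (simp add: coef_def sum_distrib_left)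
  }
  {
    fix ps x y l assume "bs = ps @ x # y # l"
    then have "set (ps @ y # x # l) = set bs" by auto
    then show "coef u R C (ps @ y # x # l) = coef u R C bs" unfolding coef_def by simp
  }
  {
    fix b l assume bs: "bs = b # l"
    have eq: "set (C[r := b]) \<union> set (C ! r # l) = set C \<union> set bs" if "r < length C" for r
    proof -
      have "mset (C[r := b] @ C ! r # l) = mset (C @ bs)"
        using that nth_mem_mset[OF that] by (simp add: bs mset_update)
      then show ?thesis by (metis mset_eq_setD set_append)
    qed
    show "coef u R C bs = (\<Sum>r<length C. coef u R (C[r := b]) (C ! r # l))"
    proof (cases "set C \<union> set bs = u \<union> set R")
      case True
      have "(\<Sum>r<length C. coef u R (C[r := b]) (C ! r # l)) = (\<Sum>r<length C. \<Sum>y\<in>u. orient (y # R) (C[r := b]))"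
        using eq True by (intro sum.cong refl) (simp only: coef_def lessThan_iff simp_thms if_True)
      then show ?thesis
        using orient_shuffle[OF assms, of C b] v True by (auto simp: coef_def bs hook_filling_def)
    next
      case False
      then have "(\<Sum>r<length C. coef u R (C[r := b]) (C ! r # l)) = 0"
        using eq by (intro sum.neutral ballI) (simp only: coef_def lessThan_iff simp_thms if_False)
      then show ?thesis using False by (simp add: coef_def)
    qed
  }
qed

text \<open>This matches the sign of the differential: a removed letter has as many signs as there
  are letters below it in the column, and they disappear when it is appended at the end of
  \<open>R\<close>.\<close>

lemma coef_snoc:
  assumes "distinct (xs @ a # zs)" "a \<notin> set bs" "a \<notin> u" "a \<notin> set R"
  shows "coef u (R @ [a]) (xs @ a # zs) bs = (- 1) ^ length zs * coef u R (xs @ zs) bs"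
proof -
  have "orient (y # R @ [a]) (xs @ a # zs) = (- 1) ^ length zs * orient (y # R) (xs @ zs)" if "y \<in> u" for y
    using orient_move[OF assms(1), of "y # R @ [a]"] orient_snoc[of a "y # R" "xs @ zs"] assms that by auto
  moreover have "set (xs @ a # zs) \<union> set bs = u \<union> set (R @ [a]) \<longleftrightarrow> set (xs @ zs) \<union> set bs = u \<union> set R"
    using assms by auto
  ultimately show ?thesis by (simp add: coef_def sum_distrib_left)
qed

abbreviation "srt \<equiv> sorted_list_of_set"

context hooks
begin

text \<open>The ring as a module over itself. The scalar field of \<open>poly_ring\<close> is
  occupied by the action of \<open>A\<close>, hence the separate record.\<close>

definition PP :: "(nat multiset \<Rightarrow> 'a, nat multiset \<Rightarrow> 'a) module"
  where "PP = \<lparr>carrier = carrier P, monoid.mult = undefined, one = undefined, zero = zero P,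
    add = add P, smult = monoid.mult P\<rparr>"

lemma PP_simps: "carrier PP = carrier P" "zero PP = zero P" "add PP = add P" "smult PP = monoid.mult P"
  by (simp_all add: PP_def)

lemma same_group_PP: "same_group PP P"
  by (simp add: same_group_def PP_simps)

lemma PP_module: "module P PP"
  by (intro moduleI P_cring same_group_abelian_group[OF P.abelian_group_axioms same_group_PP])
    (simp_all add: PP_simps P.l_distr P.r_distr P.m_assoc)

subsection \<open>Standard hook tableaux form a basis\<close>

text \<open>A standard hook tableau on the set \<open>W = u \<union> S\<close> is encoded by the pair \<open>(u, S)\<close>: the corner
  is \<open>Min u = Min W\<close>, the rest of the first column is \<open>S\<close> and the rest of the first row is
  \<open>u - {Min u}\<close>. These pairs also index the symbols of the Eliahou-Kervaire resolution, with
  \<open>u\<close> standing for a generator.\<close>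

definition idx :: "nat \<Rightarrow> (nat set \<times> nat set) set"
  where "idx i = {(u, S). u \<subseteq> {1..n} \<and> S \<subseteq> {1..n} \<and> u \<inter> S = {} \<and> card u = d \<and> card S = i \<and>
    (\<forall>s\<in>S. Min u < s)}"

definition bcol :: "nat set \<Rightarrow> nat set \<Rightarrow> nat list" where "bcol u S = Min u # srt S"
definition brow :: "nat set \<Rightarrow> nat list" where "brow u = srt (u - {Min u})"

lemma finite_idx: "finite (idx i)"
  by (rule finite_subset[of _ "Pow {1..n} \<times> Pow {1..n}"]) (auto simp: idx_def)

lemma idxD:
  assumes "(u, S) \<in> idx i"
  shows "finite u" "finite S" "u \<noteq> {}" "Min u \<in> u" "Min u \<notin> S" "u \<inter> S = {}"
    "u \<subseteq> {1..n}" "S \<subseteq> {1..n}" "card u = d" "card S = i" "\<And>s. s \<in> S \<Longrightarrow> Min u < s"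
proof -
  show "u \<subseteq> {1..n}" "S \<subseteq> {1..n}" "u \<inter> S = {}" "card u = d" "card S = i" "\<And>s. s \<in> S \<Longrightarrow> Min u < s"
    using assms by (auto simp: idx_def)
  then show "finite u" "finite S" "u \<noteq> {}" using d finite_subset[OF _ finite_atLeastAtMost] by auto
  then show "Min u \<in> u" by simp
  then show "Min u \<notin> S" using \<open>u \<inter> S = {}\<close> by auto
qed

lemma filling_basis:
  assumes "(u, S) \<in> idx i" shows "filling i (bcol u S) (brow u)"
proof -
  note D = idxD[OF assms]
  have "Suc (card (u - {Min u})) = d" using D(1,4,9) by (metis card_Suc_Diff1)
  moreover have "Min u \<in> {1..n}" "u - {Min u} \<subseteq> {1..n}" using D(4,7) by blast+
  moreover have "distinct (bcol u S @ brow u)"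
    using D(1,2,5,6) by (auto simp: bcol_def brow_def)
  ultimately show ?thesis
    using D(1,2,8,10) unfolding hook_filling_def
    by (simp add: bcol_def brow_def del: One_nat_def)
qed

lemma set_basis:
  assumes "(u, S) \<in> idx i" shows "set (bcol u S) \<union> set (brow u) = u \<union> S"
proof -
  have "set (bcol u S) \<union> set (brow u) = insert (Min u) S \<union> (u - {Min u})"
    using idxD(1,2)[OF assms] by (simp add: bcol_def brow_def)
  also have "\<dots> = u \<union> S" using idxD(4)[OF assms] by blast
  finally show ?thesis .
qed

definition lam :: "nat set \<Rightarrow> nat set \<Rightarrow> nat list \<Rightarrow> nat list \<Rightarrow> int"
  where "lam u S = coef u (srt S)"

text \<open>The functionals are dual to the standard tableaux. For a nonzero value both pairs have
  the same union W, whose minimum is the corner on either side. That minimum is not in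
  \<open>S\<close>, so it can only be the summation letter \<open>y\<close>; then
  \<open>S = S'\<close>, and the unions give \<open>u = u'\<close>.\<close>

lemma lam_basis:
  assumes "(u, S) \<in> idx i" "(u', S') \<in> idx i"
  shows "lam u S (bcol u' S') (brow u') = (if u = u' \<and> S = S' then 1 else 0)"
proof -
  note D = idxD[OF assms(1)] and D' = idxD[OF assms(2)]
  note W' = set_basis[OF assms(2)]
  have or0: "orient (y # srt S) (bcol u' S') = 0" if "insert y S \<noteq> insert (Min u') S'" for y
    using that D D' by (intro orient_zero) (simp add: bcol_def)
  have key: "y = Min u' \<and> S = S' \<and> u = u'"
    if W: "u \<union> S = u' \<union> S'" and y: "y \<in> u" "insert y S = insert (Min u') S'" for y
  proof -
    have "Min (u \<union> S) = Min u"
      using D by (intro Min_eqI) (auto simp: Min_le less_imp_le)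
    moreover have "Min (u' \<union> S') = Min u'"
      using D' by (intro Min_eqI) (auto simp: Min_le less_imp_le)
    ultimately have m: "Min u = Min u'" using W by simp
    then have "Min u' \<notin> S" using D by simp
    then have "y = Min u'" using y(2) by auto
    moreover have "S = S'" using y(2) \<open>Min u' \<notin> S\<close> D'(5) unfolding \<open>y = Min u'\<close> by (rule insert_ident[THEN iffD1, rotated 2])
    moreover have "u = u'" using W D(6) D'(6) unfolding \<open>S = S'\<close> by auto
    ultimately show ?thesis by simp
  qed
  show ?thesis
  proof (cases "u = u' \<and> S = S'")
    case True
    have "(\<Sum>y\<in>u. orient (y # srt S) (bcol u' S')) = (\<Sum>y\<in>{Min u}. orient (y # srt S) (bcol u' S'))"
      using D key[of "_"] True or0 by (intro sum.mono_neutral_right) (auto, blast)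
    also have "\<dots> = 1"
      using True D by (simp add: bcol_def orient_self)
    finally show ?thesis using True W' D by (simp add: lam_def coef_def)
  next
    case False
    then have "(\<Sum>y\<in>u. orient (y # srt S) (bcol u' S')) = 0" if "u \<union> S = u' \<union> S'"
      using key[OF that] or0 by (intro sum.neutral) blast
    then show ?thesis using False W' D by (auto simp: lam_def coef_def)
  qed
qed

lemma lam_relations: "(u, S) \<in> idx j \<Longrightarrow> int_hook_relations d n i (lam u S)"
  unfolding lam_def using idxD[of u S j] by (intro coef_relations) auto

text \<open>Integer multiples of a fixed \<open>x\<close> turn integer relations into relations in
  \<open>M\<close>, whatever the characteristic.\<close>

lemma add_pow_relations:
  assumes M: "abelian_group M" and x: "x \<in> carrier M" and f: "int_hook_relations d n i f"
  shows "hook_relations d n i M (\<lambda>C bs. add_pow M (f C bs) x)"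
proof -
  interpret M: abelian_group M by (rule M)
  have sum: "add_pow M (sum h I) x = (\<Oplus>\<^bsub>M\<^esub>r\<in>I. add_pow M (h r) x)" for h :: "nat \<Rightarrow> int" and I
  proof (induction I rule: infinite_finite_induct)
    case (insert r I)
    then show ?case
      using x M.add.int_pow_closed by (subst M.finsum_insert) (auto simp: M.add.int_pow_mult)
  qed (simp_all add: add_pow_def)
  show ?thesis
  proof (rule hook_relationsI)
    fix C bs s assume "filling i C bs" "s permutes set C"
    then have "f (map s C) bs = sign s * f C bs" using f unfolding int_hook_relations_def by blast
    then show "add_pow M (f (map s C) bs) x = add_pow M (sign s) (add_pow M (f C bs) x)"
      using x by (simp add: M.add.int_pow_pow mult.commute)
  next
    fix C b l assume "filling i C (b # l)"
    then have "f C (b # l) = (\<Sum>r<length C. f (C[r := b]) (C ! r # l))"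
      using f unfolding int_hook_relations_def by blast
    then show "add_pow M (f C (b # l)) x = (\<Oplus>\<^bsub>M\<^esub>r\<in>{..<length C}. add_pow M (f (C[r := b]) (C ! r # l)) x)"
      using sum by simp
  next
    fix C ps a b l assume "filling i C (ps @ a # b # l)"
    then have "f C (ps @ b # a # l) = f C (ps @ a # b # l)"
      using f unfolding int_hook_relations_def by blast
    then show "add_pow M (f C (ps @ b # a # l)) x = add_pow M (f C (ps @ a # b # l)) x" by simp
  qed (rule M.add.int_pow_closed[OF x])
qed

definition iota :: "int \<Rightarrow> nat multiset \<Rightarrow> 'a" where "iota k = add_pow P k (one P)"

lemma iota_0: "iota 0 = zero P" and iota_1: "iota 1 = one P"
  using P_one_closed P.add.int_pow_1[of "one P"] by (simp_all add: iota_def) (simp add: add_pow_def)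

lemma hook_relations_same_group:
  "same_group M' M \<Longrightarrow> hook_relations d n i M' g \<longleftrightarrow> hook_relations d n i M g"
  unfolding hook_relations_def by (simp only: same_group_finsum same_group_add_pow) (simp add: same_group_def)

lemma kap_ex:
  assumes "(u, S) \<in> idx j"
  shows "\<exists>h\<in>module_homs P (F i) PP. \<forall>C bs. filling i C bs \<longrightarrow> h (E i C bs) = iota (lam u S C bs)"
  unfolding iota_def
  using add_pow_relations[OF P.abelian_group_axioms P_one_closed lam_relations[OF assms]]
  by (intro F_lift[OF PP_module]) (simp add: hook_relations_same_group[OF same_group_PP])

text \<open>The coordinate at \<open>p\<close>, extended linearly over \<open>R_n\<close>.
  \<open>F_lift\<close> only asserts existence, hence \<open>SOME\<close>; by
  \<open>F_homs_eq\<close> the values on the carrier do not depend on the choice.\<close>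

definition kap :: "nat \<Rightarrow> nat set \<times> nat set \<Rightarrow>
    ((nat list list \<Rightarrow> 'a) set \<times> (nat multiset \<Rightarrow> 'a) \<Rightarrow> 'a) set \<Rightarrow> nat multiset \<Rightarrow> 'a"
  where "kap i p = (SOME h. h \<in> module_homs P (F i) PP \<and>
    (\<forall>C bs. filling i C bs \<longrightarrow> h (E i C bs) = iota (lam (fst p) (snd p) C bs)))"

lemma
  assumes "p \<in> idx j"
  shows kap_hom: "kap i p \<in> module_homs P (F i) PP"
    and kap_E: "filling i C bs \<Longrightarrow> kap i p (E i C bs) = iota (lam (fst p) (snd p) C bs)"
proof -
  have "(fst p, snd p) \<in> idx j" using assms by simp
  from kap_ex[OF this, of i] have "kap i p \<in> module_homs P (F i) PP \<and>
    (\<forall>C bs. filling i C bs \<longrightarrow> kap i p (E i C bs) = iota (lam (fst p) (snd p) C bs))"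
    unfolding kap_def by (intro someI_ex[of "\<lambda>h. h \<in> module_homs P (F i) PP \<and> _ h"]) blast
  then show "kap i p \<in> module_homs P (F i) PP"
    "filling i C bs \<Longrightarrow> kap i p (E i C bs) = iota (lam (fst p) (snd p) C bs)" by auto
qed

definition bas :: "nat \<Rightarrow> nat set \<times> nat set \<Rightarrow> ((nat list list \<Rightarrow> 'a) set \<times> (nat multiset \<Rightarrow> 'a) \<Rightarrow> 'a) set"
  where "bas i p = E i (bcol (fst p) (snd p)) (brow (fst p))"

lemma bas_closed: "p \<in> idx i \<Longrightarrow> bas i p \<in> carrier (F i)"
  unfolding bas_def by (rule E_closed[OF filling_basis]) simp

lemma kap_closed: "p \<in> idx j \<Longrightarrow> x \<in> carrier (F i) \<Longrightarrow> kap i p x \<in> carrier P"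
  using module_homs_closed[OF kap_hom] by (simp add: PP_simps)

lemma kap_add: "p \<in> idx j \<Longrightarrow> x \<in> carrier (F i) \<Longrightarrow> y \<in> carrier (F i) \<Longrightarrow>
    kap i p (x \<oplus>\<^bsub>F i\<^esub> y) = kap i p x \<oplus>\<^bsub>P\<^esub> kap i p y"
  using module_homs_add[OF kap_hom] by (simp add: PP_simps)

lemma kap_smult: "p \<in> idx j \<Longrightarrow> q \<in> carrier P \<Longrightarrow> x \<in> carrier (F i) \<Longrightarrow>
    kap i p (q \<odot>\<^bsub>F i\<^esub> x) = q \<otimes>\<^bsub>P\<^esub> kap i p x"
  using module_homs_smult[OF kap_hom] by (simp add: PP_simps)

lemma kap_zero: "p \<in> idx j \<Longrightarrow> kap i p (zero (F i)) = zero P"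
  using module_homs_zero[OF F_module PP_module kap_hom] by (simp add: PP_simps)

lemma kap_finsum: "p \<in> idx j \<Longrightarrow> f \<in> I \<rightarrow> carrier (F i) \<Longrightarrow>
    kap i p (\<Oplus>\<^bsub>F i\<^esub>k\<in>I. f k) = (\<Oplus>\<^bsub>P\<^esub>k\<in>I. kap i p (f k))"
  using module_homs_finsum[OF F_module PP_module kap_hom] by (simp add: same_group_finsum[OF same_group_PP])

lemma kap_bas:
  assumes "p \<in> idx i" "q \<in> idx i"
  shows "kap i p (bas i q) = (if p = q then one P else zero P)"
proof -
  have pq: "(fst p, snd p) \<in> idx i" "(fst q, snd q) \<in> idx i" using assms by simp_all
  have "kap i p (bas i q) = iota (lam (fst p) (snd p) (bcol (fst q) (snd q)) (brow (fst q)))"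
    unfolding bas_def by (rule kap_E[OF assms(1) filling_basis[OF pq(2)]])
  then show ?thesis
    using lam_basis[OF pq] by (auto simp: iota_0 iota_1 prod_eq_iff)
qed

text \<open>That the standard tableaux span is expressed by this map being the identity. The
  condition is linear over \<open>R_n\<close>, so it has to be checked only on classes of
  fillings.\<close>

definition expansion :: "nat \<Rightarrow> ((nat list list \<Rightarrow> 'a) set \<times> (nat multiset \<Rightarrow> 'a) \<Rightarrow> 'a) set \<Rightarrow>
    ((nat list list \<Rightarrow> 'a) set \<times> (nat multiset \<Rightarrow> 'a) \<Rightarrow> 'a) set"
  where "expansion i x = (\<Oplus>\<^bsub>F i\<^esub>p\<in>idx i. kap i p x \<odot>\<^bsub>F i\<^esub> bas i p)"

lemma expansion_hom: "expansion i \<in> module_homs P (F i) (F i)"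
proof (rule module_homsI)
  interpret M: module P "F i" by (rule F_module)
  have t: "kap i p x \<odot>\<^bsub>F i\<^esub> bas i p \<in> carrier (F i)" if "p \<in> idx i" "x \<in> carrier (F i)" for p x
    using that by (intro M.smult_closed kap_closed bas_closed)
  show "expansion i x \<in> carrier (F i)" if "x \<in> carrier (F i)" for x
    unfolding expansion_def using t[OF _ that] by (intro M.finsum_closed) simp
  show "expansion i (x \<oplus>\<^bsub>F i\<^esub> y) = expansion i x \<oplus>\<^bsub>F i\<^esub> expansion i y"
    if x: "x \<in> carrier (F i)" and y: "y \<in> carrier (F i)" for x y
  proof -
    have "expansion i (x \<oplus>\<^bsub>F i\<^esub> y) =
        (\<Oplus>\<^bsub>F i\<^esub>p\<in>idx i. kap i p x \<odot>\<^bsub>F i\<^esub> bas i p \<oplus>\<^bsub>F i\<^esub> kap i p y \<odot>\<^bsub>F i\<^esub> bas i p)"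
      unfolding expansion_def using x y t
      by (intro M.finsum_cong') (simp_all add: kap_add kap_closed bas_closed M.smult_l_distr)
    then show ?thesis
      unfolding expansion_def using t[OF _ x] t[OF _ y] by (subst (asm) M.finsum_addf) auto
  qed
  show "expansion i (q \<odot>\<^bsub>F i\<^esub> x) = q \<odot>\<^bsub>F i\<^esub> expansion i x"
    if q: "q \<in> carrier P" and x: "x \<in> carrier (F i)" for q x
  proof -
    have "expansion i (q \<odot>\<^bsub>F i\<^esub> x) = (\<Oplus>\<^bsub>F i\<^esub>p\<in>idx i. q \<odot>\<^bsub>F i\<^esub> (kap i p x \<odot>\<^bsub>F i\<^esub> bas i p))"
      unfolding expansion_def using q x t
      by (intro M.finsum_cong') (simp_all add: kap_smult kap_closed bas_closed M.smult_assoc1)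
    then show ?thesis
      unfolding expansion_def using t[OF _ x] by (simp add: M.finsum_smult_ldistr[OF finite_idx q])
  qed
qed

definition expandable :: "nat \<Rightarrow> ((nat list list \<Rightarrow> 'a) set \<times> (nat multiset \<Rightarrow> 'a) \<Rightarrow> 'a) set set"
  where "expandable i = {x \<in> carrier (F i). expansion i x = x}"

lemma expandable_submodule: "submodule (expandable i) P (F i)"
proof -
  interpret M: module P "F i" by (rule F_module)
  show ?thesis
    by (rule submodule_by_closure[OF F_module])
      (auto simp: expandable_def module_homsD[OF expansion_hom] module_homs_zero[OF F_module F_module expansion_hom])
qed

lemma expandable_bas:
  assumes q: "q \<in> idx i" shows "bas i q \<in> expandable i"
proof -
  interpret M: module P "F i" by (rule F_module)
  have "expansion i (bas i q) = (\<Oplus>\<^bsub>F i\<^esub>p\<in>idx i. if q = p then bas i p else \<zero>\<^bsub>F i\<^esub>)"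
    unfolding expansion_def using bas_closed
    by (intro M.finsum_cong') (auto simp: kap_bas q)
  also have "\<dots> = bas i q"
    using bas_closed by (intro M.finsum_singleton[OF q finite_idx]) simp
  finally show ?thesis using bas_closed[OF q] by (simp add: expandable_def)
qed

lemma expandable_add_pow:
  assumes "x \<in> expandable i" shows "add_pow (F i) (k :: int) x \<in> expandable i"
proof -
  interpret M: module P "F i" by (rule F_module)
  have "x \<in> carrier (F i)" "expansion i x = x" using assms by (auto simp: expandable_def)
  then show ?thesis
    using module_homs_add_pow[OF F_module F_module expansion_hom, of x i k] M.add.int_pow_closed[of x k]
    by (simp add: expandable_def)
qed

lemma E_row_move:
  assumes "filling i C (ps @ qs @ x # rs)"
  shows "E i C (ps @ qs @ x # rs) = E i C (ps @ x # qs @ rs)"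
  using assms
proof (induction qs arbitrary: rs rule: rev_induct)
  case (snoc y qs)
  have v: "filling i C ((ps @ qs) @ y # x # rs)" using snoc.prems by simp
  have "E i C ((ps @ qs) @ y # x # rs) = E i C ((ps @ qs) @ x # y # rs)"
    using hook_relations_swap[OF E_relations v] by simp
  also have "\<dots> = E i C (ps @ x # qs @ y # rs)"
    using snoc.IH[of "y # rs"] swap_step[OF v] by simp
  finally show ?case by simp
qed simp

lemma E_row_perm:
  assumes "filling i C (ps @ xs)" "mset xs = mset ys"
  shows "E i C (ps @ xs) = E i C (ps @ ys)"
  using assms
proof (induction xs arbitrary: ps ys)
  case (Cons x xs)
  then have "x \<in> set ys" by (metis list.set_intros(1) mset_eq_setD)
  then obtain y1 y2 where ys: "ys = y1 @ x # y2" by (meson split_list)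
  have m: "mset xs = mset (y1 @ y2)" using Cons.prems(2) by (simp add: ys)
  have "mset (ps @ y1 @ x # y2) = mset (ps @ x # xs)" using m by simp
  then have v: "filling i C (ps @ y1 @ x # y2)"
    using Cons.prems(1) unfolding hook_filling_def
    by (metis (no_types, lifting) append.assoc mset_append mset_eq_imp_distinct_iff mset_eq_setD size_mset)
  have "E i C (ps @ x # xs) = E i C ((ps @ [x]) @ y1 @ y2)"
    using Cons.IH[of "ps @ [x]" "y1 @ y2"] Cons.prems(1) m by simp
  also have "\<dots> = E i C (ps @ y1 @ x # y2)" using E_row_move[OF v] by simp
  finally show ?case by (simp add: ys)
qed simp

lemma expandable_col_perm:
  assumes v: "filling i C bs" and e: "E i (srt (set C)) bs \<in> expandable i"
  shows "E i C bs \<in> expandable i"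
proof -
  have C: "distinct C" using v by (simp add: hook_filling_def)
  obtain p where p: "p permutes set (srt (set C))" "map p (srt (set C)) = C"
    using orient_ex[of "srt (set C)" C] C by auto
  have "length (srt (set C)) = length C" using C by (simp add: distinct_card)
  then have v': "filling i (srt (set C)) bs" using v by (simp add: hook_filling_def)
  have "E i C bs = add_pow (F i) (sign p) (E i (srt (set C)) bs)"
    using hook_relations_alt[OF E_relations v' p(1)] p(2) by simp
  then show ?thesis using expandable_add_pow[OF e] by simp
qed

text \<open>If the smallest letter is already in the column, sorting the column (up to sign) and the
  row (freely) produces a standard tableau, without any shuffle.\<close>

lemma expandable_min:
  assumes v: "filling i C bs" and min: "Min (set C \<union> set bs) \<in> set C"
  shows "E i C bs \<in> expandable i"
proof (rule expandable_col_perm[OF v])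
  define m where "m = Min (set C \<union> set bs)"
  have D: "distinct C" "distinct bs" "set C \<inter> set bs = {}" "length C = Suc i" "Suc (length bs) = d"
    "set C \<subseteq> {1..n}" "set bs \<subseteq> {1..n}"
    using v by (auto simp: hook_filling_def)
  define S u where "S = set C - {m}" and "u = insert m (set bs)"
  have mC: "m \<in> set C" using min by (simp add: m_def)
  have le: "m \<le> x" if "x \<in> set C \<union> set bs" for x
    unfolding m_def using that by (intro Min_le) auto
  have Mu: "Min u = m" using le by (intro Min_eqI) (auto simp: u_def)
  have mb: "m \<notin> set bs" using mC D by auto
  have "card S = i" using D mC by (simp add: S_def distinct_card)
  moreover have "card u = d" using D mb by (simp add: u_def distinct_card)
  moreover have "Min u < s" if "s \<in> S" for s
    using that le[of s] by (auto simp: Mu S_def le_neq_implies_less)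
  ultimately have idx: "(u, S) \<in> idx i"
    using D mC by (auto simp: idx_def u_def S_def)
  have col: "srt (set C) = bcol u S"
  proof -
    have "\<forall>s\<in>S. m < s" using \<open>\<And>s. s \<in> S \<Longrightarrow> Min u < s\<close> Mu by simp
    then have "sorted (m # srt S)" "distinct (m # srt S)" "set (m # srt S) = set C"
      using mC by (auto simp: S_def less_imp_le)
    then show ?thesis
      unfolding bcol_def Mu by (metis sorted_list_of_set.idem_if_sorted_distinct)
  qed
  have "u - {Min u} = set bs" unfolding Mu using mb by (auto simp: u_def)
  then have "mset (brow u) = mset bs"
    using mset_set_set[of "srt (set bs)"] mset_set_set[OF D(2)] by (simp add: brow_def)
  then have "E i (bcol u S) (brow u) = E i (bcol u S) bs"
    using E_row_perm[of i "bcol u S" "[]" "brow u" bs] filling_basis[OF idx] by simp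
  then show "E i (srt (set C)) bs \<in> expandable i"
    using expandable_bas[OF idx] by (simp add: bas_def col)
qed

text \<open>Straightening takes a single shuffle. If the smallest letter \<open>b\<close> is in the
  row, it is brought to the front and shuffled into the column; every resulting term has the same
  letters and carries \<open>b\<close> in its column.\<close>

lemma expandable_E:
  assumes v: "filling i C bs" shows "E i C bs \<in> expandable i"
proof (cases "Min (set C \<union> set bs) \<in> set C")
  case True
  then show ?thesis by (rule expandable_min[OF v])
next
  case False
  define b where "b = Min (set C \<union> set bs)"
  have "b \<in> set C \<union> set bs"
    unfolding b_def using hook_filling_nonempty[OF v] by (intro Min_in) auto
  then have "b \<in> set bs" using False by (simp add: b_def)
  then obtain l1 l2 where bs: "bs = l1 @ b # l2" by (meson split_list)
  have v1: "filling i C (b # l1 @ l2)" using v by (auto simp: bs hook_filling_def)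
  have "E i C bs = E i C (b # l1 @ l2)"
    using E_row_move[of i C "[]" l1 b l2] v by (simp add: bs)
  also have "\<dots> = (\<Oplus>\<^bsub>F i\<^esub>r\<in>{..<length C}. E i (C[r := b]) (C ! r # l1 @ l2))"
    by (rule hook_relations_shuffle[OF E_relations v1])
  also have "\<dots> \<in> expandable i"
  proof (rule submodule_finsum[OF F_module expandable_submodule], rule Pi_I)
    fix r assume "r \<in> {..<length C}"
    then have r: "r < length C" by simp
    have "mset (C[r := b] @ C ! r # l1 @ l2) = mset (C @ b # l1 @ l2)"
      using r nth_mem_mset[OF r] by (simp add: mset_update)
    then have "set (C[r := b] @ C ! r # l1 @ l2) = set (C @ b # l1 @ l2)" by (rule mset_eq_setD)
    then have "set (C[r := b]) \<union> set (C ! r # l1 @ l2) = set C \<union> set bs" by (simp add: bs)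
    then have "Min (set (C[r := b]) \<union> set (C ! r # l1 @ l2)) = b" by (simp only: b_def)
    then show "E i (C[r := b]) (C ! r # l1 @ l2) \<in> expandable i"
      using r by (intro expandable_min shuffle_step[OF v1 r]) (simp add: set_update_memI)
  qed
  finally show ?thesis .
qed

lemma expansion_eq:
  assumes "x \<in> carrier (F i)" shows "x = (\<Oplus>\<^bsub>F i\<^esub>p\<in>idx i. kap i p x \<odot>\<^bsub>F i\<^esub> bas i p)"
proof -
  have "expansion i x = x"
    by (rule F_homs_eq[OF F_module expansion_hom module_homs_id _ assms])
      (use expandable_E in \<open>simp add: expandable_def\<close>)
  then show ?thesis by (simp add: expansion_def)
qed

lemma F_eqI:
  assumes "x \<in> carrier (F i)" "y \<in> carrier (F i)" "\<And>p. p \<in> idx i \<Longrightarrow> kap i p x = kap i p y"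
  shows "x = y"
proof -
  interpret M: module P "F i" by (rule F_module)
  have "x = (\<Oplus>\<^bsub>F i\<^esub>p\<in>idx i. kap i p x \<odot>\<^bsub>F i\<^esub> bas i p)" by (rule expansion_eq[OF assms(1)])
  also have "\<dots> = (\<Oplus>\<^bsub>F i\<^esub>p\<in>idx i. kap i p y \<odot>\<^bsub>F i\<^esub> bas i p)"
    by (intro M.finsum_cong' Pi_I M.smult_closed kap_closed[OF _ assms(2)] bas_closed)
      (simp_all add: assms(3))
  also have "\<dots> = y" by (rule expansion_eq[OF assms(2), symmetric])
  finally show ?thesis .
qed

lemma F_combination:
  assumes c: "c \<in> idx i \<rightarrow> carrier P"
  shows "(\<Oplus>\<^bsub>F i\<^esub>p\<in>idx i. c p \<odot>\<^bsub>F i\<^esub> bas i p) \<in> carrier (F i)"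
    and "q \<in> idx i \<Longrightarrow> kap i q (\<Oplus>\<^bsub>F i\<^esub>p\<in>idx i. c p \<odot>\<^bsub>F i\<^esub> bas i p) = c q"
proof -
  interpret M: module P "F i" by (rule F_module)
  have t: "(\<lambda>p. c p \<odot>\<^bsub>F i\<^esub> bas i p) \<in> idx i \<rightarrow> carrier (F i)"
    by (intro Pi_I M.smult_closed bas_closed funcset_mem[OF c])
  then show "(\<Oplus>\<^bsub>F i\<^esub>p\<in>idx i. c p \<odot>\<^bsub>F i\<^esub> bas i p) \<in> carrier (F i)" by (rule M.finsum_closed)
  assume q: "q \<in> idx i"
  have cP: "c p \<in> carrier P" if "p \<in> idx i" for p using c that by auto
  have "kap i q (\<Oplus>\<^bsub>F i\<^esub>p\<in>idx i. c p \<odot>\<^bsub>F i\<^esub> bas i p) = (\<Oplus>\<^bsub>P\<^esub>p\<in>idx i. kap i q (c p \<odot>\<^bsub>F i\<^esub> bas i p))"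
    by (rule kap_finsum[OF q t])
  also have "\<dots> = (\<Oplus>\<^bsub>P\<^esub>p\<in>idx i. if q = p then c p else zero P)"
    using q cP by (intro P.finsum_cong') (auto simp: kap_smult bas_closed kap_bas)
  also have "\<dots> = c q" using c by (intro P.finsum_singleton[OF q finite_idx])
  finally show "kap i q (\<Oplus>\<^bsub>F i\<^esub>p\<in>idx i. c p \<odot>\<^bsub>F i\<^esub> bas i p) = c q" .
qed

end

lemma submodule_add_pow:
  assumes "module R M" "submodule H R M" "x \<in> H"
  shows "add_pow M (k :: int) x \<in> H"
proof -
  interpret M: module R M by fact
  show ?thesis
    using group.subgroup_int_pow_closed[OF M.a_group submodule.axioms(1)[OF assms(2)] assms(3)]
    by (simp add: add_pow_def)
qed

text \<open>Off-diagonal terms cancel in pairs. The diagonal is treated by a separate assumption,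
  since antisymmetry alone does not make it vanish when there is 2-torsion.\<close>

lemma (in abelian_group) finsum_antisymmetric:
  assumes "finite I" "\<And>a b. a \<in> I \<Longrightarrow> b \<in> I \<Longrightarrow> f a b \<in> carrier G"
    and "\<And>a. a \<in> I \<Longrightarrow> f a a = \<zero>" and "\<And>a b. a \<in> I \<Longrightarrow> b \<in> I \<Longrightarrow> f a b = \<ominus> f b a"
  shows "(\<Oplus>a\<in>I. \<Oplus>b\<in>I. f a b) = \<zero>"
  using assms
proof (induction I)
  case (insert c I)
  have cl: "f a b \<in> carrier G" if "a \<in> insert c I" "b \<in> insert c I" for a b
    using insert.prems(1) that by blast
  have in1: "(\<Oplus>b\<in>insert c I. f a b) = f a c \<oplus> (\<Oplus>b\<in>I. f a b)" if "a \<in> insert c I" for a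
    using insert.hyps cl that by (intro finsum_insert) auto
  have s1: "(\<Oplus>b\<in>I. f a b) \<in> carrier G" if "a \<in> insert c I" for a
    using cl that by (intro finsum_closed) auto
  have "(\<Oplus>a\<in>insert c I. \<Oplus>b\<in>insert c I. f a b) = (\<Oplus>a\<in>insert c I. f a c \<oplus> (\<Oplus>b\<in>I. f a b))"
    using cl s1 by (intro finsum_cong') (auto simp: in1)
  also have "\<dots> = (f c c \<oplus> (\<Oplus>b\<in>I. f c b)) \<oplus> (\<Oplus>a\<in>I. f a c \<oplus> (\<Oplus>b\<in>I. f a b))"
    using insert.hyps cl s1 by (intro finsum_insert) auto
  also have "\<dots> = (\<Oplus>b\<in>I. f c b) \<oplus> ((\<Oplus>a\<in>I. f a c) \<oplus> (\<Oplus>a\<in>I. \<Oplus>b\<in>I. f a b))"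
  proof -
    have 1: "(\<Oplus>a\<in>I. f a c \<oplus> (\<Oplus>b\<in>I. f a b)) = (\<Oplus>a\<in>I. f a c) \<oplus> (\<Oplus>a\<in>I. \<Oplus>b\<in>I. f a b)"
      using cl s1 by (intro finsum_addf) auto
    have 2: "(\<Oplus>b\<in>I. f c b) \<in> carrier G" by (rule s1) simp
    have 3: "f c c = \<zero>" by (rule insert.prems(2)) simp
    show ?thesis unfolding 1 3 l_zero[OF 2] ..
  qed
  also have "(\<Oplus>a\<in>I. \<Oplus>b\<in>I. f a b) = \<zero>"
    by (rule insert.IH; rule insert.prems; simp)
  also have "(\<Oplus>a\<in>I. f a c) = (\<Oplus>a\<in>I. \<ominus> f c a)"
  proof (intro finsum_cong' refl Pi_I)
    show "f a c = \<ominus> f c a" if "a \<in> I" for a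
      by (rule insert.prems(3)) (use that in auto)
    show "\<ominus> f c a \<in> carrier G" if "a \<in> I" for a
      using cl that by auto
  qed
  also have "(\<Oplus>b\<in>I. f c b) \<oplus> ((\<Oplus>a\<in>I. \<ominus> f c a) \<oplus> \<zero>) = (\<Oplus>b\<in>I. f c b \<oplus> \<ominus> f c b)"
  proof -
    have 1: "(\<Oplus>b\<in>I. f c b \<oplus> \<ominus> f c b) = (\<Oplus>b\<in>I. f c b) \<oplus> (\<Oplus>b\<in>I. \<ominus> f c b)"
      using cl by (intro finsum_addf) auto
    have 2: "(\<Oplus>a\<in>I. \<ominus> f c a) \<in> carrier G" using cl by (intro finsum_closed) auto
    show ?thesis unfolding 1 r_zero[OF 2] ..
  qed
  also have "\<dots> = (\<Oplus>b\<in>I. \<zero>)"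
  proof (intro finsum_cong' refl Pi_I)
    show "f c b \<oplus> \<ominus> f c b = \<zero>" if "b \<in> I" for b
      by (rule r_neg[OF cl]) (use that in auto)
  qed simp
  finally show ?case by simp
next
  case empty
  show ?case by simp
qed

context hooks
begin

subsection \<open>Graded freeness\<close>

lemma F_module_basis: "module_basis P (F i) (bas i ` idx i)"
  unfolding module_basis_def
proof (intro conjI ballI)
  interpret M: module P "F i" by (rule F_module)
  let ?B = "bas i ` idx i"
  show "?B \<subseteq> carrier (F i)" using bas_closed by blast
  fix m assume m: "m \<in> carrier (F i)"
  have supp: "b \<in> ?B" if "c \<in> carrier (free_module P ?B)" "c b \<noteq> zero P" for c b
    using that by (auto simp: free_module_carrier[OF P_cring])
  have cP: "c b \<in> carrier P" if "c \<in> carrier (free_module P ?B)" for c b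
    using that by (simp add: free_module_carrier[OF P_cring])
  have memI: "c \<in> carrier (free_module P ?B)" if "\<And>b. c b \<in> carrier P" "\<And>b. b \<notin> ?B \<Longrightarrow> c b = zero P" for c
  proof -
    have "finite {b. c b \<noteq> zero P}"
      by (rule finite_subset[of _ ?B]) (use that(2) finite_idx in auto)
    then show ?thesis using that by (simp add: free_module_carrier[OF P_cring])
  qed
  show "\<exists>!c. c \<in> carrier (free_module P ?B) \<and> m = (\<Oplus>\<^bsub>F i\<^esub>b\<in>{b. c b \<noteq> zero P}. c b \<odot>\<^bsub>F i\<^esub> b)"
  \<comment> \<open>Over the zero ring different indices may have the same basis vector, so
    \<open>bas\<close> need not be injective; but then the module and all coefficients are
    zero.\<close>
  proof (cases "one P = zero P")
    case True
    have triv: "p = zero P" if "p \<in> carrier P" for p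
      using that True P_l_one P.l_null by metis
    have "m = zero (F i)" using m True M.smult_one M.smult_l_null by metis
    then show ?thesis
      using triv cP by (intro ex1I[of _ "\<lambda>_. zero P"]) (auto intro!: memI)
  next
    case False
    have inj: "inj_on (bas i) (idx i)"
    proof (rule inj_onI)
      fix p q assume p: "p \<in> idx i" and q: "q \<in> idx i" and e: "bas i p = bas i q"
      show "p = q"
        using kap_bas[OF p p] kap_bas[OF p q] False unfolding e by (auto split: if_splits)
    qed
    have sum: "(\<Oplus>\<^bsub>F i\<^esub>b\<in>{b. c b \<noteq> zero P}. c b \<odot>\<^bsub>F i\<^esub> b) = (\<Oplus>\<^bsub>F i\<^esub>p\<in>idx i. c (bas i p) \<odot>\<^bsub>F i\<^esub> bas i p)"
      if c: "c \<in> carrier (free_module P ?B)" for c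
    proof -
      have t: "c b \<odot>\<^bsub>F i\<^esub> b \<in> carrier (F i)" if "b \<in> ?B" for b
        using that cP[OF c] bas_closed by (intro M.smult_closed) auto
      have "(\<Oplus>\<^bsub>F i\<^esub>b\<in>{b. c b \<noteq> zero P}. c b \<odot>\<^bsub>F i\<^esub> b) = (\<Oplus>\<^bsub>F i\<^esub>b\<in>?B. c b \<odot>\<^bsub>F i\<^esub> b)"
        using supp[OF c] t finite_idx bas_closed
        by (intro M.add.finprod_mono_neutral_cong_left) (auto intro!: M.smult_l_null)
      also have "\<dots> = (\<Oplus>\<^bsub>F i\<^esub>p\<in>idx i. c (bas i p) \<odot>\<^bsub>F i\<^esub> bas i p)"
        using t by (intro M.finsum_reindex[OF _ inj]) auto
      finally show ?thesis .
    qed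
    \<comment> \<open>\<open>module_basis\<close> indexes coefficients by the basis vectors
      themselves, so the coordinates are transported along the inverse of
      \<open>bas\<close>.\<close>
    define c0 where "c0 b = (if b \<in> ?B then kap i (the_inv_into (idx i) (bas i) b) m else zero P)" for b
    have c0: "c0 (bas i p) = kap i p m" if "p \<in> idx i" for p
      using that by (simp add: c0_def the_inv_into_f_f[OF inj])
    have c0c: "c0 \<in> carrier (free_module P ?B)"
    proof (rule memI)
      show "c0 b \<in> carrier P" for b
        using c0 kap_closed[OF _ m] by (cases "b \<in> ?B") (auto simp: c0_def)
    qed (simp add: c0_def)
    show ?thesis
    proof (rule ex1I[of _ c0])
      have "(\<Oplus>\<^bsub>F i\<^esub>p\<in>idx i. c0 (bas i p) \<odot>\<^bsub>F i\<^esub> bas i p) = (\<Oplus>\<^bsub>F i\<^esub>p\<in>idx i. kap i p m \<odot>\<^bsub>F i\<^esub> bas i p)"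
        by (intro M.finsum_cong' Pi_I M.smult_closed kap_closed[OF _ m] bas_closed) (simp_all add: c0)
      then show "c0 \<in> carrier (free_module P ?B) \<and> m = (\<Oplus>\<^bsub>F i\<^esub>b\<in>{b. c0 b \<noteq> zero P}. c0 b \<odot>\<^bsub>F i\<^esub> b)"
        using c0c expansion_eq[OF m] by (simp only: sum[OF c0c])
    next
      fix c assume "c \<in> carrier (free_module P ?B) \<and> m = (\<Oplus>\<^bsub>F i\<^esub>b\<in>{b. c b \<noteq> zero P}. c b \<odot>\<^bsub>F i\<^esub> b)"
      then have c: "c \<in> carrier (free_module P ?B)" and mc: "m = (\<Oplus>\<^bsub>F i\<^esub>p\<in>idx i. c (bas i p) \<odot>\<^bsub>F i\<^esub> bas i p)"
        using sum by auto
      have cc: "(\<lambda>p. c (bas i p)) \<in> idx i \<rightarrow> carrier P" using cP[OF c] by simp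
      have "c (bas i p) = c0 (bas i p)" if p: "p \<in> idx i" for p
        unfolding c0[OF p] using F_combination(2)[OF cc p] mc by simp
      then show "c = c0"
        using c by (intro ext) (auto simp: free_module_carrier[OF P_cring] c0_def)
    qed
  qed
qed

lemma F_graded_free: "graded_free P (F i)"
  unfolding graded_free_def
proof (intro conjI exI[of _ "bas i ` idx i"] F_graded F_module_basis)
  have "bas i p \<in> hcomp (F i) (int d + int i)" if "p \<in> idx i" for p
    unfolding bas_def by (rule E_hcomp[OF filling_basis]) (use that in simp)
  then show "bas i ` idx i \<subseteq> (\<Union>k. hcomp (F i) k)" by blast
qed

lemma F_induct [consumes 1, case_names E add smult zero]:
  assumes x: "x \<in> carrier (F i)" and E: "\<And>C bs. filling i C bs \<Longrightarrow> Q (E i C bs)"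
    and add: "\<And>x y. x \<in> carrier (F i) \<Longrightarrow> y \<in> carrier (F i) \<Longrightarrow> Q x \<Longrightarrow> Q y \<Longrightarrow> Q (x \<oplus>\<^bsub>F i\<^esub> y)"
    and smult: "\<And>p x. p \<in> carrier P \<Longrightarrow> x \<in> carrier (F i) \<Longrightarrow> Q x \<Longrightarrow> Q (p \<odot>\<^bsub>F i\<^esub> x)"
    and zero: "Q \<zero>\<^bsub>F i\<^esub>"
  shows "Q x"
proof -
  interpret M: module P "F i" by (rule F_module)
  have H: "submodule {x \<in> carrier (F i). Q x} P (F i)"
    by (rule submodule_by_closure[OF F_module]) (auto simp: add smult zero)
  have "(\<Oplus>\<^bsub>F i\<^esub>p\<in>idx i. kap i p x \<odot>\<^bsub>F i\<^esub> bas i p) \<in> {x \<in> carrier (F i). Q x}"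
  proof (rule submodule_finsum[OF F_module H], rule Pi_I)
    fix p assume p: "p \<in> idx i"
    have "bas i p \<in> {x \<in> carrier (F i). Q x}"
      using bas_closed[OF p] E[OF filling_basis[of "fst p" "snd p"]] p by (simp add: bas_def)
    then show "kap i p x \<odot>\<^bsub>F i\<^esub> bas i p \<in> {x \<in> carrier (F i). Q x}"
      by (rule M.submoduleE(4)[OF H kap_closed[OF p x]])
  qed
  then show ?thesis using expansion_eq[OF x] by simp
qed

subsection \<open>The differential\<close>

abbreviation rm :: "nat \<Rightarrow> nat list \<Rightarrow> nat list" where "rm j C \<equiv> take j C @ drop (Suc j) C"

lemma filling_rm:
  assumes "filling (Suc i) C bs" "j \<le> Suc i"
  shows "filling i (rm j C) bs"
proof -
  have C: "C = take j C @ C ! j # drop (Suc j) C"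
    using assms by (intro id_take_nth_drop) (simp add: hook_filling_def)
  have len: "length (rm j C) = Suc i" using assms by (simp add: hook_filling_def min_def)
  have "distinct (C @ bs)" "set (C @ bs) \<subseteq> {1..n}" "Suc (length bs) = d"
    using assms by (simp_all add: hook_filling_def)
  then have "distinct (rm j C @ bs)" "set (rm j C @ bs) \<subseteq> {1..n}"
    by (subst (asm) C, auto)+
  then show ?thesis using len \<open>Suc (length bs) = d\<close> by (simp only: hook_filling_def)
qed

lemma filling_nth: "filling i C bs \<Longrightarrow> j \<le> i \<Longrightarrow> C ! j \<in> {1..n}"
proof -
  assume v: "filling i C bs" and j: "j \<le> i"
  have "C ! j \<in> set C" using v j by (simp add: hook_filling_def)
  moreover have "set C \<subseteq> {1..n}" using v by (simp add: hook_filling_def)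
  ultimately show "C ! j \<in> {1..n}" by blast
qed

text \<open>The integer coefficient of the variable \<open>a\<close> in the coordinate of a boundary
  at \<open>u\<close> and \<open>R\<close>. It is 0 for \<open>a\<close> in \<open>u\<close> or
  \<open>R\<close>, because a removed letter does not occur in what remains.\<close>

definition coefR :: "nat set \<Rightarrow> nat list \<Rightarrow> nat \<Rightarrow> nat list \<Rightarrow> nat list \<Rightarrow> int"
  where "coefR u R a C bs = (if a \<in> u \<union> set R then 0 else coef u (R @ [a]) C bs)"

lemma coefR_zero: "a \<notin> set C \<Longrightarrow> coefR u R a C bs = 0"
proof -
  assume "a \<notin> set C"
  then have "orient (y # R @ [a]) C = 0" for y by (intro orient_zero) auto
  then show ?thesis by (simp add: coefR_def coef_def)
qed

text \<open>The letter at position \<open>j\<close> has \<open>i - j\<close> letters below it, so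
  the sign of the differential is the one that \<open>coef_snoc\<close> produces; if that letter
  belongs to \<open>u\<close> or \<open>R\<close>, the letter sets disagree and both sides
  vanish.\<close>

lemma coefR_rm:
  assumes v: "filling i C bs" and j: "j \<le> i"
  shows "(- 1) ^ (i - j) * coef u R (rm j C) bs = coefR u R (C ! j) C bs"
proof -
  have len: "length C = Suc i" and dist: "distinct (C @ bs)" using v by (simp_all add: hook_filling_def)
  have C: "C = take j C @ C ! j # drop (Suc j) C"
    using len j by (intro id_take_nth_drop) simp
  define xs a zs where "xs = take j C" and "a = C ! j" and "zs = drop (Suc j) C"
  have Ce: "C = xs @ a # zs" using C by (simp add: xs_def a_def zs_def)
  have dist': "distinct (xs @ a # zs)" "a \<notin> set bs" "a \<notin> set (xs @ zs)" using dist unfolding Ce by auto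
  have lz: "length zs = i - j" using len by (simp add: zs_def)
  have "(- 1) ^ (i - j) * coef u R (xs @ zs) bs = coefR u R a (xs @ a # zs) bs"
  proof (cases "a \<in> u \<union> set R")
    case True
    then have "set (xs @ zs) \<union> set bs \<noteq> u \<union> set R" using dist'(2,3) by blast
    then show ?thesis using True by (simp add: coef_def coefR_def)
  next
    case False
    then show ?thesis using coef_snoc[OF dist'(1,2)] by (simp add: coefR_def lz)
  qed
  then show ?thesis unfolding xs_def a_def zs_def C[symmetric] .
qed

text \<open>Summing over all letters instead of the positions of a column makes the index set
  independent of the filling; only then can relations be verified summand by summand.\<close>

lemma finsum_column:
  assumes v: "filling i C bs" and M: "abelian_group M" and f: "\<And>a. a \<in> {1..n} \<Longrightarrow> f a \<in> carrier M"
    and z: "\<And>a. a \<in> {1..n} - set C \<Longrightarrow> f a = \<zero>\<^bsub>M\<^esub>"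
  shows "(\<Oplus>\<^bsub>M\<^esub>j\<in>{0..i}. f (C ! j)) = (\<Oplus>\<^bsub>M\<^esub>a\<in>{1..n}. f a)"
proof -
  interpret M: abelian_group M by (rule M)
  have len: "length C = Suc i" and dist: "distinct C" and sub: "set C \<subseteq> {1..n}"
    using v by (simp_all add: hook_filling_def)
  have bij: "inj_on (\<lambda>j. C ! j) {0..i}"
    using dist len by (auto simp: inj_on_def nth_eq_iff_index_eq)
  have "{0..i} = {..<length C}" using len by auto
  then have im: "(\<lambda>j. C ! j) ` {0..i} = set C" using nth_image[of "length C" C] by (simp add: lessThan_atLeast0)
  have "(\<Oplus>\<^bsub>M\<^esub>j\<in>{0..i}. f (C ! j)) = (\<Oplus>\<^bsub>M\<^esub>a\<in>set C. f a)"
    using M.finsum_reindex[OF _ bij, of f] f sub unfolding im by (simp add: Pi_iff subset_iff)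
  also have "\<dots> = (\<Oplus>\<^bsub>M\<^esub>a\<in>{1..n}. f a)"
    using sub f z by (intro M.add.finprod_mono_neutral_cong_left) auto
  finally show ?thesis .
qed

lemma mult_iota: "p \<in> carrier P \<Longrightarrow> p \<otimes>\<^bsub>P\<^esub> iota k = add_pow P k p"
  unfolding iota_def using module_homs_add_pow[OF P_module P_module mult_hom_right P_one_closed, of p k]
  by simp

lemma mult_add_pow: "p \<in> carrier P \<Longrightarrow> q \<in> carrier P \<Longrightarrow> p \<otimes>\<^bsub>P\<^esub> add_pow P (k :: int) q = add_pow P k (p \<otimes>\<^bsub>P\<^esub> q)"
  by (rule module_homs_add_pow[OF P_module P_module mult_hom_right])

lemma add_pow_add_pow: "p \<in> carrier P \<Longrightarrow> add_pow P (k :: int) (add_pow P (l :: int) p) = add_pow P (k * l) p"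
  by (simp add: P.add.int_pow_pow mult.commute)

lemma kap_add_pow: "p \<in> idx j \<Longrightarrow> x \<in> carrier (F i) \<Longrightarrow> kap i p (add_pow (F i) (k :: int) x) = add_pow P k (kap i p x)"
  using module_homs_add_pow[OF F_module PP_module kap_hom] by (simp add: same_group_add_pow[OF same_group_PP])

abbreviation var :: "nat \<Rightarrow> nat multiset \<Rightarrow> 'a" where "var k \<equiv> mon {#k#}"

lemma var_carrier: "a \<in> {1..n} \<Longrightarrow> var a \<in> carrier P"
  by (rule mon_closed) simp

definition bdry :: "nat \<Rightarrow> nat list \<Rightarrow> nat list \<Rightarrow> ((nat list list \<Rightarrow> 'a) set \<times> (nat multiset \<Rightarrow> 'a) \<Rightarrow> 'a) set"
  where "bdry i C bs = (\<Oplus>\<^bsub>F i\<^esub>j\<in>{0..Suc i}. add_pow (F i) ((- 1) ^ (Suc i - j) :: int)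
    (var (C ! j) \<odot>\<^bsub>F i\<^esub> E i (rm j C) bs))"

lemma bdry_term_closed:
  assumes "filling (Suc i) C bs" "j \<in> {0..Suc i}"
  shows "var (C ! j) \<odot>\<^bsub>F i\<^esub> E i (rm j C) bs \<in> carrier (F i)"
    "add_pow (F i) (k :: int) (var (C ! j) \<odot>\<^bsub>F i\<^esub> E i (rm j C) bs) \<in> carrier (F i)"
proof -
  interpret M: module P "F i" by (rule F_module)
  have j: "j \<le> Suc i" using assms(2) by simp
  show 1: "var (C ! j) \<odot>\<^bsub>F i\<^esub> E i (rm j C) bs \<in> carrier (F i)"
    by (intro M.smult_closed var_carrier E_closed filling_rm[OF assms(1) j] filling_nth[OF assms(1) j])
  show "add_pow (F i) k (var (C ! j) \<odot>\<^bsub>F i\<^esub> E i (rm j C) bs) \<in> carrier (F i)"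
    by (rule M.add.int_pow_closed[OF 1])
qed

lemma bdry_closed: "filling (Suc i) C bs \<Longrightarrow> bdry i C bs \<in> carrier (F i)"
proof -
  interpret M: module P "F i" by (rule F_module)
  show "filling (Suc i) C bs \<Longrightarrow> bdry i C bs \<in> carrier (F i)"
    unfolding bdry_def using bdry_term_closed(2) by (intro M.finsum_closed) simp
qed

text \<open>Each summand of the boundary is a variable times a generator with integer coordinate.
  \<open>coefR_rm\<close> absorbs the signs, and \<open>finsum_column\<close> makes the formula
  uniform in the filling.\<close>

lemma kap_bdry:
  assumes v: "filling (Suc i) C bs" and p: "(u, S) \<in> idx i"
  shows "kap i (u, S) (bdry i C bs) = (\<Oplus>\<^bsub>P\<^esub>a\<in>{1..n}. add_pow P (coefR u (srt S) a C bs) (var a))"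
proof -
  have "kap i (u, S) (bdry i C bs) = (\<Oplus>\<^bsub>P\<^esub>j\<in>{0..Suc i}. kap i (u, S)
      (add_pow (F i) ((- 1) ^ (Suc i - j) :: int) (var (C ! j) \<odot>\<^bsub>F i\<^esub> E i (rm j C) bs)))"
    unfolding bdry_def using bdry_term_closed(2)[OF v] by (intro kap_finsum[OF p]) simp
  also have "\<dots> = (\<Oplus>\<^bsub>P\<^esub>j\<in>{0..Suc i}. add_pow P (coefR u (srt S) (C ! j) C bs) (var (C ! j)))"
  proof (intro P.finsum_cong' Pi_I refl)
    fix j assume j: "j \<in> {0..Suc i}"
    then have j': "j \<le> Suc i" by simp
    have x: "var (C ! j) \<in> carrier P" by (rule var_carrier[OF filling_nth[OF v j']])
    then show "add_pow P (coefR u (srt S) (C ! j) C bs) (var (C ! j)) \<in> carrier P"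
      by (rule P.add.int_pow_closed)
    show "kap i (u, S) (add_pow (F i) ((- 1) ^ (Suc i - j) :: int) (var (C ! j) \<odot>\<^bsub>F i\<^esub> E i (rm j C) bs))
        = add_pow P (coefR u (srt S) (C ! j) C bs) (var (C ! j))"
      unfolding kap_add_pow[OF p bdry_term_closed(1)[OF v j]]
        kap_smult[OF p x E_closed[OF filling_rm[OF v j']]] kap_E[OF p filling_rm[OF v j']]
        mult_iota[OF x] add_pow_add_pow[OF x] fst_conv snd_conv lam_def coefR_rm[OF v j'] ..
  qed
  also have "\<dots> = (\<Oplus>\<^bsub>P\<^esub>a\<in>{1..n}. add_pow P (coefR u (srt S) a C bs) (var a))"
    by (rule finsum_column[OF v P.abelian_group_axioms])
      (simp_all add: P.add.int_pow_closed var_carrier coefR_zero add_pow_def[of _ "0::int"])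
  finally show ?thesis .
qed

lemma hook_relations_finsum:
  assumes M: "abelian_group M" and I: "finite I" and g: "\<And>a. a \<in> I \<Longrightarrow> hook_relations d n i M (g a)"
  shows "hook_relations d n i M (\<lambda>C bs. \<Oplus>\<^bsub>M\<^esub>a\<in>I. g a C bs)"
proof -
  interpret M: abelian_group M by (rule M)
  note R = hook_relationsD[OF g]
  show ?thesis
  proof (rule hook_relationsI)
    fix C bs assume v: "filling i C bs"
    show "(\<Oplus>\<^bsub>M\<^esub>a\<in>I. g a C bs) \<in> carrier M" using R(1)[OF _ v] by (intro M.finsum_closed) simp
  next
    fix C bs s assume v: "filling i C bs" and s: "s permutes set C"
    have pow: "add_pow M (sign s) (\<Oplus>\<^bsub>M\<^esub>a\<in>I. g a C bs) = (\<Oplus>\<^bsub>M\<^esub>a\<in>I. add_pow M (sign s) (g a C bs))"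
      using R(1)[OF _ v]
      by (intro M.additive_finsum M.add.int_pow_closed) (simp_all add: M.add.int_pow_distrib)
    show "(\<Oplus>\<^bsub>M\<^esub>a\<in>I. g a (map s C) bs) = add_pow M (sign s) (\<Oplus>\<^bsub>M\<^esub>a\<in>I. g a C bs)"
      unfolding pow using R(1)[OF _ v] by (intro M.finsum_cong' Pi_I M.add.int_pow_closed) (simp_all add: R(2)[OF _ v s])
  next
    fix C ps a b l assume v: "filling i C (ps @ a # b # l)"
    show "(\<Oplus>\<^bsub>M\<^esub>k\<in>I. g k C (ps @ b # a # l)) = (\<Oplus>\<^bsub>M\<^esub>k\<in>I. g k C (ps @ a # b # l))"
      using R(1)[OF _ v] R(3)[OF _ v] by (intro M.finsum_cong') simp_all
  next
    fix C b l assume v: "filling i C (b # l)"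
    note c = R(1)[OF _ shuffle_step[OF v]]
    have "(\<Oplus>\<^bsub>M\<^esub>a\<in>J. g a C (b # l)) = (\<Oplus>\<^bsub>M\<^esub>r\<in>{..<length C}. \<Oplus>\<^bsub>M\<^esub>a\<in>J. g a (C[r := b]) (C ! r # l))" if "J \<subseteq> I" for J
      using finite_subset[OF that I] that
    proof (induction J)
      case (insert a J)
      have gc: "g a (C[r := b]) (C ! r # l) \<in> carrier M" if "a \<in> I" "r < length C" for a r
        using c that by simp
      have "(\<Oplus>\<^bsub>M\<^esub>a\<in>insert a J. g a C (b # l)) = g a C (b # l) \<oplus>\<^bsub>M\<^esub> (\<Oplus>\<^bsub>M\<^esub>a\<in>J. g a C (b # l))"
        using insert R(1)[OF _ v] by (intro M.finsum_insert) auto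
      also have "\<dots> = (\<Oplus>\<^bsub>M\<^esub>r\<in>{..<length C}. g a (C[r := b]) (C ! r # l)) \<oplus>\<^bsub>M\<^esub>
          (\<Oplus>\<^bsub>M\<^esub>r\<in>{..<length C}. \<Oplus>\<^bsub>M\<^esub>a\<in>J. g a (C[r := b]) (C ! r # l))"
        using insert R(4)[OF _ v, of a] by simp
      also have "\<dots> = (\<Oplus>\<^bsub>M\<^esub>r\<in>{..<length C}. g a (C[r := b]) (C ! r # l) \<oplus>\<^bsub>M\<^esub>
          (\<Oplus>\<^bsub>M\<^esub>a\<in>J. g a (C[r := b]) (C ! r # l)))"
        using insert.prems gc by (intro M.finsum_addf[symmetric] Pi_I M.finsum_closed) auto
      also have "\<dots> = (\<Oplus>\<^bsub>M\<^esub>r\<in>{..<length C}. \<Oplus>\<^bsub>M\<^esub>a\<in>insert a J. g a (C[r := b]) (C ! r # l))"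
        using insert.prems insert.hyps gc
        by (intro M.finsum_cong' Pi_I M.finsum_closed M.finsum_insert[symmetric]) auto
      finally show ?case .
    qed simp
    then show "(\<Oplus>\<^bsub>M\<^esub>a\<in>I. g a C (b # l)) = (\<Oplus>\<^bsub>M\<^esub>r\<in>{..<length C}. \<Oplus>\<^bsub>M\<^esub>a\<in>I. g a (C[r := b]) (C ! r # l))"
      by simp
  qed
qed

text \<open>For a letter outside \<open>u\<close> and \<open>S\<close> this is again a functional of
  type \<open>coef\<close>, with a longer \<open>R\<close>; otherwise it is identically
  zero.\<close>

lemma coefR_relations:
  assumes "(u, S) \<in> idx j" shows "int_hook_relations d n i (coefR u (srt S) a)"
proof (cases "a \<in> u \<union> S")
  case True
  then show ?thesis using idxD(2)[OF assms] by (simp add: coefR_def[abs_def] int_hook_relations_def)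
next
  case False
  then have "coefR u (srt S) a = coef u (srt S @ [a])"
    using idxD(2)[OF assms] by (intro ext) (simp add: coefR_def)
  moreover have "int_hook_relations d n i (coef u (srt S @ [a]))"
    using idxD(1,2,6)[OF assms] False by (intro coef_relations) auto
  ultimately show ?thesis by simp
qed

text \<open>This is the well-definedness of the differential. Each coordinate of a boundary is a sum
  of variables with coefficients \<open>coefR\<close>, all of which obey the relations for columns
  with one box more, and \<open>F_eqI\<close> lifts the conclusion from coordinates to
  elements.\<close>

lemma bdry_relations: "hook_relations d n (Suc i) (F i) (bdry i)"
proof -
  interpret M: module P "F i" by (rule F_module)
  define g where "g p C bs = (\<Oplus>\<^bsub>P\<^esub>a\<in>{1..n}. add_pow P (coefR (fst p) (srt (snd p)) a C bs) (var a))" for p C bs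
  have R: "hook_relations d n (Suc i) P (g p)" if "p \<in> idx i" for p
    unfolding g_def
    by (intro hook_relations_finsum[OF P.abelian_group_axioms] add_pow_relations[OF P.abelian_group_axioms]
        coefR_relations[of _ "snd p" i] var_carrier) (use that in auto)
  have K: "kap i p (bdry i C bs) = g p C bs" if "p \<in> idx i" "filling (Suc i) C bs" for p C bs
    using kap_bdry[OF that(2), of "fst p" "snd p"] that(1) by (simp add: g_def)
  show ?thesis
  proof (rule hook_relationsI)
    fix C bs s assume v: "filling (Suc i) C bs" and s: "s permutes set C"
    show "bdry i (map s C) bs = add_pow (F i) (sign s) (bdry i C bs)"
    proof (rule F_eqI[OF bdry_closed[OF perm_step[OF v s]] M.add.int_pow_closed[OF bdry_closed[OF v]]])
      fix p assume p: "p \<in> idx i"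
      show "kap i p (bdry i (map s C) bs) = kap i p (add_pow (F i) (sign s) (bdry i C bs))"
        unfolding kap_add_pow[OF p bdry_closed[OF v]] K[OF p v] K[OF p perm_step[OF v s]]
        by (rule hook_relations_alt[OF R[OF p] v s])
    qed
  next
    fix C ps a b l assume v: "filling (Suc i) C (ps @ a # b # l)"
    show "bdry i C (ps @ b # a # l) = bdry i C (ps @ a # b # l)"
    proof (rule F_eqI[OF bdry_closed[OF swap_step[OF v]] bdry_closed[OF v]])
      fix p assume p: "p \<in> idx i"
      show "kap i p (bdry i C (ps @ b # a # l)) = kap i p (bdry i C (ps @ a # b # l))"
        unfolding K[OF p v] K[OF p swap_step[OF v]] by (rule hook_relations_swap[OF R[OF p] v])
    qed
  next
    fix C b l assume v: "filling (Suc i) C (b # l)"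
    have c: "(\<lambda>r. bdry i (C[r := b]) (C ! r # l)) \<in> {..<length C} \<rightarrow> carrier (F i)"
      using bdry_closed[OF shuffle_step[OF v]] by simp
    show "bdry i C (b # l) = (\<Oplus>\<^bsub>F i\<^esub>r\<in>{..<length C}. bdry i (C[r := b]) (C ! r # l))"
    proof (rule F_eqI[OF bdry_closed[OF v] M.finsum_closed[OF c]])
      fix p assume p: "p \<in> idx i"
      have "kap i p (\<Oplus>\<^bsub>F i\<^esub>r\<in>{..<length C}. bdry i (C[r := b]) (C ! r # l))
        = (\<Oplus>\<^bsub>P\<^esub>r\<in>{..<length C}. g p (C[r := b]) (C ! r # l))"
        unfolding kap_finsum[OF p c]
        using hook_relations_closed[OF R[OF p] shuffle_step[OF v]] K[OF p shuffle_step[OF v]]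
        by (intro P.finsum_cong') simp_all
      then show "kap i p (bdry i C (b # l)) = kap i p (\<Oplus>\<^bsub>F i\<^esub>r\<in>{..<length C}. bdry i (C[r := b]) (C ! r # l))"
        unfolding K[OF p v] using hook_relations_shuffle[OF R[OF p] v] by simp
    qed
  qed (rule bdry_closed)
qed

lemma bdry_act:
  assumes s: "s permutes {1..n}" and v: "filling (Suc i) C bs"
  shows "act (F i) s (bdry i C bs) = bdry i (map s C) (map s bs)"
proof -
  interpret T: module A "TT i" by (rule TT_module)
  interpret M: module P "F i" by (rule F_module)
  have "act (F i) s (bdry i C bs) = (\<Oplus>\<^bsub>F i\<^esub>j\<in>{0..Suc i}. act (F i) s
      (add_pow (F i) ((- 1) ^ (Suc i - j) :: int) (var (C ! j) \<odot>\<^bsub>F i\<^esub> E i (rm j C) bs)))"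
    unfolding bdry_def same_group_finsum[OF same_group_F]
    using bdry_term_closed(2)[OF v]
    by (intro module_homs_finsum[OF TT_module TT_module act_F_hom[OF s]]) (simp add: F_simps(1))
  also have "\<dots> = bdry i (map s C) (map s bs)"
    unfolding bdry_def
  proof (intro M.finsum_cong' refl Pi_I bdry_term_closed(2)[OF global_perm_step[OF v s]])
    fix j assume j: "j \<in> {0..Suc i}"
    then have j': "j \<le> Suc i" by simp
    have C: "map s C ! j = s (C ! j)" using j v by (intro nth_map) (simp add: hook_filling_def)
    have 1: "act (F i) s (add_pow (F i) k x) = add_pow (F i) k (act (F i) s x)"
      if "x \<in> carrier (F i)" for k :: int and x
      unfolding same_group_add_pow[OF same_group_F]
      by (rule module_homs_add_pow[OF TT_module TT_module act_F_hom[OF s] that[unfolded F_simps(1)]])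
    show "act (F i) s (add_pow (F i) ((- 1) ^ (Suc i - j) :: int) (var (C ! j) \<odot>\<^bsub>F i\<^esub> E i (rm j C) bs))
      = add_pow (F i) ((- 1) ^ (Suc i - j) :: int) (var (map s C ! j) \<odot>\<^bsub>F i\<^esub> E i (rm j (map s C)) (map s bs))"
      unfolding 1[OF bdry_term_closed(1)[OF v j]]
        act_F_smult[OF s var_carrier[OF filling_nth[OF v j']] E_closed[OF filling_rm[OF v j']]]
        act_F_E[OF s filling_rm[OF v j']] C
      by (simp add: act_P_mon[OF s] take_map drop_map)
  qed
  finally show ?thesis .
qed

abbreviation "diffl \<equiv> differential A d n"

lemma is_differential_iff:
  "is_differential A d n (Suc i) f \<longleftrightarrow>
    f \<in> equivariant_homs A n (F (Suc i)) (F i) \<and> f \<in> extensional (carrier (F (Suc i))) \<and>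
    (\<forall>C bs. filling (Suc i) C bs \<longrightarrow> f (E (Suc i) C bs) = bdry i C bs)"
proof -
  interpret M: module P "F i" by (rule F_module)
  have "(\<Oplus>\<^bsub>F i\<^esub>j\<in>{0..Suc i}. add_pow (F i) ((- 1) ^ (Suc i - j) :: int)
        (F_class A d n i (A.indexed_var (first_column (hooktab C bs) ! j)) (remove_box (hooktab C bs) j)))
      = bdry i C bs" if v: "filling (Suc i) C bs" for C bs
    unfolding bdry_def
  proof (intro M.finsum_cong' refl Pi_I bdry_term_closed(2)[OF v])
    fix j assume "j \<in> {0..Suc i}"
    then have j: "j \<le> Suc i" by simp
    have C: "C \<noteq> []" using hook_filling_nonempty[OF v] .
    show "add_pow (F i) ((- 1) ^ (Suc i - j) :: int)
        (F_class A d n i (A.indexed_var (first_column (hooktab C bs) ! j)) (remove_box (hooktab C bs) j))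
      = add_pow (F i) ((- 1) ^ (Suc i - j) :: int) (var (C ! j) \<odot>\<^bsub>F i\<^esub> E i (rm j C) bs)"
      unfolding first_column_hooktab[OF C] remove_box_hooktab[OF C] var_eq
        E_smult[OF filling_rm[OF v j] var_carrier[OF filling_nth[OF v j]]] ..
  qed
  note eq = this
  have all: "(\<forall>T\<in>{hooktab C bs | C bs. filling (Suc i) C bs}. Q T) \<longleftrightarrow>
      (\<forall>C bs. filling (Suc i) C bs \<longrightarrow> Q (hooktab C bs))" for Q
    by blast
  show ?thesis
    unfolding is_differential_def diff_Suc_1 tableaux_hook[OF d] all
    by (intro conj_cong refl all_cong1 imp_cong) (simp only: eq)
qed

lemma ex1_differential: "\<exists>!f. is_differential A d n (Suc i) f"
proof -
  let ?F = "F (Suc i)"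
  interpret M: module P ?F by (rule F_module)
  interpret N: module P "F i" by (rule F_module)
  obtain h where h: "h \<in> module_homs P ?F (F i)"
    and hE: "\<And>C bs. filling (Suc i) C bs \<Longrightarrow> h (E (Suc i) C bs) = bdry i C bs"
    using F_lift[OF F_module bdry_relations] by blast
  have ac: "act ?F s x \<in> carrier ?F" if "s permutes {1..n}" "x \<in> carrier ?F" for s x
    using module_homs_closed[OF act_F_hom[OF that(1), of "Suc i"], of x] that(2) unfolding F_simps(1) by blast
  \<comment> \<open>The permutation also acts on the polynomial coefficients, so both sides are only
    semilinear over \<open>R_n\<close>. Hence an induction on the element rather than
    \<open>F_homs_eq\<close>.\<close>
  have eqv: "h (act ?F s x) = act (F i) s (h x)" if s: "s permutes {1..n}" and x: "x \<in> carrier ?F" for s x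
    using x
  proof (induction rule: F_induct)
    case (E C bs)
    then show ?case using s by (simp add: act_F_E hE global_perm_step bdry_act)
  next
    case (add x y)
    note a = module_homsD[OF act_F_hom[OF s]]
    show ?case
      using add a(1)[of x "Suc i"] a(1)[of y "Suc i"] a(2)[of x "Suc i" y] a(2)[of "h x" i "h y"]
        module_homs_add[OF h] module_homs_closed[OF h]
      by (simp add: F_simps(1,3))
  next
    case (smult p x)
    have "act ?F s x \<in> carrier ?F" "act P s p \<in> carrier P"
      by (rule ac[OF s smult(2)], rule module_homs_closed[OF act_P_hom[OF s] smult(1)])
    then show ?case
      using smult by (simp add: act_F_smult[OF s] module_homs_smult[OF h] module_homs_closed[OF h])
  next
    case zero
    show ?case
      using module_homs_zero[OF TT_module TT_module act_F_hom[OF s]] module_homs_zero[OF F_module F_module h]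
      by (simp add: F_simps(2) del: of_nat_Suc)
  qed
  let ?f = "restrict h (carrier ?F)"
  have "?f \<in> module_homs P ?F (F i)"
    by (rule module_homsI) (simp_all add: module_homsD[OF h])
  then have "is_differential A d n (Suc i) ?f"
    unfolding is_differential_iff equivariant_homs_def using eqv ac hE E_closed by simp
  moreover have "f = ?f" if "is_differential A d n (Suc i) f" for f
  proof (rule extensionalityI[of _ "carrier ?F"])
    have f: "f \<in> module_homs P ?F (F i)" "\<And>C bs. filling (Suc i) C bs \<Longrightarrow> f (E (Suc i) C bs) = bdry i C bs"
      "f \<in> extensional (carrier ?F)"
      using that unfolding is_differential_iff equivariant_homs_def by auto
    show "f x = ?f x" if x: "x \<in> carrier ?F" for x
      using F_homs_eq[OF F_module f(1) h _ x] f(2) hE x by simp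
    show "f \<in> extensional (carrier ?F)" by (rule f(3))
  qed simp
  ultimately show ?thesis by blast
qed

lemma
  shows diffl_equivariant: "diffl (Suc i) \<in> equivariant_homs A n (F (Suc i)) (F i)"
    and diffl_hom: "diffl (Suc i) \<in> module_homs P (F (Suc i)) (F i)"
    and diffl_E: "filling (Suc i) C bs \<Longrightarrow> diffl (Suc i) (E (Suc i) C bs) = bdry i C bs"
proof -
  have "is_differential A d n (Suc i) (diffl (Suc i))"
    unfolding differential_def by (rule theI'[OF ex1_differential])
  then show "diffl (Suc i) \<in> equivariant_homs A n (F (Suc i)) (F i)"
    "filling (Suc i) C bs \<Longrightarrow> diffl (Suc i) (E (Suc i) C bs) = bdry i C bs"
    unfolding is_differential_iff by auto
  then show "diffl (Suc i) \<in> module_homs P (F (Suc i)) (F i)" by (simp add: equivariant_homs_def)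
qed

text \<open>Submodules over two different rings have to be covered: a homogeneous component is one
  over \<open>A\<close>, the irrelevant multiples over \<open>R_n\<close>. This is the purpose of
  the auxiliary \<open>M'\<close>.\<close>

lemma bdry_submodule:
  assumes H: "submodule H R M'" and M': "module R M'" and g: "same_group M' (F i)" and v: "filling (Suc i) C bs"
    and b: "\<And>j. j \<le> Suc i \<Longrightarrow> var (C ! j) \<odot>\<^bsub>F i\<^esub> E i (rm j C) bs \<in> H"
  shows "bdry i C bs \<in> H"
  unfolding bdry_def same_group_finsum[OF g, symmetric] same_group_add_pow[OF g, symmetric]
  by (intro submodule_finsum[OF M' H] Pi_I submodule_add_pow[OF M' H] b) simp

lemma diffl_degree: "degree_preserving (F (Suc i)) (F i) (diffl (Suc i))"
proof (rule degree_preservingI[OF F_graded diffl_hom])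
  fix C bs assume v: "filling (Suc i) C bs"
  have "bdry i C bs \<in> hcomp (F i) (int d + int (Suc i))"
  proof (rule bdry_submodule[OF F_hcomp_submodule TT_module _ v])
    show "same_group (TT i) (F i)" by (simp add: same_group_def F_simps)
    fix j assume j: "j \<le> Suc i"
    have "var (C ! j) \<in> hcomp P (int d + int (Suc i) - int d - int i)"
      using mon_hcomp[of "{#C ! j#}"] filling_nth[OF v j] by simp
    then show "var (C ! j) \<odot>\<^bsub>F i\<^esub> E i (rm j C) bs \<in> hcomp (F i) (int d + int (Suc i))"
      unfolding E_smult[OF filling_rm[OF v j] var_carrier[OF filling_nth[OF v j]]]
      by (rule F_class_hcomp[OF filling_rm[OF v j]])
  qed
  then show "diffl (Suc i) (E (Suc i) C bs) \<in> hcomp (F i) (int d + int (Suc i))"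
    unfolding diffl_E[OF v] .
qed

lemma diffl_minimal: "diffl (Suc i) ` carrier (F (Suc i)) \<subseteq> irrelevant_multiples A n (F i)"
proof (rule image_subsetI)
  interpret M: module P "F i" by (rule F_module)
  let ?X = "{p \<odot>\<^bsub>F i\<^esub> m | p m. p \<in> Idl\<^bsub>P\<^esub> (A.indexed_var ` {1..n}) \<and> m \<in> carrier (F i)}"
  have vs: "A.indexed_var ` {1..n} \<subseteq> carrier P" using var_closed by blast
  have "Idl\<^bsub>P\<^esub> (A.indexed_var ` {1..n}) \<subseteq> carrier P"
    using P.genideal_ideal[OF vs] by (meson ideal.axioms(1) additive_subgroup.a_subset)
  then have X: "?X \<subseteq> carrier (F i)" by (auto intro!: M.smult_closed)
  have sub: "submodule (irrelevant_multiples A n (F i)) P (F i)"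
    unfolding irrelevant_multiples_def by (rule module_span_submodule[OF F_module X])
  fix x assume "x \<in> carrier (F (Suc i))"
  then show "diffl (Suc i) x \<in> irrelevant_multiples A n (F i)"
  proof (induction rule: F_induct)
    case (E C bs)
    show ?case
      unfolding diffl_E[OF E]
    proof (rule bdry_submodule[OF sub F_module _ E])
      fix j assume j: "j \<le> Suc i"
      have "var (C ! j) \<in> A.indexed_var ` {1..n}"
        using filling_nth[OF E j] unfolding var_eq by (rule imageI)
      then have "var (C ! j) \<in> Idl\<^bsub>P\<^esub> (A.indexed_var ` {1..n})"
        using P.genideal_self[OF vs] by blast
      then have "var (C ! j) \<odot>\<^bsub>F i\<^esub> E i (rm j C) bs \<in> ?X"
        using E_closed[OF filling_rm[OF E j]] by blast
      then show "var (C ! j) \<odot>\<^bsub>F i\<^esub> E i (rm j C) bs \<in> irrelevant_multiples A n (F i)"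
        unfolding irrelevant_multiples_def by (rule subsetD[OF module_span_superset])
    qed (simp add: same_group_def)
  qed (simp_all add: module_homsD[OF diffl_hom] M.submoduleE[OF sub]
      module_homs_zero[OF F_module F_module diffl_hom] submodule_zero[OF sub])
qed

text \<open>\<open>h\<close> is kept general because the formula serves both for coordinates of a
  second differential and for the augmentation.\<close>

lemma diffl_bdry:
  assumes h: "h \<in> module_homs P (F i) M" and M: "module P M" and v: "filling (Suc i) C bs"
  shows "h (bdry i C bs) = (\<Oplus>\<^bsub>M\<^esub>j\<in>{0..Suc i}. add_pow M ((- 1) ^ (Suc i - j) :: int)
    (var (C ! j) \<odot>\<^bsub>M\<^esub> h (E i (rm j C) bs)))"
proof -
  interpret M: module P M by (rule M)
  have "h (bdry i C bs) = (\<Oplus>\<^bsub>M\<^esub>j\<in>{0..Suc i}. h (add_pow (F i) ((- 1) ^ (Suc i - j) :: int)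
    (var (C ! j) \<odot>\<^bsub>F i\<^esub> E i (rm j C) bs)))"
    unfolding bdry_def using bdry_term_closed(2)[OF v]
    by (intro module_homs_finsum[OF F_module M h]) simp
  also have "\<dots> = (\<Oplus>\<^bsub>M\<^esub>j\<in>{0..Suc i}. add_pow M ((- 1) ^ (Suc i - j) :: int)
    (var (C ! j) \<odot>\<^bsub>M\<^esub> h (E i (rm j C) bs)))"
  proof (intro M.finsum_cong' refl Pi_I)
    fix j assume j: "j \<in> {0..Suc i}"
    then have j': "j \<le> Suc i" by simp
    note x = var_carrier[OF filling_nth[OF v j']] and e = E_closed[OF filling_rm[OF v j']]
    show "add_pow M ((- 1) ^ (Suc i - j) :: int) (var (C ! j) \<odot>\<^bsub>M\<^esub> h (E i (rm j C) bs)) \<in> carrier M"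
      by (rule M.add.int_pow_closed[OF M.smult_closed[OF x module_homs_closed[OF h e]]])
    show "h (add_pow (F i) ((- 1) ^ (Suc i - j) :: int) (var (C ! j) \<odot>\<^bsub>F i\<^esub> E i (rm j C) bs)) =
        add_pow M ((- 1) ^ (Suc i - j) :: int) (var (C ! j) \<odot>\<^bsub>M\<^esub> h (E i (rm j C) bs))"
      unfolding module_homs_add_pow[OF F_module M h bdry_term_closed(1)[OF v j]] module_homs_smult[OF h x e] ..
  qed
  finally show ?thesis .
qed

text \<open>The content is the case of two letters outside \<open>u\<close> and \<open>R\<close>:
  transposing the last two entries of the reference list changes the orientation sign.\<close>

lemma coefR_swap:
  assumes "u \<inter> set R = {}" "a \<noteq> b"
  shows "coefR u (R @ [b]) a C bs = (if b \<in> u \<union> set R then coefR u (R @ [b]) a C bs else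
    if a \<in> u \<union> set R then 0 else - coefR u (R @ [a]) b C bs)"
proof (cases "a \<in> u \<union> set R \<or> b \<in> u \<union> set R")
  case False
  have "orient (y # R @ [b, a]) C = - orient (y # R @ [a, b]) C" if y: "y \<in> u" for y
  proof (cases "a \<in> set C \<and> b \<in> set C")
    case True
    let ?t = "transpose a b"
    have "map ?t R = R" "?t y = y"
      using False y by (auto intro!: map_idI simp: transpose_def)
    then have m: "map ?t (y # R @ [a, b]) = y # R @ [b, a]" by simp
    have "orient (y # R @ [a, b]) (map ?t C) = - orient (y # R @ [a, b]) C"
      using orient_map[of ?t C] True assms(2) permutes_swap_id[of a "set C" b] by (simp add: sign_swap_id)
    moreover have "orient (map ?t (y # R @ [a, b])) (map ?t (map ?t C)) = orient (y # R @ [a, b]) (map ?t C)"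
      by (rule orient_rename[OF permutation_swap_id])
    moreover have "map ?t (map ?t C) = C" by (simp add: comp_def)
    ultimately show ?thesis unfolding m by simp
  next
    case False
    then have "set (y # R @ [b, a]) \<noteq> set C" "set (y # R @ [a, b]) \<noteq> set C" by auto
    then show ?thesis by (simp add: orient_zero)
  qed
  then show ?thesis
    using False assms(2) by (auto simp: coefR_def coef_def sum_negf insert_commute)
qed (auto simp: coefR_def)

text \<open>In a fixed coordinate the composite is a double sum over two removed letters. Exchanging
  their order keeps the monomial and reverses the sign of the coefficient.\<close>

lemma diffl_diffl:
  assumes x: "x \<in> carrier (F (Suc (Suc i)))"
  shows "diffl (Suc i) (diffl (Suc (Suc i)) x) = \<zero>\<^bsub>F i\<^esub>"
proof -
  interpret M: module P "F i" by (rule F_module)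
  have "(\<lambda>x. \<zero>\<^bsub>F i\<^esub>) \<in> module_homs P (F (Suc (Suc i))) (F i)"
    by (rule module_homsI) simp_all
  note hz = this
  show ?thesis
  proof (rule F_homs_eq[OF F_module module_homs_comp[OF diffl_hom diffl_hom] hz _ x])
    fix C bs assume v: "filling (Suc (Suc i)) C bs"
    note c = module_homs_closed[OF diffl_hom bdry_closed[OF v]]
    have "diffl (Suc i) (bdry (Suc i) C bs) = \<zero>\<^bsub>F i\<^esub>"
    proof (rule F_eqI[OF c M.zero_closed])
      fix p assume p: "p \<in> idx i"
      obtain u S where pu: "p = (u, S)" by (cases p)
      note p' = p[unfolded pu]
      \<comment> \<open>The contribution of removing \<open>a\<close> first and \<open>b\<close>
        second. The later letter is the one next to \<open>S\<close> in the reference list, since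
        \<open>coefR\<close> appends at the end.\<close>
      define f where "f a b = (if b \<in> u \<union> S then zero P
        else add_pow P (coefR u (srt S @ [b]) a C bs) (mon {#a, b#}))" for a b
      have S: "set (srt S) = S" using idxD(2)[OF p'] by simp
      have m2: "mon {#a, b#} \<in> carrier P" if "a \<in> {1..n}" "b \<in> {1..n}" for a b
        using that by (intro mon_closed) simp
      have fc: "f a b \<in> carrier P" if "a \<in> {1..n}" "b \<in> {1..n}" for a b
        using P.add.int_pow_closed[OF m2[OF that]] P_zero_closed by (simp add: f_def)
      have hom: "(\<lambda>x. kap i p (diffl (Suc i) x)) \<in> module_homs P (F (Suc i)) PP"
        by (rule module_homs_comp[OF diffl_hom kap_hom[OF p]])
      have "kap i p (diffl (Suc i) (bdry (Suc i) C bs)) =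
          (\<Oplus>\<^bsub>P\<^esub>j\<in>{0..Suc (Suc i)}. add_pow P ((- 1) ^ (Suc (Suc i) - j) :: int)
            (var (C ! j) \<otimes>\<^bsub>P\<^esub> kap i p (diffl (Suc i) (E (Suc i) (rm j C) bs))))"
        using diffl_bdry[OF hom PP_module v]
        by (simp only: same_group_finsum[OF same_group_PP] same_group_add_pow[OF same_group_PP] PP_simps)
      also have "\<dots> = (\<Oplus>\<^bsub>P\<^esub>j\<in>{0..Suc (Suc i)}. \<Oplus>\<^bsub>P\<^esub>b\<in>{1..n}. f (C ! j) b)"
      proof (intro P.finsum_cong' refl Pi_I P.finsum_closed fc)
        fix j assume "j \<in> {0..Suc (Suc i)}"
        then have j: "j \<le> Suc (Suc i)" by simp
        show "C ! j \<in> {1..n}" by (rule filling_nth[OF v j])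
        note x = var_carrier[OF filling_nth[OF v j]] and w = filling_rm[OF v j]
        let ?e = "(- 1) ^ (Suc (Suc i) - j) :: int"
        have t: "add_pow P (coefR u (srt S) b (rm j C) bs) (var b) \<in> carrier P" if "b \<in> {1..n}" for b
          by (rule P.add.int_pow_closed[OF var_carrier[OF that]])
        have "add_pow P ?e (var (C ! j) \<otimes>\<^bsub>P\<^esub> kap i p (diffl (Suc i) (E (Suc i) (rm j C) bs)))
          = add_pow P ?e (var (C ! j) \<otimes>\<^bsub>P\<^esub> (\<Oplus>\<^bsub>P\<^esub>b\<in>{1..n}. add_pow P (coefR u (srt S) b (rm j C) bs) (var b)))"
          unfolding diffl_E[OF w] pu kap_bdry[OF w p'] ..
        also have "\<dots> = add_pow P ?e (\<Oplus>\<^bsub>P\<^esub>b\<in>{1..n}. var (C ! j) \<otimes>\<^bsub>P\<^esub> add_pow P (coefR u (srt S) b (rm j C) bs) (var b))"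
          using t by (subst P.finsum_rdistr[OF _ x]) auto
        also have "\<dots> = (\<Oplus>\<^bsub>P\<^esub>b\<in>{1..n}. add_pow P ?e (var (C ! j) \<otimes>\<^bsub>P\<^esub> add_pow P (coefR u (srt S) b (rm j C) bs) (var b)))"
          using t x by (intro P.additive_finsum P.add.int_pow_closed) (auto simp: P.add.int_pow_distrib)
        also have "\<dots> = (\<Oplus>\<^bsub>P\<^esub>b\<in>{1..n}. f (C ! j) b)"
        proof (intro P.finsum_cong' refl Pi_I fc filling_nth[OF v j])
          fix b assume b: "b \<in> {1..n}"
          have "?e * coefR u (srt S) b (rm j C) bs = (if b \<in> u \<union> S then 0 else coefR u (srt S @ [b]) (C ! j) C bs)"
            using coefR_rm[OF v j, of u "srt S @ [b]"] S by (auto simp: coefR_def[of u "srt S"])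
          then show "add_pow P ?e (var (C ! j) \<otimes>\<^bsub>P\<^esub> add_pow P (coefR u (srt S) b (rm j C) bs) (var b)) = f (C ! j) b"
            unfolding mult_add_pow[OF x var_carrier[OF b]] mon_mult_mon add_mset_add_single[symmetric]
              add_mset_commute[of b] add_pow_add_pow[OF m2[OF filling_nth[OF v j] b]] f_def
            by (simp add: add_pow_def[of _ "0::int"])
        qed
        finally show "add_pow P ?e (var (C ! j) \<otimes>\<^bsub>P\<^esub> kap i p (diffl (Suc i) (E (Suc i) (rm j C) bs)))
          = (\<Oplus>\<^bsub>P\<^esub>b\<in>{1..n}. f (C ! j) b)" .
      qed
      also have "\<dots> = (\<Oplus>\<^bsub>P\<^esub>a\<in>{1..n}. \<Oplus>\<^bsub>P\<^esub>b\<in>{1..n}. f a b)"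
      proof (rule finsum_column[OF v P.abelian_group_axioms])
        show "(\<Oplus>\<^bsub>P\<^esub>b\<in>{1..n}. f a b) \<in> carrier P" if "a \<in> {1..n}" for a
          using fc that by (intro P.finsum_closed) simp
        show "(\<Oplus>\<^bsub>P\<^esub>b\<in>{1..n}. f a b) = zero P" if "a \<in> {1..n} - set C" for a
          using that by (intro P.add.finprod_one_eqI) (simp add: f_def coefR_zero add_pow_def[of _ "0::int"])
      qed
      also have "\<dots> = zero P"
      proof (rule P.finsum_antisymmetric)
        show "f a a = zero P" if "a \<in> {1..n}" for a
          by (simp add: f_def coefR_def add_pow_def[of _ "0::int"])
        show "f a b = \<ominus>\<^bsub>P\<^esub> f b a" if ab: "a \<in> {1..n}" "b \<in> {1..n}" for a b
        proof (cases "a = b \<or> b \<in> u \<union> S \<or> a \<in> u \<union> S")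
          case True
          then show ?thesis using S
            by (auto simp: f_def coefR_def add_pow_def[of _ "0::int"])
        next
          case False
          then have "coefR u (srt S @ [b]) a C bs = - coefR u (srt S @ [a]) b C bs"
            using coefR_swap[of u "srt S" a b C bs] idxD(6)[OF p'] S by simp
          then show ?thesis
            using False m2[OF ab(2,1)] by (simp add: f_def add_mset_commute P.add.int_pow_neg)
        qed
      qed (use fc in auto)
      finally show "kap i p (diffl (Suc i) (bdry (Suc i) C bs)) = kap i p \<zero>\<^bsub>F i\<^esub>"
        using kap_zero[OF p] by simp
    qed
    then show "diffl (Suc i) (diffl (Suc (Suc i)) (E (Suc (Suc i)) C bs)) = \<zero>\<^bsub>F i\<^esub>"
      unfolding diffl_E[OF v] .
  qed
qed

end

context hooks
begin

subsection \<open>The ideal and the augmentation\<close>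

text \<open>This is the ideal itself, described by coefficients: a monomial is divisible by a
  squarefree one of degree \<open>d\<close> exactly if it involves at least \<open>d\<close>
  variables.\<close>

definition J :: "(nat multiset \<Rightarrow> 'a) set"
  where "J = {p \<in> carrier P. \<forall>m. p m \<noteq> \<zero>\<^bsub>A\<^esub> \<longrightarrow> d \<le> card (set_mset m)}"

lemma J_carrier: "p \<in> J \<Longrightarrow> p \<in> carrier P" by (simp add: J_def)

lemma J_submodule_A: "submodule J A P"
proof (rule submodule_by_closure[OF P_module])
  show "zero P \<in> J" using P_zero_closed by (simp add: J_def P_simps)
  show "p \<oplus>\<^bsub>P\<^esub> q \<in> J" if "p \<in> J" "q \<in> J" for p q
  proof -
    have "d \<le> card (set_mset m)" if "(p \<oplus>\<^bsub>P\<^esub> q) m \<noteq> \<zero>\<^bsub>A\<^esub>" for m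
    proof -
      have "p m \<noteq> \<zero>\<^bsub>A\<^esub> \<or> q m \<noteq> \<zero>\<^bsub>A\<^esub>" using that by (auto simp: P_simps)
      then show ?thesis using \<open>p \<in> J\<close> \<open>q \<in> J\<close> by (auto simp: J_def)
    qed
    then show ?thesis using P.add.m_closed[of p q] that by (simp add: J_def)
  qed
  show "a \<odot>\<^bsub>P\<^esub> p \<in> J" if "a \<in> carrier A" "p \<in> J" for a p
  proof -
    have "d \<le> card (set_mset m)" if "(a \<odot>\<^bsub>P\<^esub> p) m \<noteq> \<zero>\<^bsub>A\<^esub>" for m
    proof -
      have "p m \<noteq> \<zero>\<^bsub>A\<^esub>" using that \<open>a \<in> carrier A\<close> by (auto simp: P_simps)
      then show ?thesis using \<open>p \<in> J\<close> by (auto simp: J_def)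
    qed
    then show ?thesis using PA.smult_closed[of a p] that by (simp add: J_def)
  qed
qed (simp add: J_def)

lemma J_mult:
  assumes p: "p \<in> carrier P" and q: "q \<in> J"
  shows "p \<otimes>\<^bsub>P\<^esub> q \<in> J"
proof -
  have qc: "q \<in> carrier P" by (rule J_carrier[OF q])
  have "d \<le> card (set_mset m)" if "(p \<otimes>\<^bsub>P\<^esub> q) m \<noteq> \<zero>\<^bsub>A\<^esub>" for m
  proof -
    have "\<exists>m'. m' \<subseteq># m \<and> p m' \<otimes>\<^bsub>A\<^esub> q (m - m') \<noteq> \<zero>\<^bsub>A\<^esub>"
    proof (rule ccontr)
      assume "\<nexists>m'. m' \<subseteq># m \<and> p m' \<otimes>\<^bsub>A\<^esub> q (m - m') \<noteq> \<zero>\<^bsub>A\<^esub>"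
      then have "(p \<otimes>\<^bsub>P\<^esub> q) m = (\<Oplus>\<^bsub>A\<^esub>m'\<in>{m'. m' \<subseteq># m}. \<zero>\<^bsub>A\<^esub>)"
        unfolding P_simps by (intro A.finsum_cong') auto
      then show False using that by simp
    qed
    then obtain m' where "q (m - m') \<noteq> \<zero>\<^bsub>A\<^esub>"
      using P_coeff[OF p] by (metis A.r_null)
    then have "d \<le> card (set_mset (m - m'))" using q by (simp add: J_def)
    also have "\<dots> \<le> card (set_mset m)" by (intro card_mono) (auto dest: in_diffD)
    finally show ?thesis .
  qed
  then show ?thesis using P_mult_closed[OF p qc] by (simp add: J_def)
qed

lemma mon_J: "set_mset m \<subseteq> {1..n} \<Longrightarrow> d \<le> card (set_mset m) \<Longrightarrow> mon m \<in> J"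
  using mon_closed by (simp add: J_def unit_vec_def)

lemma mon_square_J: "W \<subseteq> {1..n} \<Longrightarrow> card W = d \<Longrightarrow> mon (mset_set W) \<in> J"
  using finite_subset[of W "{1..n}"] by (intro mon_J) auto

lemma J_submodule: "submodule J P PP"
proof (rule submodule_by_closure[OF PP_module])
  have J: "subgroup J (add_monoid P)" by (rule submodule.axioms(1)[OF J_submodule_A])
  show "zero PP \<in> J" using subgroup.one_closed[OF J] by (simp add: PP_simps)
  show "p \<oplus>\<^bsub>PP\<^esub> q \<in> J" if "p \<in> J" "q \<in> J" for p q
    using subgroup.m_closed[OF J that] by (simp add: PP_simps)
qed (auto simp: PP_simps J_mult J_carrier)

text \<open>Any monomial with at least \<open>d\<close> variables in its support is a multiple of a
  squarefree generator. The statement is about arbitrary submodules because it serves twice, for the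
  generated ideal and for the image of the augmentation.\<close>

lemma J_minimal:
  assumes H: "submodule H P PP" and gen: "\<And>W. W \<subseteq> {1..n} \<Longrightarrow> card W = d \<Longrightarrow> mon (mset_set W) \<in> H"
  shows "J \<subseteq> H"
proof
  interpret Q: module P PP by (rule PP_module)
  fix p assume p: "p \<in> J"
  have pc: "p \<in> carrier (free_module A Mon)" using J_carrier[OF p] P_carrier by simp
  have m: "mon m \<in> H" if m: "set_mset m \<subseteq> {1..n}" "d \<le> card (set_mset m)" for m
  proof -
    obtain W where W: "W \<subseteq> set_mset m" "card W = d" using m(2) by (meson obtain_subset_with_card_n)
    have "finite W" using W(1) finite_subset by blast
    then have sub: "mset_set W \<subseteq># m"
      using W(1) by (intro mset_subset_eqI) (auto simp: count_mset_set' Suc_le_eq)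
    have "mon (m - mset_set W) \<otimes>\<^bsub>P\<^esub> mon (mset_set W) = mon m"
      using sub by (simp add: mon_mult_mon)
    moreover have "mon (m - mset_set W) \<in> carrier P"
      using m(1) by (intro mon_closed) (auto dest: in_diffD)
    ultimately show ?thesis
      using Q.submoduleE(4)[OF H _ gen[of W], of "mon (m - mset_set W)"] W m(1) by (simp add: PP_simps)
  qed
  have HA: "submodule H A P"
  proof (rule submodule_by_closure[OF P_module])
    show Hc: "H \<subseteq> carrier P" using Q.submoduleE(1)[OF H] by (simp add: PP_simps)
    show "zero P \<in> H" using submodule_zero[OF H] by (simp add: PP_simps)
    show "p \<oplus>\<^bsub>P\<^esub> q \<in> H" if "p \<in> H" "q \<in> H" for p q
      using Q.submoduleE(5)[OF H that] by (simp add: PP_simps)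
    show "a \<odot>\<^bsub>P\<^esub> q \<in> H" if "a \<in> carrier A" "q \<in> H" for a q
      using Q.submoduleE(4)[OF H const_closed[OF that(1)] that(2)] const_mult(1)[OF that(1) subsetD[OF Hc that(2)]]
      by (simp add: PP_simps)
  qed
  have "p = (\<Oplus>\<^bsub>P\<^esub>m\<in>{m. p m \<noteq> \<zero>\<^bsub>A\<^esub>}. p m \<odot>\<^bsub>P\<^esub> mon m)"
    unfolding same_group_finsum[OF same_group_P]
    using free_module_expand[OF A pc] by (simp add: free_module_simps[OF A] P_simps)
  also have "\<dots> \<in> H"
  proof (rule submodule_finsum[OF P_module HA], rule Pi_I)
    fix k assume "k \<in> {m. p m \<noteq> \<zero>\<^bsub>A\<^esub>}"
    then have "p k \<noteq> \<zero>\<^bsub>A\<^esub>" by simp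
    then have "mon k \<in> H" using p by (intro m) (auto simp: J_def P_carrier_iff)
    then show "p k \<odot>\<^bsub>P\<^esub> mon k \<in> H"
      by (rule PA.submoduleE(4)[OF HA P_coeff[OF J_carrier[OF p]]])
  qed
  finally show "p \<in> H" .
qed

lemma squarefree_ideal_eq: "squarefree_ideal A d n = J"
proof -
  let ?G = "{finprod P A.indexed_var S | S. S \<subseteq> {1..n} \<and> card S = d}"
  have Ge: "?G = {mon (mset_set S) | S. S \<subseteq> {1..n} \<and> card S = d}"
    using finprod_var by (intro Collect_cong) metis
  have G: "?G \<subseteq> J" unfolding Ge using mon_square_J by blast
  have Jc: "J \<subseteq> carrier P" using J_carrier by blast
  have "ideal J P"
  proof (rule idealI[OF P.ring_axioms submodule.axioms(1)[OF J_submodule_A]])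
    show "x \<otimes>\<^bsub>P\<^esub> a \<in> J" if "a \<in> J" "x \<in> carrier P" for a x
      by (rule J_mult[OF that(2,1)])
    then show "a \<otimes>\<^bsub>P\<^esub> x \<in> J" if "a \<in> J" "x \<in> carrier P" for a x
      using that P.m_comm[OF J_carrier[OF that(1)] that(2)] by simp
  qed
  then have 1: "Idl\<^bsub>P\<^esub> ?G \<subseteq> J" using G by (rule P.genideal_minimal)
  have id: "ideal (Idl\<^bsub>P\<^esub> ?G) P" using G Jc by (intro P.genideal_ideal) (rule subset_trans)
  have "submodule (Idl\<^bsub>P\<^esub> ?G) P PP"
  proof (rule submodule_by_closure[OF PP_module])
    show "Idl\<^bsub>P\<^esub> ?G \<subseteq> carrier PP" using 1 Jc by (simp add: PP_simps)
    show "zero PP \<in> Idl\<^bsub>P\<^esub> ?G"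
      using additive_subgroup.zero_closed[OF ideal.axioms(1)[OF id]] by (simp add: PP_simps)
    show "x \<oplus>\<^bsub>PP\<^esub> y \<in> Idl\<^bsub>P\<^esub> ?G" if "x \<in> Idl\<^bsub>P\<^esub> ?G" "y \<in> Idl\<^bsub>P\<^esub> ?G" for x y
      using additive_subgroup.a_closed[OF ideal.axioms(1)[OF id] that] by (simp add: PP_simps)
    show "r \<odot>\<^bsub>PP\<^esub> x \<in> Idl\<^bsub>P\<^esub> ?G" if "r \<in> carrier P" "x \<in> Idl\<^bsub>P\<^esub> ?G" for r x
      using ideal.I_l_closed[OF id that(2,1)] by (simp add: PP_simps)
  qed
  moreover have "mon (mset_set W) \<in> Idl\<^bsub>P\<^esub> ?G" if "W \<subseteq> {1..n}" "card W = d" for W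
  proof -
    have "mon (mset_set W) \<in> ?G" unfolding Ge using that by blast
    moreover have "?G \<subseteq> Idl\<^bsub>P\<^esub> ?G" using G Jc by (intro P.genideal_self) (rule subset_trans)
    ultimately show ?thesis by (rule subsetD[rotated])
  qed
  ultimately have "J \<subseteq> Idl\<^bsub>P\<^esub> ?G" by (rule J_minimal)
  then show ?thesis using 1 unfolding squarefree_ideal_def by (rule subset_antisym[rotated])
qed

abbreviation "II \<equiv> squarefree_ideal_module A d n"

lemma II_simps: "carrier II = J" "zero II = zero P" "add II = add P" "smult II = monoid.mult P"
  "act II = act P" "hcomp II k = J \<inter> hcomp P k"
  by (simp_all add: squarefree_ideal_module_def squarefree_ideal_eq)

lemma II_module: "module P II"
proof (rule same_group_module[OF submodule.submodule_is_module[OF J_submodule PP_module]])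
qed (simp_all add: same_group_def II_simps PP_simps)

lemma II_inclusion: "(\<lambda>x. x) \<in> module_homs P II PP"
  by (rule module_homsI) (simp_all add: II_simps PP_simps J_carrier)

lemma II_finsum: "f \<in> I \<rightarrow> J \<Longrightarrow> (\<Oplus>\<^bsub>II\<^esub>i\<in>I. f i) = (\<Oplus>\<^bsub>P\<^esub>i\<in>I. f i)"
  using module_homs_finsum[OF II_module PP_module II_inclusion, of f I]
  by (simp add: II_simps same_group_finsum[OF same_group_PP])

lemma act_J:
  assumes s: "s permutes {1..n}" and p: "p \<in> J"
  shows "act P s p \<in> J"
proof -
  have "d \<le> card (set_mset m)" if "act P s p m \<noteq> \<zero>\<^bsub>A\<^esub>" for m
  proof -
    have "p (image_mset (inv_into UNIV s) m) \<noteq> \<zero>\<^bsub>A\<^esub>" using that by (simp add: act_P)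
    then have "d \<le> card (inv_into UNIV s ` set_mset m)" using p by (auto simp: J_def)
    also have "\<dots> \<le> card (set_mset m)" by (rule card_image_le) simp
    finally show ?thesis .
  qed
  then show ?thesis using module_homs_closed[OF act_P_hom[OF s] J_carrier[OF p]] by (simp add: J_def)
qed

lemma II_equivariant: "equivariant_module A n II"
  unfolding equivariant_module_def II_simps
proof (intro conjI allI impI ballI II_module)
  show "act P s \<in> J \<rightarrow> J" if "s permutes {1..n}" for s using act_J[OF that] by simp
  fix s assume s: "s permutes {1..n}"
  note h = module_homsD[OF act_P_hom[OF s]]
  show "act P s (x \<oplus>\<^bsub>P\<^esub> y) = act P s x \<oplus>\<^bsub>P\<^esub> act P s y" if "x \<in> J" "y \<in> J" for x y
    using h(2) that J_carrier by blast
  show "act P s (p \<otimes>\<^bsub>P\<^esub> x) = act P s p \<otimes>\<^bsub>P\<^esub> act P s x" if "p \<in> carrier P" "x \<in> J" for p x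
    by (rule act_P_mult[OF s that(1) J_carrier[OF that(2)]])
  show "act P s (A.indexed_const a \<otimes>\<^bsub>P\<^esub> x) = A.indexed_const a \<otimes>\<^bsub>P\<^esub> act P s x"
    if "a \<in> carrier A" "x \<in> J" for a x
    using act_P_mult[OF s const_closed[OF that(1)] J_carrier[OF that(2)]] by (simp add: act_P_const[OF s])
qed (simp_all only: act_P_id act_P_comp)

lemma hproj_J: "p \<in> J \<Longrightarrow> hproj k p \<in> J"
  using module_homs_closed[OF hproj_hom J_carrier] by (auto simp: J_def hproj_def)

lemma II_graded: "graded_module P II"
proof (rule graded_moduleI[OF II_module, where \<pi> = hproj])
  have hc: "submodule (hcomp P k) A P" for k
  proof (rule submodule_by_closure[OF P_module])
    show "hcomp P k \<subseteq> carrier P" "zero P \<in> hcomp P k"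
      using P_zero_closed by (auto simp: hcomp_P) (simp add: P_simps)
    show "x \<oplus>\<^bsub>P\<^esub> y \<in> hcomp P k" if "x \<in> hcomp P k" "y \<in> hcomp P k" for x y
    proof -
      have "x m \<noteq> \<zero>\<^bsub>A\<^esub> \<or> y m \<noteq> \<zero>\<^bsub>A\<^esub>" if "(x \<oplus>\<^bsub>P\<^esub> y) m \<noteq> \<zero>\<^bsub>A\<^esub>" for m
        using that by (auto simp: P_simps)
      then show ?thesis using that P.add.m_closed[of x y] by (fastforce simp: hcomp_P)
    qed
    show "r \<odot>\<^bsub>P\<^esub> x \<in> hcomp P k" if "r \<in> carrier A" "x \<in> hcomp P k" for r x
    proof -
      have "x m \<noteq> \<zero>\<^bsub>A\<^esub>" if "(r \<odot>\<^bsub>P\<^esub> x) m \<noteq> \<zero>\<^bsub>A\<^esub>" for m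
        using that \<open>r \<in> carrier A\<close> by (auto simp: P_simps)
      then show ?thesis using that PA.smult_closed[of r x] by (fastforce simp: hcomp_P)
    qed
  qed
  show "additive_subgroup (hcomp II k) II" for k
  proof -
    have "submodule (J \<inter> hcomp P k) A (res II)"
      using PA.submoduleE(4,5)[OF hc] PA.submoduleE(4,5)[OF J_submodule_A] submodule_zero[OF hc] submodule_zero[OF J_submodule_A]
      by (intro submodule_by_closure[OF res_module[OF II_module]])
        (simp_all add: res_simps II_simps const_mult J_carrier)
    then have "subgroup (J \<inter> hcomp P k) (add_monoid II)"
      by (rule same_group_subgroup[OF res_simps(5), THEN iffD1, OF submodule.axioms(1)])
    then show ?thesis unfolding II_simps(6) by (rule additive_subgroupI)
  qed
  show "hproj k x \<in> hcomp II k" if "x \<in> carrier II" for k x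
    using that hproj_J hproj_closed J_carrier by (simp add: II_simps)
  show "hproj k (x \<oplus>\<^bsub>II\<^esub> y) = hproj k x \<oplus>\<^bsub>II\<^esub> hproj k y" if "x \<in> carrier II" "y \<in> carrier II" for k x y
    using that module_homs_add[OF hproj_hom] J_carrier by (simp add: II_simps)
  show "hproj j x = (if j = k then x else \<zero>\<^bsub>II\<^esub>)" if "x \<in> hcomp II k" for j k x
    using that hproj_hcomp[of x k j] by (auto simp: II_simps)
  show "proj_sum II hproj x" if x: "x \<in> carrier II" for x
  proof -
    have xJ: "x \<in> J" using x by (simp add: II_simps)
    obtain S where "finite S" "\<forall>k. k \<notin> S \<longrightarrow> hproj k x = zero P" "x = (\<Oplus>\<^bsub>P\<^esub>k\<in>S. hproj k x)"
      using finsum_hproj[OF J_carrier[OF xJ]] by blast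
    then show ?thesis
      unfolding proj_sum_def using hproj_J[OF xJ] II_finsum[of "\<lambda>k. hproj k x" S]
      by (intro exI[of _ S]) (simp add: II_simps)
  qed
  show "p \<odot>\<^bsub>II\<^esub> m \<in> hcomp II (j + k)" if "p \<in> hcomp P j" "m \<in> hcomp II k" for j k p m
  proof -
    have m: "m \<in> J" "m \<in> hcomp P k" using that(2) by (simp_all add: II_simps)
    have "p \<in> carrier P" using that(1) by (simp add: hcomp_P)
    from J_mult[OF this m(1)] hcomp_mult[OF that(1) m(2)] show ?thesis by (simp add: II_simps)
  qed
qed

abbreviation "content C bs \<equiv> mset_set (set C \<union> set bs)"

lemma filling_content:
  assumes "filling i C bs"
  shows "set C \<union> set bs \<subseteq> {1..n}" "card (set C \<union> set bs) = d + i"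
proof -
  have v: "length C = Suc i" "Suc (length bs) = d" "distinct (C @ bs)" "set (C @ bs) \<subseteq> {1..n}"
    using assms by (simp_all add: hook_filling_def)
  then show "set C \<union> set bs \<subseteq> {1..n}" by simp
  have "card (set (C @ bs)) = length (C @ bs)" using v(3) by (rule distinct_card)
  then show "card (set C \<union> set bs) = d + i" using v(1,2) by simp
qed

lemma content_J: "filling 0 C bs \<Longrightarrow> mon (content C bs) \<in> J"
  using filling_content[of 0 C bs] by (intro mon_square_J) auto

text \<open>For \<open>i = 0\<close> the column is just the corner: it has no nontrivial
  permutation, and the shuffle has a single term, which exchanges the corner with a row letter. None
  of this changes the product of all letters.\<close>

lemma augmentation_relations: "hook_relations d n 0 II (\<lambda>C bs. mon (content C bs))"
proof (rule hook_relationsI)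
  interpret I: module P II by (rule II_module)
  note cl = content_J[folded II_simps(1)]
  show "mon (content C bs) \<in> carrier II" if "filling 0 C bs" for C bs by (rule cl[OF that])
  show "mon (content (map s C) bs) = add_pow II (sign s) (mon (content C bs))"
    if v: "filling 0 C bs" and s: "s permutes set C" for C bs s
  proof -
    obtain c where "C = [c]" using v by (auto simp: hook_filling_def length_Suc_conv)
    then have "s = id" using s by (metis list.set(1) list.simps(15) permutes_sing)
    then show ?thesis using cl[OF v] by (simp add: sign_id)
  qed
  show "mon (content C (ps @ y # x # l)) = mon (content C (ps @ x # y # l))" for C ps x y l
    by (simp add: insert_commute)
  show "mon (content C (b # l)) = (\<Oplus>\<^bsub>II\<^esub>r\<in>{..<length C}. mon (content (C[r := b]) (C ! r # l)))"
    if v: "filling 0 C (b # l)" for C b l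
  proof -
    obtain c where C: "C = [c]" using v by (auto simp: hook_filling_def length_Suc_conv)
    have "{..<length C} = {0}" by (auto simp: C)
    moreover have "(\<Oplus>\<^bsub>II\<^esub>r\<in>{0}. mon (content (C[r := b]) (C ! r # l))) = mon (content (C[0 := b]) (C ! 0 # l))"
      using cl[OF shuffle_step[OF v, of 0]] C I.r_zero by (subst I.finsum_insert) simp_all
    ultimately show ?thesis by (simp add: C insert_commute)
  qed
qed

text \<open>A one-row tableau goes to the product of its variables. The signs of the differential
  play against this choice in \<open>aug_diffl\<close>; the map is picked by \<open>SOME\<close>
  from \<open>F_lift\<close> and is determined on the carrier by its values on generators.\<close>

definition aug :: "((nat list list \<Rightarrow> 'a) set \<times> (nat multiset \<Rightarrow> 'a) \<Rightarrow> 'a) set \<Rightarrow> nat multiset \<Rightarrow> 'a"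
  where "aug = (SOME h. h \<in> module_homs P (F 0) II \<and>
    (\<forall>C bs. filling 0 C bs \<longrightarrow> h (E 0 C bs) = mon (content C bs)))"

lemma
  shows aug_hom: "aug \<in> module_homs P (F 0) II"
    and aug_E: "filling 0 C bs \<Longrightarrow> aug (E 0 C bs) = mon (content C bs)"
proof -
  have "aug \<in> module_homs P (F 0) II \<and> (\<forall>C bs. filling 0 C bs \<longrightarrow> aug (E 0 C bs) = mon (content C bs))"
    unfolding aug_def using F_lift[OF II_module augmentation_relations]
    by (intro someI_ex[of "\<lambda>h. h \<in> module_homs P (F 0) II \<and> _ h"]) blast
  then show "aug \<in> module_homs P (F 0) II"
    "filling 0 C bs \<Longrightarrow> aug (E 0 C bs) = mon (content C bs)" by auto
qed

lemma aug_equivariant: "aug \<in> equivariant_homs A n (F 0) II"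
  unfolding equivariant_homs_def
proof (intro CollectI conjI allI impI ballI aug_hom)
  fix s x assume s: "s permutes {1..n}" and x: "x \<in> carrier (F 0)"
  note a = module_homsD[OF act_F_hom[OF s, of 0], folded F_simps(1)]
  note h = module_homsD[OF aug_hom]
  show "aug (act (F 0) s x) = act II s (aug x)"
    using x
  proof (induction rule: F_induct)
    case (E C bs)
    have "image_mset s (content C bs) = content (map s C) (map s bs)"
      using permutes_inj_on[OF s] by (simp add: image_mset_mset_set image_Un)
    then show ?case
      using s E by (simp add: act_F_E aug_E global_perm_step II_simps act_P_mon)
  next
    case (add x y)
    have "act (F 0) s (x \<oplus>\<^bsub>F 0\<^esub> y) = act (F 0) s x \<oplus>\<^bsub>F 0\<^esub> act (F 0) s y"
      using a(2)[OF add(1,2)[unfolded F_simps(1), folded F_simps(1)]] by (simp add: F_simps(3))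
    moreover have "act P s (aug x \<oplus>\<^bsub>P\<^esub> aug y) = act P s (aug x) \<oplus>\<^bsub>P\<^esub> act P s (aug y)"
      using h(1)[OF add(1)] h(1)[OF add(2)] module_homs_add[OF act_P_hom[OF s]] J_carrier by (simp add: II_simps)
    ultimately show ?case
      using add h(2)[OF add(1,2)] h(2)[OF a(1)[OF add(1)] a(1)[OF add(2)]] by (simp add: II_simps)
  next
    case (smult p x)
    show ?case
      using smult(3) h(3)[OF smult(1,2)] act_F_smult[OF s smult(1,2)]
        h(3)[OF module_homs_closed[OF act_P_hom[OF s] smult(1)] a(1)[OF smult(2)]]
        act_P_mult[OF s smult(1) J_carrier, of "aug x"] h(1)[OF smult(2)] by (simp add: II_simps)
  next
    case zero
    have "act (F 0) s \<zero>\<^bsub>F 0\<^esub> = \<zero>\<^bsub>F 0\<^esub>"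
      unfolding F_simps(2) by (rule module_homs_zero[OF TT_module TT_module act_F_hom[OF s]])
    moreover have "act P s (zero P) = zero P" by (rule module_homs_zero[OF P_module P_module act_P_hom[OF s]])
    ultimately show ?case using module_homs_zero[OF F_module II_module aug_hom] by (simp add: II_simps)
  qed
qed

lemma aug_degree: "degree_preserving (F 0) II aug"
proof (rule degree_preservingI[OF II_graded aug_hom])
  fix C bs assume v: "filling 0 C bs"
  have "set_mset (content C bs) \<subseteq> {1..n}" using filling_content(1)[OF v] by simp
  from mon_hcomp[OF this] have "mon (content C bs) \<in> hcomp P (int d)"
    using filling_content(2)[OF v] by simp
  then show "aug (E 0 C bs) \<in> hcomp II (int d + int 0)"
    using content_J[OF v] by (simp add: aug_E[OF v] II_simps)
qed

lemma aug_bas: "(u, {}) \<in> idx 0 \<Longrightarrow> aug (bas 0 (u, {})) = mon (mset_set u)"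
  using aug_E[OF filling_basis] set_basis by (simp add: bas_def)

lemma aug_surj: "aug ` carrier (F 0) = carrier II"
proof
  show "aug ` carrier (F 0) \<subseteq> carrier II" using module_homs_closed[OF aug_hom] by blast
  have im: "submodule (aug ` carrier (F 0)) P II" by (rule submodule_image[OF F_module II_module aug_hom])
  interpret I: module P II by (rule II_module)
  have "submodule (aug ` carrier (F 0)) P PP"
    using I.submoduleE(1,4,5)[OF im] submodule_zero[OF im] J_carrier
    by (intro submodule_by_closure[OF PP_module]) (auto simp: II_simps PP_simps)
  moreover have "mon (mset_set W) \<in> aug ` carrier (F 0)" if "W \<subseteq> {1..n}" "card W = d" for W
  proof -
    have "(W, {}) \<in> idx 0" using that by (simp add: idx_def)
    then show ?thesis using aug_bas bas_closed by (metis imageI)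
  qed
  ultimately show "carrier II \<subseteq> aug ` carrier (F 0)" unfolding II_simps by (rule J_minimal)
qed

text \<open>The column has two letters. Removing either and multiplying by its variable restores the
  same monomial, and the two terms carry opposite signs.\<close>

lemma aug_diffl:
  assumes x: "x \<in> carrier (F 1)"
  shows "aug (diffl 1 x) = \<zero>\<^bsub>II\<^esub>"
proof -
  interpret I: module P II by (rule II_module)
  have 1: "(1::nat) = Suc 0" by simp
  have hz: "(\<lambda>x. \<zero>\<^bsub>II\<^esub>) \<in> module_homs P (F (Suc 0)) II" by (rule module_homsI) simp_all
  show ?thesis
    unfolding 1
  proof (rule F_homs_eq[OF II_module module_homs_comp[OF diffl_hom aug_hom] hz _ x[unfolded 1]])
    fix C bs assume v: "filling (Suc 0) C bs"
    obtain a b where C: "C = [a, b]" using v by (auto simp: hook_filling_def length_Suc_conv)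
    have ab: "a \<noteq> b" "a \<notin> set bs" "b \<notin> set bs" using v by (auto simp: C hook_filling_def)
    let ?m = "mon (content C bs)"
    have mJ: "?m \<in> J"
      using filling_content[OF v] by (intro mon_J) auto
    then have mc: "?m \<in> carrier II" by (simp only: II_simps)
    have m0: "var (C ! 0) \<otimes>\<^bsub>P\<^esub> mon (content (rm 0 C) bs) = ?m"
      using ab by (simp add: C mon_mult_mon) (rule arg_cong[where f = mon], rule add_mset_commute)
    have m1: "var (C ! 1) \<otimes>\<^bsub>P\<^esub> mon (content (rm 1 C) bs) = ?m"
      using ab by (simp add: C mon_mult_mon One_nat_def)
    have "aug (bdry 0 C bs) = (\<Oplus>\<^bsub>II\<^esub>j\<in>{0..Suc 0}. add_pow II ((- 1) ^ (Suc 0 - j) :: int) ?m)"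
      unfolding diffl_bdry[OF aug_hom II_module v]
    proof (intro I.finsum_cong' refl Pi_I)
      fix j assume "j \<in> {0..Suc 0}"
      then have j: "j = 0 \<or> j = 1" "j \<le> Suc 0" by auto
      show "add_pow II ((- 1) ^ (Suc 0 - j) :: int) (var (C ! j) \<odot>\<^bsub>II\<^esub> aug (E 0 (rm j C) bs))
        = add_pow II ((- 1) ^ (Suc 0 - j) :: int) ?m"
        unfolding aug_E[OF filling_rm[OF v j(2)]] using j(1) m0 m1 by (auto simp: II_simps)
      show "add_pow II ((- 1) ^ (Suc 0 - j) :: int) ?m \<in> carrier II"
        using mJ I.add.int_pow_closed by (simp add: II_simps)
    qed
    also have "{0..Suc 0} = {0, 1}" by auto
    also have "(\<Oplus>\<^bsub>II\<^esub>j\<in>{0, 1}. add_pow II ((- 1) ^ (Suc 0 - j) :: int) ?m) = \<ominus>\<^bsub>II\<^esub> ?m \<oplus>\<^bsub>II\<^esub> ?m"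
    proof -
      have two: "(\<Oplus>\<^bsub>II\<^esub>j\<in>{0, 1::nat}. g j) = g 0 \<oplus>\<^bsub>II\<^esub> g 1" if "\<And>j. g j \<in> carrier II" for g
        using that by (simp add: I.finsum_insert)
      have tc: "add_pow II (k :: int) ?m \<in> carrier II" for k by (rule I.add.int_pow_closed[OF mc])
      show ?thesis
        unfolding two[OF tc] using I.add.int_pow_neg[OF mc, of 1] I.add.int_pow_1[OF mc] by simp
    qed
    also have "\<dots> = \<zero>\<^bsub>II\<^esub>" by (rule I.l_neg[OF mc])
    finally show "aug (diffl (Suc 0) (E (Suc 0) C bs)) = \<zero>\<^bsub>II\<^esub>" unfolding diffl_E[OF v] .
  qed
qed

end

subsection \<open>Exactness of Koszul strands\<close>

text \<open>Larger elements are counted, not smaller ones, because the removed letter is appended at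
  the end of the sorted list of the others.\<close>

definition ksign :: "nat \<Rightarrow> nat set \<Rightarrow> int" where "ksign a S = (- 1) ^ card {s \<in> S. a < s}"

text \<open>The contracting homotopy moves the largest available variable from the monomial to the
  exterior part.\<close>

definition (in abelian_group) khomotopy ::
  "nat set \<Rightarrow> (nat set \<Rightarrow> nat multiset \<Rightarrow> 'a) \<Rightarrow> nat set \<Rightarrow> nat multiset \<Rightarrow> 'a"
  where "khomotopy V z S m = (if S \<noteq> {} \<and> (\<forall>s\<in>V. s \<in># m \<longrightarrow> s \<le> Max S)
    then z (S - {Max S}) (m + {#Max S#}) else \<zero>)"

text \<open>Only one coefficient of the homotopy identity is considered, so the cycle condition is
  needed only for subsets of \<open>S\<close> with one element less. Let \<open>t\<close> be the
  largest element of \<open>V\<close> in \<open>S\<close> or \<open>m\<close>. If \<open>t\<close>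
  is not in \<open>S\<close>, only the summand \<open>a = t\<close> survives. If it is in
  \<open>S\<close>, the sum is the remainder of the cycle condition at \<open>S - {t}\<close> with
  \<open>t\<close> moved into the monomial. Without any such \<open>t\<close> the coefficient lies
  in the homology of the Koszul complex.\<close>

lemma (in abelian_group) koszul_exact:
  assumes V: "finite V" and zc: "\<And>S m. z S m \<in> carrier G" and S: "S \<subseteq> V"
    and ne: "V \<inter> (S \<union> set_mset m) \<noteq> {}"
    and cycle: "\<And>S' m'. S' \<subseteq> S \<Longrightarrow> Suc (card S') = card S \<Longrightarrow>
      (\<Oplus>a\<in>{a \<in> V. a \<notin> S' \<and> a \<in># m'}. add_pow G (ksign a S') (z (insert a S') (m' - {#a#}))) = \<zero>"
  shows "(\<Oplus>a\<in>{a \<in> V. a \<notin> S \<and> a \<in># m}. add_pow G (ksign a S) (khomotopy V z (insert a S) (m - {#a#})))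
    = z S m"
proof -
  define t where "t = Max (V \<inter> (S \<union> set_mset m))"
  have fin: "finite (V \<inter> (S \<union> set_mset m))" "finite S" using V S finite_subset by auto
  have tV: "t \<in> V" "t \<in> S \<union> set_mset m" using Max_in[OF fin(1) ne] by (auto simp: t_def)
  have le: "x \<le> t" if "x \<in> V" "x \<in> S \<or> x \<in># m" for x
    unfolding t_def using that by (intro Max_ge[OF fin(1)]) auto
  let ?I = "{a \<in> V. a \<notin> S \<and> a \<in># m}"
  have finI: "finite ?I" using V by simp
  have kc: "khomotopy V z T k \<in> carrier G" for T k by (simp add: khomotopy_def zc)
  show ?thesis
  proof (cases "t \<in> S")
    case False
    then have tm: "t \<in># m" and tI: "t \<in> ?I" using tV by auto
    \<comment> \<open>After another letter has been moved, \<open>t\<close> is still in the monomial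
      and exceeds the maximum of \<open>insert a S\<close>, so the homotopy vanishes by its
      definition.\<close>
    have z: "khomotopy V z (insert a S) (m - {#a#}) = \<zero>" if a: "a \<in> ?I" "a \<noteq> t" for a
    proof -
      have "Max (insert a S) \<in> insert a S" using fin(2) by (intro Max_in) auto
      then have "Max (insert a S) < t" using le a S False by (metis insertE le_neq_implies_less mem_Collect_eq subsetD)
      moreover have "t \<in># m - {#a#}" using tm a(2) by (simp add: in_diff_count)
      ultimately show ?thesis using tV(1) unfolding khomotopy_def by (meson leD)
    qed
    have "Max (insert t S) = t" using fin(2) le S by (intro Max_eqI) auto
    moreover have "\<forall>s\<in>V. s \<in># m - {#t#} \<longrightarrow> s \<le> t" using le by (meson in_diffD)
    moreover have "insert t S - {t} = S" "m - {#t#} + {#t#} = m" using False tm by auto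
    ultimately have v: "khomotopy V z (insert t S) (m - {#t#}) = z S m"
      unfolding khomotopy_def by simp
    have "{s \<in> S. t < s} = {}" using le S by fastforce
    then have k: "ksign t S = 1" by (simp only: ksign_def card.empty power_0)
    have "(\<Oplus>a\<in>?I. add_pow G (ksign a S) (khomotopy V z (insert a S) (m - {#a#})))
      = (\<Oplus>a\<in>?I. if t = a then z S m else \<zero>)"
    proof (intro finsum_cong' refl Pi_I)
      fix a assume a: "a \<in> ?I"
      show "(if t = a then z S m else \<zero>) \<in> carrier G" using zc by simp
      show "add_pow G (ksign a S) (khomotopy V z (insert a S) (m - {#a#})) = (if t = a then z S m else \<zero>)"
        using z[OF a] v k zc by auto
    qed
    also have "\<dots> = z S m" using zc by (intro finsum_singleton[OF tI finI]) auto
    finally show ?thesis .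
  next
    case True
    \<comment> \<open>The homotopy moves \<open>t\<close> back into the monomial in every summand.
      Since \<open>t\<close> is larger than every available \<open>a\<close>, dropping it from
      \<open>S\<close> reverses each sign; its own summand in the cycle condition is
      \<open>z S m\<close>.\<close>
    define S' m' where "S' = S - {t}" and "m' = m + {#t#}"
    have SS': "S = insert t S'" "t \<notin> S'" using True by (auto simp: S'_def)
    have v: "khomotopy V z (insert a S) (m - {#a#}) = z (insert a S') (m' - {#a#})" if a: "a \<in> ?I" for a
    proof -
      have at: "a \<noteq> t" using a True by auto
      have "Max (insert a S) = t" using fin(2) le S True a by (intro Max_eqI) auto
      moreover have "\<forall>s\<in>V. s \<in># m - {#a#} \<longrightarrow> s \<le> t" using le by (meson in_diffD)
      moreover have "insert a S - {t} = insert a S'" using at by (auto simp: S'_def)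
      moreover have "m - {#a#} + {#t#} = m' - {#a#}" using a by (simp add: m'_def)
      ultimately show ?thesis unfolding khomotopy_def by simp
    qed
    have ks: "ksign a S = - ksign a S'" if a: "a \<in> ?I" for a
    proof -
      have "a < t" using le[of a] a True by (metis (no_types, lifting) le_neq_implies_less mem_Collect_eq)
      then have "{s \<in> S. a < s} = insert t {s \<in> S'. a < s}" using SS' by auto
      moreover have "finite S'" using fin(2) by (simp add: S'_def)
      ultimately show ?thesis using SS'(2) by (simp add: ksign_def)
    qed
    let ?f = "\<lambda>a. add_pow G (ksign a S') (z (insert a S') (m' - {#a#}))"
    have fc: "?f a \<in> carrier G" for a by (rule add.int_pow_closed[OF zc])
    have J: "{a \<in> V. a \<notin> S' \<and> a \<in># m'} = insert t ?I" "t \<notin> ?I"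
      using tV(1) SS' by (auto simp: m'_def)
    have "{s \<in> S'. t < s} = {}" using le S by (fastforce simp: S'_def)
    then have kt: "ksign t S' = 1" by (simp only: ksign_def card.empty power_0)
    have ft: "?f t = z S m" using kt SS'(1) zc by (simp add: m'_def)
    have "(\<Oplus>a\<in>insert t ?I. ?f a) = \<zero>"
      unfolding J(1)[symmetric]
    proof (rule cycle)
      show "S' \<subseteq> S" by (auto simp: S'_def)
      have "finite S'" using fin(2) by (simp add: S'_def)
      then show "Suc (card S') = card S" using SS' card_insert_disjoint by metis
    qed
    then have 0: "z S m \<oplus> (\<Oplus>a\<in>?I. ?f a) = \<zero>"
      using finsum_insert[OF finI J(2), of ?f] fc ft zc[of S m] by simp
    have "(\<Oplus>a\<in>?I. add_pow G (ksign a S) (khomotopy V z (insert a S) (m - {#a#}))) = (\<Oplus>a\<in>?I. \<ominus> ?f a)"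
      using fc by (intro finsum_cong') (simp_all add: v ks add.int_pow_neg zc)
    also have "\<dots> = \<ominus> (\<Oplus>a\<in>?I. ?f a)"
      using fc by (intro additive_finsum[symmetric]) (simp_all add: minus_add)
    also have "\<dots> = z S m"
      using 0 fc zc by (metis (no_types, lifting) Pi_I finsum_closed minus_equality minus_minus)
    finally show ?thesis .
  qed
qed

section \<open>The differential in the standard basis\<close>

context hooks
begin

text \<open>The Koszul variables attached to \<open>u\<close>: by \<open>idx_iff\<close> the pairs
  with first component \<open>u\<close> are indexed by the subsets of \<open>V u\<close>, like the
  basis of an exterior algebra.\<close>

definition V :: "nat set \<Rightarrow> nat set" where "V u = {a \<in> {1..n}. a \<notin> u \<and> Min u < a}"

lemma finite_V: "finite (V u)" by (simp add: V_def)

lemma idx_iff: "(u, S) \<in> idx i \<longleftrightarrow> u \<subseteq> {1..n} \<and> card u = d \<and> S \<subseteq> V u \<and> card S = i"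
  by (auto simp: idx_def V_def)

text \<open>Only \<open>y = Min u\<close> contributes, as no other letter of \<open>u\<close> lies
  in the column. Moving \<open>a\<close> to the end passes exactly the larger elements of
  \<open>S'\<close>, which gives the Koszul sign.\<close>

lemma coefR_basis_same:
  assumes "(u, S') \<in> idx i" "(u, S) \<in> idx (Suc i)"
  shows "coefR u (srt S') a (bcol u S) (brow u) =
    (if a \<in> V u \<and> a \<notin> S' \<and> S = insert a S' then ksign a S' else 0)"
proof -
  note D = idxD[OF assms(1)] and D' = idxD[OF assms(2)]
  show ?thesis
  proof (cases "a \<notin> u \<union> S' \<and> S = insert a S'")
    case True
    then have aV: "a \<in> V u" using D'(8,11) by (auto simp: V_def)
    have S: "set (srt S) = S" "distinct (srt S)" "sorted (srt S)" using D'(2) by auto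
    then obtain xs zs where xz: "srt S = xs @ a # zs" using True by (metis insertI1 split_list)
    have S': "S' = set (xs @ zs)" "distinct (xs @ zs)" "a \<notin> set (xs @ zs)" 
      using S(1,2) True unfolding xz by auto
    have "sorted (xs @ zs)" using S(3) unfolding xz by (auto simp: sorted_append)
    then have xs: "srt S' = xs @ zs" using S' by (metis sorted_list_of_set.idem_if_sorted_distinct)
    have mm: "Min u \<notin> set (xs @ a # zs)" using D'(5) S(1) xz by simp
    have "(\<Sum>y\<in>u. orient (y # srt S' @ [a]) (bcol u S)) = (\<Sum>y\<in>{Min u}. orient (y # srt S' @ [a]) (bcol u S))"
    proof (intro sum.mono_neutral_right D(1) ballI)
      fix y assume y: "y \<in> u - {Min u}"
      then have "y \<notin> set (bcol u S)" using D'(2,6) by (auto simp: bcol_def)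
      then show "orient (y # srt S' @ [a]) (bcol u S) = 0" by (intro orient_zero) auto
    qed (use D(4) in auto)
    also have "\<dots> = orient (Min u # xs @ zs @ [a]) ((Min u # xs) @ a # zs)"
      by (simp add: bcol_def xs xz)
    also have "\<dots> = (- 1) ^ length zs * orient (Min u # xs @ zs @ [a]) ((Min u # xs) @ zs @ [a])"
      using S(2) mm unfolding xz by (intro orient_move) auto
    also have "orient (Min u # xs @ zs @ [a]) ((Min u # xs) @ zs @ [a]) = 1"
      using S'(2,3) mm orient_self[of "Min u # xs @ zs @ [a]"] by simp
    also have "length zs = card {s \<in> S'. a < s}"
    proof -
      have "{s \<in> S'. a < s} = set zs"
        using S(2,3) unfolding xz S'(1) by (auto simp: sorted_append intro!: le_neq_implies_less)
      then show ?thesis using S'(2) by (simp add: distinct_card)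
    qed
    finally have "(\<Sum>y\<in>u. orient (y # srt S' @ [a]) (bcol u S)) = ksign a S'" by (simp add: ksign_def)
    moreover have "set (bcol u S) \<union> set (brow u) = u \<union> set (srt S' @ [a])"
      using set_basis[OF assms(2)] True D(2) by auto
    ultimately show ?thesis using True aV D(2) by (simp add: coefR_def coef_def)
  next
    case False
    have z: "coefR u (srt S') a (bcol u S) (brow u) = 0"
    proof (cases "a \<in> u \<union> S'")
      case True
      then show ?thesis using D(2) by (simp add: coefR_def)
    next
      case F: False
      have "u \<union> S \<noteq> u \<union> insert a S'"
        using False F D(6) D'(6) by blast
      then have "set (bcol u S) \<union> set (brow u) \<noteq> u \<union> set (srt S' @ [a])"
        using set_basis[OF assms(2)] D(2) by simp
      then show ?thesis by (simp add: coefR_def coef_def)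
    qed
    have "\<not> (a \<in> V u \<and> a \<notin> S' \<and> S = insert a S')" using False by (auto simp: V_def)
    then show ?thesis unfolding z by (simp only: if_False)
  qed
qed

text \<open>The coefficients between different \<open>u\<close> are triangular with respect to the sum of the
  elements: removing the corner replaces the minimum of \<open>u\<close> by a larger element.\<close>

lemma coefR_basis_diff:
  assumes "(u', S') \<in> idx i" "(u, S) \<in> idx (Suc i)" "u \<noteq> u'"
    and "coefR u' (srt S') a (bcol u S) (brow u) \<noteq> 0"
  shows "\<Sum>u < \<Sum>u'"
proof -
  note D' = idxD[OF assms(1)] and D = idxD[OF assms(2)]
  have a: "a \<notin> u' \<union> S'" and W: "u \<union> S = insert a (u' \<union> S')"
    and sum: "(\<Sum>y\<in>u'. orient (y # srt S' @ [a]) (bcol u S)) \<noteq> 0"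
    using assms(4) set_basis[OF assms(2)] D'(2) by (auto simp: coefR_def coef_def split: if_splits)
  obtain y where y: "y \<in> u'" "orient (y # srt S' @ [a]) (bcol u S) \<noteq> 0"
    using sum by (meson sum.neutral)
  have "set (y # srt S' @ [a]) = set (bcol u S)" using y(2) orient_zero by blast
  then have col: "insert y (insert a S') = insert (Min u) S" using D(2) D'(2) by (simp add: bcol_def insert_commute)
  have ya: "y \<notin> S'" "y \<noteq> a" using y(1) a D'(6) by auto
  have MW: "Min u \<le> x" if "x \<in> u \<union> S" for x
    using that D(1,11) by (auto intro: less_imp_le)
  show ?thesis
  proof (cases "a = Min u")
    case True
    have S: "S = insert y S'"
    proof -
      have "insert y S' = insert y (insert a S') - {a}" using ya a by auto
      also have "\<dots> = S" using col True D(5) by auto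
      finally show ?thesis by simp
    qed
    have u': "u' = insert y (u - {Min u})"
      using W S D(6) D'(6) a y(1) ya unfolding True by blast
    have "y \<notin> u" using S D(6) by auto
    moreover have "Min u < y" using S D(11) by auto
    moreover have "\<Sum>u = Min u + \<Sum>(u - {Min u})" using D(1,4) by (rule sum.remove)
    ultimately show ?thesis using D(1) by (simp add: u')
  next
    \<comment> \<open>The removed letter is not the corner. The minimum survives, the two corners
      coincide, and comparing letters gives \<open>u = u'\<close> against the assumption.\<close>
    case False
    then have aS: "a \<in> S" using col by auto
    have "Min u \<in> u' \<union> S'" using W D(4) False by auto
    moreover have "Min u' \<le> x" if "x \<in> u' \<union> S'" for x
      using that D'(1,11) by (auto intro: less_imp_le)
    moreover have "Min u' \<in> u \<union> S" using W D'(4) by auto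
    ultimately have "Min u = Min u'" using MW by (metis order_antisym)
    then have m: "Min u \<notin> S'" using D'(5) by simp
    then have "y = Min u" using col False by auto
    then have "insert a S' = S"
      using insert_ident[of "Min u" "insert a S'" S] col m D(5) False by simp
    then have "S = insert a S'" by (rule sym)
    then have "u = u'" using W D(6) D'(6) a aS by blast
    then show ?thesis using assms(3) by simp
  qed
qed

lemma coeff_group_hom: "group_hom (add_monoid P) (add_monoid A) (\<lambda>p. p m)"
  by (intro group_hom.intro group_hom_axioms.intro P.a_group A.a_group)
    (auto simp: hom_def P_simps P_coeff)

lemma coeff_add_pow: "p \<in> carrier P \<Longrightarrow> add_pow P (k :: int) p m = add_pow A k (p m)"
  using group_hom.hom_int_pow[OF coeff_group_hom, of p k m] by (simp add: add_pow_def)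

lemma coeff_finsum: "finite I \<Longrightarrow> f \<in> I \<rightarrow> carrier P \<Longrightarrow> (\<Oplus>\<^bsub>P\<^esub>i\<in>I. f i) m = (\<Oplus>\<^bsub>A\<^esub>i\<in>I. f i m)"
  unfolding same_group_finsum[OF same_group_P] P_carrier by (rule free_module_finsum_apply[OF A])

text \<open>By triangularity, blocks whose sum is not below that of \<open>u'\<close> contribute
  nothing unless they belong to \<open>u'\<close> itself, and the lower blocks of \<open>x\<close>
  are zero by assumption. What remains is the Koszul differential of the block of \<open>u'\<close>,
  read off at one monomial.\<close>

lemma kap_diffl:
  assumes x: "x \<in> carrier (F (Suc i))" and p: "(u', S') \<in> idx i"
    and low: "\<And>u S. (u, S) \<in> idx (Suc i) \<Longrightarrow> \<Sum>u < \<Sum>u' \<Longrightarrow> kap (Suc i) (u, S) x = zero P"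
  shows "kap i (u', S') (diffl (Suc i) x) m =
    (\<Oplus>\<^bsub>A\<^esub>a\<in>{a \<in> V u'. a \<notin> S' \<and> a \<in># m}. add_pow A (ksign a S') (kap (Suc i) (u', insert a S') x (m - {#a#})))"
proof -
  interpret M: module P "F (Suc i)" by (rule F_module)
  let ?h = "\<lambda>x. kap i (u', S') (diffl (Suc i) x)"
  let ?k = "\<lambda>q. kap (Suc i) q x"
  define b where "b q = ?h (bas (Suc i) q)" for q
  have h: "?h \<in> module_homs P (F (Suc i)) PP" by (rule module_homs_comp[OF diffl_hom kap_hom[OF p]])
  have kc: "?k q \<in> carrier P" if "q \<in> idx (Suc i)" for q by (rule kap_closed[OF that x])
  have bc: "b q \<in> carrier P" if "q \<in> idx (Suc i)" for q
    using module_homs_closed[OF h bas_closed[OF that]] by (simp add: b_def PP_simps)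
  have t: "?k q \<odot>\<^bsub>F (Suc i)\<^esub> bas (Suc i) q \<in> carrier (F (Suc i))" if "q \<in> idx (Suc i)" for q
    by (rule M.smult_closed[OF kc[OF that] bas_closed[OF that]])
  have "?h x = ?h (\<Oplus>\<^bsub>F (Suc i)\<^esub>q\<in>idx (Suc i). ?k q \<odot>\<^bsub>F (Suc i)\<^esub> bas (Suc i) q)"
    using expansion_eq[OF x] by simp
  also have "\<dots> = (\<Oplus>\<^bsub>PP\<^esub>q\<in>idx (Suc i). ?h (?k q \<odot>\<^bsub>F (Suc i)\<^esub> bas (Suc i) q))"
    using t by (intro module_homs_finsum[OF F_module PP_module h]) simp
  also have "\<dots> = (\<Oplus>\<^bsub>P\<^esub>q\<in>idx (Suc i). ?k q \<otimes>\<^bsub>P\<^esub> b q)"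
    unfolding same_group_finsum[OF same_group_PP]
    using kc bc bas_closed
    by (intro P.finsum_cong') (simp_all add: module_homs_smult[OF h] PP_simps b_def)
  finally have hx: "?h x = (\<Oplus>\<^bsub>P\<^esub>q\<in>idx (Suc i). ?k q \<otimes>\<^bsub>P\<^esub> b q)" .
  have b: "b (u, S) = (\<Oplus>\<^bsub>P\<^esub>a\<in>{1..n}. add_pow P (coefR u' (srt S') a (bcol u S) (brow u)) (var a))"
    if q: "(u, S) \<in> idx (Suc i)" for u S
    using diffl_E[OF filling_basis[OF q]] kap_bdry[OF filling_basis[OF q] p] by (simp add: b_def bas_def)
  let ?I = "{a \<in> V u'. a \<notin> S'}"
  have D: "u' \<subseteq> {1..n}" "card u' = d" "S' \<subseteq> V u'" "card S' = i" using p by (simp_all add: idx_iff)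
  have fS: "finite S'" using D(3) finite_V finite_subset by blast
  have In: "?I \<subseteq> {1..n}" by (auto simp: V_def)
  have qa: "(u', insert a S') \<in> idx (Suc i)" if "a \<in> ?I" for a
    using that D fS by (auto simp: idx_iff)
  have pw: "add_pow P (k :: int) (var a) \<in> carrier P" if "a \<in> {1..n}" for a k
    by (rule P.add.int_pow_closed[OF var_carrier[OF that]])
  have b1: "b (u', insert a S') = add_pow P (ksign a S') (var a)" if a: "a \<in> ?I" for a
  proof -
    have "b (u', insert a S') = (\<Oplus>\<^bsub>P\<^esub>c\<in>{1..n}. if a = c then add_pow P (ksign a S') (var c) else zero P)"
      unfolding b[OF qa[OF a]] coefR_basis_same[OF p qa[OF a]]
      using a pw P_zero_closed by (intro P.finsum_cong') (auto simp: add_pow_def[of _ "0::int"])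
    also have "\<dots> = add_pow P (ksign a S') (var a)"
      using a In pw by (intro P.finsum_singleton) auto
    finally show ?thesis .
  qed
  \<comment> \<open>Either the coordinate of \<open>x\<close> vanishes by \<open>low\<close>, or the
    matrix entry does: inside the block of \<open>u'\<close> because \<open>S\<close> is not
    \<open>S'\<close> with a letter added, outside it by triangularity.\<close>
  have b0: "?k q \<otimes>\<^bsub>P\<^esub> b q = zero P"
    if q: "q \<in> idx (Suc i)" and no: "q \<notin> (\<lambda>a. (u', insert a S')) ` ?I" for q
  proof -
    obtain u S where us: "q = (u, S)" by (cases q)
    note q' = q[unfolded us]
    show ?thesis
    proof (cases "u \<noteq> u' \<and> \<Sum>u < \<Sum>u'")
      case True
      then show ?thesis using low[OF q'] bc[OF q] by (simp add: us)
    next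
      case False
      have "coefR u' (srt S') a (bcol u S) (brow u) = 0" for a
      proof (cases "u = u'")
        case True
        then show ?thesis
          using coefR_basis_same[OF p q'[unfolded True], of a] no us by auto
      next
        case F: False
        then show ?thesis using coefR_basis_diff[OF p q' F, of a] False by auto
      qed
      then have "b q = (\<Oplus>\<^bsub>P\<^esub>a\<in>{1..n}. zero P)"
        unfolding us b[OF q'] by (simp add: add_pow_def[of _ "0::int"])
      then show ?thesis using kc[OF q] by simp
    qed
  qed
  have inj: "inj_on (\<lambda>a. (u', insert a S')) ?I" by (auto simp: inj_on_def)
  have c1: "?k (u', insert a S') \<otimes>\<^bsub>P\<^esub> b (u', insert a S') \<in> carrier P" if "a \<in> ?I" for a
    by (rule P_mult_closed[OF kc[OF qa[OF that]] bc[OF qa[OF that]]])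
  have "?h x = (\<Oplus>\<^bsub>P\<^esub>q\<in>(\<lambda>a. (u', insert a S')) ` ?I. ?k q \<otimes>\<^bsub>P\<^esub> b q)"
    unfolding hx
    using b0 qa kc bc P_mult_closed finite_idx by (intro P.add.finprod_mono_neutral_cong_right) auto
  also have "\<dots> = (\<Oplus>\<^bsub>P\<^esub>a\<in>?I. ?k (u', insert a S') \<otimes>\<^bsub>P\<^esub> b (u', insert a S'))"
    using c1 by (intro P.finsum_reindex[OF _ inj]) auto
  finally have "?h x m = (\<Oplus>\<^bsub>A\<^esub>a\<in>?I. (?k (u', insert a S') \<otimes>\<^bsub>P\<^esub> b (u', insert a S')) m)"
    using coeff_finsum[of ?I "\<lambda>a. ?k (u', insert a S') \<otimes>\<^bsub>P\<^esub> b (u', insert a S')" m] c1 finite_V by simp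
  also have "\<dots> = (\<Oplus>\<^bsub>A\<^esub>a\<in>{a \<in> V u'. a \<notin> S' \<and> a \<in># m}. add_pow A (ksign a S') (?k (u', insert a S') (m - {#a#})))"
  proof (rule A.add.finprod_mono_neutral_cong_right)
    have e: "(?k (u', insert a S') \<otimes>\<^bsub>P\<^esub> b (u', insert a S')) m =
        add_pow A (ksign a S') (if a \<in># m then ?k (u', insert a S') (m - {#a#}) else \<zero>\<^bsub>A\<^esub>)" if a: "a \<in> ?I" for a
    proof -
      have v: "var a \<in> carrier P" using a In var_carrier by blast
      note k = kc[OF qa[OF a]]
      have "?k (u', insert a S') \<otimes>\<^bsub>P\<^esub> b (u', insert a S') = add_pow P (ksign a S') (var a \<otimes>\<^bsub>P\<^esub> ?k (u', insert a S'))"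
        unfolding b1[OF a] mult_add_pow[OF k v] P.m_comm[OF k v] ..
      then show ?thesis
        using coeff_add_pow[OF P_mult_closed[OF v k], of "ksign a S'" m] mon_mult[of "?k (u', insert a S')" "{#a#}" m] k
        by simp
    qed
    show "(?k (u', insert a S') \<otimes>\<^bsub>P\<^esub> b (u', insert a S')) m = \<zero>\<^bsub>A\<^esub>"
      if "a \<in> ?I - {a \<in> V u'. a \<notin> S' \<and> a \<in># m}" for a
    proof -
      have "a \<in> ?I" "a \<notin># m" using that by auto
      then show ?thesis using e[of a] by (simp add: A.add.int_pow_one)
    qed
    show "(?k (u', insert a S') \<otimes>\<^bsub>P\<^esub> b (u', insert a S')) m = add_pow A (ksign a S') (?k (u', insert a S') (m - {#a#}))"
      if "a \<in> {a \<in> V u'. a \<notin> S' \<and> a \<in># m}" for a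
      using that e[of a] by simp
    show "(\<lambda>a. (?k (u', insert a S') \<otimes>\<^bsub>P\<^esub> b (u', insert a S')) m) \<in> ?I \<rightarrow> carrier A"
      using c1 by simp
  qed (auto simp: finite_V)
  finally show ?thesis .
qed

subsection \<open>Exactness of the complex\<close>

text \<open>For \<open>i > 0\<close> a good element vanishes in all components with \<open>\<Sum>u < k\<close>. For \<open>i = 0\<close>
  it only involves there monomials in the elements of \<open>u\<close> and those below \<open>Min u\<close>, that is, those
  \<open>m\<close> for which \<open>u\<close> consists of the \<open>d\<close> largest elements of the support of \<open>x\<^sup>u m\<close>.\<close>

definition good :: "nat \<Rightarrow> nat \<Rightarrow> ((nat list list \<Rightarrow> 'a) set \<times> (nat multiset \<Rightarrow> 'a) \<Rightarrow> 'a) set \<Rightarrow> bool"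
  where "good k i z \<longleftrightarrow> (\<forall>u S m. (u, S) \<in> idx i \<longrightarrow> \<Sum>u < k \<longrightarrow>
    V u \<inter> (S \<union> set_mset m) \<noteq> {} \<longrightarrow> kap i (u, S) z m = \<zero>\<^bsub>A\<^esub>)"

text \<open>For \<open>i = 0\<close> the condition is void. This suits the reduction, since the
  Koszul argument at an empty \<open>S\<close> uses no cycle condition.\<close>

definition cycle :: "nat \<Rightarrow> ((nat list list \<Rightarrow> 'a) set \<times> (nat multiset \<Rightarrow> 'a) \<Rightarrow> 'a) set \<Rightarrow> bool"
  where "cycle i z \<longleftrightarrow> (\<forall>j. i = Suc j \<longrightarrow> diffl (Suc j) z = \<zero>\<^bsub>F j\<^esub>)"

text \<open>In positive degree \<open>S\<close> is a nonempty subset of \<open>V u\<close>, so the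
  restriction on monomials in \<open>good\<close> is automatic and the whole coordinate
  vanishes.\<close>

lemma good_kap_zero:
  assumes "good k (Suc j) z" "(u, S) \<in> idx (Suc j)" "\<Sum>u < k"
  shows "kap (Suc j) (u, S) z = zero P"
proof
  fix m
  have "S \<noteq> {}" "S \<subseteq> V u" using assms(2) by (auto simp: idx_iff)
  then have "V u \<inter> (S \<union> set_mset m) \<noteq> {}" by blast
  then show "kap (Suc j) (u, S) z m = zero P m" using assms by (simp add: good_def P_simps)
qed

lemma coeff_minus: "p \<in> carrier P \<Longrightarrow> q \<in> carrier P \<Longrightarrow> (p \<ominus>\<^bsub>P\<^esub> q) m = p m \<ominus>\<^bsub>A\<^esub> q m"
  using group_hom.hom_inv[OF coeff_group_hom, of q m] by (simp add: a_minus_def a_inv_def P_simps)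

lemma kap_minus:
  assumes "p \<in> idx j" "x \<in> carrier (F i)" "y \<in> carrier (F i)"
  shows "kap i p (x \<ominus>\<^bsub>F i\<^esub> y) m = kap i p x m \<ominus>\<^bsub>A\<^esub> kap i p y m"
proof -
  have "kap i p (x \<ominus>\<^bsub>F i\<^esub> y) = kap i p x \<ominus>\<^bsub>P\<^esub> kap i p y"
    using module_homs_minus[OF F_module PP_module kap_hom[OF assms(1)] assms(2,3)]
    by (simp add: a_minus_def same_group_a_inv[OF same_group_PP] PP_simps)
  then show ?thesis using kap_closed assms by (simp add: coeff_minus)
qed

text \<open>The correction \<open>y\<close> consists of the Koszul homotopies of the blocks with sum
  exactly \<open>k\<close>. Its boundary does not touch lower blocks, agrees with \<open>z\<close>
  in these blocks wherever \<open>good (Suc k)\<close> demands a zero, and may alter higher ones,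
  which are treated later.\<close>

lemma reduce_step:
  assumes z: "z \<in> carrier (F i)" and g: "good k i z" and cyc: "cycle i z"
  shows "\<exists>y\<in>carrier (F (Suc i)). good (Suc k) i (z \<ominus>\<^bsub>F i\<^esub> diffl (Suc i) y)"
proof -
  interpret M: module P "F i" by (rule F_module)
  interpret N: module P "F (Suc i)" by (rule F_module)
  \<comment> \<open>\<open>koszul_exact\<close> wants a family defined for all subsets and
    monomials, so the coordinates of \<open>z\<close> are continued by zero.\<close>
  define zz where "zz u S m = (if (u, S) \<in> idx i then kap i (u, S) z m else \<zero>\<^bsub>A\<^esub>)" for u S m
  have zzc: "zz u S m \<in> carrier A" for u S m
    using P_coeff[OF kap_closed[OF _ z]] by (simp add: zz_def)
  define c where "c q = (if \<Sum>(fst q) = k then A.khomotopy (V (fst q)) (zz (fst q)) (snd q) else zero P)" for q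
  \<comment> \<open>The homotopy of a fixed set is part of one coordinate of \<open>z\<close>,
    shifted by the variable \<open>Max S\<close>; this makes it finitely supported on monomials in
    the right variables.\<close>
  have kh: "A.khomotopy W (zz u) S \<in> carrier P" for W u S
  proof -
    let ?k = "A.khomotopy W (zz u) S" and ?s = "kap i (u, S - {Max S}) z"
    have nz: "(u, S - {Max S}) \<in> idx i \<and> ?s (m + {#Max S#}) \<noteq> \<zero>\<^bsub>A\<^esub>" if "?k m \<noteq> \<zero>\<^bsub>A\<^esub>" for m
      using that by (auto simp: A.khomotopy_def zz_def split: if_splits)
    have sP: "?s \<in> carrier P" if "(u, S - {Max S}) \<in> idx i" by (rule kap_closed[OF that z])
    have "finite {m. ?k m \<noteq> \<zero>\<^bsub>A\<^esub>}"
    proof (cases "(u, S - {Max S}) \<in> idx i")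
      case True
      show ?thesis
      proof (rule finite_subset)
        show "{m. ?k m \<noteq> \<zero>\<^bsub>A\<^esub>} \<subseteq> (\<lambda>m. m - {#Max S#}) ` {m. ?s m \<noteq> \<zero>\<^bsub>A\<^esub>}"
        proof
          fix m assume "m \<in> {m. ?k m \<noteq> \<zero>\<^bsub>A\<^esub>}"
          then have "m + {#Max S#} \<in> {m. ?s m \<noteq> \<zero>\<^bsub>A\<^esub>}" using nz by blast
          then have "(m + {#Max S#}) - {#Max S#} \<in> (\<lambda>m. m - {#Max S#}) ` {m. ?s m \<noteq> \<zero>\<^bsub>A\<^esub>}" by (rule imageI)
          then show "m \<in> (\<lambda>m. m - {#Max S#}) ` {m. ?s m \<noteq> \<zero>\<^bsub>A\<^esub>}" by simp
        qed
        show "finite ((\<lambda>m. m - {#Max S#}) ` {m. ?s m \<noteq> \<zero>\<^bsub>A\<^esub>})"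
          using sP[OF True] by (simp add: P_carrier_iff)
      qed
    next
      case False
      then have "{m. ?k m \<noteq> \<zero>\<^bsub>A\<^esub>} = {}" using nz by blast
      then show ?thesis by simp
    qed
    moreover have "?k m = \<zero>\<^bsub>A\<^esub>" if "\<not> set_mset m \<subseteq> {1..n}" for m
    proof (rule ccontr)
      assume "?k m \<noteq> \<zero>\<^bsub>A\<^esub>"
      then have "(u, S - {Max S}) \<in> idx i" "?s (m + {#Max S#}) \<noteq> \<zero>\<^bsub>A\<^esub>" using nz by blast+
      then have "set_mset (m + {#Max S#}) \<subseteq> {1..n}" using sP unfolding P_carrier_iff by blast
      then show False using that by simp
    qed
    moreover have "?k m \<in> carrier A" for m using zzc by (simp add: A.khomotopy_def)
    ultimately show ?thesis unfolding P_carrier_iff by blast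
  qed
  have cc: "c \<in> idx (Suc i) \<rightarrow> carrier P" using kh P_zero_closed by (simp add: c_def)
  define y where "y = (\<Oplus>\<^bsub>F (Suc i)\<^esub>q\<in>idx (Suc i). c q \<odot>\<^bsub>F (Suc i)\<^esub> bas (Suc i) q)"
  note y = F_combination[OF cc, folded y_def]
  have dy: "diffl (Suc i) y \<in> carrier (F i)" by (rule module_homs_closed[OF diffl_hom y(1)])
  have ins: "(u, insert a S) \<in> idx (Suc j)" if "(u, S) \<in> idx j" "a \<in> V u" "a \<notin> S" for u a S j
    using that finite_subset[OF _ finite_V] by (auto simp: idx_iff)
  have D: "kap i (u, S) (diffl (Suc i) y) m =
      (\<Oplus>\<^bsub>A\<^esub>a\<in>{a \<in> V u. a \<notin> S \<and> a \<in># m}. add_pow A (ksign a S) (c (u, insert a S) (m - {#a#})))"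
    if p: "(u, S) \<in> idx i" and k: "\<Sum>u \<le> k" for u S m
  proof -
    have low: "kap (Suc i) (u1, S1) y = zero P" if "(u1, S1) \<in> idx (Suc i)" "\<Sum>u1 < \<Sum>u" for u1 S1
      using y(2)[OF that(1)] that(2) k by (simp add: c_def)
    have cA: "c q m' \<in> carrier A" for q m' using kh by (simp add: c_def P_simps)
    have "kap i (u, S) (diffl (Suc i) y) m = (\<Oplus>\<^bsub>A\<^esub>a\<in>{a \<in> V u. a \<notin> S \<and> a \<in># m}.
        add_pow A (ksign a S) (kap (Suc i) (u, insert a S) y (m - {#a#})))"
      by (rule kap_diffl[OF y(1) p]) (rule low)
    also have "\<dots> = (\<Oplus>\<^bsub>A\<^esub>a\<in>{a \<in> V u. a \<notin> S \<and> a \<in># m}. add_pow A (ksign a S) (c (u, insert a S) (m - {#a#})))"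
      by (intro A.finsum_cong' refl Pi_I A.add.int_pow_closed cA) (simp add: y(2)[OF ins[OF p]])
    finally show ?thesis .
  qed
  have "good (Suc k) i (z \<ominus>\<^bsub>F i\<^esub> diffl (Suc i) y)"
    unfolding good_def
  proof (intro allI impI)
    fix u S m assume p: "(u, S) \<in> idx i" and k: "\<Sum>u < Suc k" and ne: "V u \<inter> (S \<union> set_mset m) \<noteq> {}"
    have zc: "kap i (u, S) z m \<in> carrier A" by (rule P_coeff[OF kap_closed[OF p z]])
    have "kap i (u, S) (diffl (Suc i) y) m = kap i (u, S) z m"
    proof (cases "\<Sum>u < k")
      \<comment> \<open>All entries of \<open>c\<close> in a block of smaller sum are zero, so
        nothing is subtracted there and the property of \<open>z\<close> persists.\<close>
      case True
      have "kap i (u, S) (diffl (Suc i) y) m = (\<Oplus>\<^bsub>A\<^esub>a\<in>{a \<in> V u. a \<notin> S \<and> a \<in># m}. \<zero>\<^bsub>A\<^esub>)"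
        unfolding D[OF p less_imp_le[OF True]] using True
        by (intro A.finsum_cong') (simp_all add: c_def P_simps A.add.int_pow_one)
      then show ?thesis using g p True ne by (simp add: good_def)
    next
      case False
      then have uk: "\<Sum>u = k" using k by simp
      have SV: "S \<subseteq> V u" "card S = i" using p by (auto simp: idx_iff)
      have "kap i (u, S) (diffl (Suc i) y) m =
        (\<Oplus>\<^bsub>A\<^esub>a\<in>{a \<in> V u. a \<notin> S \<and> a \<in># m}. add_pow A (ksign a S) (A.khomotopy (V u) (zz u) (insert a S) (m - {#a#})))"
        using D[OF p, of m] uk by (simp add: c_def)
      also have "\<dots> = zz u S m"
      proof (rule A.koszul_exact[OF finite_V zzc SV(1) ne])
        \<comment> \<open>Such a subset exists only in positive degree \<open>i = Suc j\<close>. The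
          lower blocks of \<open>z\<close> vanish there, so \<open>kap_diffl\<close> translates the
          assumption that \<open>z\<close> is a cycle into the Koszul cycle condition.\<close>
        fix S' m' assume S': "S' \<subseteq> S" "Suc (card S') = card S"
        then obtain j where j: "i = Suc j" "card S' = j" using SV(2) by auto
        have p': "(u, S') \<in> idx j" using p S'(1) j(2) by (auto simp: idx_iff)
        have low: "kap (Suc j) (u1, S1) z = zero P" if "(u1, S1) \<in> idx (Suc j)" "\<Sum>u1 < \<Sum>u" for u1 S1
          using good_kap_zero[of k j z u1 S1] g that uk by (simp add: j(1))
        have zj: "z \<in> carrier (F (Suc j))" using z by (simp only: j(1))
        have kz: "kap (Suc j) (u, insert a S') z k \<in> carrier A" if "a \<in> V u" "a \<notin> S'" for a k
          by (rule P_coeff[OF kap_closed[OF ins[OF p' that] zj]])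
        have "kap j (u, S') (diffl (Suc j) z) m' = (\<Oplus>\<^bsub>A\<^esub>a\<in>{a \<in> V u. a \<notin> S' \<and> a \<in># m'}.
            add_pow A (ksign a S') (kap (Suc j) (u, insert a S') z (m' - {#a#})))"
          by (rule kap_diffl[OF zj p']) (rule low)
        moreover have "(\<Oplus>\<^bsub>A\<^esub>a\<in>{a \<in> V u. a \<notin> S' \<and> a \<in># m'}. add_pow A (ksign a S') (zz u (insert a S') (m' - {#a#})))
          = (\<Oplus>\<^bsub>A\<^esub>a\<in>{a \<in> V u. a \<notin> S' \<and> a \<in># m'}.
            add_pow A (ksign a S') (kap (Suc j) (u, insert a S') z (m' - {#a#})))"
          using ins[OF p'] kz
          by (intro A.finsum_cong' refl Pi_I A.add.int_pow_closed) (simp_all add: zz_def j(1))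
        moreover have "kap j (u, S') (diffl (Suc j) z) m' = \<zero>\<^bsub>A\<^esub>"
          using cyc kap_zero[OF p', of j] by (simp add: cycle_def j(1) P_simps)
        ultimately show "(\<Oplus>\<^bsub>A\<^esub>a\<in>{a \<in> V u. a \<notin> S' \<and> a \<in># m'}.
            add_pow A (ksign a S') (zz u (insert a S') (m' - {#a#}))) = \<zero>\<^bsub>A\<^esub>" by simp
      qed
      also have "\<dots> = kap i (u, S) z m" using p by (simp add: zz_def)
      finally show ?thesis .
    qed
    then show "kap i (u, S) (z \<ominus>\<^bsub>F i\<^esub> diffl (Suc i) y) m = \<zero>\<^bsub>A\<^esub>"
      using kap_minus[OF p z dy, of m] zc by (simp add: a_minus_def A.r_neg)
  qed
  then show ?thesis using y(1) by blast
qed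

lemma cycle_minus:
  assumes z: "z \<in> carrier (F i)" and cyc: "cycle i z" and y: "y \<in> carrier (F (Suc i))"
  shows "cycle i (z \<ominus>\<^bsub>F i\<^esub> diffl (Suc i) y)"
  unfolding cycle_def
proof (intro allI impI)
  fix j assume j: "i = Suc j"
  interpret M: module P "F j" by (rule F_module)
  have "diffl (Suc j) (z \<ominus>\<^bsub>F (Suc j)\<^esub> diffl (Suc (Suc j)) y) =
      diffl (Suc j) z \<ominus>\<^bsub>F j\<^esub> diffl (Suc j) (diffl (Suc (Suc j)) y)"
    using z y unfolding j
    by (intro module_homs_minus[OF F_module F_module diffl_hom] module_homs_closed[OF diffl_hom])
  also have "\<dots> = \<zero>\<^bsub>F j\<^esub>"
    using cyc diffl_diffl[of y j] y unfolding j cycle_def by (simp add: M.diff_zero)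
  finally show "diffl (Suc j) (z \<ominus>\<^bsub>F i\<^esub> diffl (Suc i) y) = \<zero>\<^bsub>F j\<^esub>" unfolding j .
qed

text \<open>The corrections of the single steps add up, and subtracting a boundary from a cycle
  leaves a cycle, so the step can be iterated.\<close>

lemma reduce:
  assumes z: "z \<in> carrier (F i)" and cyc: "cycle i z"
  shows "\<exists>y\<in>carrier (F (Suc i)). good k i (z \<ominus>\<^bsub>F i\<^esub> diffl (Suc i) y)"
proof (induction k)
  case 0
  interpret N: module P "F (Suc i)" by (rule F_module)
  show ?case by (intro bexI[of _ "\<zero>\<^bsub>F (Suc i)\<^esub>"]) (simp_all add: good_def)
next
  case (Suc k)
  interpret M: module P "F i" by (rule F_module)
  interpret N: module P "F (Suc i)" by (rule F_module)
  note dc = module_homs_closed[OF diffl_hom]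
  from Suc obtain y where y: "y \<in> carrier (F (Suc i))" and g: "good k i (z \<ominus>\<^bsub>F i\<^esub> diffl (Suc i) y)" by blast
  obtain y' where y': "y' \<in> carrier (F (Suc i))"
    and g': "good (Suc k) i ((z \<ominus>\<^bsub>F i\<^esub> diffl (Suc i) y) \<ominus>\<^bsub>F i\<^esub> diffl (Suc i) y')"
    using reduce_step[OF M.minus_closed[OF z dc[OF y]] g cycle_minus[OF z cyc y]] by blast
  have "(z \<ominus>\<^bsub>F i\<^esub> diffl (Suc i) y) \<ominus>\<^bsub>F i\<^esub> diffl (Suc i) y' = z \<ominus>\<^bsub>F i\<^esub> diffl (Suc i) (y \<oplus>\<^bsub>F (Suc i)\<^esub> y')"
    unfolding module_homs_add[OF diffl_hom y y'] a_minus_def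
    using z dc[OF y] dc[OF y'] by (simp add: M.minus_add M.a_assoc)
  then show ?case using g' N.add.m_closed[OF y y'] by (intro bexI[of _ "y \<oplus>\<^bsub>F (Suc i)\<^esub> y'"]) simp_all
qed

text \<open>From this value of \<open>k\<close> on, \<open>good\<close> constrains every
  index.\<close>

lemma sum_idx_bound: "(u, S) \<in> idx i \<Longrightarrow> \<Sum>u < Suc (\<Sum>{1..n})"
  using sum_mono2[of "{1..n}" u "\<lambda>x. x"] by (simp add: idx_iff less_Suc_eq_le)

lemma kernel_diffl:
  assumes z: "z \<in> carrier (F (Suc j))" and dz: "diffl (Suc j) z = \<zero>\<^bsub>F j\<^esub>"
  shows "z \<in> diffl (Suc (Suc j)) ` carrier (F (Suc (Suc j)))"
proof -
  interpret M: module P "F (Suc j)" by (rule F_module)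
  have "cycle (Suc j) z" using dz by (simp add: cycle_def)
  \<comment> \<open>The bound exceeds the sum of every admissible \<open>u\<close>, so all
    coordinates of the reduced element vanish.\<close>
  from reduce[OF z this, of "Suc (\<Sum>{1..n})"] obtain y where y: "y \<in> carrier (F (Suc (Suc j)))"
    and g: "good (Suc (\<Sum>{1..n})) (Suc j) (z \<ominus>\<^bsub>F (Suc j)\<^esub> diffl (Suc (Suc j)) y)" by blast
  have dy: "diffl (Suc (Suc j)) y \<in> carrier (F (Suc j))" by (rule module_homs_closed[OF diffl_hom y])
  have "z \<ominus>\<^bsub>F (Suc j)\<^esub> diffl (Suc (Suc j)) y = \<zero>\<^bsub>F (Suc j)\<^esub>"
  proof (rule F_eqI[OF M.minus_closed[OF z dy] M.zero_closed])
    fix p assume p: "p \<in> idx (Suc j)"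
    obtain u S where "p = (u, S)" by (cases p)
    then show "kap (Suc j) p (z \<ominus>\<^bsub>F (Suc j)\<^esub> diffl (Suc (Suc j)) y) = kap (Suc j) p \<zero>\<^bsub>F (Suc j)\<^esub>"
      using good_kap_zero[OF g] sum_idx_bound p kap_zero[OF p] by simp
  qed
  from M.eq_if_minus_zero[OF z dy this] show ?thesis using y by blast
qed

lemma aug_expansion:
  assumes x: "x \<in> carrier (F 0)"
  shows "aug x = (\<Oplus>\<^bsub>P\<^esub>p\<in>idx 0. mon (mset_set (fst p)) \<otimes>\<^bsub>P\<^esub> kap 0 p x)"
proof -
  interpret M: module P "F 0" by (rule F_module)
  have b: "aug (bas 0 p) = mon (mset_set (fst p))" "mon (mset_set (fst p)) \<in> carrier P" if "p \<in> idx 0" for p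
  proof -
    obtain u S where p: "p = (u, S)" by (cases p)
    have "S = {}" using idxD(2,10)[OF that[unfolded p]] by simp
    then show "aug (bas 0 p) = mon (mset_set (fst p))" using aug_bas that by (simp add: p)
    have "u \<subseteq> {1..n}" using that by (simp add: p idx_iff)
    then show "mon (mset_set (fst p)) \<in> carrier P"
      using finite_subset[of u "{1..n}"] by (intro mon_closed) (simp add: p)
  qed
  have kc: "kap 0 p x \<in> carrier P" if "p \<in> idx 0" for p by (rule kap_closed[OF that x])
  have h: "aug \<in> module_homs P (F 0) PP" by (rule module_homs_comp[OF aug_hom II_inclusion])
  have "aug x = aug (\<Oplus>\<^bsub>F 0\<^esub>p\<in>idx 0. kap 0 p x \<odot>\<^bsub>F 0\<^esub> bas 0 p)"
    using expansion_eq[OF x] by simp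
  also have "\<dots> = (\<Oplus>\<^bsub>PP\<^esub>p\<in>idx 0. aug (kap 0 p x \<odot>\<^bsub>F 0\<^esub> bas 0 p))"
    using kc bas_closed by (intro module_homs_finsum[OF F_module PP_module h]) simp
  also have "\<dots> = (\<Oplus>\<^bsub>P\<^esub>p\<in>idx 0. mon (mset_set (fst p)) \<otimes>\<^bsub>P\<^esub> kap 0 p x)"
    unfolding same_group_finsum[OF same_group_PP]
    by (intro P.finsum_cong') (simp_all add: module_homs_smult[OF h] kc bas_closed b PP_simps P.m_comm)
  finally show ?thesis .
qed

text \<open>If no element of \<open>W\<close> lies in \<open>V u\<close>, then those outside
  \<open>u\<close> are below \<open>Min u\<close>, so \<open>u\<close> consists of the largest
  elements of \<open>W\<close>. For two such sets of equal size, an element \<open>x\<close> of one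
  only and an element \<open>y\<close> of the other only would each be at most the other.\<close>

lemma top_set_unique:
  assumes "(u, {}) \<in> idx 0" "(u', {}) \<in> idx 0" "u \<subseteq> W" "u' \<subseteq> W" "V u \<inter> W = {}" "V u' \<inter> W = {}" "W \<subseteq> {1..n}"
  shows "u = u'"
proof (rule ccontr)
  assume ne: "u \<noteq> u'"
  note D = idxD[OF assms(1)] and D' = idxD[OF assms(2)]
  have "\<not> u \<subseteq> u'" "\<not> u' \<subseteq> u"
    using ne card_subset_eq[OF D'(1), of u] card_subset_eq[OF D(1), of u'] D(9) D'(9) by auto
  then obtain x y where x: "x \<in> u" "x \<notin> u'" and y: "y \<in> u'" "y \<notin> u" by blast
  have "\<not> Min u' < x" "\<not> Min u < y"
  proof -
    have "x \<notin> V u'" "y \<notin> V u" "x \<in> {1..n}" "y \<in> {1..n}" using x y assms(3-7) by blast+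
    then show "\<not> Min u' < x" "\<not> Min u < y" using x y unfolding V_def by blast+
  qed
  moreover have "Min u \<le> x" "Min u' \<le> y" using x y D(1) D'(1) by auto
  ultimately have "x = y" by linarith
  then show False using x y by simp
qed

text \<open>The augmentation is not injective on a block-by-block basis, since different
  \<open>u\<close> may yield the same monomial. After reduction each monomial can come from one
  \<open>u\<close> only, so its coefficient in \<open>aug w\<close> is a single coordinate of
  \<open>w\<close>.\<close>

lemma kernel_aug:
  assumes z: "z \<in> carrier (F 0)" and az: "aug z = \<zero>\<^bsub>II\<^esub>"
  shows "z \<in> diffl 1 ` carrier (F 1)"
proof -
  interpret M: module P "F 0" by (rule F_module)
  interpret I: module P II by (rule II_module)
  have "cycle 0 z" by (simp add: cycle_def)
  from reduce[OF z this, of "Suc (\<Sum>{1..n})"] obtain y where y: "y \<in> carrier (F (Suc 0))"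
    and g: "good (Suc (\<Sum>{1..n})) 0 (z \<ominus>\<^bsub>F 0\<^esub> diffl (Suc 0) y)" by blast
  define w where "w = z \<ominus>\<^bsub>F 0\<^esub> diffl (Suc 0) y"
  have dy: "diffl (Suc 0) y \<in> carrier (F 0)" by (rule module_homs_closed[OF diffl_hom y])
  have wc: "w \<in> carrier (F 0)" unfolding w_def by (rule M.minus_closed[OF z dy])
  have "aug w = aug z \<ominus>\<^bsub>II\<^esub> aug (diffl (Suc 0) y)"
    unfolding w_def by (rule module_homs_minus[OF F_module II_module aug_hom z dy])
  also have "\<dots> = \<zero>\<^bsub>II\<^esub>"
    using az aug_diffl[of y] y by (simp add: One_nat_def I.diff_zero)
  finally have aw: "aug w = zero P" by (simp only: II_simps)
  have S0: "S = {}" if "(u, S) \<in> idx 0" for u S using idxD(2,10)[OF that] by simp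
  have "w = \<zero>\<^bsub>F 0\<^esub>"
  proof (rule F_eqI[OF wc M.zero_closed])
    fix p assume p0: "p \<in> idx 0"
    obtain u where pu: "p = (u, {})" using S0 p0 by (cases p) auto
    note p = p0[unfolded pu]
    note D = idxD[OF p]
    have kc: "kap 0 q w \<in> carrier P" if "q \<in> idx 0" for q by (rule kap_closed[OF that wc])
    have gz: "kap 0 (u', {}) w m = \<zero>\<^bsub>A\<^esub>" if "(u', {}) \<in> idx 0" "V u' \<inter> set_mset m \<noteq> {}" for u' m
      using g that sum_idx_bound[OF that(1)] unfolding w_def[symmetric] good_def by auto
    have "kap 0 p w m = \<zero>\<^bsub>A\<^esub>" for m
    proof (cases "set_mset m \<subseteq> {1..n} \<and> V u \<inter> set_mset m = {}")
      \<comment> \<open>Monomials with letters out of range have coefficient zero in any polynomial;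
        those meeting \<open>V u\<close> were removed by the reduction.\<close>
      case False
      then show ?thesis using gz[OF p] kc[OF p0] unfolding pu P_carrier_iff by blast
    next
      case True
      \<comment> \<open>The monomial at which the coordinate \<open>kap 0 p w m\<close> enters
        \<open>aug w\<close>. By the case assumption \<open>u\<close> is the set of the largest
        letters of its support.\<close>
      define m' where "m' = m + mset_set u"
      have m'W: "set_mset m' \<subseteq> {1..n}" "V u \<inter> set_mset m' = {}"
        using True D(1,7) by (auto simp: m'_def V_def)
      have mc: "mon (mset_set (fst q)) \<otimes>\<^bsub>P\<^esub> kap 0 q w \<in> carrier P" if "q \<in> idx 0" for q
      proof -
        have "fst q \<subseteq> {1..n}" using that by (auto simp: idx_def)
        then show ?thesis
          using finite_subset[of "fst q" "{1..n}"] by (intro P_mult_closed kc[OF that] mon_closed) simp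
      qed
      have "\<zero>\<^bsub>A\<^esub> = aug w m'" using aw by (simp add: P_simps)
      also have "\<dots> = (\<Oplus>\<^bsub>A\<^esub>q\<in>idx 0. (mon (mset_set (fst q)) \<otimes>\<^bsub>P\<^esub> kap 0 q w) m')"
        unfolding aug_expansion[OF wc] using mc by (intro coeff_finsum finite_idx) simp
      also have "\<dots> = (\<Oplus>\<^bsub>A\<^esub>q\<in>idx 0. if p = q then kap 0 q w m else \<zero>\<^bsub>A\<^esub>)"
      proof (intro A.finsum_cong' refl Pi_I)
        fix q assume q0: "q \<in> idx 0"
        show "(if p = q then kap 0 q w m else \<zero>\<^bsub>A\<^esub>) \<in> carrier A" using P_coeff[OF kc[OF q0]] by simp
        obtain u' where qu: "q = (u', {})" using S0 q0 by (cases q) auto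
        note q = q0[unfolded qu]
        note D' = idxD[OF q]
        have e: "(mon (mset_set (fst q)) \<otimes>\<^bsub>P\<^esub> kap 0 q w) m' =
            (if mset_set u' \<subseteq># m' then kap 0 q w (m' - mset_set u') else \<zero>\<^bsub>A\<^esub>)"
          using mon_mult[of "kap 0 q w" "mset_set u'" m'] kc[OF q0] by (simp add: qu)
        show "(mon (mset_set (fst q)) \<otimes>\<^bsub>P\<^esub> kap 0 q w) m' = (if p = q then kap 0 q w m else \<zero>\<^bsub>A\<^esub>)"
        proof (cases "p = q")
          case True
          then have "u' = u" by (simp add: pu qu)
          then show ?thesis unfolding e using True by (simp add: m'_def)
        next
          case False
          \<comment> \<open>Another \<open>u'\<close> dividing \<open>m'\<close> cannot consist of
            the largest letters of its support as well, so some letter of \<open>V u'\<close> occurs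
            in \<open>m'\<close>. It lies outside \<open>u'\<close> and remains after division, and
            goodness makes the coefficient zero.\<close>
          have "kap 0 q w (m' - mset_set u') = \<zero>\<^bsub>A\<^esub>" if sub: "mset_set u' \<subseteq># m'"
          proof -
            have u'm: "u' \<subseteq> set_mset m'" using set_mset_mono[OF sub] D'(1) by simp
            have um: "u \<subseteq> set_mset m'" using D(1) by (auto simp: m'_def)
            have "V u' \<inter> set_mset m' \<noteq> {}"
              using top_set_unique[OF p q um u'm m'W(2) _ m'W(1)] False by (auto simp: pu qu)
            then obtain a where a: "a \<in> V u'" "a \<in># m'" by blast
            then have "a \<notin> u'" by (simp add: V_def)
            then have "a \<in># m' - mset_set u'" using a(2) D'(1) by (simp add: in_diff_count count_mset_set')
            then show ?thesis using gz[OF q, of "m' - mset_set u'"] a(1) unfolding qu by blast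
          qed
          then show ?thesis unfolding e using False by simp
        qed
      qed
      also have "\<dots> = kap 0 p w m"
        using P_coeff[OF kc] by (intro A.finsum_singleton[OF p0 finite_idx]) simp
      finally show ?thesis by simp
    qed
    then show "kap 0 p w = kap 0 p \<zero>\<^bsub>F 0\<^esub>"
      unfolding kap_zero[OF p0] by (intro ext) (simp add: P_simps)
  qed
  then have "z = diffl (Suc 0) y" unfolding w_def by (rule M.eq_if_minus_zero[OF z dy])
  then show ?thesis using y by (simp add: One_nat_def)
qed

lemma a_kernel_iff: "x \<in> a_kernel M M' f \<longleftrightarrow> x \<in> carrier M \<and> f x = \<zero>\<^bsub>M'\<^esub>"
  by (simp add: a_kernel_def kernel_def)

lemma resolution: "equivariant_minimal_free_resolution A n F diffl II"
  unfolding equivariant_minimal_free_resolution_def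
proof (intro conjI allI impI exI[of _ aug])
  show "graded_module P II" by (rule II_graded)
  show "equivariant_module A n II" by (rule II_equivariant)
  show "graded_free P (F i)" for i by (rule F_graded_free)
  show "equivariant_module A n (F i)" for i by (rule F_equivariant)
  show "aug \<in> equivariant_homs A n (F 0) II" by (rule aug_equivariant)
  show "degree_preserving (F 0) II aug" by (rule aug_degree)
  show "aug ` carrier (F 0) = carrier II" by (rule aug_surj)
  show "diffl 1 ` carrier (F 1) = a_kernel (F 0) II aug"
  proof (intro subset_antisym subsetI)
    fix x assume "x \<in> diffl 1 ` carrier (F 1)"
    then show "x \<in> a_kernel (F 0) II aug"
      using aug_diffl module_homs_closed[OF diffl_hom] by (auto simp: a_kernel_iff One_nat_def)
  next
    fix x assume "x \<in> a_kernel (F 0) II aug"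
    then show "x \<in> diffl 1 ` carrier (F 1)" using kernel_aug by (simp add: a_kernel_iff)
  qed
  fix i :: nat assume "1 \<le> i"
  then obtain j where i: "i = Suc j" by (metis One_nat_def Suc_le_D)
  show "diffl i \<in> equivariant_homs A n (F i) (F (i - 1))"
    unfolding i diff_Suc_1 by (rule diffl_equivariant)
  show "degree_preserving (F i) (F (i - 1)) (diffl i)"
    unfolding i diff_Suc_1 by (rule diffl_degree)
  show "diffl i ` carrier (F i) \<subseteq> irrelevant_multiples A n (F (i - 1))"
    unfolding i diff_Suc_1 by (rule diffl_minimal)
  show "diffl (i + 1) ` carrier (F (i + 1)) = a_kernel (F i) (F (i - 1)) (diffl i)"
    unfolding i diff_Suc_1 Suc_eq_plus1[symmetric]
  proof (intro subset_antisym subsetI)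
    fix x assume "x \<in> diffl (Suc (Suc j)) ` carrier (F (Suc (Suc j)))"
    then show "x \<in> a_kernel (F (Suc j)) (F j) (diffl (Suc j))"
      using diffl_diffl module_homs_closed[OF diffl_hom] by (auto simp: a_kernel_iff)
  next
    fix x assume "x \<in> a_kernel (F (Suc j)) (F j) (diffl (Suc j))"
    then show "x \<in> diffl (Suc (Suc j)) ` carrier (F (Suc (Suc j)))"
      using kernel_diffl by (simp add: a_kernel_iff)
  qed
qed

end

theorem theorem4p11:
  fixes A :: "('a, 'x) ring_scheme" and d n :: nat
  assumes "cring A" and "1 \<le> d" and "d \<le> n"
  shows "(\<forall>i\<ge>1. \<exists>!f. is_differential A d n i f) \<and>
    equivariant_minimal_free_resolution A n (F_mod A d n) (differential A d n)
      (squarefree_ideal_module A d n)"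
proof -
  interpret hooks A n d
    using assms by (simp add: hooks_def polys_def hooks_axioms_def)
  have "\<exists>!f. is_differential A d n i f" if "1 \<le> i" for i
    using ex1_differential[of "i - 1"] that by simp
  then show ?thesis using resolution by blast
qed

end
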